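(* Let $M$ be a compact smooth connected manifold of dimension $m\ge1$, let $(N,g)$ be a connected Riemannian manifold of dimension $n>m$, and let $A>0$. Then the geodesic distance of the metric $G^A$ separates points of the space $B_e(M,N)=\operatorname{Emb}(M,N)/\operatorname{Diff}(M)$ of submanifolds of $N$ of diffeomorphism type $M$: if $F_0,F_1\in B_e(M,N)$ and $F_0\ne F_1$, then $\operatorname{dist}^{B_i}_{G^A}(F_0,F_1)>0$.
   Context: $\operatorname{Imm}(M,N)$ is the space of smooth immersions $M\to N$ and $\operatorname{Emb}(M,N)\subset\operatorname{Imm}(M,N)$ the open subset of embeddings; $\operatorname{Diff}(M)$ acts from the right by composition. $\pi:\operatorname{Imm}(M,N)\to B_i(M,N)=\operatorname{Imm}(M,N)/\operatorname{Diff}(M)$ is the quotient map and $B_e(M,N)\subset B_i(M,N)$. For an immersion $f$, $N(f)\subset f^*TN$ is the normal bundle, $S^f(X,Y)=\nabla^g_X(Tf.Y)-Tf.\nabla^{f^*g}_XY\in\Gamma(N(f))$ is the second fundamental form, and $\operatorname{Tr}^{f^*g}(S^f)\in\Gamma(N(f))$ is its trace with respect to $f^*g$ (the mean curvature). $\operatorname{vol}(f^*g)$ is the volume density of $f^*g$. The weak Riemannian metric $G^A$ on $\operatorname{Imm}(M,N)$ is $$G^A_f(h,k)=\int_M\bigl(1+A\|\operatorname{Tr}^{f^*g}(S^f)\|_g^2\bigr)g(h,k)\operatorname{vol}(f^*g)$$ for vector fields $h,k$ along $f$. For a smooth path $f:[0,1]\times M\to N$ of immersions, with $f_t^\bot$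 the component of $f_t=\partial_tf$ normal to the immersion $f(t,\cdot)$, put $L^{\mathrm{hor}}_{G^A}(f)=\int_0^1\sqrt{G^A_{f}(f_t^\bot,f_t^\bot)}\,dt$. For $F_0,F_1\in B_i(M,N)$, $\operatorname{dist}^{B_i}_{G^A}(F_0,F_1)$ is the infimum of $L^{\mathrm{hor}}_{G^A}(f)$ over all smooth paths $f$ in $\operatorname{Imm}(M,N)$ with $\pi(f(0,\cdot))=F_0$ and $\pi(f(1,\cdot))=F_1$ (with $\inf\emptyset=+\infty$). *)

theory Defs
  imports "HOL-Analysis.Analysis"
begin

section \<open>Smooth maps between Euclidean spaces\<close>

text \<open>
  \<open>Ck_on k S f\<close> is meant for open \<open>S\<close>. A map on an arbitrary set is smooth if it extends locally
  to smooth maps on open sets; this is what smoothness on \<open>[0,1] \<times> M\<close> needs.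
\<close>

primrec Ck_on :: "nat \<Rightarrow> 'a::real_normed_vector set \<Rightarrow> ('a \<Rightarrow> 'b::real_normed_vector) \<Rightarrow> bool" where
  "Ck_on 0 S f \<longleftrightarrow> continuous_on S f"
| "Ck_on (Suc k) S f \<longleftrightarrow> (\<forall>x\<in>S. f differentiable (at x)) \<and>
     (\<forall>v. Ck_on k S (\<lambda>x. frechet_derivative f (at x) v))"

definition smooth_on :: "'a::real_normed_vector set \<Rightarrow> ('a \<Rightarrow> 'b::real_normed_vector) \<Rightarrow> bool" where
  "smooth_on S f \<longleftrightarrow>
     (\<forall>x\<in>S. \<exists>U h. open U \<and> x \<in> U \<and> (\<forall>k. Ck_on k U h) \<and> (\<forall>y\<in>S \<inter> U. h y = f y))"


section \<open>Smooth manifolds\<close>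

text \<open>
  The underlying space of a manifold is a whole type; a chart is an open set together with a
  coordinate map, whose values outside that set are irrelevant. The dimension is the cardinality
  of the index type of the model space. Atlases are not required to be maximal.
\<close>

type_synonym ('a, 'i) chart = "'a set \<times> ('a \<Rightarrow> real ^ 'i)"
type_synonym ('a, 'i) atlas = "('a, 'i) chart set"

definition cdom :: "('a, 'i) chart \<Rightarrow> 'a set" where
  "cdom c = fst c"

definition cmap :: "('a, 'i) chart \<Rightarrow> 'a \<Rightarrow> real ^ 'i" where
  "cmap c = snd c"

definition cinv :: "('a, 'i) chart \<Rightarrow> real ^ 'i \<Rightarrow> 'a" where
  "cinv c = inv_into (cdom c) (cmap c)"

definition is_chart :: "('a::topological_space, 'i::finite) chart \<Rightarrow> bool" where
  "is_chart c \<longleftrightarrow> open (cdom c) \<and> open (cmap c ` cdom c) \<and>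
     homeomorphism (cdom c) (cmap c ` cdom c) (cmap c) (cinv c)"

definition local_rep ::
  "('a, 'i) chart \<Rightarrow> ('b, 'j) chart \<Rightarrow> ('a \<Rightarrow> 'b) \<Rightarrow> real ^ 'i \<Rightarrow> real ^ 'j" where
  "local_rep c d f = cmap d \<circ> f \<circ> cinv c"

definition smooth_manifold ::
  "('a::{t2_space,second_countable_topology}, 'i::finite) atlas \<Rightarrow> bool" where
  "smooth_manifold M \<longleftrightarrow> (\<forall>c\<in>M. is_chart c) \<and> (\<Union>c\<in>M. cdom c) = UNIV \<and>
     (\<forall>c\<in>M. \<forall>d\<in>M. smooth_on (cmap c ` (cdom c \<inter> cdom d)) (local_rep c d id))"

definition smooth_map ::
  "('a::topological_space, 'i::finite) atlas \<Rightarrow> ('b::topological_space, 'j::finite) atlas \<Rightarrow>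
     ('a \<Rightarrow> 'b) \<Rightarrow> bool" where
  "smooth_map M N f \<longleftrightarrow> continuous_on UNIV f \<and>
     (\<forall>c\<in>M. \<forall>d\<in>N. smooth_on (cmap c ` (cdom c \<inter> f -` cdom d)) (local_rep c d f))"

definition chart_at :: "('a, 'i) atlas \<Rightarrow> 'a \<Rightarrow> ('a, 'i) chart" where
  "chart_at M x = (SOME c. c \<in> M \<and> x \<in> cdom c)"


section \<open>Tangent vectors\<close>

text \<open>
  A tangent vector at \<open>x\<close> is the family of its component vectors in all charts around \<open>x\<close>, subject
  to the usual transformation law (components in charts not around \<open>x\<close> are set to \<open>0\<close>, so that
  equality of tangent vectors is equality of functions). The vector space structure is pointwise.
\<close>

type_synonym ('a, 'i) tangent = "('a, 'i) chart \<Rightarrow> real ^ 'i"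

definition tangent_space :: "('a, 'i::finite) atlas \<Rightarrow> 'a \<Rightarrow> ('a, 'i) tangent set" where
  "tangent_space M x = {v. (\<forall>c. c \<notin> M \<or> x \<notin> cdom c \<longrightarrow> v c = 0) \<and>
     (\<forall>c\<in>M. \<forall>d\<in>M. x \<in> cdom c \<inter> cdom d \<longrightarrow>
        v d = frechet_derivative (local_rep c d id) (at (cmap c x)) (v c))}"

definition tangent_at ::
  "('a, 'i::finite) atlas \<Rightarrow> ('a, 'i) chart \<Rightarrow> 'a \<Rightarrow> real ^ 'i \<Rightarrow> ('a, 'i) tangent" where
  "tangent_at M c x v = (\<lambda>d. if d \<in> M \<and> x \<in> cdom d
     then frechet_derivative (local_rep c d id) (at (cmap c x)) v else 0)"

definition coord_field ::
  "('a, 'i::finite) atlas \<Rightarrow> ('a, 'i) chart \<Rightarrow> 'i \<Rightarrow> 'a \<Rightarrow> ('a, 'i) tangent" where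
  "coord_field M c i x = tangent_at M c x (axis i 1)"

definition tmap ::
  "('a, 'i::finite) atlas \<Rightarrow> ('b, 'j::finite) atlas \<Rightarrow> ('a \<Rightarrow> 'b) \<Rightarrow> 'a \<Rightarrow>
     ('a, 'i) tangent \<Rightarrow> ('b, 'j) tangent" where
  "tmap M N f x X = (\<lambda>d. if d \<in> N \<and> f x \<in> cdom d
     then let c = chart_at M x in frechet_derivative (local_rep c d f) (at (cmap c x)) (X c)
     else 0)"


section \<open>Riemannian metrics\<close>

type_synonym ('a, 'i) metric = "'a \<Rightarrow> ('a, 'i) tangent \<Rightarrow> ('a, 'i) tangent \<Rightarrow> real"

definition gram ::
  "('a, 'i::finite) atlas \<Rightarrow> ('a, 'i) metric \<Rightarrow> ('a, 'i) chart \<Rightarrow> real ^ 'i \<Rightarrow> real ^ 'i ^ 'i" where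
  "gram M g c z = (\<chi> i j. g (cinv c z) (coord_field M c i (cinv c z)) (coord_field M c j (cinv c z)))"

definition riemannian_metric :: "('a, 'i::finite) atlas \<Rightarrow> ('a, 'i) metric \<Rightarrow> bool" where
  "riemannian_metric M g \<longleftrightarrow>
     (\<forall>x. \<forall>u\<in>tangent_space M x. \<forall>v\<in>tangent_space M x. \<forall>w\<in>tangent_space M x. \<forall>a b.
        g x (\<lambda>c. a *\<^sub>R u c + b *\<^sub>R v c) w = a * g x u w + b * g x v w) \<and>
     (\<forall>x. \<forall>u\<in>tangent_space M x. \<forall>v\<in>tangent_space M x. g x u v = g x v u) \<and>
     (\<forall>x. \<forall>u\<in>tangent_space M x. u \<noteq> (\<lambda>c. 0) \<longrightarrow> g x u u > 0) \<and>
     (\<forall>c\<in>M. \<forall>i j. smooth_on (cmap c ` cdom c) (\<lambda>z. gram M g c z $ i $ j))"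

definition pullback ::
  "('a, 'i::finite) atlas \<Rightarrow> ('b, 'j::finite) atlas \<Rightarrow> ('a \<Rightarrow> 'b) \<Rightarrow> ('b, 'j) metric \<Rightarrow>
     ('a, 'i) metric" where
  "pullback M N f g x X Y = g (f x) (tmap M N f x X) (tmap M N f x Y)"

text \<open>
  The volume density, as the Borel measure whose density in each chart is \<open>sqrt (det (g\<^sub>i\<^sub>j))\<close>.
\<close>

definition vol ::
  "('a::topological_space, 'i::finite) atlas \<Rightarrow> ('a, 'i) metric \<Rightarrow> 'a measure" where
  "vol M g = (THE \<mu>. sets \<mu> = sets borel \<and>
     (\<forall>c\<in>M. \<forall>E\<in>sets borel. E \<subseteq> cdom c \<longrightarrow>
        emeasure \<mu> E = (\<integral>\<^sup>+z\<in>cmap c ` E. ennreal (sqrt (det (gram M g c z))) \<partial>lborel)))"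


section \<open>Levi-Civita connection and second fundamental form\<close>

definition partial :: "'i::finite \<Rightarrow> (real ^ 'i \<Rightarrow> real) \<Rightarrow> real ^ 'i \<Rightarrow> real" where
  "partial i h z = frechet_derivative h (at z) (axis i 1)"

text \<open>\<open>christoffel G z k i j\<close> is the Christoffel symbol of the second kind with upper index \<open>k\<close>.\<close>

definition christoffel ::
  "(real ^ 'i \<Rightarrow> real ^ 'i ^ 'i) \<Rightarrow> real ^ 'i \<Rightarrow> 'i::finite \<Rightarrow> 'i \<Rightarrow> 'i \<Rightarrow> real" where
  "christoffel G z k i j = (\<Sum>l\<in>UNIV. 1 / 2 * matrix_inv (G z) $ k $ l *
     (partial i (\<lambda>y. G y $ j $ l) z + partial j (\<lambda>y. G y $ i $ l) z - partial l (\<lambda>y. G y $ i $ j) z))"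

text \<open>
  The Levi-Civita covariant derivative \<open>\<nabla>\<^sub>X V\<close> of a vector field \<open>V\<close> along \<open>f : M \<rightarrow> N\<close>, where \<open>X\<close> is a
  vector field on \<open>M\<close>. For \<open>f = id\<close> it is the covariant derivative of vector fields on \<open>M\<close>.
  In coordinates \<open>(\<nabla>\<^sub>X V)\<^sup>k = dV\<^sup>k(X) + \<Gamma>\<^sup>k\<^sub>i\<^sub>j (df(X))\<^sup>i V\<^sup>j\<close>; the value does not depend on the
  chart of \<open>M\<close> that is chosen.
\<close>

definition nabla ::
  "('a, 'i::finite) atlas \<Rightarrow> ('b, 'j::finite) atlas \<Rightarrow> ('b, 'j) metric \<Rightarrow> ('a \<Rightarrow> 'b) \<Rightarrow>
     ('a \<Rightarrow> ('a, 'i) tangent) \<Rightarrow> ('a \<Rightarrow> ('b, 'j) tangent) \<Rightarrow> 'a \<Rightarrow> ('b, 'j) tangent" where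
  "nabla M N g f X V x = (\<lambda>d. if d \<in> N \<and> f x \<in> cdom d
     then let c = chart_at M x in
       frechet_derivative (\<lambda>z. V (cinv c z) d) (at (cmap c x)) (X x c) +
       (\<chi> k. \<Sum>i\<in>UNIV. \<Sum>j\<in>UNIV.
          christoffel (gram N g d) (cmap d (f x)) k i j * tmap M N f x (X x) d $ i * V x d $ j)
     else 0)"

definition second_fundamental_form ::
  "('a, 'i::finite) atlas \<Rightarrow> ('b, 'j::finite) atlas \<Rightarrow> ('b, 'j) metric \<Rightarrow> ('a \<Rightarrow> 'b) \<Rightarrow>
     ('a \<Rightarrow> ('a, 'i) tangent) \<Rightarrow> ('a \<Rightarrow> ('a, 'i) tangent) \<Rightarrow> 'a \<Rightarrow> ('b, 'j) tangent" where
  "second_fundamental_form M N g f X Y x = (\<lambda>d.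
     nabla M N g f X (\<lambda>y. tmap M N f y (Y y)) x d -
     tmap M N f x (nabla M M (pullback M N f g) id X Y x) d)"

definition mean_curvature ::
  "('a, 'i::finite) atlas \<Rightarrow> ('b, 'j::finite) atlas \<Rightarrow> ('b, 'j) metric \<Rightarrow> ('a \<Rightarrow> 'b) \<Rightarrow>
     'a \<Rightarrow> ('b, 'j) tangent" where
  "mean_curvature M N g f x = (\<lambda>d. let c = chart_at M x in
     \<Sum>i\<in>UNIV. \<Sum>j\<in>UNIV. matrix_inv (gram M (pullback M N f g) c (cmap c x)) $ i $ j *\<^sub>R
       second_fundamental_form M N g f (coord_field M c i) (coord_field M c j) x d)"


section \<open>Immersions, embeddings and shape spaces\<close>

definition Imm ::
  "('a::topological_space, 'i::finite) atlas \<Rightarrow> ('b::topological_space, 'j::finite) atlas \<Rightarrow>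
     ('a \<Rightarrow> 'b) set" where
  "Imm M N = {f. smooth_map M N f \<and> (\<forall>x. inj_on (tmap M N f x) (tangent_space M x))}"

definition Emb ::
  "('a::topological_space, 'i::finite) atlas \<Rightarrow> ('b::topological_space, 'j::finite) atlas \<Rightarrow>
     ('a \<Rightarrow> 'b) set" where
  "Emb M N = {f \<in> Imm M N. \<exists>h. homeomorphism UNIV (range f) f h}"

definition Diff :: "('a::topological_space, 'i::finite) atlas \<Rightarrow> ('a \<Rightarrow> 'a) set" where
  "Diff M = {\<phi>. bij \<phi> \<and> smooth_map M M \<phi> \<and> smooth_map M M (inv \<phi>)}"

definition shape :: "('a::topological_space, 'i::finite) atlas \<Rightarrow> ('a \<Rightarrow> 'b) \<Rightarrow> ('a \<Rightarrow> 'b) set" where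
  "shape M f = {f \<circ> \<phi> |\<phi>. \<phi> \<in> Diff M}"

definition B_i ::
  "('a::topological_space, 'i::finite) atlas \<Rightarrow> ('b::topological_space, 'j::finite) atlas \<Rightarrow>
     ('a \<Rightarrow> 'b) set set" where
  "B_i M N = shape M ` Imm M N"

definition B_e ::
  "('a::topological_space, 'i::finite) atlas \<Rightarrow> ('b::topological_space, 'j::finite) atlas \<Rightarrow>
     ('a \<Rightarrow> 'b) set set" where
  "B_e M N = shape M ` Emb M N"


section \<open>The metric and its geodesic distance\<close>

definition G_metric ::
  "('a::topological_space, 'i::finite) atlas \<Rightarrow> ('b, 'j::finite) atlas \<Rightarrow> ('b, 'j) metric \<Rightarrow> real \<Rightarrow>
     ('a \<Rightarrow> 'b) \<Rightarrow> ('a \<Rightarrow> ('b, 'j) tangent) \<Rightarrow> ('a \<Rightarrow> ('b, 'j) tangent) \<Rightarrow> real" where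
  "G_metric M N g A f h k =
     (\<integral>x. (1 + A * g (f x) (mean_curvature M N g f x) (mean_curvature M N g f x)) *
          g (f x) (h x) (k x) \<partial>vol M (pullback M N f g))"

definition smooth_path ::
  "('a::topological_space, 'i::finite) atlas \<Rightarrow> ('b::topological_space, 'j::finite) atlas \<Rightarrow>
     (real \<Rightarrow> 'a \<Rightarrow> 'b) \<Rightarrow> bool" where
  "smooth_path M N f \<longleftrightarrow> continuous_on ({0..1} \<times> UNIV) (\<lambda>(t, x). f t x) \<and>
     (\<forall>c\<in>M. \<forall>d\<in>N. smooth_on
        {(t, z). t \<in> {0..1} \<and> z \<in> cmap c ` cdom c \<and> f t (cinv c z) \<in> cdom d}
        (\<lambda>(t, z). cmap d (f t (cinv c z))))"

definition velocity ::
  "('b, 'j::finite) atlas \<Rightarrow> (real \<Rightarrow> 'a \<Rightarrow> 'b) \<Rightarrow> real \<Rightarrow> 'a \<Rightarrow> ('b, 'j) tangent" where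
  "velocity N f t x = (\<lambda>d. if d \<in> N \<and> f t x \<in> cdom d
     then vector_derivative (\<lambda>s. cmap d (f s x)) (at t within {0..1}) else 0)"

definition normal_space ::
  "('a, 'i::finite) atlas \<Rightarrow> ('b, 'j::finite) atlas \<Rightarrow> ('b, 'j) metric \<Rightarrow> ('a \<Rightarrow> 'b) \<Rightarrow> 'a \<Rightarrow>
     ('b, 'j) tangent set" where
  "normal_space M N g f x = {w \<in> tangent_space N (f x).
     \<forall>X\<in>tangent_space M x. g (f x) w (tmap M N f x X) = 0}"

definition normal_part ::
  "('a, 'i::finite) atlas \<Rightarrow> ('b, 'j::finite) atlas \<Rightarrow> ('b, 'j) metric \<Rightarrow> ('a \<Rightarrow> 'b) \<Rightarrow> 'a \<Rightarrow>
     ('b, 'j) tangent \<Rightarrow> ('b, 'j) tangent" where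
  "normal_part M N g f x v = (THE w. w \<in> normal_space M N g f x \<and>
     (\<exists>X\<in>tangent_space M x. v = (\<lambda>d. w d + tmap M N f x X d)))"

definition L_hor ::
  "('a::topological_space, 'i::finite) atlas \<Rightarrow> ('b, 'j::finite) atlas \<Rightarrow> ('b, 'j) metric \<Rightarrow> real \<Rightarrow>
     (real \<Rightarrow> 'a \<Rightarrow> 'b) \<Rightarrow> real" where
  "L_hor M N g A f = integral {0..1} (\<lambda>t.
     let h = (\<lambda>x. normal_part M N g (f t) x (velocity N f t x))
     in sqrt (G_metric M N g A (f t) h h))"

definition dist_Bi ::
  "('a::topological_space, 'i::finite) atlas \<Rightarrow> ('b::topological_space, 'j::finite) atlas \<Rightarrow>
     ('b, 'j) metric \<Rightarrow> real \<Rightarrow> ('a \<Rightarrow> 'b) set \<Rightarrow> ('a \<Rightarrow> 'b) set \<Rightarrow> ereal" where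
  "dist_Bi M N g A F0 F1 =
     (INF f\<in>{f. smooth_path M N f \<and> (\<forall>t\<in>{0..1}. f t \<in> Imm M N) \<and>
              shape M (f 0) = F0 \<and> shape M (f 1) = F1}. ereal (L_hor M N g A f))"

end

theory Submission
  imports Defs
begin

text \<open>
  Fix a point \<open>p\<close> that lies on exactly one of the two submanifolds and a bump function \<open>\<phi> = \<psi>\<^sup>2\<close> around
  \<open>p\<close> that vanishes on the other one, and consider the localized volume \<open>\<Phi>(f) = \<integral> \<phi>(f) vol(f\<^sup>*g)\<close>. It is
  invariant under reparametrization, positive on the first submanifold and zero on the second. By the
  first variation formula and the divergence theorem, along a path of immersions
  \<open>d/dt \<Phi> = \<integral> (d\<phi>(w) - \<phi> g(H, w)) vol\<close>, where \<open>w\<close> is the normal velocity and \<open>H\<close> the mean curvature.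
  Because \<open>d\<phi>\<close> is \<open>O(\<psi>)\<close>, the integrand is bounded by a constant times \<open>\<psi> |w| sqrt (1 + A |H|\<^sup>2)\<close>, so by the
  Cauchy-Schwarz inequality \<open>d/dt sqrt \<Phi>\<close> is at most a constant times \<open>sqrt (G\<^sup>A(w, w))\<close>. Hence the length of a
  path joining the two submanifolds is bounded below. Since \<open>sqrt \<Phi>\<close> need not be differentiable where
  \<open>\<Phi> = 0\<close>, the argument is run with \<open>sqrt (\<Phi> + \<epsilon>)\<close>.
\<close>

section \<open>Calculus of continuously differentiable maps\<close>

text \<open>A point on exactly one submanifold exists because two embeddings with the same image
  differ by a diffeomorphism of \<open>M\<close>; this is the one place where embeddings rather than
  immersions are used. Compactness of \<open>M\<close> makes the images closed, so that a bump
  function can avoid one of them. Only the normal velocity survives because the tangential velocity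
  moves the density by a divergence. The obstacle that shapes the proof is that mean curvature,
  normal part and volume are introduced point by point, through chosen charts and descriptions;
  nothing about their dependence on time and place is immediate. Each is therefore first shown to
  agree, in arbitrary charts, with an explicit smooth formula in a local extension of the path,
  where the variation formula becomes a pointwise identity between densities. The test function is
  only C^1: \<psi> is the positive part of a quadratic polynomial in a chart, and the derivative of
  its square carries a factor \<psi>. The weight \<open>A\<close> enters through the inequality |H|
  \<le> sqrt (1 + A |H|^2) / sqrt A, which absorbs the curvature term.\<close>

lemma Ck_on_SucI:
  assumes "\<And>x. x \<in> S \<Longrightarrow> (f has_derivative D x) (at x)"
    and "\<And>v. Ck_on k S (\<lambda>x. D x v)" and "open S"
  shows "Ck_on (Suc k) S f"
proof -
  have eq: "frechet_derivative f (at x) = D x" if "x \<in> S" for x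
    using frechet_derivative_at[OF assms(1)[OF that]] by simp
  \<comment> \<open>\<open>Ck_on\<close> recurses through \<open>frechet_derivative\<close>, and the
    formula \<open>D\<close> agrees with it only on \<open>S\<close>. Replacing one by the other on
    an open set is a congruence, proved here because \<open>Ck_on_cong\<close> is itself obtained
    from this rule.\<close>
  have cong: "Ck_on k S g" if "Ck_on k S h" "\<And>x. x \<in> S \<Longrightarrow> h x = g x" for g h :: "'a \<Rightarrow> 'b"
    using that
  proof (induction k arbitrary: g h)
    case 0
    then show ?case by (simp cong: continuous_on_cong)
  next
    case (Suc k)
    have d: "(g has_derivative frechet_derivative h (at x)) (at x)" if "x \<in> S" for x
    proof (rule has_derivative_transform_within_open[OF _ assms(3) that])
      show "(h has_derivative frechet_derivative h (at x)) (at x)"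
        using Suc.prems that frechet_derivative_works by auto
    qed (use Suc.prems in auto)
    have "Ck_on k S (\<lambda>x. frechet_derivative g (at x) v)" for v
    proof (rule Suc.IH)
      show "Ck_on k S (\<lambda>x. frechet_derivative h (at x) v)" using Suc.prems by simp
      show "frechet_derivative h (at x) v = frechet_derivative g (at x) v" if "x \<in> S" for x
        using frechet_derivative_at[OF d[OF that]] by simp
    qed
    then show ?case using d differentiable_def by (auto simp: differentiable_def)
  qed
  show ?thesis
    using assms(1) eq cong[OF assms(2)] by (auto simp: differentiable_def)
qed

lemma Ck_on_SucD:
  assumes "Ck_on (Suc k) S f" "x \<in> S"
  shows "(f has_derivative frechet_derivative f (at x)) (at x)"
  using assms frechet_derivative_works by auto

lemma Ck_on_cong:
  assumes "open S" "\<And>x. x \<in> S \<Longrightarrow> f x = g x" "Ck_on k S f"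
  shows "Ck_on k S g"
proof (cases k)
  case 0
  then show ?thesis using assms by (simp cong: continuous_on_cong)
next
  case (Suc j)
  show ?thesis unfolding Suc
  proof (rule Ck_on_SucI[where D = "\<lambda>x. frechet_derivative f (at x)"])
    fix x assume x: "x \<in> S"
    show "(g has_derivative frechet_derivative f (at x)) (at x)"
      using has_derivative_transform_within_open[OF Ck_on_SucD[OF assms(3)[unfolded Suc] x] assms(1) x] assms(2)
      by blast
  qed (use assms Suc in auto)
qed

lemma Ck_on_subset: "Ck_on k S f \<Longrightarrow> T \<subseteq> S \<Longrightarrow> Ck_on k T f"
  by (induction k arbitrary: f) (auto intro: continuous_on_subset)

lemma Ck_on_local:
  assumes "\<And>x. x \<in> S \<Longrightarrow> \<exists>U. open U \<and> x \<in> U \<and> Ck_on k U f"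
  shows "Ck_on k S f"
  using assms
proof (induction k arbitrary: f)
  case 0
  then show ?case
    unfolding Ck_on.simps
    by (intro continuous_at_imp_continuous_on ballI) (metis continuous_on_eq_continuous_at)
next
  case (Suc k)
  have "f differentiable (at x)" if "x \<in> S" for x using Suc.prems[OF that] by auto
  moreover have "Ck_on k S (\<lambda>x. frechet_derivative f (at x) v)" for v
    by (rule Suc.IH) (use Suc.prems in force)
  ultimately show ?case by simp
qed

lemma Ck_on_Suc: "Ck_on (Suc k) S f \<Longrightarrow> Ck_on k S f"
  by (induction k arbitrary: f)
    (auto intro!: continuous_at_imp_continuous_on differentiable_imp_continuous_within)

lemma Ck_on_mono: "Ck_on k S f \<Longrightarrow> j \<le> k \<Longrightarrow> Ck_on j S f"
  by (induction k) (auto simp del: Ck_on.simps simp: le_Suc_eq dest: Ck_on_Suc)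

lemma Ck_on_imp_continuous: "Ck_on k S f \<Longrightarrow> continuous_on S f"
  using Ck_on_mono[of k S f 0] by simp

lemma Ck_on_frechet: "Ck_on (Suc k) S f \<Longrightarrow> Ck_on k S (\<lambda>x. frechet_derivative f (at x) v)"
  by simp

lemma Ck_on_const: "open S \<Longrightarrow> Ck_on k S (\<lambda>x. c)"
proof (induction k arbitrary: c)
  case (Suc k)
  show ?case by (rule Ck_on_SucI[where D = "\<lambda>x v. 0"]) (use Suc in auto)
qed auto

lemma Ck_on_bounded_linear_comp:
  assumes "open S" "bounded_linear L" "Ck_on k S f"
  shows "Ck_on k S (\<lambda>x. L (f x))"
  using assms(3)
proof (induction k arbitrary: f)
  case 0
  then show ?case
    using bounded_linear.continuous_on[OF assms(2)] by auto
next
  case (Suc k)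
  show ?case
  proof (rule Ck_on_SucI[where D = "\<lambda>x v. L (frechet_derivative f (at x) v)"])
    show "((\<lambda>x. L (f x)) has_derivative (\<lambda>v. L (frechet_derivative f (at x) v))) (at x)" if "x \<in> S" for x
      using bounded_linear.has_derivative[OF assms(2) Ck_on_SucD[OF Suc.prems that]] .
    show "Ck_on k S (\<lambda>x. L (frechet_derivative f (at x) v))" for v
      by (rule Suc.IH) (use Suc.prems in auto)
  qed (rule assms)
qed

lemma Ck_on_add:
  assumes "open S" "Ck_on k S f" "Ck_on k S g"
  shows "Ck_on k S (\<lambda>x. f x + g x)"
  using assms(2,3)
proof (induction k arbitrary: f g)
  case 0
  then show ?case by (auto intro: continuous_on_add)
next
  case (Suc k)
  show ?case
  proof (rule Ck_on_SucI[where D = "\<lambda>x v. frechet_derivative f (at x) v + frechet_derivative g (at x) v"])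
    show "((\<lambda>x. f x + g x) has_derivative
        (\<lambda>v. frechet_derivative f (at x) v + frechet_derivative g (at x) v)) (at x)" if "x \<in> S" for x
      using Ck_on_SucD[OF Suc.prems(1) that] Ck_on_SucD[OF Suc.prems(2) that] by (rule has_derivative_add)
    show "Ck_on k S (\<lambda>x. frechet_derivative f (at x) v + frechet_derivative g (at x) v)" for v
      by (rule Suc.IH) (use Suc.prems in auto)
  qed (rule assms)
qed

lemma Ck_on_sum:
  assumes "open S" "\<And>i. i \<in> I \<Longrightarrow> Ck_on k S (f i)"
  shows "Ck_on k S (\<lambda>x. \<Sum>i\<in>I. f i x)"
  using assms(2)
  by (induction I rule: infinite_finite_induct) (auto intro: Ck_on_const Ck_on_add assms(1))

lemma Ck_on_bilinear:
  assumes "open S" "bounded_bilinear b" "Ck_on k S f" "Ck_on k S g"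
  shows "Ck_on k S (\<lambda>x. b (f x) (g x))"
  using assms(3,4)
proof (induction k arbitrary: f g)
  case 0
  then show ?case by (auto intro: bounded_bilinear.continuous_on[OF assms(2)])
next
  case (Suc k)
  show ?case
  proof (rule Ck_on_SucI[where D = "\<lambda>x v. b (f x) (frechet_derivative g (at x) v) + b (frechet_derivative f (at x) v) (g x)"])
    show "((\<lambda>x. b (f x) (g x)) has_derivative
        (\<lambda>v. b (f x) (frechet_derivative g (at x) v) + b (frechet_derivative f (at x) v) (g x))) (at x)" if "x \<in> S" for x
      by (rule bounded_bilinear.FDERIV[OF assms(2) Ck_on_SucD[OF Suc.prems(1) that] Ck_on_SucD[OF Suc.prems(2) that]])
    show "Ck_on k S (\<lambda>x. b (f x) (frechet_derivative g (at x) v) + b (frechet_derivative f (at x) v) (g x))" for v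
      by (intro Ck_on_add Suc.IH assms Ck_on_Suc[of k S f] Ck_on_Suc[of k S g]) (use Suc.prems in auto)
  qed (rule assms)
qed

lemmas Ck_on_scaleR = Ck_on_bilinear[OF _ bounded_bilinear_scaleR]
lemmas Ck_on_mult = Ck_on_bilinear[OF _ bounded_bilinear_mult]
lemmas Ck_on_uminus = Ck_on_bounded_linear_comp[OF _ bounded_linear_minus[OF bounded_linear_ident]]
lemmas Ck_on_inner_left = Ck_on_bounded_linear_comp[OF _ bounded_linear_inner_left]
lemmas Ck_on_vec_nth = Ck_on_bounded_linear_comp[OF _ bounded_linear_vec_nth]

lemma Ck_on_diff:
  assumes "open S" "Ck_on k S f" "Ck_on k S g"
  shows "Ck_on k S (\<lambda>x. f x - g x)"
  using Ck_on_add[OF assms(1,2) Ck_on_uminus[OF assms(1,3)]] by simp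

lemma Ck_on_prod:
  fixes f :: "'i \<Rightarrow> 'a::real_normed_vector \<Rightarrow> real"
  assumes "open S" "\<And>i. i \<in> I \<Longrightarrow> Ck_on k S (f i)"
  shows "Ck_on k S (\<lambda>x. \<Prod>i\<in>I. f i x)"
  using assms(2)
  by (induction I rule: infinite_finite_induct) (auto intro: Ck_on_const Ck_on_mult assms(1))

text \<open>The chain rule evaluates \<open>f'\<close> in the direction \<open>g' x v\<close>, which
  moves with \<open>x\<close>, while \<open>Ck_on\<close> only knows derivatives in fixed
  directions. Expanding that direction over \<open>Basis\<close> turns it into scalar coefficients;
  this is why the middle space is Euclidean.\<close>

lemma Ck_on_compose:
  fixes f :: "'b::euclidean_space \<Rightarrow> 'c::real_normed_vector" and g :: "'a::real_normed_vector \<Rightarrow> 'b"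
  assumes "open S" "Ck_on k T f" "Ck_on k S g" "g ` S \<subseteq> T"
  shows "Ck_on k S (\<lambda>x. f (g x))"
  using assms(2,3)
proof (induction k arbitrary: f)
  case 0
  then show ?case using continuous_on_compose2 assms(4) by auto
next
  case (Suc k)
  let ?D = "\<lambda>x v. \<Sum>b\<in>Basis. (frechet_derivative g (at x) v \<bullet> b) *\<^sub>R frechet_derivative f (at (g x)) b"
  show ?case
  proof (rule Ck_on_SucI[where D = ?D])
    fix x assume x: "x \<in> S"
    have f: "(f has_derivative frechet_derivative f (at (g x))) (at (g x))"
      using Ck_on_SucD[OF Suc.prems(1)] x assms(4) by blast
    have g: "(g has_derivative frechet_derivative g (at x)) (at x)"
      using Ck_on_SucD[OF Suc.prems(2) x] .
    have lin: "linear (frechet_derivative f (at (g x)))"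
      using f has_derivative_linear by blast
    have "?D x v = frechet_derivative f (at (g x)) (frechet_derivative g (at x) v)" for v
      by (subst (3) euclidean_representation[symmetric])
        (simp add: linear_sum[OF lin] linear_cmul[OF lin] o_def)
    then show "((\<lambda>x. f (g x)) has_derivative ?D x) (at x)"
      using diff_chain_at[OF g f] by (simp add: o_def)
  next
    fix v
    show "Ck_on k S (\<lambda>x. ?D x v)"
    proof (intro Ck_on_sum Ck_on_scaleR assms(1) Ck_on_inner_left)
      show "Ck_on k S (\<lambda>x. frechet_derivative g (at x) v)" using Suc.prems by simp
      show "Ck_on k S (\<lambda>x. frechet_derivative f (at (g x)) b)" for b
        by (rule Suc.IH) (use Suc.prems Ck_on_Suc in auto)
    qed
  qed (rule assms)
qed

text \<open>The derivative is a product of \<open>f'\<close> and two factors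
  \<open>inverse (f x)\<close>, so the induction hypothesis is used for the same \<open>f\<close>
  one order lower.\<close>

lemma Ck_on_inverse:
  fixes f :: "'a::real_normed_vector \<Rightarrow> real"
  assumes "open S" "Ck_on k S f" "\<And>x. x \<in> S \<Longrightarrow> f x \<noteq> 0"
  shows "Ck_on k S (\<lambda>x. inverse (f x))"
  using assms(2)
proof (induction k)
  case 0
  then show ?case using assms(3) by (auto intro: continuous_on_inverse)
next
  case (Suc k)
  show ?case
  proof (rule Ck_on_SucI[where D = "\<lambda>x v. - (inverse (f x) * frechet_derivative f (at x) v * inverse (f x))"])
    show "((\<lambda>x. inverse (f x)) has_derivative
        (\<lambda>v. - (inverse (f x) * frechet_derivative f (at x) v * inverse (f x)))) (at x)" if "x \<in> S" for x
      by (rule Deriv.has_derivative_inverse[OF assms(3)[OF that] Ck_on_SucD[OF Suc.prems that]])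
    show "Ck_on k S (\<lambda>x. - (inverse (f x) * frechet_derivative f (at x) v * inverse (f x)))" for v
      by (intro Ck_on_uminus Ck_on_mult assms(1) Suc.IH Ck_on_frechet Suc.prems Ck_on_Suc[OF Suc.prems])
  qed (rule assms)
qed

lemma Ck_on_divide:
  fixes f g :: "'a::real_normed_vector \<Rightarrow> real"
  assumes "open S" "Ck_on k S f" "Ck_on k S g" "\<And>x. x \<in> S \<Longrightarrow> g x \<noteq> 0"
  shows "Ck_on k S (\<lambda>x. f x / g x)"
  unfolding divide_inverse by (intro Ck_on_mult Ck_on_inverse assms)

lemma Ck_on_sqrt:
  fixes f :: "'a::real_normed_vector \<Rightarrow> real"
  assumes "open S" "Ck_on k S f" "\<And>x. x \<in> S \<Longrightarrow> f x > 0"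
  shows "Ck_on k S (\<lambda>x. sqrt (f x))"
  using assms(2)
proof (induction k)
  case 0
  then show ?case by (auto intro: continuous_intros)
next
  case (Suc k)
  show ?case
  proof (rule Ck_on_SucI[where D = "\<lambda>x v. frechet_derivative f (at x) v * (1/2) * inverse (sqrt (f x))"])
    show "((\<lambda>x. sqrt (f x)) has_derivative
        (\<lambda>v. frechet_derivative f (at x) v * (1/2) * inverse (sqrt (f x)))) (at x)" if "x \<in> S" for x
      using has_derivative_real_sqrt[OF assms(3)[OF that] Ck_on_SucD[OF Suc.prems that]]
      by (simp add: field_simps)
    have "sqrt (f x) \<noteq> 0" if "x \<in> S" for x using assms(3)[OF that] by simp
    then show "Ck_on k S (\<lambda>x. frechet_derivative f (at x) v * (1/2) * inverse (sqrt (f x)))" for v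
      by (intro Ck_on_mult Ck_on_const Ck_on_inverse assms(1) Suc.IH Ck_on_frechet Suc.prems Ck_on_Suc[OF Suc.prems])
  qed (rule assms)
qed

section \<open>Smooth dependence of vectors, determinants and inverse matrices\<close>

lemma bounded_linear_axis: "bounded_linear (axis i :: 'b::euclidean_space \<Rightarrow> 'b^'n::finite)"
  unfolding linear_conv_bounded_linear[symmetric] by (auto intro!: linearI simp: axis_def vec_eq_iff)

lemma Ck_on_vec:
  fixes f :: "'a::real_normed_vector \<Rightarrow> 'b::euclidean_space ^ 'n::finite"
  assumes "open S" "\<And>i. Ck_on k S (\<lambda>x. f x $ i)"
  shows "Ck_on k S f"
proof -
  have "f = (\<lambda>x. \<Sum>i\<in>UNIV. axis i (f x $ i))"
    by (auto simp: fun_eq_iff vec_eq_iff axis_def sum.delta)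
  moreover have "Ck_on k S (\<lambda>x. \<Sum>i\<in>UNIV. axis i (f x $ i))"
    by (intro Ck_on_sum Ck_on_bounded_linear_comp[OF _ bounded_linear_axis] assms)
  ultimately show ?thesis by simp
qed

lemma Ck_on_det:
  fixes f :: "'a::real_normed_vector \<Rightarrow> real^'n^'n::finite"
  assumes "open S" "\<And>i j. Ck_on k S (\<lambda>x. f x $ i $ j)"
  shows "Ck_on k S (\<lambda>x. det (f x))"
  unfolding det_def by (intro Ck_on_sum Ck_on_mult Ck_on_const Ck_on_prod assms)

lemma matrix_inv_mult:
  fixes A :: "real^'n^'n::finite"
  assumes "det A \<noteq> 0"
  shows "A ** matrix_inv A = mat 1" "matrix_inv A ** A = mat 1"
proof -
  have "\<exists>B. A ** B = mat 1 \<and> B ** A = mat 1"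
    using assms invertible_det_nz[of A] unfolding invertible_def by blast
  from someI_ex[OF this] show "A ** matrix_inv A = mat 1" "matrix_inv A ** A = mat 1"
    unfolding matrix_inv_def by auto
qed

text \<open>Cramer's rule for the \<open>l\<close>-th unit vector. Entries of the inverse become
  quotients of polynomials in the entries of \<open>A\<close>, hence as smooth as \<open>A\<close>
  itself.\<close>

lemma matrix_inv_nth:
  fixes A :: "real^'n^'n::finite"
  assumes "det A \<noteq> 0"
  shows "matrix_inv A $ k $ l = det (\<chi> i j. if j = k then axis l 1 $ i else A $ i $ j) / det A"
proof -
  have "A *v (matrix_inv A *v axis l 1) = axis l 1"
    by (simp add: matrix_vector_mul_assoc matrix_inv_mult[OF assms])
  from this[unfolded cramer[OF assms]]
  have "(matrix_inv A *v axis l 1) $ k = det (\<chi> i j. if j = k then axis l 1 $ i else A $ i $ j) / det A"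
    by (simp only: vec_lambda_beta)
  moreover have "(matrix_inv A *v axis l 1) $ k = matrix_inv A $ k $ l"
    by (simp add: matrix_vector_mul_component inner_axis)
  ultimately show ?thesis by simp
qed

lemma Ck_on_matrix_inv:
  fixes f :: "'a::real_normed_vector \<Rightarrow> real^'n^'n::finite"
  assumes "open S" "\<And>i j. Ck_on k S (\<lambda>x. f x $ i $ j)" "\<And>x. x \<in> S \<Longrightarrow> det (f x) \<noteq> 0"
  shows "Ck_on k S (\<lambda>x. matrix_inv (f x) $ i $ j)"
proof (rule Ck_on_cong[OF assms(1)])
  show "det (\<chi> r s. if s = i then axis j 1 $ r else f x $ r $ s) / det (f x) = matrix_inv (f x) $ i $ j"
    if "x \<in> S" for x
    by (rule matrix_inv_nth[OF assms(3)[OF that], symmetric])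
  show "Ck_on k S (\<lambda>x. det (\<chi> r s. if s = i then axis j 1 $ r else f x $ r $ s) / det (f x))"
  proof (intro Ck_on_divide Ck_on_det assms)
    show "Ck_on k S (\<lambda>x. (\<chi> r s. if s = i then axis j 1 $ r else f x $ r $ s) $ a $ b)" for a b
      using assms by (cases "b = i") (auto intro: Ck_on_const)
  qed
qed

section \<open>From local extensions to \<open>Ck_on\<close>, and the inverse function
  theorem\<close>

lemma smooth_on_openD: "smooth_on S f \<Longrightarrow> open S \<Longrightarrow> Ck_on k S f"
proof (rule Ck_on_local)
  fix x assume "smooth_on S f" "open S" "x \<in> S"
  then obtain U h where U: "open U" "x \<in> U" "Ck_on k U h" "\<And>y. y \<in> S \<inter> U \<Longrightarrow> h y = f y"
    unfolding smooth_on_def by meson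
  have "Ck_on k (S \<inter> U) f"
    by (rule Ck_on_cong[of _ h]) (use U \<open>open S\<close> in \<open>auto intro: Ck_on_subset\<close>)
  then show "\<exists>U. open U \<and> x \<in> U \<and> Ck_on k U f"
    using U \<open>x \<in> S\<close> \<open>open S\<close> by (intro exI[of _ "S \<inter> U"]) auto
qed

lemma smooth_on_localI:
  assumes "\<And>x. x \<in> S \<Longrightarrow> \<exists>U. open U \<and> x \<in> U \<and> (\<forall>k. Ck_on k U f)"
  shows "smooth_on S f"
  unfolding smooth_on_def using assms by blast

text \<open>The inverse function theorem supplies a differentiable inverse; its regularity is
  bootstrapped. The Jacobian matrix of \<open>g\<close> at \<open>y\<close> is the inverse of that
  of \<open>f\<close> at \<open>g y\<close>, so if \<open>g\<close> is of order \<open>k\<close>,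
  then so is \<open>g'\<close>, and \<open>g\<close> is of order \<open>Suc k\<close>.\<close>

lemma Ck_on_inverse_function:
  fixes f :: "real^'n::finite \<Rightarrow> real^'n"
  assumes "open U" "\<And>k. Ck_on k U f" "x0 \<in> U" "inj (frechet_derivative f (at x0))"
  obtains U' V g where "open U'" "U' \<subseteq> U" "x0 \<in> U'" "open V" "homeomorphism U' V f g"
    "\<And>k. Ck_on k V g"
proof -
  \<comment> \<open>\<open>inverse_function_theorem\<close> asks for the derivative as a continuous
    family of bounded linear operators; in finite dimension continuity can be tested direction by
    direction.\<close>
  define f' where "f' = (\<lambda>x. Blinfun (frechet_derivative f (at x)))"
  have der: "(f has_derivative frechet_derivative f (at x)) (at x)" if "x \<in> U" for x
    using Ck_on_SucD[OF assms(2) that] .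
  have f': "blinfun_apply (f' x) = frechet_derivative f (at x)" if "x \<in> U" for x
    unfolding f'_def using has_derivative_bounded_linear[OF der[OF that]]
    by (rule bounded_linear_Blinfun_apply)
  have cont: "continuous_on U f'"
  proof (rule continuous_on_blinfun_componentwise)
    fix i :: "real^'n"
    have "continuous_on U (\<lambda>x. frechet_derivative f (at x) i)"
      using assms(2)[of 1] by auto
    then show "continuous_on U (\<lambda>x. blinfun_apply (f' x) i)"
      by (rule continuous_on_eq) (simp add: f')
  qed
  obtain h where h: "linear h" "h \<circ> frechet_derivative f (at x0) = id"
    using linear_injective_left_inverse[OF has_derivative_linear[OF der[OF assms(3)]] assms(4)] by blast
  have "Blinfun h o\<^sub>L f' x0 = id_blinfun"
    using h assms(3)
    by (intro blinfun_eqI) (simp add: f' bounded_linear_Blinfun_apply linear_linear pointfree_idE)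
  from inverse_function_theorem[OF assms(1) _ cont assms(3) this, of f] der f'
  obtain U' V g g' where UV: "open U'" "U' \<subseteq> U" "x0 \<in> U'" "open V" "homeomorphism U' V f g"
    and g': "\<And>y. y \<in> V \<Longrightarrow> (g has_derivative g' y) (at y)"
      "\<And>y. y \<in> V \<Longrightarrow> g' y = inv (blinfun_apply (f' (g y)))"
      "\<And>y. y \<in> V \<Longrightarrow> bij (blinfun_apply (f' (g y)))"
    by metis
  have gV: "g y \<in> U" if "y \<in> V" for y
    using UV that by (auto simp: homeomorphism_def)
  define J where "J = (\<lambda>x. matrix (frechet_derivative f (at x)))"
  have J: "J x *v v = frechet_derivative f (at x) v" if "x \<in> U" for x v
    unfolding J_def using has_derivative_linear[OF der[OF that]] by (simp add: matrix_works)
  have detJ: "det (J (g y)) \<noteq> 0" if "y \<in> V" for y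
  proof -
    have "inj ((*v) (J (g y)))"
      using g'(3)[OF that] f'[OF gV[OF that]] J[OF gV[OF that]] by (simp add: bij_def inj_def)
    then show ?thesis
      using det_nz_iff_inj matrix_vector_mul_linear[of "J (g y)"] by (metis matrix_of_matrix_vector_mul)
  qed
  have inv: "g' y v = matrix_inv (J (g y)) *v v" if "y \<in> V" for y v
  proof -
    let ?L = "blinfun_apply (f' (g y))"
    have "?L (matrix_inv (J (g y)) *v v) = v"
      using matrix_inv_mult(1)[OF detJ[OF that]]
      by (simp add: f' gV that J[symmetric] matrix_vector_mul_assoc)
    then show ?thesis
      using g'(2,3)[OF that] by (metis bij_inv_eq_iff)
  qed
  have "Ck_on k V g" for k
  proof (induction k)
    case 0
    then show ?case using UV by (simp add: homeomorphism_def)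
  next
    case (Suc k)
    show ?case
    proof (rule Ck_on_SucI[OF g'(1) _ UV(4)])
      fix v
      have J_Ck: "Ck_on k V (\<lambda>y. J (g y) $ i $ j)" for i j
      proof -
        have "Ck_on k U (\<lambda>x. frechet_derivative f (at x) (axis j 1) $ i)"
          by (intro Ck_on_vec_nth Ck_on_frechet assms)
        then show ?thesis unfolding J_def matrix_def vec_lambda_beta
          by (rule Ck_on_compose[OF UV(4) _ Suc.IH]) (use gV in auto)
      qed
      have "Ck_on k V (\<lambda>y. matrix_inv (J (g y)) *v v)"
        unfolding matrix_vector_mult_def
        by (rule Ck_on_vec[OF UV(4)], unfold vec_lambda_beta,
            intro Ck_on_sum Ck_on_mult Ck_on_const Ck_on_matrix_inv UV(4) J_Ck detJ)
      then show "Ck_on k V (\<lambda>y. g' y v)"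
        by (rule Ck_on_cong[OF UV(4), rotated]) (simp add: inv)
    qed
  qed
  then show ?thesis using that UV by blast
qed

section \<open>Symmetry of second derivatives\<close>

lemma second_difference:
  fixes h :: "'a::real_normed_vector \<Rightarrow> real"
  assumes "Ck_on 2 U h" "0 < \<tau>"
    and U: "\<And>s t. 0 \<le> s \<Longrightarrow> s \<le> \<tau> \<Longrightarrow> 0 \<le> t \<Longrightarrow> t \<le> \<tau> \<Longrightarrow> p + s *\<^sub>R u + t *\<^sub>R v \<in> U"
  shows "\<exists>s t. 0 < s \<and> s < \<tau> \<and> 0 < t \<and> t < \<tau> \<and>
    h (p + \<tau> *\<^sub>R u + \<tau> *\<^sub>R v) - h (p + \<tau> *\<^sub>R u) - (h (p + \<tau> *\<^sub>R v) - h p) =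
    \<tau>^2 * frechet_derivative (\<lambda>q. frechet_derivative h (at q) u) (at (p + s *\<^sub>R u + t *\<^sub>R v)) v"
proof -
  have h: "(h has_derivative frechet_derivative h (at q)) (at q)" if "q \<in> U" for q
    using Ck_on_SucD[of 1 U h q] assms(1) that by (simp add: numeral_2_eq_2)
  define d where "d = (\<lambda>q. frechet_derivative h (at q) u)"
  have d: "(d has_derivative frechet_derivative d (at q)) (at q)" if "q \<in> U" for q
    using Ck_on_SucD[of 0 U d q] assms(1) that by (simp add: numeral_2_eq_2 d_def)
  have h': "((\<lambda>s. h (p + s *\<^sub>R u + t *\<^sub>R v)) has_real_derivative d (p + s *\<^sub>R u + t *\<^sub>R v)) (at s)"
    if "0 \<le> s" "s \<le> \<tau>" "0 \<le> t" "t \<le> \<tau>" for s t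
  proof -
    have "((\<lambda>s. p + s *\<^sub>R u + t *\<^sub>R v) has_derivative (\<lambda>r. r *\<^sub>R u)) (at s)"
      by (auto intro!: derivative_eq_intros)
    from diff_chain_at[OF this h[OF U[OF that]]] show ?thesis
      using linear_cmul[OF has_derivative_linear[OF h[OF U[OF that]]]]
      by (auto simp: has_field_derivative_def o_def d_def mult.commute elim!: has_derivative_eq_rhs)
  qed
  have d': "((\<lambda>t. d (p + s *\<^sub>R u + t *\<^sub>R v)) has_real_derivative
      frechet_derivative d (at (p + s *\<^sub>R u + t *\<^sub>R v)) v) (at t)"
    if "0 \<le> s" "s \<le> \<tau>" "0 \<le> t" "t \<le> \<tau>" for s t
  proof -
    have "((\<lambda>t. p + s *\<^sub>R u + t *\<^sub>R v) has_derivative (\<lambda>r. r *\<^sub>R v)) (at t)"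
      by (auto intro!: derivative_eq_intros)
    from diff_chain_at[OF this d[OF U[OF that]]] show ?thesis
      using linear_cmul[OF has_derivative_linear[OF d[OF U[OF that]]]]
      by (auto simp: has_field_derivative_def o_def mult.commute elim!: has_derivative_eq_rhs)
  qed
  define k where "k = (\<lambda>s. h (p + s *\<^sub>R u + \<tau> *\<^sub>R v) - h (p + s *\<^sub>R u + 0 *\<^sub>R v))"
  have "\<exists>s. 0 < s \<and> s < \<tau> \<and> k \<tau> - k 0 = (\<tau> - 0) * (d (p + s *\<^sub>R u + \<tau> *\<^sub>R v) - d (p + s *\<^sub>R u + 0 *\<^sub>R v))"
    by (rule MVT2[OF assms(2)], unfold k_def, intro DERIV_diff h') (use assms(2) in auto)
  then obtain s where s: "0 < s" "s < \<tau>"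
    "k \<tau> - k 0 = \<tau> * (d (p + s *\<^sub>R u + \<tau> *\<^sub>R v) - d (p + s *\<^sub>R u + 0 *\<^sub>R v))" by auto
  have "\<exists>t. 0 < t \<and> t < \<tau> \<and> d (p + s *\<^sub>R u + \<tau> *\<^sub>R v) - d (p + s *\<^sub>R u + 0 *\<^sub>R v) =
      (\<tau> - 0) * frechet_derivative d (at (p + s *\<^sub>R u + t *\<^sub>R v)) v"
    by (rule MVT2[OF assms(2)], intro d') (use s in auto)
  then obtain t where t: "0 < t" "t < \<tau>" "d (p + s *\<^sub>R u + \<tau> *\<^sub>R v) - d (p + s *\<^sub>R u + 0 *\<^sub>R v) =
      \<tau> * frechet_derivative d (at (p + s *\<^sub>R u + t *\<^sub>R v)) v" by auto
  show ?thesis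
    using s t by (intro exI[of _ s] exI[of _ t]) (simp add: k_def d_def power2_eq_square)
qed

text \<open>The second difference over the parallelogram spanned by
  \<open>\<tau> *\<^sub>R u\<close> and \<open>\<tau> *\<^sub>R v\<close> does not change when
  \<open>u\<close> and \<open>v\<close> are exchanged, and two applications of the mean value
  theorem make it \<tau>^2 times either mixed derivative at some point nearby. Continuity then
  forbids different values at \<open>p\<close>.\<close>

lemma second_derivative_symmetric_real:
  fixes h :: "'a::real_normed_vector \<Rightarrow> real"
  assumes "open U" "Ck_on 2 U h" "p \<in> U"
  shows "frechet_derivative (\<lambda>q. frechet_derivative h (at q) u) (at p) v =
    frechet_derivative (\<lambda>q. frechet_derivative h (at q) v) (at p) u" (is "?A p = ?B p")
proof (rule ccontr)
  assume ne: "?A p \<noteq> ?B p"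
  \<comment> \<open>Half of the gap: values within \<open>e\<close> of \<open>?A p\<close> and of
    \<open>?B p\<close> cannot coincide.\<close>
  define e where "e = \<bar>?A p - ?B p\<bar> / 2"
  have e: "e > 0" using ne by (simp add: e_def)
  have A: "continuous_on U ?A" and B: "continuous_on U ?B"
    using assms(2) by (auto simp: numeral_2_eq_2)
  obtain d1 where d1: "d1 > 0" "\<And>q. dist q p < d1 \<Longrightarrow> \<bar>?A q - ?A p\<bar> < e"
    using A assms e unfolding continuous_on_eq_continuous_at[OF assms(1)] continuous_at_eps_delta dist_real_def
    by (metis)
  obtain d2 where d2: "d2 > 0" "\<And>q. dist q p < d2 \<Longrightarrow> \<bar>?B q - ?B p\<bar> < e"
    using B assms e unfolding continuous_on_eq_continuous_at[OF assms(1)] continuous_at_eps_delta dist_real_def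
    by (metis)
  obtain d3 where d3: "d3 > 0" "ball p d3 \<subseteq> U"
    using assms open_contains_ball by blast
  define d where "d = min d1 (min d2 d3)"
  \<comment> \<open>Chosen so that the whole parallelogram stays within \<open>d / 2\<close> of
    \<open>p\<close>; the summand 1 keeps the denominator positive when \<open>u\<close> and
    \<open>v\<close> are both zero.\<close>
  define \<tau> where "\<tau> = d / (2 * (norm u + norm v + 1))"
  have pos: "norm u + norm v + 1 > 0" by (simp add: add_nonneg_pos)
  have d: "d > 0" using d1 d2 d3 by (simp add: d_def)
  have \<tau>: "\<tau> > 0" using d pos by (simp add: \<tau>_def)
  have near: "dist (p + s *\<^sub>R u + t *\<^sub>R v) p < d" if "0 \<le> s" "s \<le> \<tau>" "0 \<le> t" "t \<le> \<tau>" for s t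
  proof -
    have "norm (s *\<^sub>R u + t *\<^sub>R v) \<le> s * norm u + t * norm v"
      using that by (metis abs_of_nonneg norm_scaleR norm_triangle_ineq)
    also have "\<dots> \<le> \<tau> * norm u + \<tau> * norm v"
      using that by (intro add_mono mult_right_mono) auto
    also have "\<dots> \<le> \<tau> * (norm u + norm v + 1)" using \<tau> by (simp add: algebra_simps)
    also have "\<dots> = d / 2" using pos by (simp add: \<tau>_def field_simps)
    also have "\<dots> < d" using d by simp
    finally show ?thesis by (simp add: dist_norm add.assoc)
  qed
  have inU: "p + s *\<^sub>R u + t *\<^sub>R v \<in> U" if "0 \<le> s" "s \<le> \<tau>" "0 \<le> t" "t \<le> \<tau>" for s t
    using near[OF that] d3 by (auto simp: d_def dist_commute subset_iff)
  have inU': "p + s *\<^sub>R v + t *\<^sub>R u \<in> U" if "0 \<le> s" "s \<le> \<tau>" "0 \<le> t" "t \<le> \<tau>" for s t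
    using inU[OF that(3,4,1,2)] by (simp add: algebra_simps)
  obtain s t where st: "0 < s" "s < \<tau>" "0 < t" "t < \<tau>"
    "h (p + \<tau> *\<^sub>R u + \<tau> *\<^sub>R v) - h (p + \<tau> *\<^sub>R u) - (h (p + \<tau> *\<^sub>R v) - h p) = \<tau>^2 * ?A (p + s *\<^sub>R u + t *\<^sub>R v)"
    using second_difference[OF assms(2) \<tau> inU] by blast
  obtain s' t' where st': "0 < s'" "s' < \<tau>" "0 < t'" "t' < \<tau>"
    "h (p + \<tau> *\<^sub>R v + \<tau> *\<^sub>R u) - h (p + \<tau> *\<^sub>R v) - (h (p + \<tau> *\<^sub>R u) - h p) = \<tau>^2 * ?B (p + s' *\<^sub>R v + t' *\<^sub>R u)"
    using second_difference[OF assms(2) \<tau> inU'] by blast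
  have "p + \<tau> *\<^sub>R v + \<tau> *\<^sub>R u = p + \<tau> *\<^sub>R u + \<tau> *\<^sub>R v" by simp
  then have "\<tau>^2 * ?A (p + s *\<^sub>R u + t *\<^sub>R v) = \<tau>^2 * ?B (p + s' *\<^sub>R v + t' *\<^sub>R u)"
    using st(5) st'(5) by (simp only: algebra_simps)
  then have eq: "?A (p + s *\<^sub>R u + t *\<^sub>R v) = ?B (p + s' *\<^sub>R v + t' *\<^sub>R u)" using \<tau> by simp
  have "\<bar>?A (p + s *\<^sub>R u + t *\<^sub>R v) - ?A p\<bar> < e"
    using near[of s t] st by (intro d1(2)) (auto simp: d_def)
  moreover have "\<bar>?B (p + s' *\<^sub>R v + t' *\<^sub>R u) - ?B p\<bar> < e"
    using near[of t' s'] st' by (intro d2(2)) (auto simp: d_def algebra_simps)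
  ultimately show False using eq unfolding e_def by argo
qed

lemma second_derivative_symmetric:
  fixes h :: "'a::real_normed_vector \<Rightarrow> 'b::euclidean_space"
  assumes "open U" "Ck_on 2 U h" "p \<in> U"
  shows "frechet_derivative (\<lambda>q. frechet_derivative h (at q) u) (at p) v =
    frechet_derivative (\<lambda>q. frechet_derivative h (at q) v) (at p) u"
proof (rule euclidean_eqI)
  fix b :: 'b
  have inner: "frechet_derivative (\<lambda>q. k q \<bullet> b) (at q) = (\<lambda>v. frechet_derivative k (at q) v \<bullet> b)"
    if "Ck_on (Suc j) U k" "q \<in> U" for j k q
    using frechet_derivative_at[OF has_derivative_inner_left[OF Ck_on_SucD[OF that], of b]] by simp
  have h: "Ck_on (Suc 1) U h" using assms(2) by (simp add: numeral_2_eq_2)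
  have "frechet_derivative (\<lambda>q. frechet_derivative (\<lambda>q. h q \<bullet> b) (at q) u) (at p) v =
      frechet_derivative (\<lambda>q. frechet_derivative h (at q) u) (at p) v \<bullet> b" for u v
  proof -
    have "Ck_on (Suc 0) U (\<lambda>q. frechet_derivative h (at q) u)" using h by simp
    from Ck_on_SucD[OF this assms(3)]
    have "((\<lambda>q. frechet_derivative h (at q) u \<bullet> b) has_derivative
        (\<lambda>v. frechet_derivative (\<lambda>q. frechet_derivative h (at q) u) (at p) v \<bullet> b)) (at p)"
      by (rule has_derivative_inner_left)
    then have "((\<lambda>q. frechet_derivative (\<lambda>q. h q \<bullet> b) (at q) u) has_derivative
        (\<lambda>v. frechet_derivative (\<lambda>q. frechet_derivative h (at q) u) (at p) v \<bullet> b)) (at p)"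
      by (rule has_derivative_transform_within_open[OF _ assms(1,3)]) (simp add: inner[OF h])
    then show ?thesis using frechet_derivative_at by metis
  qed
  moreover have "Ck_on 2 U (\<lambda>q. h q \<bullet> b)"
    by (intro Ck_on_inner_left assms)
  ultimately show "frechet_derivative (\<lambda>q. frechet_derivative h (at q) u) (at p) v \<bullet> b =
    frechet_derivative (\<lambda>q. frechet_derivative h (at q) v) (at p) u \<bullet> b"
    using second_derivative_symmetric_real[OF assms(1) _ assms(3), of "\<lambda>q. h q \<bullet> b" u v] by simp
qed

section \<open>The derivative of a determinant\<close>

lemma det_replace_row:
  fixes A :: "real^'n^'n::finite"
  shows "det (\<chi> r. if r = i then B $ i else A $ r) =
    (\<Sum>p | p permutes UNIV. of_int (sign p) * (B $ i $ p i * (\<Prod>r\<in>UNIV - {i}. A $ r $ p r)))"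
proof -
  have "(\<Prod>r\<in>UNIV. (\<chi> r. if r = i then B $ i else A $ r) $ r $ p r) =
      B $ i $ p i * (\<Prod>r\<in>UNIV - {i}. A $ r $ p r)" for p
    by (subst prod.remove[of _ i]) (auto intro: prod.cong)
  then show ?thesis by (simp add: det_def)
qed

text \<open>Jacobi's formula. The product rule in the Leibniz expansion gives, for each
  \<open>i\<close>, the determinant of \<open>A x\<close> with row \<open>i\<close> replaced by that
  of \<open>A' v\<close>. Writing \<open>A' v = R ** A x\<close> makes this row a combination of the
  rows of \<open>A x\<close>, and the determinant is \<open>R $ i $ i * det (A x)\<close>.\<close>

lemma has_derivative_det:
  fixes A :: "'a::real_normed_vector \<Rightarrow> real^'n^'n::finite"
  assumes A: "(A has_derivative A') (at x)" and det: "det (A x) \<noteq> 0"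
  shows "((\<lambda>x. det (A x)) has_derivative (\<lambda>v. det (A x) * trace (matrix_inv (A x) ** A' v))) (at x)"
proof -
  have entry: "((\<lambda>x. A x $ i $ j) has_derivative (\<lambda>v. A' v $ i $ j)) (at x)" for i j
    by (intro bounded_linear.has_derivative[OF bounded_linear_vec_nth] A)
  have "((\<lambda>x. det (A x)) has_derivative (\<lambda>v. \<Sum>p | p permutes UNIV. of_int (sign p) *
      (\<Sum>i\<in>UNIV. A' v $ i $ p i * (\<Prod>r\<in>UNIV - {i}. A x $ r $ p r)))) (at x)"
    unfolding det_def
    by (intro has_derivative_sum has_derivative_mult_right has_derivative_prod entry)
  moreover have "(\<Sum>p | p permutes UNIV. of_int (sign p) *
      (\<Sum>i\<in>UNIV. A' v $ i $ p i * (\<Prod>r\<in>UNIV - {i}. A x $ r $ p r))) =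
      det (A x) * trace (matrix_inv (A x) ** A' v)" for v
  proof -
    define R where "R = A' v ** matrix_inv (A x)"
    have R: "R ** A x = A' v"
      by (simp add: R_def matrix_mul_assoc[symmetric] matrix_inv_mult[OF det])
    have "det (\<chi> r. if r = i then A' v $ i else A x $ r) = R $ i $ i * det (A x)" for i
    proof -
      have "A' v $ i = (\<Sum>k\<in>UNIV. (R $ i) $ k *s row k (A x))"
        unfolding R[symmetric]
        by (simp add: vec_eq_iff matrix_matrix_mult_def row_def)
      then show ?thesis
        using cramer_lemma_transpose[of i "R $ i" "A x"] by (simp add: row_def vec_nth_inverse cong: if_cong)
    qed
    then have "(\<Sum>i\<in>UNIV. det (\<chi> r. if r = i then A' v $ i else A x $ r)) = trace R * det (A x)"
      by (simp add: trace_def sum_distrib_right)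
    moreover have "trace R = trace (matrix_inv (A x) ** A' v)"
      unfolding R_def by (rule trace_mul_sym)
    moreover have "(\<Sum>p | p permutes UNIV. of_int (sign p) *
      (\<Sum>i\<in>UNIV. A' v $ i $ p i * (\<Prod>r\<in>UNIV - {i}. A x $ r $ p r))) =
      (\<Sum>i\<in>UNIV. det (\<chi> r. if r = i then A' v $ i else A x $ r))"
      unfolding det_replace_row sum_distrib_left by (rule sum.swap)
    ultimately show ?thesis by simp
  qed
  ultimately show ?thesis by simp
qed

text \<open>Charts are pairs; quantifiers over charts should not be split.\<close>

declare split_paired_All [simp del] split_paired_Ex [simp del]

section \<open>Charts, tangent spaces and metrics in coordinates\<close>

lemma chart_props:
  assumes "is_chart c"
  shows "open (cdom c)" "open (cmap c ` cdom c)" "continuous_on (cdom c) (cmap c)"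
    "continuous_on (cmap c ` cdom c) (cinv c)"
    "\<And>x. x \<in> cdom c \<Longrightarrow> cinv c (cmap c x) = x"
    "\<And>z. z \<in> cmap c ` cdom c \<Longrightarrow> cmap c (cinv c z) = z"
    "\<And>z. z \<in> cmap c ` cdom c \<Longrightarrow> cinv c z \<in> cdom c"
  using assms unfolding is_chart_def homeomorphism_def by auto

lemma chart_image_Int:
  assumes "is_chart c"
  shows "cmap c ` (cdom c \<inter> W) = {z \<in> cmap c ` cdom c. cinv c z \<in> W}"
  using chart_props[OF assms] by force

lemma open_chart_image:
  assumes "is_chart c" "open W"
  shows "open (cmap c ` (cdom c \<inter> W))"
  using continuous_open_preimage[OF chart_props(4,2)[OF assms(1)] assms(2)]
  unfolding chart_image_Int[OF assms(1)] by (simp add: vimage_def Int_def)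

lemma manifold_chart: "smooth_manifold M \<Longrightarrow> c \<in> M \<Longrightarrow> is_chart c"
  by (simp add: smooth_manifold_def)

lemma chart_at_props:
  assumes "smooth_manifold M"
  shows "chart_at M x \<in> M" "x \<in> cdom (chart_at M x)"
proof -
  have "\<exists>c. c \<in> M \<and> x \<in> cdom c" using assms unfolding smooth_manifold_def by blast
  from someI_ex[OF this] show "chart_at M x \<in> M" "x \<in> cdom (chart_at M x)"
    unfolding chart_at_def by auto
qed

lemma smooth_map_id: "smooth_manifold M \<Longrightarrow> smooth_map M M id"
  unfolding smooth_map_def smooth_manifold_def by simp

definition chart_deriv ::
  "('a, 'i::finite) chart \<Rightarrow> ('b, 'j::finite) chart \<Rightarrow> ('a \<Rightarrow> 'b) \<Rightarrow> 'a \<Rightarrow> real ^ 'i \<Rightarrow> real ^ 'j" where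
  "chart_deriv c d f x = frechet_derivative (local_rep c d f) (at (cmap c x))"

lemma open_rep_domain:
  assumes "is_chart c" "is_chart d" "continuous_on UNIV f"
  shows "open (cmap c ` (cdom c \<inter> f -` cdom d))"
  using assms chart_props(1)[OF assms(2)] by (intro open_chart_image) (auto intro: open_vimage)

lemma Ck_on_local_rep:
  assumes "smooth_manifold M" "smooth_manifold N" "smooth_map M N f" "c \<in> M" "d \<in> N"
  shows "Ck_on k (cmap c ` (cdom c \<inter> f -` cdom d)) (local_rep c d f)"
  using assms manifold_chart[OF assms(1,4)] manifold_chart[OF assms(2,5)]
  by (intro smooth_on_openD open_rep_domain) (auto simp: smooth_map_def)

lemma has_derivative_local_rep:
  assumes "smooth_manifold M" "smooth_manifold N" "smooth_map M N f" "c \<in> M" "d \<in> N"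
    "x \<in> cdom c" "f x \<in> cdom d"
  shows "(local_rep c d f has_derivative chart_deriv c d f x) (at (cmap c x))"
  unfolding chart_deriv_def
  using Ck_on_SucD[OF Ck_on_local_rep[OF assms(1-5)], of "cmap c x"] assms(6,7) by auto

lemma linear_chart_deriv:
  assumes "smooth_manifold M" "smooth_manifold N" "smooth_map M N f" "c \<in> M" "d \<in> N"
    "x \<in> cdom c" "f x \<in> cdom d"
  shows "linear (chart_deriv c d f x)"
  using has_derivative_linear[OF has_derivative_local_rep[OF assms]] .

lemma local_rep_comp:
  assumes "is_chart d" "z \<in> cmap c ` (cdom c \<inter> f -` cdom d)" "is_chart c"
  shows "local_rep c e (h \<circ> f) z = local_rep d e h (local_rep c d f z)"
  using assms(2) chart_props(5)[OF assms(1)] chart_props(5)[OF assms(3)] by (auto simp: local_rep_def)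

text \<open>The chain rule in charts. With one of the two maps the identity it becomes the
  transformation law under a change of chart in the source or in the target, which is the form used
  later.\<close>

lemma chart_deriv_comp:
  assumes M: "smooth_manifold M" and N: "smooth_manifold N" and P: "smooth_manifold P"
    and f: "smooth_map M N f" and h: "smooth_map N P h" and c: "c \<in> M" and d: "d \<in> N" and e: "e \<in> P"
    and x: "x \<in> cdom c" "f x \<in> cdom d" "h (f x) \<in> cdom e"
  shows "chart_deriv c e (h \<circ> f) x v = chart_deriv d e h (f x) (chart_deriv c d f x v)"
proof -
  have "local_rep c d f (cmap c x) = cmap d (f x)"
    using chart_props(5)[OF manifold_chart[OF M c] x(1)] by (simp add: local_rep_def)
  with diff_chain_at[OF has_derivative_local_rep[OF M N f c d x(1,2)], of "local_rep d e h"]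
    has_derivative_local_rep[OF N P h d e x(2,3)]
  have "(local_rep d e h \<circ> local_rep c d f has_derivative
      chart_deriv d e h (f x) \<circ> chart_deriv c d f x) (at (cmap c x))" by simp
  then have "(local_rep c e (h \<circ> f) has_derivative
      chart_deriv d e h (f x) \<circ> chart_deriv c d f x) (at (cmap c x))"
    by (rule has_derivative_transform_within_open[OF _ open_rep_domain[of c d f]])
      (use f x manifold_chart[OF M c] manifold_chart[OF N d] local_rep_comp[of d _ c f e h]
        in \<open>auto simp: smooth_map_def\<close>)
  from frechet_derivative_at[OF this] show ?thesis unfolding chart_deriv_def by (metis o_apply)
qed

lemma smooth_map_comp:
  assumes M: "smooth_manifold M" and N: "smooth_manifold N" and P: "smooth_manifold P"
    and f: "smooth_map M N f" and h: "smooth_map N P h"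
  shows "smooth_map M P (h \<circ> f)"
  unfolding smooth_map_def
proof (intro conjI ballI smooth_on_localI)
  show "continuous_on UNIV (h \<circ> f)"
    using f h continuous_on_compose[of UNIV f h] continuous_on_subset[of UNIV h] by (auto simp: smooth_map_def)
  fix c e z assume c: "c \<in> M" and e: "e \<in> P" and z: "z \<in> cmap c ` (cdom c \<inter> (h \<circ> f) -` cdom e)"
  then obtain x where x: "x \<in> cdom c" "h (f x) \<in> cdom e" "z = cmap c x" by auto
  define d where "d = chart_at N (f x)"
  note d = chart_at_props[OF N, of "f x", folded d_def]
  have charts: "is_chart c" "is_chart d" "is_chart e" using manifold_chart M N P c d e by blast+
  define W where "W = cdom c \<inter> (f -` cdom d \<inter> (h \<circ> f) -` cdom e)"
  have W: "open (cmap c ` W)" unfolding W_def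
    using \<open>continuous_on UNIV (h \<circ> f)\<close> f charts chart_props(1)[OF charts(2)] chart_props(1)[OF charts(3)]
    by (intro open_chart_image open_Int open_vimage) (auto simp: smooth_map_def)
  have "Ck_on k (cmap c ` W) (\<lambda>z. local_rep d e h (local_rep c d f z))" for k
  proof (rule Ck_on_compose[OF W Ck_on_local_rep[OF N P h d(1) e]])
    show "Ck_on k (cmap c ` W) (local_rep c d f)"
      by (rule Ck_on_subset[OF Ck_on_local_rep[OF M N f c d(1)]]) (auto simp: W_def)
    show "local_rep c d f ` cmap c ` W \<subseteq> cmap d ` (cdom d \<inter> h -` cdom e)"
      using chart_props(5)[OF charts(1)] by (auto simp: W_def local_rep_def)
  qed
  then have "Ck_on k (cmap c ` W) (local_rep c e (h \<circ> f))" for k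
    by (rule Ck_on_cong[OF W, rotated]) (use local_rep_comp[OF charts(2) _ charts(1), of _ f e h] in \<open>auto simp: W_def\<close>)
  then show "\<exists>U. open U \<and> z \<in> U \<and> (\<forall>k. Ck_on k U (local_rep c e (h \<circ> f)))"
    using W x d by (intro exI[of _ "cmap c ` W"]) (auto simp: W_def)
qed

lemma chart_deriv_self:
  assumes "smooth_manifold M" "c \<in> M" "x \<in> cdom c"
  shows "chart_deriv c c id x v = v"
proof -
  note ch = manifold_chart[OF assms(1,2)]
  have "(local_rep c c id has_derivative (\<lambda>v. v)) (at (cmap c x))"
    by (rule has_derivative_transform_within_open[OF has_derivative_ident chart_props(2)[OF ch]])
      (use assms chart_props(6)[OF ch] in \<open>auto simp: local_rep_def\<close>)
  then show ?thesis unfolding chart_deriv_def using frechet_derivative_at by metis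
qed

lemma chart_deriv_id_id:
  assumes "smooth_manifold M" "c \<in> M" "d \<in> M" "e \<in> M" "x \<in> cdom c" "x \<in> cdom d" "x \<in> cdom e"
  shows "chart_deriv d e id x (chart_deriv c d id x v) = chart_deriv c e id x v"
  using chart_deriv_comp[OF assms(1,1,1) smooth_map_id[OF assms(1)] smooth_map_id[OF assms(1)] assms(2-5)] assms
  by simp

lemma chart_deriv_dom:
  assumes "smooth_manifold M" "smooth_manifold N" "smooth_map M N f" "c \<in> M" "c' \<in> M" "d \<in> N"
    "x \<in> cdom c" "x \<in> cdom c'" "f x \<in> cdom d"
  shows "chart_deriv c' d f x (chart_deriv c c' id x v) = chart_deriv c d f x v"
  using chart_deriv_comp[OF assms(1,1,2) smooth_map_id[OF assms(1)] assms(3-7)] assms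
  by simp

lemma chart_deriv_cod:
  assumes "smooth_manifold M" "smooth_manifold N" "smooth_map M N f" "c \<in> M" "d \<in> N" "d' \<in> N"
    "x \<in> cdom c" "f x \<in> cdom d" "f x \<in> cdom d'"
  shows "chart_deriv d d' id (f x) (chart_deriv c d f x v) = chart_deriv c d' f x v"
  using chart_deriv_comp[OF assms(1,2,2,3) smooth_map_id[OF assms(2)] assms(4-7)] assms
  by simp

section \<open>Tangent vectors and tangent maps in arbitrary charts\<close>

lemma tangent_space_iff:
  "v \<in> tangent_space M x \<longleftrightarrow> (\<forall>c. c \<notin> M \<or> x \<notin> cdom c \<longrightarrow> v c = 0) \<and>
     (\<forall>c\<in>M. \<forall>d\<in>M. x \<in> cdom c \<inter> cdom d \<longrightarrow> v d = chart_deriv c d id x (v c))"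
  by (simp add: tangent_space_def chart_deriv_def)

lemma tangent_spaceD:
  assumes "v \<in> tangent_space M x"
  shows "c \<notin> M \<or> x \<notin> cdom c \<Longrightarrow> v c = 0"
    "c \<in> M \<Longrightarrow> d \<in> M \<Longrightarrow> x \<in> cdom c \<Longrightarrow> x \<in> cdom d \<Longrightarrow> chart_deriv c d id x (v c) = v d"
  using assms unfolding tangent_space_iff by (blast, metis IntI)

lemma tangent_at_eq:
  "tangent_at M c x v = (\<lambda>d. if d \<in> M \<and> x \<in> cdom d then chart_deriv c d id x v else 0)"
  unfolding tangent_at_def chart_deriv_def ..

lemma tangent_at_in:
  assumes "smooth_manifold M" "c \<in> M" "x \<in> cdom c"
  shows "tangent_at M c x v \<in> tangent_space M x" "tangent_at M c x v c = v"
  using assms by (auto simp: tangent_space_iff tangent_at_eq chart_deriv_id_id chart_deriv_self)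

lemma tangent_eq_tangent_at:
  assumes "v \<in> tangent_space M x" "c \<in> M" "x \<in> cdom c"
  shows "v = tangent_at M c x (v c)"
  using tangent_spaceD[OF assms(1)] assms(2,3) by (auto simp: tangent_at_eq fun_eq_iff)

lemma tangent_eqI:
  assumes "u \<in> tangent_space M x" "v \<in> tangent_space M x" "c \<in> M" "x \<in> cdom c" "u c = v c"
  shows "u = v"
  using tangent_eq_tangent_at assms by metis

lemma linear_trans:
  assumes "smooth_manifold M" "c \<in> M" "d \<in> M" "x \<in> cdom c" "x \<in> cdom d"
  shows "linear (chart_deriv c d id x)"
  using linear_chart_deriv[OF assms(1,1) smooth_map_id[OF assms(1)] assms(2-4)] assms by simp

lemma tangent_space_lin:
  assumes "smooth_manifold M" "u \<in> tangent_space M x" "v \<in> tangent_space M x"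
  shows "(\<lambda>c. a *\<^sub>R u c + b *\<^sub>R v c) \<in> tangent_space M x"
  unfolding tangent_space_iff
proof (intro conjI allI ballI impI)
  show "a *\<^sub>R u c + b *\<^sub>R v c = 0" if "c \<notin> M \<or> x \<notin> cdom c" for c
    using tangent_spaceD(1)[OF assms(2) that] tangent_spaceD(1)[OF assms(3) that] by simp
  fix c d assume c: "c \<in> M" "d \<in> M" "x \<in> cdom c \<inter> cdom d"
  then have x: "x \<in> cdom c" "x \<in> cdom d" by auto
  show "a *\<^sub>R u d + b *\<^sub>R v d = chart_deriv c d id x (a *\<^sub>R u c + b *\<^sub>R v c)"
    unfolding linear_add[OF linear_trans[OF assms(1) c(1,2) x]] linear_cmul[OF linear_trans[OF assms(1) c(1,2) x]]
      tangent_spaceD(2)[OF assms(2) c(1,2) x] tangent_spaceD(2)[OF assms(3) c(1,2) x] ..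
qed

lemma tangent_at_lin:
  assumes "smooth_manifold M" "c \<in> M" "x \<in> cdom c"
  shows "tangent_at M c x (a *\<^sub>R u + b *\<^sub>R v) = (\<lambda>d. a *\<^sub>R tangent_at M c x u d + b *\<^sub>R tangent_at M c x v d)"
  using assms by (auto simp: tangent_at_eq fun_eq_iff linear_add[OF linear_trans] linear_cmul[OF linear_trans])

text \<open>\<open>tmap\<close> is computed in the chart picked by \<open>chart_at\<close>; the
  transformation law of tangent vectors and the chain rule show that every chart around
  \<open>x\<close> gives the same value.\<close>

lemma tmap_chart:
  assumes "smooth_manifold M" "smooth_manifold N" "smooth_map M N f" "c \<in> M" "d \<in> N"
    "x \<in> cdom c" "f x \<in> cdom d" "X \<in> tangent_space M x"
  shows "tmap M N f x X d = chart_deriv c d f x (X c)"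
proof -
  note ca = chart_at_props[OF assms(1), of x]
  have "X c = chart_deriv (chart_at M x) c id x (X (chart_at M x))"
    using tangent_spaceD(2)[OF assms(8) ca(1) assms(4) ca(2) assms(6)] by simp
  then have "chart_deriv c d f x (X c) = chart_deriv (chart_at M x) d f x (X (chart_at M x))"
    using chart_deriv_dom[OF assms(1-3) ca(1) assms(4,5) ca(2) assms(6,7)] by simp
  then show ?thesis using assms by (simp add: tmap_def Let_def chart_deriv_def)
qed

lemma tmap_in:
  assumes "smooth_manifold M" "smooth_manifold N" "smooth_map M N f" "X \<in> tangent_space M x"
  shows "tmap M N f x X \<in> tangent_space N (f x)"
proof -
  note ca = chart_at_props[OF assms(1), of x]
  show ?thesis
    using tmap_chart[OF assms(1-3) ca(1) _ ca(2) _ assms(4)] chart_deriv_cod[OF assms(1-3) ca(1) _ _ ca(2)]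
    by (auto simp: tangent_space_iff tmap_def)
qed

lemma tmap_comp:
  assumes "smooth_manifold M" "smooth_manifold N" "smooth_manifold P"
    "smooth_map M N f" "smooth_map N P h" "X \<in> tangent_space M x"
  shows "tmap M P (h \<circ> f) x X = tmap N P h (f x) (tmap M N f x X)"
proof -
  note ca = chart_at_props[OF assms(1), of x] chart_at_props[OF assms(2), of "f x"]
  note hf = smooth_map_comp[OF assms(1-5)]
  show ?thesis
  proof
    fix d
    show "tmap M P (h \<circ> f) x X d = tmap N P h (f x) (tmap M N f x X) d"
    proof (cases "d \<in> P \<and> h (f x) \<in> cdom d")
      case True
      then show ?thesis
        using tmap_chart[OF assms(1,3) hf ca(1) _ ca(2) _ assms(6), of d]
          tmap_chart[OF assms(2,3,5) ca(3) _ ca(4) _ tmap_in[OF assms(1,2,4,6)], of d]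
          tmap_chart[OF assms(1,2,4) ca(1) ca(3) ca(2) ca(4) assms(6)]
          chart_deriv_comp[OF assms(1-5) ca(1,3) _ ca(2,4)]
        by simp
    qed (auto simp: tmap_def)
  qed
qed

lemma chart_deriv_inj:
  assumes "smooth_manifold M" "smooth_manifold N" "f \<in> Imm M N" "c \<in> M" "d \<in> N"
    "x \<in> cdom c" "f x \<in> cdom d"
  shows "inj (chart_deriv c d f x)"
proof (rule injI)
  fix u v assume eq: "chart_deriv c d f x u = chart_deriv c d f x v"
  have f: "smooth_map M N f" "inj_on (tmap M N f x) (tangent_space M x)"
    using assms(3) by (auto simp: Imm_def)
  note t = tangent_at_in[OF assms(1,4,6)]
  have "tmap M N f x (tangent_at M c x u) = tmap M N f x (tangent_at M c x v)"
    using tmap_chart[OF assms(1,2) f(1) assms(4-7) t(1)] eq t(2)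
    by (intro tangent_eqI[OF tmap_in[OF assms(1,2) f(1) t(1)] tmap_in[OF assms(1,2) f(1) t(1)] assms(5,7)]) simp
  then have "tangent_at M c x u = tangent_at M c x v"
    using f(2) t(1) by (auto simp: inj_on_def)
  then show "u = v" using t(2) by metis
qed

section \<open>Positive definite forms and Riemannian metrics in coordinates\<close>

definition ip :: "real^'n^'n::finite \<Rightarrow> real^'n \<Rightarrow> real^'n \<Rightarrow> real" where
  "ip G u v = u \<bullet> (G *v v)"

lemma ip_sum: "ip G u v = (\<Sum>i\<in>UNIV. \<Sum>j\<in>UNIV. u $ i * G $ i $ j * v $ j)"
  by (simp add: ip_def inner_vec_def matrix_vector_mult_def sum_distrib_left mult.assoc)

lemma ip_add_left: "ip G (u + w) v = ip G u v + ip G w v"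
  and ip_scaleR_left: "ip G (a *\<^sub>R u) v = a * ip G u v"
  and ip_diff_left: "ip G (u - w) v = ip G u v - ip G w v"
  and ip_minus_left: "ip G (- u) v = - ip G u v"
  and ip_0_left: "ip G 0 v = 0"
  by (simp_all add: ip_def inner_add_left inner_diff_left)

lemma ip_add_right: "ip G v (u + w) = ip G v u + ip G v w"
  and ip_scaleR_right: "ip G v (a *\<^sub>R u) = a * ip G v u"
  and ip_diff_right: "ip G v (u - w) = ip G v u - ip G v w"
  and ip_minus_right: "ip G v (- u) = - ip G v u"
  and ip_0_right: "ip G v 0 = 0"
  by (simp_all add: ip_sum algebra_simps sum.distrib sum_subtractf sum_distrib_left sum_negf)

lemma ip_sum_left: "ip G (\<Sum>i\<in>I. u i) v = (\<Sum>i\<in>I. ip G (u i) v)"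
  by (simp add: ip_def inner_sum_left)

lemma ip_sum_right: "ip G v (\<Sum>i\<in>I. u i) = (\<Sum>i\<in>I. ip G v (u i))"
  by (induction I rule: infinite_finite_induct) (auto simp: ip_0_right ip_add_right)

lemmas ip_bilinear = ip_add_left ip_add_right ip_scaleR_left ip_scaleR_right ip_diff_left ip_diff_right
  ip_minus_left ip_minus_right ip_0_left ip_0_right ip_sum_left ip_sum_right

lemma vec_expand: "(v::real^'n::finite) = (\<Sum>i\<in>UNIV. (v $ i) *\<^sub>R axis i 1)"
  by (simp add: vec_eq_iff axis_def if_distrib cong: if_cong)

lemma linear_expand:
  fixes L :: "real^'n::finite \<Rightarrow> 'a::real_vector"
  assumes "linear L"
  shows "L v = (\<Sum>i\<in>UNIV. (v $ i) *\<^sub>R L (axis i 1))"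
  by (subst vec_expand) (simp add: linear_sum[OF assms] linear_cmul[OF assms])

definition sympd :: "real^'n^'n::finite \<Rightarrow> bool" where
  "sympd G \<longleftrightarrow> (\<forall>u v. ip G u v = ip G v u) \<and> (\<forall>v. v \<noteq> 0 \<longrightarrow> ip G v v > 0)"

lemma sympd_sym: "sympd G \<Longrightarrow> ip G u v = ip G v u"
  and sympd_pos: "sympd G \<Longrightarrow> v \<noteq> 0 \<Longrightarrow> ip G v v > 0"
  and sympd_nonneg: "sympd G \<Longrightarrow> ip G v v \<ge> 0"
  unfolding sympd_def by (auto, cases "v = 0", auto simp: ip_0_left intro: less_imp_le)

lemma ip_axis: "ip G (axis i 1) (axis j 1) = G $ i $ j"
proof -
  have "(G *v axis j 1) $ i = G $ i $ j" by (simp add: matrix_vector_mul_component inner_axis)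
  then show ?thesis unfolding ip_def by (simp add: inner_axis')
qed

text \<open>On the segment from the identity matrix to \<open>G\<close> all forms are positive
  definite, hence have trivial kernel. The determinant starts at 1 and cannot reach 0.\<close>

lemma sympd_det_pos:
  assumes "sympd G"
  shows "det G > 0"
proof (rule ccontr)
  assume neg: "\<not> det G > 0"
  define H where "H = (\<lambda>s::real. (1 - s) *\<^sub>R mat 1 + s *\<^sub>R G)"
  have "continuous_on {0..1} (\<lambda>s. det (H s))"
    unfolding H_def det_def by (intro continuous_intros)
  moreover have "det (H 0) = 1" "det (H 1) = det G" by (auto simp: H_def det_I)
  ultimately obtain s where s: "0 \<le> s" "s \<le> 1" "det (H s) = 0"
    using IVT2'[of "\<lambda>s. det (H s)" 1 0 0] neg by auto
  have "\<not> inj ((*v) (H s))"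
    using det_nz_iff_inj[OF matrix_vector_mul_linear, of "H s"] s(3) by simp
  then obtain u w where "H s *v u = H s *v w" "u \<noteq> w" by (auto simp: inj_def)
  then have v: "H s *v (u - w) = 0" "u - w \<noteq> 0" by (auto simp: matrix_vector_mult_diff_distrib)
  define v where "v = u - w"
  have "ip (H s) v v = (1 - s) * (v \<bullet> v) + s * ip G v v"
    unfolding ip_def H_def
    by (simp add: matrix_vector_mult_add_rdistrib inner_add_right scaleR_matrix_vector_assoc[symmetric])
  moreover have "ip (H s) v v = 0" using v by (simp add: ip_def v_def)
  moreover have "v \<bullet> v > 0" "ip G v v > 0" using v sympd_pos[OF assms] by (auto simp: v_def)
  ultimately show False using s
    by (smt (verit) mult_nonneg_nonneg mult_pos_pos)
qed

lemma sympd_cauchy: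
  assumes "sympd G"
  shows "(ip G u v)\<^sup>2 \<le> ip G u u * ip G v v"
proof (cases "v = 0")
  case True
  then show ?thesis by (simp add: ip_bilinear)
next
  case False
  define a where "a = ip G v v"
  define b where "b = ip G u v"
  have a: "a > 0" using sympd_pos[OF assms False] by (simp add: a_def)
  have "0 \<le> ip G (a *\<^sub>R u - b *\<^sub>R v) (a *\<^sub>R u - b *\<^sub>R v)" by (rule sympd_nonneg[OF assms])
  also have "\<dots> = a * (ip G u u * a - b\<^sup>2)"
    by (simp add: ip_bilinear sympd_sym[OF assms, of v u] flip: a_def b_def) (simp add: algebra_simps power2_eq_square)
  finally have "0 \<le> ip G u u * a - b\<^sup>2" using a by (simp add: zero_le_mult_iff)
  then show ?thesis by (simp add: a_def b_def)
qed

lemma metric_lin: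
  assumes "riemannian_metric M g"
    "u \<in> tangent_space M x" "v \<in> tangent_space M x" "w \<in> tangent_space M x"
  shows "g x (\<lambda>c. a *\<^sub>R u c + b *\<^sub>R v c) w = a * g x u w + b * g x v w" "g x u v = g x v u"
    "u \<noteq> (\<lambda>c. 0) \<Longrightarrow> g x u u > 0"
  using assms unfolding riemannian_metric_def by blast+

text \<open>A metric is linear in its first argument by definition, and symmetry carries this over
  to the second. From here on, computations with the metric are linear algebra with its Gram
  matrix.\<close>

lemma metric_chart:
  assumes M: "smooth_manifold M" and g: "riemannian_metric M g" and c: "c \<in> M" "x \<in> cdom c"
    and u: "u \<in> tangent_space M x" and v: "v \<in> tangent_space M x"
  shows "g x u v = ip (gram M g c (cmap c x)) (u c) (v c)"
proof -
  let ?T = "tangent_at M c x"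
  note T = tangent_at_in[OF M c]
  have L1: "linear (\<lambda>p. g x (?T p) w)" if "w \<in> tangent_space M x" for w
  proof (rule linearI)
    show "g x (?T (p + q)) w = g x (?T p) w + g x (?T q) w" for p q
      using tangent_at_lin[OF M c, of 1 p 1 q] metric_lin(1)[OF g T(1) T(1) that, of 1 p 1 q] by simp
    show "g x (?T (r *\<^sub>R p)) w = r *\<^sub>R g x (?T p) w" for r p
      using tangent_at_lin[OF M c, of r p 0 p] metric_lin(1)[OF g T(1) T(1) that, of r p 0 p] by simp
  qed
  have sym: "g x (?T p) (?T q) = g x (?T q) (?T p)" for p q
    using metric_lin(2)[OF g T(1) T(1) T(1)] .
  have "g x u v = g x (?T (u c)) (?T (v c))"
    using tangent_eq_tangent_at[OF u c] tangent_eq_tangent_at[OF v c] by simp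
  also have "\<dots> = (\<Sum>i\<in>UNIV. (u c $ i) * g x (?T (axis i 1)) (?T (v c)))"
    using linear_expand[OF L1[OF T(1)[of "v c"]], of "u c"] by simp
  also have "\<dots> = (\<Sum>i\<in>UNIV. (u c $ i) * g x (?T (v c)) (?T (axis i 1)))" by (simp add: sym)
  also have "\<dots> = (\<Sum>i\<in>UNIV. (u c $ i) * (\<Sum>j\<in>UNIV. (v c $ j) * g x (?T (axis j 1)) (?T (axis i 1))))"
    using linear_expand[OF L1[OF T(1)], of "v c"] by simp
  also have "\<dots> = (\<Sum>i\<in>UNIV. (u c $ i) * (\<Sum>j\<in>UNIV. (v c $ j) * g x (?T (axis i 1)) (?T (axis j 1))))"
    by (simp add: sym)
  also have "\<dots> = ip (gram M g c (cmap c x)) (u c) (v c)"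
    by (simp add: ip_sum gram_def coord_field_def chart_props(5)[OF manifold_chart[OF M c(1)] c(2)]
        sum_distrib_left algebra_simps)
  finally show ?thesis .
qed

lemma sympd_gram:
  assumes M: "smooth_manifold M" and g: "riemannian_metric M g" and c: "c \<in> M" "x \<in> cdom c"
  shows "sympd (gram M g c (cmap c x))"
proof -
  note T = tangent_at_in[OF M c]
  have eq: "ip (gram M g c (cmap c x)) u v = g x (tangent_at M c x u) (tangent_at M c x v)" for u v
    using metric_chart[OF M g c T(1) T(1)] T(2) by simp
  show ?thesis unfolding sympd_def eq
  proof (intro conjI allI impI)
    show "g x (tangent_at M c x u) (tangent_at M c x v) = g x (tangent_at M c x v) (tangent_at M c x u)" for u v
      using metric_lin(2)[OF g T(1) T(1) T(1)] .
    show "g x (tangent_at M c x v) (tangent_at M c x v) > 0" if "v \<noteq> 0" for v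
      by (rule metric_lin(3)[OF g T(1) T(1) T(1)]) (use T(2) that in metis)
  qed
qed

lemma gram_trans:
  assumes M: "smooth_manifold M" and g: "riemannian_metric M g" and c: "c \<in> M" "x \<in> cdom c" "d \<in> M" "x \<in> cdom d"
  shows "ip (gram M g c (cmap c x)) u v =
    ip (gram M g d (cmap d x)) (chart_deriv c d id x u) (chart_deriv c d id x v)"
proof -
  note T = tangent_at_in[OF M c(1,2)]
  have "tangent_at M c x u d = chart_deriv c d id x u" for u
    using c by (simp add: tangent_at_eq)
  then show ?thesis
    using metric_chart[OF M g c(1,2) T(1) T(1), of u v] metric_chart[OF M g c(3,4) T(1) T(1), of u v] T(2) by simp
qed

lemma Ck_on_gram:
  assumes M: "smooth_manifold M" and g: "riemannian_metric M g" and c: "c \<in> M"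
  shows "Ck_on k (cmap c ` cdom c) (\<lambda>z. gram M g c z $ i $ j)"
  using g c chart_props(2)[OF manifold_chart[OF M c]]
  by (intro smooth_on_openD) (auto simp: riemannian_metric_def)

lemma metric_nonneg:
  assumes "smooth_manifold M" "riemannian_metric M g" "u \<in> tangent_space M x"
  shows "g x u u \<ge> 0"
  using metric_chart[OF assms(1,2) chart_at_props[OF assms(1)] assms(3,3)]
    sympd_nonneg[OF sympd_gram[OF assms(1,2) chart_at_props[OF assms(1)]]] by simp

lemma metric_cauchy:
  assumes "smooth_manifold M" "riemannian_metric M g" "u \<in> tangent_space M x" "v \<in> tangent_space M x"
  shows "\<bar>g x u v\<bar> \<le> sqrt (g x u u) * sqrt (g x v v)"
proof -
  note ch = chart_at_props[OF assms(1), of x]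
  have "(g x u v)\<^sup>2 \<le> g x u u * g x v v"
    using sympd_cauchy[OF sympd_gram[OF assms(1,2) ch]]
    by (simp add: metric_chart[OF assms(1,2) ch] assms)
  then show ?thesis by (metis real_sqrt_abs real_sqrt_le_mono real_sqrt_mult)
qed

lemma gram_pullback:
  assumes M: "smooth_manifold M" and N: "smooth_manifold N" and g: "riemannian_metric N g"
    and f: "smooth_map M N f" and c: "c \<in> M" "x \<in> cdom c" and d: "d \<in> N" "f x \<in> cdom d"
  shows "ip (gram M (pullback M N f g) c (cmap c x)) u v =
    ip (gram N g d (cmap d (f x))) (chart_deriv c d f x u) (chart_deriv c d f x v)"
proof -
  note T = tangent_at_in[OF M c]
  note L = linear_chart_deriv[OF M N f c(1) d(1) c(2) d(2)]
  have "gram M (pullback M N f g) c (cmap c x) $ i $ j =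
    ip (gram N g d (cmap d (f x))) (chart_deriv c d f x (axis i 1)) (chart_deriv c d f x (axis j 1))" for i j
    using metric_chart[OF N g d tmap_in[OF M N f T(1)] tmap_in[OF M N f T(1)]]
      tmap_chart[OF M N f c(1) d(1) c(2) d(2) T(1)]
    by (simp add: gram_def pullback_def coord_field_def chart_props(5)[OF manifold_chart[OF M c(1)] c(2)] T(2))
  then show ?thesis
    by (simp add: ip_sum[of "gram M (pullback M N f g) c (cmap c x)"] linear_expand[OF L, of u]
        linear_expand[OF L, of v] ip_bilinear sum_distrib_left)
      (subst sum.swap, simp add: algebra_simps)
qed

text \<open>Here the immersion property enters: an injective differential keeps the pulled-back form
  definite, so its Gram matrix is invertible.\<close>

lemma sympd_gram_pullback:
  assumes M: "smooth_manifold M" and N: "smooth_manifold N" and g: "riemannian_metric N g"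
    and f: "f \<in> Imm M N" and c: "c \<in> M" "x \<in> cdom c"
  shows "sympd (gram M (pullback M N f g) c (cmap c x))"
proof -
  note d = chart_at_props[OF N, of "f x"]
  have sf: "smooth_map M N f" using f by (simp add: Imm_def)
  note G = sympd_gram[OF N g d]
  have "chart_deriv c (chart_at N (f x)) f x v \<noteq> 0" if "v \<noteq> 0" for v
    using chart_deriv_inj[OF M N f c(1) d(1) c(2) d(2)] linear_chart_deriv[OF M N sf c(1) d(1) c(2) d(2)] that
    by (metis injD linear_0)
  then show ?thesis
    using sympd_sym[OF G] sympd_pos[OF G]
    by (auto simp: sympd_def gram_pullback[OF M N g sf c d])
qed

section \<open>Levi-Civita connection and mean curvature in coordinates\<close>

lemma bounded_bilinear_matrix_vector_mult:
  "bounded_bilinear ((*v) :: real^'n::finite^'m::finite \<Rightarrow> real^'n \<Rightarrow> real^'m)"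
proof -
  have "bilinear ((*v) :: real^'n::finite^'m::finite \<Rightarrow> real^'n \<Rightarrow> real^'m)"
    unfolding bilinear_def
    by (auto intro!: linearI simp: matrix_vector_mult_add_rdistrib matrix_vector_right_distrib
        scaleR_matrix_vector_assoc matrix_vector_mult_scaleR)
  then show ?thesis by (simp add: bilinear_conv_bounded_bilinear)
qed

lemma has_derivative_ip:
  assumes "(A has_derivative A') (at x)" "(a has_derivative a') (at x)" "(b has_derivative b') (at x)"
  shows "((\<lambda>q. ip (A q) (a q) (b q)) has_derivative
    (\<lambda>h. ip (A' h) (a x) (b x) + ip (A x) (a' h) (b x) + ip (A x) (a x) (b' h))) (at x)"
  unfolding ip_def
  by (rule has_derivative_eq_rhs[OF has_derivative_inner[OF assms(2)
      bounded_bilinear.FDERIV[OF bounded_bilinear_matrix_vector_mult assms(1,3)]]])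
    (auto simp: inner_add_right inner_commute algebra_simps)

lemma Ck_on_ip:
  assumes "open S" "\<And>i j. Ck_on k S (\<lambda>x. A x $ i $ j)" "\<And>i. Ck_on k S (\<lambda>x. a x $ i)" "\<And>i. Ck_on k S (\<lambda>x. b x $ i)"
  shows "Ck_on k S (\<lambda>x. ip (A x) (a x) (b x))"
  unfolding ip_sum by (intro Ck_on_sum Ck_on_mult assms)

section \<open>Second derivatives and Christoffel symbols under composition\<close>

definition D2 :: "('a::real_normed_vector \<Rightarrow> 'b::real_normed_vector) \<Rightarrow> 'a \<Rightarrow> 'a \<Rightarrow> 'a \<Rightarrow> 'b" where
  "D2 F z u v = frechet_derivative (\<lambda>q. frechet_derivative F (at q) v) (at z) u"

lemma D2_props:
  fixes F :: "'a::real_normed_vector \<Rightarrow> 'b::euclidean_space"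
  assumes "open U" "Ck_on 2 U F" "z \<in> U"
  shows "D2 F z u v = D2 F z v u"
    "((\<lambda>q. frechet_derivative F (at q) v) has_derivative (\<lambda>u. D2 F z u v)) (at z)"
    "linear (\<lambda>u. D2 F z u v)" "linear (\<lambda>v. D2 F z u v)"
proof -
  show sym: "D2 F z u v = D2 F z v u" for u v
    unfolding D2_def by (rule second_derivative_symmetric[OF assms])
  show "((\<lambda>q. frechet_derivative F (at q) v) has_derivative (\<lambda>u. D2 F z u v)) (at z)" for v
    unfolding D2_def using Ck_on_SucD[of 0 U "\<lambda>q. frechet_derivative F (at q) v" z] assms(2,3)
    by (simp add: numeral_2_eq_2)
  from has_derivative_linear[OF this] show "linear (\<lambda>u. D2 F z u v)" for v .
  then show "linear (\<lambda>v. D2 F z u v)" by (simp add: sym[of u])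
qed

text \<open>The second-order chain rule. After one differentiation the derivative of \<sigma> is
  taken in a direction that depends on the point; expanding it over the unit vectors makes the
  second differentiation a product rule.\<close>

lemma D2_comp:
  fixes F :: "'a::real_normed_vector \<Rightarrow> real^'n::finite" and \<sigma> :: "real^'n \<Rightarrow> 'b::euclidean_space"
  assumes U: "open U" "Ck_on 2 U F" "z \<in> U" and V: "open V" "Ck_on 2 V \<sigma>" "F ` U \<subseteq> V"
    and comp: "\<And>q. q \<in> U \<Longrightarrow> F' q = \<sigma> (F q)"
  shows "D2 F' z u v = D2 \<sigma> (F z) (frechet_derivative F (at z) u) (frechet_derivative F (at z) v) +
    frechet_derivative \<sigma> (at (F z)) (D2 F z u v)"
proof -
  have Fd: "(F has_derivative frechet_derivative F (at q)) (at q)" if "q \<in> U" for q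
    using Ck_on_SucD[of 1 U F q] U(2) that by (simp add: numeral_2_eq_2)
  have \<sigma>d: "(\<sigma> has_derivative frechet_derivative \<sigma> (at y)) (at y)" if "y \<in> V" for y
    using Ck_on_SucD[of 1 V \<sigma> y] V(2) that by (simp add: numeral_2_eq_2)
  have FV: "F q \<in> V" if "q \<in> U" for q using V(3) that by blast
  have 1: "frechet_derivative F' (at q) v =
      (\<Sum>k\<in>UNIV. frechet_derivative F (at q) v $ k *\<^sub>R frechet_derivative \<sigma> (at (F q)) (axis k 1))"
    if q: "q \<in> U" for q
  proof -
    have "(\<sigma> \<circ> F has_derivative frechet_derivative \<sigma> (at (F q)) \<circ> frechet_derivative F (at q)) (at q)"
      using diff_chain_at[OF Fd[OF q] \<sigma>d[OF FV[OF q]]] .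
    then have "(F' has_derivative frechet_derivative \<sigma> (at (F q)) \<circ> frechet_derivative F (at q)) (at q)"
      by (rule has_derivative_transform_within_open[OF _ U(1) q]) (simp add: comp)
    then have "frechet_derivative F' (at q) v = frechet_derivative \<sigma> (at (F q)) (frechet_derivative F (at q) v)"
      by (simp add: frechet_derivative_at[symmetric, of F'] o_def)
    then show ?thesis
      by (simp add: linear_expand[OF has_derivative_linear[OF \<sigma>d[OF FV[OF q]]], of "frechet_derivative F (at q) v"])
  qed
  let ?a = "\<lambda>q. frechet_derivative F (at q) v"
  have "((\<lambda>q. frechet_derivative \<sigma> (at (F q)) (axis k 1)) has_derivative
      (\<lambda>u. D2 \<sigma> (F z) (frechet_derivative F (at z) u) (axis k 1))) (at z)" for k
    using diff_chain_at[OF Fd[OF U(3)] D2_props(2)[OF V(1,2) FV[OF U(3)]]] by (simp add: o_def)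
  then have "((\<lambda>q. \<Sum>k\<in>UNIV. ?a q $ k *\<^sub>R frechet_derivative \<sigma> (at (F q)) (axis k 1)) has_derivative
      (\<lambda>u. \<Sum>k\<in>UNIV. ?a z $ k *\<^sub>R D2 \<sigma> (F z) (frechet_derivative F (at z) u) (axis k 1) +
        (D2 F z u v) $ k *\<^sub>R frechet_derivative \<sigma> (at (F z)) (axis k 1))) (at z)"
    by (intro has_derivative_sum has_derivative_scaleR
        bounded_linear.has_derivative[OF bounded_linear_vec_nth] D2_props(2)[OF U])
  then have "((\<lambda>q. frechet_derivative F' (at q) v) has_derivative
      (\<lambda>u. \<Sum>k\<in>UNIV. ?a z $ k *\<^sub>R D2 \<sigma> (F z) (frechet_derivative F (at z) u) (axis k 1) +
        (D2 F z u v) $ k *\<^sub>R frechet_derivative \<sigma> (at (F z)) (axis k 1))) (at z)"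
    by (rule has_derivative_transform_within_open[OF _ U(1,3)]) (simp add: 1)
  from frechet_derivative_at[OF this, THEN fun_cong, of u]
  have "D2 F' z u v = (\<Sum>k\<in>UNIV. ?a z $ k *\<^sub>R D2 \<sigma> (F z) (frechet_derivative F (at z) u) (axis k 1) +
        (D2 F z u v) $ k *\<^sub>R frechet_derivative \<sigma> (at (F z)) (axis k 1))"
    by (simp add: D2_def)
  then show ?thesis
    using linear_expand[OF D2_props(4)[OF V(1,2) FV[OF U(3)]], of "frechet_derivative F (at z) u" "?a z"]
      linear_expand[OF has_derivative_linear[OF \<sigma>d[OF FV[OF U(3)]]], of "D2 F z u v"]
    by (simp add: sum.distrib)
qed

definition dmet :: "(real^'n \<Rightarrow> real^'n^'n) \<Rightarrow> real^'n::finite \<Rightarrow> real^'n \<Rightarrow> real^'n \<Rightarrow> real^'n \<Rightarrow> real" where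
  "dmet G z u v w = ip (frechet_derivative G (at z) u) v w"

text \<open>Christoffel symbols of the first kind and of the second kind, as multilinear maps.\<close>

definition clow :: "(real^'n \<Rightarrow> real^'n^'n) \<Rightarrow> real^'n::finite \<Rightarrow> real^'n \<Rightarrow> real^'n \<Rightarrow> real^'n \<Rightarrow> real" where
  "clow G z u v w = 1 / 2 * (dmet G z u v w + dmet G z v u w - dmet G z w u v)"

definition chr :: "(real^'n \<Rightarrow> real^'n^'n) \<Rightarrow> real^'n::finite \<Rightarrow> real^'n \<Rightarrow> real^'n \<Rightarrow> real^'n" where
  "chr G z u v = (\<chi> k. \<Sum>i\<in>UNIV. \<Sum>j\<in>UNIV. christoffel G z k i j * u $ i * v $ j)"

lemma dmet_expand:
  assumes "G differentiable (at z)"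
  shows "dmet G z u v w = (\<Sum>i\<in>UNIV. \<Sum>j\<in>UNIV. \<Sum>l\<in>UNIV. u $ i * v $ j * w $ l * partial i (\<lambda>y. G y $ j $ l) z)"
proof -
  have G: "(G has_derivative frechet_derivative G (at z)) (at z)" using assms frechet_derivative_works by blast
  have p: "partial i (\<lambda>y. G y $ j $ l) z = frechet_derivative G (at z) (axis i 1) $ j $ l" for i j l
    unfolding partial_def
    using frechet_derivative_at[OF bounded_linear.has_derivative[OF bounded_linear_vec_nth
        bounded_linear.has_derivative[OF bounded_linear_vec_nth G]]] by metis
  have "dmet G z u v w = (\<Sum>j\<in>UNIV. \<Sum>l\<in>UNIV. \<Sum>i\<in>UNIV. v $ j * (u $ i * frechet_derivative G (at z) (axis i 1) $ j $ l) * w $ l)"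
    unfolding dmet_def ip_sum
    by (subst linear_expand[OF has_derivative_linear[OF G]]) (simp add: sum_distrib_left sum_distrib_right)
  also have "\<dots> = (\<Sum>i\<in>UNIV. \<Sum>j\<in>UNIV. \<Sum>l\<in>UNIV. v $ j * (u $ i * frechet_derivative G (at z) (axis i 1) $ j $ l) * w $ l)"
    by (subst sum.swap[of _ UNIV UNIV], subst (2) sum.swap, subst sum.swap[of _ UNIV UNIV]) (rule sum.cong[OF refl], rule sum.swap)
  finally show ?thesis by (simp add: p mult_ac)
qed

text \<open>Lowering the index cancels \<open>matrix_inv\<close>. The connection can then be handled
  through \<open>clow\<close>, which is linear in the first derivatives of the metric.\<close>

lemma ip_chr:
  assumes "G differentiable (at z)" "det (G z) \<noteq> 0"
  shows "ip (G z) w (chr G z u v) = clow G z u v w"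
proof -
  define P where "P = (\<lambda>i j l. partial i (\<lambda>y. G y $ j $ l) z)"
  define c where "c = (\<chi> l. \<Sum>i\<in>UNIV. \<Sum>j\<in>UNIV. 1 / 2 * (P i j l + P j i l - P l i j) * u $ i * v $ j)"
  have "chr G z u v = matrix_inv (G z) *v c"
  proof -
    have "chr G z u v $ k = (matrix_inv (G z) *v c) $ k" for k
    proof -
      have "chr G z u v $ k = (\<Sum>i\<in>UNIV. \<Sum>j\<in>UNIV. \<Sum>l\<in>UNIV.
          matrix_inv (G z) $ k $ l * (1 / 2 * (P i j l + P j i l - P l i j) * u $ i * v $ j))"
        by (simp add: chr_def christoffel_def P_def sum_distrib_left sum_distrib_right sum_divide_distrib mult_ac)
      also have "\<dots> = (\<Sum>l\<in>UNIV. \<Sum>i\<in>UNIV. \<Sum>j\<in>UNIV.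
          matrix_inv (G z) $ k $ l * (1 / 2 * (P i j l + P j i l - P l i j) * u $ i * v $ j))"
        unfolding sum.cartesian_product
        by (rule sum.reindex_bij_witness[where i = "\<lambda>(l, i, j). (i, j, l)" and j = "\<lambda>(i, j, l). (l, i, j)"]) auto
      also have "\<dots> = (matrix_inv (G z) *v c) $ k"
        by (simp add: matrix_vector_mult_def c_def sum_distrib_left)
      finally show ?thesis .
    qed
    then show ?thesis by (simp add: vec_eq_iff)
  qed
  then have "ip (G z) w (chr G z u v) = w \<bullet> c"
    by (simp add: ip_def matrix_vector_mul_assoc matrix_inv_mult[OF assms(2)])
  also have "\<dots> = (\<Sum>l\<in>UNIV. \<Sum>i\<in>UNIV. \<Sum>j\<in>UNIV. w $ l * (1 / 2 * (P i j l + P j i l - P l i j) * u $ i * v $ j))"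
    by (simp add: inner_vec_def c_def sum_distrib_left)
  also have "\<dots> = 1 / 2 * ((\<Sum>l\<in>UNIV. \<Sum>i\<in>UNIV. \<Sum>j\<in>UNIV. w $ l * u $ i * v $ j * P i j l) +
      (\<Sum>l\<in>UNIV. \<Sum>i\<in>UNIV. \<Sum>j\<in>UNIV. w $ l * u $ i * v $ j * P j i l) -
      (\<Sum>l\<in>UNIV. \<Sum>i\<in>UNIV. \<Sum>j\<in>UNIV. w $ l * u $ i * v $ j * P l i j))"
    by (simp only: sum_distrib_left sum.distrib[symmetric] sum_subtractf[symmetric])
      (simp add: algebra_simps)
  also have "(\<Sum>l\<in>UNIV. \<Sum>i\<in>UNIV. \<Sum>j\<in>UNIV. w $ l * u $ i * v $ j * P l i j) = dmet G z w u v"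
    by (simp add: dmet_expand[OF assms(1)] P_def)
  also have "(\<Sum>l\<in>UNIV. \<Sum>i\<in>UNIV. \<Sum>j\<in>UNIV. w $ l * u $ i * v $ j * P i j l) = dmet G z u v w"
    unfolding dmet_expand[OF assms(1)] sum.cartesian_product
    by (rule sum.reindex_bij_witness[where i = "\<lambda>(i, j, l). (l, i, j)" and j = "\<lambda>(l, i, j). (i, j, l)"])
      (auto simp: P_def mult_ac)
  also have "(\<Sum>l\<in>UNIV. \<Sum>i\<in>UNIV. \<Sum>j\<in>UNIV. w $ l * u $ i * v $ j * P j i l) = dmet G z v u w"
    unfolding dmet_expand[OF assms(1)] sum.cartesian_product
    by (rule sum.reindex_bij_witness[where i = "\<lambda>(j, i, l). (l, i, j)" and j = "\<lambda>(l, i, j). (j, i, l)"])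
      (auto simp: P_def mult_ac)
  finally show ?thesis by (simp add: clow_def)
qed

lemma dmet_pullback:
  fixes F :: "real^'m::finite \<Rightarrow> real^'n::finite"
  assumes U: "open U" "Ck_on 2 U F" "z \<in> U"
    and G: "G differentiable (at (F z))" and \<gamma>: "\<gamma> differentiable (at z)"
    and pull: "\<And>q u w. q \<in> U \<Longrightarrow>
      ip (\<gamma> q) u w = ip (G (F q)) (frechet_derivative F (at q) u) (frechet_derivative F (at q) w)"
  defines "T \<equiv> frechet_derivative F (at z)"
  shows "dmet \<gamma> z u v w = dmet G (F z) (T u) (T v) (T w) +
    ip (G (F z)) (D2 F z u v) (T w) + ip (G (F z)) (T v) (D2 F z u w)"
proof -
  have Fd: "(F has_derivative T) (at z)"
    using Ck_on_SucD[of 1 U F z] U by (simp add: numeral_2_eq_2 T_def)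
  have "((\<lambda>q. ip (\<gamma> q) v w) has_derivative (\<lambda>u. ip (frechet_derivative \<gamma> (at z) u) v w + ip (\<gamma> z) 0 w + ip (\<gamma> z) v 0)) (at z)"
    by (intro has_derivative_ip has_derivative_const) (use \<gamma> frechet_derivative_works in auto)
  moreover have "((\<lambda>q. ip (G (F q)) (frechet_derivative F (at q) v) (frechet_derivative F (at q) w)) has_derivative
      (\<lambda>u. ip (frechet_derivative G (at (F z)) (T u)) (T v) (T w) + ip (G (F z)) (D2 F z u v) (T w) + ip (G (F z)) (T v) (D2 F z u w))) (at z)"
    unfolding T_def
    by (intro has_derivative_ip D2_props(2)[OF U] diff_chain_at[OF Fd, unfolded o_def T_def])
      (use G frechet_derivative_works in auto)
  then have "((\<lambda>q. ip (\<gamma> q) v w) has_derivative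
      (\<lambda>u. ip (frechet_derivative G (at (F z)) (T u)) (T v) (T w) + ip (G (F z)) (D2 F z u v) (T w) + ip (G (F z)) (T v) (D2 F z u w))) (at z)"
    by (rule has_derivative_transform_within_open[OF _ U(1,3)]) (simp add: pull)
  ultimately show ?thesis
    unfolding dmet_def using has_derivative_unique by (fastforce simp: ip_bilinear dest: fun_cong)
qed

text \<open>Differentiating the pullback identity produces six terms with second derivatives of
  \<open>F\<close>; in the combination that defines \<open>clow\<close> they cancel in pairs by
  symmetry, up to one. Applied to a change of coordinates this is the transformation law of
  Christoffel symbols, applied to an immersion it is the Gauss formula.\<close>

lemma clow_pullback:
  fixes F :: "real^'m::finite \<Rightarrow> real^'n::finite"
  assumes U: "open U" "Ck_on 2 U F" "z \<in> U"
    and G: "G differentiable (at (F z))" and \<gamma>: "\<gamma> differentiable (at z)"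
    and pull: "\<And>q u w. q \<in> U \<Longrightarrow>
      ip (\<gamma> q) u w = ip (G (F q)) (frechet_derivative F (at q) u) (frechet_derivative F (at q) w)"
    and pd: "sympd (G (F z))"
  defines "T \<equiv> frechet_derivative F (at z)"
  shows "clow \<gamma> z u v w = clow G (F z) (T u) (T v) (T w) + ip (G (F z)) (D2 F z u v) (T w)"
proof -
  have dm: "dmet \<gamma> z u v w = dmet G (F z) (T u) (T v) (T w) +
    ip (G (F z)) (D2 F z u v) (T w) + ip (G (F z)) (T v) (D2 F z u w)" for u v w
    unfolding T_def by (rule dmet_pullback[OF U G \<gamma> pull])
  show ?thesis
    unfolding clow_def dm
    using D2_props(1)[OF U, of u v] D2_props(1)[OF U, of w u] D2_props(1)[OF U, of w v]
      sympd_sym[OF pd, of "D2 F z u w" "T v"] sympd_sym[OF pd, of "D2 F z v w" "T u"]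
    by (simp add: algebra_simps)
qed

lemma sympd_unique:
  assumes "sympd G" "\<And>w. ip G u w = ip G v w"
  shows "u = v"
proof (rule ccontr)
  assume "u \<noteq> v"
  then have "ip G (u - v) (u - v) > 0" using sympd_pos[OF assms(1)] by simp
  then show False using assms(2) by (simp add: ip_diff_left)
qed

text \<open>The inhomogeneous transformation law of the Christoffel symbols.
  \<open>clow_pullback\<close> gives it after pairing with vectors in the range of the derivative of
  \<sigma>; by surjectivity these are all vectors, and a definite form determines the other
  factor.\<close>

lemma chr_transform:
  fixes \<sigma> :: "real^'n::finite \<Rightarrow> real^'n"
  assumes V: "open V" "Ck_on 2 V \<sigma>" "y \<in> V"
    and G: "G differentiable (at y)" "G' differentiable (at (\<sigma> y))"
    and pull: "\<And>q u w. q \<in> V \<Longrightarrow>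
      ip (G q) u w = ip (G' (\<sigma> q)) (frechet_derivative \<sigma> (at q) u) (frechet_derivative \<sigma> (at q) w)"
    and pd: "sympd (G y)" "sympd (G' (\<sigma> y))" and surj: "surj (frechet_derivative \<sigma> (at y))"
  shows "frechet_derivative \<sigma> (at y) (chr G y u v) =
    chr G' (\<sigma> y) (frechet_derivative \<sigma> (at y) u) (frechet_derivative \<sigma> (at y) v) + D2 \<sigma> y u v"
proof (rule sympd_unique[OF pd(2)])
  fix w'
  define T where "T = frechet_derivative \<sigma> (at y)"
  obtain w where w: "w' = T w" using surj unfolding T_def by (metis surjD)
  have "ip (G' (\<sigma> y)) (T (chr G y u v)) w' = ip (G y) w (chr G y u v)"
    using pull[OF V(3), folded T_def] sympd_sym[OF pd(1)] w by metis
  also have "\<dots> = clow G y u v w" using sympd_det_pos[OF pd(1)] by (intro ip_chr G) simp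
  also have "\<dots> = clow G' (\<sigma> y) (T u) (T v) (T w) + ip (G' (\<sigma> y)) (D2 \<sigma> y u v) (T w)"
    unfolding T_def by (rule clow_pullback[OF V G(2,1) pull pd(2)])
  also have "clow G' (\<sigma> y) (T u) (T v) (T w) = ip (G' (\<sigma> y)) (T w) (chr G' (\<sigma> y) (T u) (T v))"
    using sympd_det_pos[OF pd(2)] by (intro ip_chr[symmetric] G) simp
  finally show "ip (G' (\<sigma> y)) (T (chr G y u v)) w' =
      ip (G' (\<sigma> y)) (chr G' (\<sigma> y) (T u) (T v) + D2 \<sigma> y u v) w'"
    using w sympd_sym[OF pd(2)] by (simp add: ip_bilinear)
qed

lemma linear_chr: "linear (\<lambda>u. chr G z u v)" "linear (\<lambda>v. chr G z u v)"
  by (auto intro!: linearI simp: chr_def vec_eq_iff algebra_simps sum.distrib sum_distrib_left)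

lemma pullback_matrix:
  fixes T :: "real^'n::finite \<Rightarrow> real^'n"
  assumes T: "linear T" and g: "\<And>u v. ip g' u v = ip g (T u) (T v)"
  shows "g' = transpose (matrix T) ** g ** matrix T"
proof -
  define t where "t = matrix T"
  have t: "T u = t *v u" for u unfolding t_def using T by (simp add: matrix_works)
  have "g' $ i $ j = (transpose t ** g ** t) $ i $ j" for i j
    using g[of "axis i 1" "axis j 1"]
    unfolding t ip_axis[of g', symmetric] ip_axis[of "transpose t ** g ** t", symmetric]
    by (simp add: ip_def dot_lmul_matrix matrix_vector_mul_assoc[symmetric] inner_commute[of "t *v _"])
      (metis dot_lmul_matrix inner_commute transpose_matrix_vector)
  then show ?thesis by (simp add: vec_eq_iff t_def)
qed

text \<open>With \<open>t\<close> the matrix of \<open>T\<close>, the hypothesis reads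
  \<open>g' = transpose t ** g ** t\<close>. Invertibility gives
  \<open>t ** matrix_inv g' ** transpose t = matrix_inv g\<close>, so a metric trace does not depend
  on the basis. This is what makes the mean curvature independent of the chart of
  \<open>M\<close>.\<close>

lemma trace_form_invariant:
  fixes B :: "real^'n::finite \<Rightarrow> real^'n \<Rightarrow> 'a::real_vector" and T :: "real^'n \<Rightarrow> real^'n"
  assumes B: "\<And>u. linear (B u)" "\<And>v. linear (\<lambda>u. B u v)" and T: "linear T"
    and g: "\<And>u v. ip g' u v = ip g (T u) (T v)" and det: "det g \<noteq> 0" "det g' \<noteq> 0"
  shows "(\<Sum>i\<in>UNIV. \<Sum>j\<in>UNIV. matrix_inv g' $ i $ j *\<^sub>R B (T (axis i 1)) (T (axis j 1))) =
    (\<Sum>i\<in>UNIV. \<Sum>j\<in>UNIV. matrix_inv g $ i $ j *\<^sub>R B (axis i 1) (axis j 1))"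
proof -
  define t where "t = matrix T"
  have t: "T u = t *v u" for u unfolding t_def using T by (simp add: matrix_works)
  have g': "g' = transpose t ** g ** t" unfolding t_def by (rule pullback_matrix[OF T g])
  then have d: "det t \<noteq> 0" using det by (auto simp: det_mul)
  have "t ** matrix_inv g' ** transpose t = matrix_inv g"
  proof -
    have "transpose t ** (g ** (t ** matrix_inv g')) = mat 1"
      using matrix_inv_mult(1)[OF det(2)] g' by (simp add: matrix_mul_assoc)
    then have "g ** (t ** matrix_inv g') ** transpose t = mat 1"
      using matrix_left_right_inverse by blast
    then have "matrix_inv g ** (g ** (t ** matrix_inv g') ** transpose t) = matrix_inv g" by simp
    then show ?thesis using matrix_inv_mult(2)[OF det(1)] by (simp add: matrix_mul_assoc)
  qed
  then have inv: "(\<Sum>j\<in>UNIV. (\<Sum>i\<in>UNIV. t $ k $ i * matrix_inv g' $ i $ j) * t $ l $ j) = matrix_inv g $ k $ l" for k l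
    by (simp add: vec_eq_iff matrix_matrix_mult_def transpose_def)
  have Tax: "T (axis i 1) $ k = t $ k $ i" for i k
    by (simp add: t matrix_vector_mul_component inner_axis)
  have "B (T (axis i 1)) (T (axis j 1)) = (\<Sum>k\<in>UNIV. \<Sum>l\<in>UNIV. (t $ k $ i * t $ l $ j) *\<^sub>R B (axis k 1) (axis l 1))" for i j
    by (subst linear_expand[OF B(2)], subst linear_expand[OF B(1)]) (simp add: Tax scaleR_sum_right)
  then have "(\<Sum>i\<in>UNIV. \<Sum>j\<in>UNIV. matrix_inv g' $ i $ j *\<^sub>R B (T (axis i 1)) (T (axis j 1))) =
      (\<Sum>i\<in>UNIV. \<Sum>j\<in>UNIV. \<Sum>k\<in>UNIV. \<Sum>l\<in>UNIV. (t $ k $ i * matrix_inv g' $ i $ j * t $ l $ j) *\<^sub>R B (axis k 1) (axis l 1))"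
    by (simp add: scaleR_sum_right mult_ac)
  also have "\<dots> = (\<Sum>k\<in>UNIV. \<Sum>l\<in>UNIV. \<Sum>j\<in>UNIV. \<Sum>i\<in>UNIV. (t $ k $ i * matrix_inv g' $ i $ j * t $ l $ j) *\<^sub>R B (axis k 1) (axis l 1))"
    unfolding sum.cartesian_product
    by (rule sum.reindex_bij_witness[where i = "\<lambda>(k, l, j, i). (i, j, k, l)" and j = "\<lambda>(i, j, k, l). (k, l, j, i)"]) auto
  also have "\<dots> = (\<Sum>k\<in>UNIV. \<Sum>l\<in>UNIV. matrix_inv g $ k $ l *\<^sub>R B (axis k 1) (axis l 1))"
    unfolding inv[symmetric] by (simp add: scaleR_sum_left sum_distrib_right)
  finally show ?thesis .
qed

section \<open>Second fundamental form and mean curvature of an immersion in charts\<close>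

locale riem_setup =
  fixes M :: "('a::{t2_space,second_countable_topology}, 'm::finite) atlas"
    and N :: "('b::{t2_space,second_countable_topology}, 'n::finite) atlas"
    and g :: "('b, 'n) metric"
  assumes M: "smooth_manifold M" and N: "smooth_manifold N" and g: "riemannian_metric N g"
begin

abbreviation GM :: "('a \<Rightarrow> 'b) \<Rightarrow> ('a, 'm) chart \<Rightarrow> real^'m \<Rightarrow> real^'m^'m" where
  "GM f \<equiv> gram M (pullback M N f g)"

abbreviation GN :: "('b, 'n) chart \<Rightarrow> real^'n \<Rightarrow> real^'n^'n" where
  "GN \<equiv> gram N g"

lemma local_rep_cmap:
  assumes "c \<in> M" "x \<in> cdom c"
  shows "local_rep c d f (cmap c x) = cmap d (f x)"
  using chart_props(5)[OF manifold_chart[OF M assms(1)] assms(2)] by (simp add: local_rep_def)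

lemma Ck_on_GM:
  assumes f: "smooth_map M N f" and c: "c \<in> M"
  shows "Ck_on k (cmap c ` cdom c) (\<lambda>z. GM f c z $ i $ j)"
proof (rule Ck_on_local)
  fix z assume "z \<in> cmap c ` cdom c"
  then obtain x where x: "x \<in> cdom c" "z = cmap c x" by auto
  define d where "d = chart_at N (f x)"
  note d = chart_at_props[OF N, of "f x", folded d_def]
  define U where "U = cmap c ` (cdom c \<inter> f -` cdom d)"
  have U: "open U" unfolding U_def
    using f by (intro open_rep_domain manifold_chart[OF M c] manifold_chart[OF N d(1)]) (simp add: smooth_map_def)
  let ?F = "local_rep c d f"
  have F: "Ck_on k U ?F" for k unfolding U_def by (rule Ck_on_local_rep[OF M N f c d(1)])
  have FU: "?F ` U \<subseteq> cmap d ` cdom d" using c by (auto simp: U_def local_rep_cmap)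
  have "Ck_on k U (\<lambda>z. ip (GN d (?F z)) (frechet_derivative ?F (at z) (axis i 1)) (frechet_derivative ?F (at z) (axis j 1)))"
    using F by (intro Ck_on_ip U Ck_on_vec_nth Ck_on_frechet Ck_on_compose[OF U Ck_on_gram[OF N g d(1)] _ FU])
  then have "Ck_on k U (\<lambda>z. GM f c z $ i $ j)"
    by (rule Ck_on_cong[OF U, rotated])
      (auto simp: U_def ip_axis[symmetric] gram_pullback[OF M N g f c _ d(1)] local_rep_cmap[OF c] chart_deriv_def)
  then show "\<exists>U. open U \<and> z \<in> U \<and> Ck_on k U (\<lambda>z. GM f c z $ i $ j)"
    using U x d by (intro exI[of _ U]) (auto simp: U_def)
qed

lemma differentiable_GM:
  assumes "smooth_map M N f" "c \<in> M" "x \<in> cdom c"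
  shows "GM f c differentiable (at (cmap c x))"
proof -
  have "Ck_on (Suc 0) (cmap c ` cdom c) (GM f c)"
    by (intro Ck_on_vec Ck_on_GM assms chart_props(2)[OF manifold_chart[OF M assms(2)]])
  then show ?thesis using assms(3) by auto
qed

lemma differentiable_GN:
  assumes "d \<in> N" "y \<in> cdom d"
  shows "GN d differentiable (at (cmap d y))"
proof -
  have "Ck_on (Suc 0) (cmap d ` cdom d) (GN d)"
    by (intro Ck_on_vec Ck_on_gram[OF N g] assms chart_props(2)[OF manifold_chart[OF N assms(1)]])
  then show ?thesis using assms(2) by auto
qed

text \<open>The second fundamental form before the tangential correction by the connection of
  \<open>M\<close> is subtracted. For an immersion its normal part is the second fundamental form
  itself, and it involves no derivative of the induced metric.\<close>

definition hess :: "('a \<Rightarrow> 'b) \<Rightarrow> ('a, 'm) chart \<Rightarrow> ('b, 'n) chart \<Rightarrow> 'a \<Rightarrow> real^'m \<Rightarrow> real^'m \<Rightarrow> real^'n" where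
  "hess f c d x u v = D2 (local_rep c d f) (cmap c x) u v +
     chr (GN d) (cmap d (f x)) (chart_deriv c d f x u) (chart_deriv c d f x v)"

definition hess_trace :: "('a \<Rightarrow> 'b) \<Rightarrow> ('a, 'm) chart \<Rightarrow> ('b, 'n) chart \<Rightarrow> 'a \<Rightarrow> real^'n" where
  "hess_trace f c d x = (\<Sum>i\<in>UNIV. \<Sum>j\<in>UNIV.
     matrix_inv (GM f c (cmap c x)) $ i $ j *\<^sub>R hess f c d x (axis i 1) (axis j 1))"

lemma chart_dom_open:
  assumes "smooth_map M N f" "c \<in> M" "d \<in> N"
  shows "open (cmap c ` (cdom c \<inter> f -` cdom d))"
  using assms manifold_chart[OF M assms(2)] manifold_chart[OF N assms(3)]
  by (intro open_rep_domain) (auto simp: smooth_map_def)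

lemma linear_hess:
  assumes f: "smooth_map M N f" and c: "c \<in> M" "x \<in> cdom c" and d: "d \<in> N" "f x \<in> cdom d"
  shows "linear (hess f c d x u)" "linear (\<lambda>u. hess f c d x u v)"
proof -
  note L = linear_chart_deriv[OF M N f c(1) d(1) c(2) d(2)]
  have x: "cmap c x \<in> cmap c ` (cdom c \<inter> f -` cdom d)" using c d by auto
  note D = D2_props[OF chart_dom_open[OF f c(1) d(1)] Ck_on_local_rep[OF M N f c(1) d(1)] x]
  show "linear (hess f c d x u)" unfolding hess_def
    using linear_compose[OF L linear_chr(2)]
    by (intro linear_compose_add D(4)) (simp add: o_def)
  show "linear (\<lambda>u. hess f c d x u v)" unfolding hess_def
    using linear_compose[OF L linear_chr(1)]
    by (intro linear_compose_add D(3)) (simp add: o_def)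
qed

lemma second_fundamental_form_chart:
  assumes f: "smooth_map M N f" and d: "d \<in> N" "f x \<in> cdom d"
  defines "c \<equiv> chart_at M x"
  shows "second_fundamental_form M N g f (coord_field M c i) (coord_field M c j) x d =
    hess f c d x (axis i 1) (axis j 1) - chart_deriv c d f x (chr (GM f c) (cmap c x) (axis i 1) (axis j 1))"
proof -
  note c = chart_at_props[OF M, of x, folded c_def]
  note ch = manifold_chart[OF M c(1)]
  have coord: "coord_field M c k y c = axis k 1" "coord_field M c k y \<in> tangent_space M y" if "y \<in> cdom c" for k y
    using tangent_at_in[OF M c(1) that] by (simp_all add: coord_field_def)
  have T: "tmap M N f y (coord_field M c k y) d = chart_deriv c d f y (axis k 1)"
    if "y \<in> cdom c" "f y \<in> cdom d" for k y
    using tmap_chart[OF M N f c(1) d(1) that coord(2)[OF that(1)]] coord(1)[OF that(1)] by simp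
  define U where "U = cmap c ` (cdom c \<inter> f -` cdom d)"
  have U: "open U" "cmap c x \<in> U" using chart_dom_open[OF f c(1) d(1)] c d by (auto simp: U_def)
  have "((\<lambda>z. frechet_derivative (local_rep c d f) (at z) (axis j 1)) has_derivative
      (\<lambda>u. D2 (local_rep c d f) (cmap c x) u (axis j 1))) (at (cmap c x))"
    by (rule D2_props(2)[OF U(1) _ U(2)]) (simp only: U_def Ck_on_local_rep[OF M N f c(1) d(1)])
  then have "((\<lambda>z. tmap M N f (cinv c z) (coord_field M c j (cinv c z)) d) has_derivative
      (\<lambda>u. D2 (local_rep c d f) (cmap c x) u (axis j 1))) (at (cmap c x))"
    by (rule has_derivative_transform_within_open[OF _ U])
      (auto simp: U_def T chart_props(5)[OF ch] chart_deriv_def)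
  from frechet_derivative_at[OF this]
  have 1: "nabla M N g f (coord_field M c i) (\<lambda>y. tmap M N f y (coord_field M c j y)) x d =
      hess f c d x (axis i 1) (axis j 1)"
    using d by (simp add: nabla_def Let_def flip: c_def)
      (simp add: T[OF c(2) d(2)] coord[OF c(2)] hess_def chr_def fun_eq_iff)
  \<comment> \<open>A coordinate field has constant components in its own chart, so of its covariant
    derivative only the Christoffel term remains.\<close>
  have "((\<lambda>z. axis j 1 :: real^'m) has_derivative (\<lambda>u. 0)) (at (cmap c x))" by simp
  then have "((\<lambda>z. coord_field M c j (cinv c z) c) has_derivative (\<lambda>u. 0)) (at (cmap c x))"
    by (rule has_derivative_transform_within_open[OF _ chart_props(2)[OF ch]])
      (use c in \<open>auto simp: coord chart_props(5)[OF ch]\<close>)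
  from frechet_derivative_at[OF this, symmetric]
  have "nabla M M (pullback M N f g) id (coord_field M c i) (coord_field M c j) x c =
      chr (GM f c) (cmap c x) (axis i 1) (axis j 1)"
    using c tmap_chart[OF M M smooth_map_id[OF M] c(1) c(1) c(2) _ coord(2)[OF c(2)]]
    by (simp add: nabla_def Let_def flip: c_def) (simp add: coord chart_deriv_self[OF M] chr_def)
  then have "tmap M N f x (nabla M M (pullback M N f g) id (coord_field M c i) (coord_field M c j) x) d =
      chart_deriv c d f x (chr (GM f c) (cmap c x) (axis i 1) (axis j 1))"
    using d by (simp add: tmap_def Let_def chart_deriv_def flip: c_def)
  with 1 show ?thesis by (simp add: second_fundamental_form_def)
qed

text \<open>Neither the second derivative nor the Christoffel term is a vector of \<open>N\<close>,
  but the second derivative of the coordinate change appears in \<open>D2_comp\<close> and in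
  \<open>chr_transform\<close> with opposite effect, and the sum transforms as a vector.\<close>

lemma hess_cod:
  assumes f: "smooth_map M N f" and c: "c \<in> M" "x \<in> cdom c"
    and d: "d \<in> N" "f x \<in> cdom d" and d': "d' \<in> N" "f x \<in> cdom d'"
  shows "hess f c d' x u v = chart_deriv d d' id (f x) (hess f c d x u v)"
proof -
  let ?F = "local_rep c d f" and ?\<sigma> = "local_rep d d' id"
  note idN = smooth_map_id[OF N]
  define V where "V = cmap d ` (cdom d \<inter> id -` cdom d')"
  define U where "U = cmap c ` (cdom c \<inter> f -` (cdom d \<inter> cdom d'))"
  have V: "open V" "Ck_on k V ?\<sigma>" for k
    unfolding V_def by (intro open_rep_domain manifold_chart[OF N] d d' continuous_on_id')
      (rule Ck_on_local_rep[OF N N idN d(1) d'(1)])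
  have U: "open U" unfolding U_def
    using f manifold_chart[OF M c(1)] chart_props(1)[OF manifold_chart[OF N d(1)]] chart_props(1)[OF manifold_chart[OF N d'(1)]]
    by (intro open_chart_image open_vimage open_Int) (auto simp: smooth_map_def)
  have FU: "Ck_on k U ?F" for k
    by (rule Ck_on_subset[OF Ck_on_local_rep[OF M N f c(1) d(1)]]) (auto simp: U_def)
  have xU: "cmap c x \<in> U" using c d d' by (auto simp: U_def)
  have Fx: "?F (cmap c x) = cmap d (f x)" by (rule local_rep_cmap[OF c])
  have yV: "cmap d (f x) \<in> V" using d d' by (auto simp: V_def)
  have FUV: "?F ` U \<subseteq> V" using c by (auto simp: U_def V_def local_rep_cmap)
  have comp: "local_rep c d' f q = ?\<sigma> (?F q)" if "q \<in> U" for q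
    using local_rep_comp[of d q c f d' id] that manifold_chart[OF M c(1)] manifold_chart[OF N d(1)] by (auto simp: U_def)
  have D2: "D2 (local_rep c d' f) (cmap c x) u v =
      D2 ?\<sigma> (cmap d (f x)) (chart_deriv c d f x u) (chart_deriv c d f x v) +
      chart_deriv d d' id (f x) (D2 ?F (cmap c x) u v)"
    unfolding chart_deriv_def Fx[symmetric] by (rule D2_comp[OF U FU xU V(1) V(2) FUV comp])
  have \<sigma>y: "?\<sigma> (cmap d (f x)) = cmap d' (f x)"
    using chart_props(5)[OF manifold_chart[OF N d(1)] d(2)] by (simp add: local_rep_def)
  have pull: "ip (GN d q) u w = ip (GN d' (?\<sigma> q)) (frechet_derivative ?\<sigma> (at q) u) (frechet_derivative ?\<sigma> (at q) w)"
    if q: "q \<in> V" for q u w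
  proof -
    obtain y where y: "y \<in> cdom d" "y \<in> cdom d'" "q = cmap d y" using q by (auto simp: V_def)
    moreover have "?\<sigma> q = cmap d' y"
      using chart_props(5)[OF manifold_chart[OF N d(1)] y(1)] y by (simp add: local_rep_def)
    ultimately show ?thesis using gram_trans[OF N g d(1) y(1) d'(1) y(2)] by (simp add: chart_deriv_def)
  qed
  have surj: "surj (chart_deriv d d' id (f x))"
  proof (rule surjI)
    show "chart_deriv d d' id (f x) (chart_deriv d' d id (f x) v) = v" for v
      using chart_deriv_id_id[OF N d'(1) d(1) d'(1) d'(2) d(2) d'(2)] chart_deriv_self[OF N d'] by simp
  qed
  have "chart_deriv d d' id (f x) (chr (GN d) (cmap d (f x)) a b) =
      chr (GN d') (cmap d' (f x)) (chart_deriv d d' id (f x) a) (chart_deriv d d' id (f x) b) + D2 ?\<sigma> (cmap d (f x)) a b" for a b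
    unfolding chart_deriv_def \<sigma>y[symmetric]
  proof (rule chr_transform[OF V(1) V(2) yV differentiable_GN[OF d] _ pull sympd_gram[OF N g d]])
    show "GN d' differentiable (at (?\<sigma> (cmap d (f x))))" unfolding \<sigma>y by (rule differentiable_GN[OF d'])
    show "sympd (GN d' (?\<sigma> (cmap d (f x))))" unfolding \<sigma>y by (rule sympd_gram[OF N g d'])
    show "surj (frechet_derivative ?\<sigma> (at (cmap d (f x))))" using surj unfolding chart_deriv_def .
  qed
  then show ?thesis
    using linear_trans[OF N d(1) d'(1) d(2) d'(2)] chart_deriv_cod[OF M N f c(1) d(1) d'(1) c(2) d(2) d'(2)]
    by (simp add: hess_def linear_add D2)
qed

text \<open>In the source \<open>hess\<close> is not a tensor; the defect, however, lies in the
  range of the differential of \<open>f\<close>, and a normal projection does not see it.\<close>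

lemma hess_dom:
  assumes f: "smooth_map M N f" and c: "c \<in> M" "x \<in> cdom c"
    and c': "c' \<in> M" "x \<in> cdom c'" and d: "d \<in> N" "f x \<in> cdom d"
  shows "hess f c' d x u v = hess f c d x (chart_deriv c' c id x u) (chart_deriv c' c id x v) +
    chart_deriv c d f x (D2 (local_rep c' c id) (cmap c' x) u v)"
proof -
  let ?F = "local_rep c d f" and ?\<theta> = "local_rep c' c id"
  note idM = smooth_map_id[OF M]
  define V where "V = cmap c ` (cdom c \<inter> f -` cdom d)"
  define U where "U = cmap c' ` (cdom c' \<inter> (cdom c \<inter> f -` cdom d))"
  have V: "open V" "Ck_on k V ?F" for k
    unfolding V_def using chart_dom_open[OF f c(1) d(1)] Ck_on_local_rep[OF M N f c(1) d(1)] by auto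
  have U: "open U" unfolding U_def
    using f chart_props(1)[OF manifold_chart[OF M c(1)]] chart_props(1)[OF manifold_chart[OF N d(1)]]
    by (intro open_chart_image manifold_chart[OF M c'(1)] open_Int open_vimage) (auto simp: smooth_map_def)
  have FU: "Ck_on k U ?\<theta>" for k
    by (rule Ck_on_subset[OF Ck_on_local_rep[OF M M idM c'(1) c(1)]]) (auto simp: U_def)
  have xU: "cmap c' x \<in> U" using c d c' by (auto simp: U_def)
  have \<theta>: "?\<theta> (cmap c' y) = cmap c y" if "y \<in> cdom c'" for y
    using chart_props(5)[OF manifold_chart[OF M c'(1)] that] by (simp add: local_rep_def)
  have UV: "?\<theta> ` U \<subseteq> V" by (auto simp: U_def V_def \<theta>)
  have comp: "local_rep c' d f q = ?F (?\<theta> q)" if "q \<in> U" for q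
    using local_rep_comp[of c q c' id d f] that manifold_chart[OF M c(1)] manifold_chart[OF M c'(1)] by (auto simp: U_def)
  have "D2 (local_rep c' d f) (cmap c' x) u v =
      D2 ?F (cmap c x) (chart_deriv c' c id x u) (chart_deriv c' c id x v) +
      chart_deriv c d f x (D2 ?\<theta> (cmap c' x) u v)"
    using D2_comp[OF U FU xU V(1) V(2) UV comp] by (simp add: \<theta> c' chart_deriv_def)
  then show ?thesis
    using chart_deriv_dom[OF M N f c'(1) c(1) d(1) c'(2) c(2) d(2)] by (simp add: hess_def)
qed

text \<open>The Gauss formula: the tangential part of the ambient derivative is the Levi-Civita
  derivative of the induced metric. Both sides equal the first-kind Christoffel symbols of that
  metric, by \<open>clow_pullback\<close> and \<open>ip_chr\<close>. Hence the second fundamental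
  form is normal.\<close>

lemma hess_tangential:
  assumes f: "f \<in> Imm M N" and c: "c \<in> M" "x \<in> cdom c" and d: "d \<in> N" "f x \<in> cdom d"
  shows "ip (GN d (cmap d (f x))) (hess f c d x u v) (chart_deriv c d f x w) =
    ip (GN d (cmap d (f x))) (chart_deriv c d f x (chr (GM f c) (cmap c x) u v)) (chart_deriv c d f x w)"
proof -
  let ?F = "local_rep c d f" and ?T = "chart_deriv c d f x"
  have sf: "smooth_map M N f" using f by (simp add: Imm_def)
  define U where "U = cmap c ` (cdom c \<inter> f -` cdom d)"
  have U: "open U" "Ck_on 2 U ?F" "cmap c x \<in> U"
    unfolding U_def using chart_dom_open[OF sf c(1) d(1)] Ck_on_local_rep[OF M N sf c(1) d(1)] c d by auto
  note Fx = local_rep_cmap[OF c, of d f]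
  note G = sympd_gram[OF N g d] and \<gamma> = sympd_gram_pullback[OF M N g f c]
  have pull: "ip (GM f c q) u w = ip (GN d (?F q)) (frechet_derivative ?F (at q) u) (frechet_derivative ?F (at q) w)"
    if "q \<in> U" for q u w
    using that gram_pullback[OF M N g sf c(1) _ d(1)] by (auto simp: U_def local_rep_cmap[OF c(1)] chart_deriv_def)
  have "ip (GN d (cmap d (f x))) (hess f c d x u v) (?T w) =
      ip (GN d (cmap d (f x))) (D2 ?F (cmap c x) u v) (?T w) + clow (GN d) (cmap d (f x)) (?T u) (?T v) (?T w)"
    using ip_chr[OF differentiable_GN[OF d], of "?T w" "?T u" "?T v"] sympd_det_pos[OF G]
    by (simp add: hess_def ip_bilinear sympd_sym[OF G, of "?T w"])
  also have "\<dots> = clow (GM f c) (cmap c x) u v w"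
    using clow_pullback[OF U _ differentiable_GM[OF sf c] pull, of u v w] differentiable_GN[OF d] G
    by (simp add: Fx chart_deriv_def)
  also have "\<dots> = ip (GM f c (cmap c x)) w (chr (GM f c) (cmap c x) u v)"
    using ip_chr[OF differentiable_GM[OF sf c]] sympd_det_pos[OF \<gamma>] by simp
  also have "\<dots> = ip (GN d (cmap d (f x))) (?T (chr (GM f c) (cmap c x) u v)) (?T w)"
    unfolding gram_pullback[OF M N g sf c d] by (rule sympd_sym[OF G])
  finally show ?thesis .
qed

lemma normal_space_chart:
  assumes f: "smooth_map M N f" and c: "c \<in> M" "x \<in> cdom c" and d: "d \<in> N" "f x \<in> cdom d"
    and w: "w \<in> tangent_space N (f x)"
  shows "w \<in> normal_space M N g f x \<longleftrightarrow> (\<forall>v. ip (GN d (cmap d (f x))) (w d) (chart_deriv c d f x v) = 0)"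
proof -
  note T = tangent_at_in[OF M c]
  have "g (f x) w (tmap M N f x X) = ip (GN d (cmap d (f x))) (w d) (chart_deriv c d f x (X c))"
    if "X \<in> tangent_space M x" for X
    using metric_chart[OF N g d w tmap_in[OF M N f that]] tmap_chart[OF M N f c(1) d(1) c(2) d(2) that] by simp
  then show ?thesis unfolding normal_space_def using w T by fastforce
qed

lemma mean_curvature_chart_at:
  assumes f: "smooth_map M N f" and d: "d \<in> N" "f x \<in> cdom d"
  defines "c \<equiv> chart_at M x"
  shows "mean_curvature M N g f x d = hess_trace f c d x - chart_deriv c d f x (\<Sum>i\<in>UNIV. \<Sum>j\<in>UNIV.
    matrix_inv (GM f c (cmap c x)) $ i $ j *\<^sub>R chr (GM f c) (cmap c x) (axis i 1) (axis j 1))"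
proof -
  note c = chart_at_props[OF M, of x, folded c_def]
  note L = linear_chart_deriv[OF M N f c(1) d(1) c(2) d(2)]
  show ?thesis
    using second_fundamental_form_chart[OF f d, folded c_def]
    by (simp add: mean_curvature_def hess_trace_def linear_sum[OF L] linear_cmul[OF L] scaleR_diff_right
        sum_subtractf flip: c_def)
qed

lemma mean_curvature_normal:
  assumes f: "f \<in> Imm M N"
  shows "mean_curvature M N g f x \<in> normal_space M N g f x"
proof -
  have sf: "smooth_map M N f" using f by (simp add: Imm_def)
  define c where "c = chart_at M x"
  note c = chart_at_props[OF M, of x, folded c_def]
  note mc = mean_curvature_chart_at[OF sf, of _ x, folded c_def]
  define \<xi> where "\<xi> = (\<Sum>i\<in>UNIV. \<Sum>j\<in>UNIV.
    matrix_inv (GM f c (cmap c x)) $ i $ j *\<^sub>R chr (GM f c) (cmap c x) (axis i 1) (axis j 1))"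
  have tan: "mean_curvature M N g f x \<in> tangent_space N (f x)"
    unfolding tangent_space_iff
  proof (intro conjI allI ballI impI)
    show "mean_curvature M N g f x d = 0" if "d \<notin> N \<or> f x \<notin> cdom d" for d
    proof -
      have "nabla M N g f X Y x d = 0" "tmap M N f x Z d = 0" for X Y Z
        using that by (auto simp: nabla_def tmap_def)
      then show ?thesis by (simp add: mean_curvature_def second_fundamental_form_def Let_def)
    qed
    fix d d' assume "d \<in> N" "d' \<in> N" "f x \<in> cdom d \<inter> cdom d'"
    then have d: "d \<in> N" "f x \<in> cdom d" and d': "d' \<in> N" "f x \<in> cdom d'" by auto
    note L = linear_trans[OF N d(1) d'(1) d(2) d'(2)]
    have "hess_trace f c d' x = chart_deriv d d' id (f x) (hess_trace f c d x)"
      by (simp add: hess_trace_def hess_cod[OF sf c d d'] linear_sum[OF L] linear_cmul[OF L])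
    then show "mean_curvature M N g f x d' = chart_deriv d d' id (f x) (mean_curvature M N g f x d)"
      using chart_deriv_cod[OF M N sf c(1) d(1) d'(1) c(2) d(2) d'(2)]
      by (simp add: mc[OF d] mc[OF d'] linear_diff[OF L])
  qed
  define d where "d = chart_at N (f x)"
  note d = chart_at_props[OF N, of "f x", folded d_def]
  note L = linear_chart_deriv[OF M N sf c(1) d(1) c(2) d(2)]
  show ?thesis
    unfolding normal_space_chart[OF sf c d tan] mc[OF d] hess_trace_def
    by (simp add: ip_bilinear hess_tangential[OF f c d] linear_sum[OF L] linear_cmul[OF L])
qed

text \<open>The chart in the definition of the mean curvature is an arbitrary choice at each point, so even
  its continuity rests on the independence of the chart.\<close>

lemma mean_curvature_chart:
  assumes f: "f \<in> Imm M N" and c': "c' \<in> M" "x \<in> cdom c'" and d: "d \<in> N" "f x \<in> cdom d"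
  shows "\<exists>\<xi>. mean_curvature M N g f x d = hess_trace f c' d x - chart_deriv c' d f x \<xi>"
proof -
  have sf: "smooth_map M N f" using f by (simp add: Imm_def)
  define c where "c = chart_at M x"
  note c = chart_at_props[OF M, of x, folded c_def]
  let ?\<theta> = "chart_deriv c' c id x" and ?z = "cmap c x" and ?z' = "cmap c' x"
  note L = linear_chart_deriv[OF M N sf c(1) d(1) c(2) d(2)]
  note G = sympd_gram_pullback[OF M N g f c] and G' = sympd_gram_pullback[OF M N g f c']
  have pull: "ip (GM f c' ?z') u v = ip (GM f c ?z) (?\<theta> u) (?\<theta> v)" for u v
    using chart_deriv_dom[OF M N sf c'(1) c(1) d(1) c'(2) c(2) d(2)]
    by (simp add: gram_pullback[OF M N g sf c d] gram_pullback[OF M N g sf c' d])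
  have "(\<Sum>i\<in>UNIV. \<Sum>j\<in>UNIV. matrix_inv (GM f c' ?z') $ i $ j *\<^sub>R hess f c d x (?\<theta> (axis i 1)) (?\<theta> (axis j 1))) =
      hess_trace f c d x"
    unfolding hess_trace_def
    using sympd_det_pos[OF G] sympd_det_pos[OF G'] linear_hess[OF sf c d] linear_trans[OF M c'(1) c(1) c'(2) c(2)] pull
    by (intro trace_form_invariant[where T = "?\<theta>"]) auto
  then have "hess_trace f c' d x = hess_trace f c d x + chart_deriv c d f x (\<Sum>i\<in>UNIV. \<Sum>j\<in>UNIV.
      matrix_inv (GM f c' ?z') $ i $ j *\<^sub>R D2 (local_rep c' c id) ?z' (axis i 1) (axis j 1))"
    by (simp add: hess_trace_def[of f c'] hess_dom[OF sf c c' d] scaleR_add_right sum.distrib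
        linear_sum[OF L] linear_cmul[OF L])
  then obtain a where a: "hess_trace f c' d x = hess_trace f c d x + chart_deriv c d f x a" by blast
  obtain b where b: "mean_curvature M N g f x d = hess_trace f c d x - chart_deriv c d f x b"
    using mean_curvature_chart_at[OF sf d, folded c_def] by blast
  define \<eta> where "\<eta> = a + b"
  have "mean_curvature M N g f x d = hess_trace f c' d x - chart_deriv c d f x \<eta>"
    using a b by (simp add: \<eta>_def linear_add[OF L])
  moreover have "chart_deriv c d f x \<eta> = chart_deriv c' d f x (chart_deriv c c' id x \<eta>)"
    using chart_deriv_dom[OF M N sf c(1) c'(1) d(1) c(2) c'(2) d(2)] by simp
  ultimately show ?thesis by metis
qed

end

text \<open>\<open>nrm G T \<gamma>\<close> is the orthogonal projection along the range of \<open>T\<close>, where \<open>\<gamma>\<close> is the pullback of \<open>G\<close> by \<open>T\<close>.\<close>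

definition tcomp :: "real^'n^'n::finite \<Rightarrow> (real^'m::finite \<Rightarrow> real^'n) \<Rightarrow> real^'m^'m \<Rightarrow> real^'n \<Rightarrow> real^'m" where
  "tcomp G T \<gamma> v = matrix_inv \<gamma> *v (\<chi> j. ip G v (T (axis j 1)))"

definition nrm :: "real^'n^'n::finite \<Rightarrow> (real^'m::finite \<Rightarrow> real^'n) \<Rightarrow> real^'m^'m \<Rightarrow> real^'n \<Rightarrow> real^'n" where
  "nrm G T \<gamma> v = v - T (tcomp G T \<gamma> v)"

text \<open>Testing \<open>v\<close> against the vectors \<open>T (axis j 1)\<close> removes
  \<open>w\<close> and leaves the normal equations for \<open>X\<close>, with matrix \<gamma>.
  Through this uniqueness the normal part of a vector and the mean curvature, which are introduced
  in different ways, receive one explicit formula.\<close>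

lemma tcomp_unique:
  fixes T :: "real^'m::finite \<Rightarrow> real^'n::finite"
  assumes "\<And>u v. ip \<gamma> u v = ip G (T u) (T v)" "sympd \<gamma>" "\<And>u. ip G w (T u) = 0" "v = w + T X"
  shows "X = tcomp G T \<gamma> v" "w = nrm G T \<gamma> v"
proof -
  have "ip G v (T (axis j 1)) = ip \<gamma> (axis j 1) X" for j
    using assms(3)[of "axis j 1"] assms(1)[of X "axis j 1"] sympd_sym[OF assms(2)] by (simp add: assms(4) ip_bilinear)
  also have "ip \<gamma> (axis j 1) X = (\<gamma> *v X) $ j" for j
    by (simp add: ip_def inner_axis')
  finally have "(\<chi> j. ip G v (T (axis j 1))) = \<gamma> *v X" by (simp add: vec_eq_iff)
  then show "X = tcomp G T \<gamma> v"
    using sympd_det_pos[OF assms(2)] by (simp add: tcomp_def matrix_vector_mul_assoc matrix_inv_mult)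
  then show "w = nrm G T \<gamma> v" using assms(4) by (simp add: nrm_def)
qed

lemma nrm_orthogonal:
  fixes T :: "real^'m::finite \<Rightarrow> real^'n::finite"
  assumes "\<And>u v. ip \<gamma> u v = ip G (T u) (T v)" "sympd \<gamma>" "linear T"
  shows "ip G (nrm G T \<gamma> v) (T u) = 0"
proof -
  define X where "X = tcomp G T \<gamma> v"
  have "\<gamma> *v X = (\<chi> j. ip G v (T (axis j 1)))"
    using sympd_det_pos[OF assms(2)] by (simp add: X_def tcomp_def matrix_vector_mul_assoc matrix_inv_mult)
  then have *: "ip \<gamma> (axis j 1) X = ip G v (T (axis j 1))" for j
    by (simp add: ip_def inner_axis')
  have "ip \<gamma> X u = (\<Sum>j\<in>UNIV. u $ j * ip \<gamma> (axis j 1) X)"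
    by (subst sympd_sym[OF assms(2)], subst vec_expand[of u]) (simp add: ip_bilinear)
  also have "\<dots> = ip G v (T u)"
    by (simp add: linear_expand[OF assms(3), of u] ip_bilinear *)
  finally show ?thesis by (simp add: nrm_def ip_bilinear X_def assms(1)[symmetric])
qed

section \<open>Normal and tangential parts of vectors along an immersion\<close>

context riem_setup
begin

text \<open>The mean curvature is normal and differs from \<open>hess_trace\<close> by a tangential
  vector, so it is the orthogonal projection of \<open>hess_trace\<close>. In contrast to the
  definition, the right-hand side is available in any chart \<open>c\<close> around \<open>x\<close>
  and visibly depends smoothly on the data.\<close>

lemma mean_curvature_nrm:
  assumes f: "f \<in> Imm M N" and c: "c \<in> M" "x \<in> cdom c" and d: "d \<in> N" "f x \<in> cdom d"
  shows "mean_curvature M N g f x d =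
    nrm (GN d (cmap d (f x))) (chart_deriv c d f x) (GM f c (cmap c x)) (hess_trace f c d x)"
proof -
  have sf: "smooth_map M N f" using f by (simp add: Imm_def)
  note n = mean_curvature_normal[OF f, of x]
  then have t: "mean_curvature M N g f x \<in> tangent_space N (f x)" by (simp add: normal_space_def)
  obtain \<xi> where \<xi>: "mean_curvature M N g f x d = hess_trace f c d x - chart_deriv c d f x \<xi>"
    using mean_curvature_chart[OF f c d] by blast
  show ?thesis
    by (rule tcomp_unique(2)[OF gram_pullback[OF M N g sf c d] sympd_gram_pullback[OF M N g f c]])
      (use n \<xi> in \<open>auto simp: normal_space_chart[OF sf c d t]\<close>)
qed

text \<open>\<open>normal_part\<close> is a description. The projection \<open>nrm\<close> provides
  a vector that satisfies it, and \<open>tcomp_unique\<close> shows that there is no other.\<close>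

lemma normal_decomposition:
  assumes f: "f \<in> Imm M N" and v: "v \<in> tangent_space N (f x)"
  shows "normal_part M N g f x v \<in> normal_space M N g f x"
    "\<exists>X\<in>tangent_space M x. v = (\<lambda>d. normal_part M N g f x v d + tmap M N f x X d)"
proof -
  have sf: "smooth_map M N f" using f by (simp add: Imm_def)
  define c d where "c = chart_at M x" and "d = chart_at N (f x)"
  note c = chart_at_props[OF M, of x, folded c_def]
  note d = chart_at_props[OF N, of "f x", folded d_def]
  note pull = gram_pullback[OF M N g sf c d] and pd = sympd_gram_pullback[OF M N g f c]
  note L = linear_chart_deriv[OF M N sf c(1) d(1) c(2) d(2)]
  define X where "X = tangent_at M c x (tcomp (GN d (cmap d (f x))) (chart_deriv c d f x) (GM f c (cmap c x)) (v d))"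
  have X: "X \<in> tangent_space M x" unfolding X_def by (rule tangent_at_in[OF M c])
  define w where "w = (\<lambda>e. v e - tmap M N f x X e)"
  have w: "w \<in> tangent_space N (f x)"
    using tangent_space_lin[OF N v tmap_in[OF M N sf X], of 1 "-1"] by (simp add: w_def)
  have wd: "w d = nrm (GN d (cmap d (f x))) (chart_deriv c d f x) (GM f c (cmap c x)) (v d)"
    by (simp add: w_def nrm_def tmap_chart[OF M N sf c(1) d(1) c(2) d(2) X])
      (simp add: X_def tangent_at_in[OF M c])
  have wn: "w \<in> normal_space M N g f x"
    unfolding normal_space_chart[OF sf c d w] wd using nrm_orthogonal[OF pull pd L] by blast
  let ?P = "\<lambda>w. w \<in> normal_space M N g f x \<and> (\<exists>X\<in>tangent_space M x. v = (\<lambda>d. w d + tmap M N f x X d))"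
  have ex: "?P w" using wn by (intro conjI bexI[OF _ X]) (simp_all add: w_def)
  have uniq: "w' = w" if w': "?P w'" for w'
  proof -
    obtain X' where X': "X' \<in> tangent_space M x" "v = (\<lambda>d. w' d + tmap M N f x X' d)" using w' by blast
    have t: "w' \<in> tangent_space N (f x)" using w' by (simp add: normal_space_def)
    have "w' d = nrm (GN d (cmap d (f x))) (chart_deriv c d f x) (GM f c (cmap c x)) (v d)"
      by (rule tcomp_unique(2)[OF pull pd])
        (use w' normal_space_chart[OF sf c d t] X' tmap_chart[OF M N sf c(1) d(1) c(2) d(2) X'(1)] in auto)
    then show ?thesis using tangent_eqI[OF t w d] wd by simp
  qed
  have "?P (normal_part M N g f x v)"
    unfolding normal_part_def by (rule theI[of ?P, OF ex uniq])
  then show "normal_part M N g f x v \<in> normal_space M N g f x"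
    "\<exists>X\<in>tangent_space M x. v = (\<lambda>d. normal_part M N g f x v d + tmap M N f x X d)" by auto
qed

text \<open>The vector on \<open>M\<close> that accounts for the tangential component of
  \<open>v\<close>; \<open>normal_part_chart\<close> removes the apparent choice. For the velocity
  of a path it is the field whose divergence integrates to zero.\<close>

definition tangent_part :: "('a \<Rightarrow> 'b) \<Rightarrow> 'a \<Rightarrow> ('b, 'n) tangent \<Rightarrow> ('a, 'm) tangent" where
  "tangent_part f x v = (SOME X. X \<in> tangent_space M x \<and> v = (\<lambda>d. normal_part M N g f x v d + tmap M N f x X d))"

lemma tangent_part_props:
  assumes f: "f \<in> Imm M N" and v: "v \<in> tangent_space N (f x)"
  shows "tangent_part f x v \<in> tangent_space M x"
    "v = (\<lambda>d. normal_part M N g f x v d + tmap M N f x (tangent_part f x v) d)"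
  using someI_ex[OF normal_decomposition(2)[OF f v, unfolded Bex_def], folded tangent_part_def] by auto

lemma normal_part_chart:
  assumes f: "f \<in> Imm M N" and v: "v \<in> tangent_space N (f x)"
    and c: "c \<in> M" "x \<in> cdom c" and d: "d \<in> N" "f x \<in> cdom d"
  shows "normal_part M N g f x v d = nrm (GN d (cmap d (f x))) (chart_deriv c d f x) (GM f c (cmap c x)) (v d)"
    "tangent_part f x v c = tcomp (GN d (cmap d (f x))) (chart_deriv c d f x) (GM f c (cmap c x)) (v d)"
proof -
  have sf: "smooth_map M N f" using f by (simp add: Imm_def)
  note n = normal_decomposition(1)[OF f v] and X = tangent_part_props[OF f v]
  have t: "normal_part M N g f x v \<in> tangent_space N (f x)" using n by (simp add: normal_space_def)
  have o: "ip (GN d (cmap d (f x))) (normal_part M N g f x v d) (chart_deriv c d f x u) = 0" for u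
    using n normal_space_chart[OF sf c d t] by blast
  have e: "v d = normal_part M N g f x v d + chart_deriv c d f x (tangent_part f x v c)"
    using X(2) tmap_chart[OF M N sf c(1) d(1) c(2) d(2) X(1)] by metis
  show "normal_part M N g f x v d = nrm (GN d (cmap d (f x))) (chart_deriv c d f x) (GM f c (cmap c x)) (v d)"
    "tangent_part f x v c = tcomp (GN d (cmap d (f x))) (chart_deriv c d f x) (GM f c (cmap c x)) (v d)"
    using tcomp_unique[OF gram_pullback[OF M N g sf c d] sympd_gram_pullback[OF M N g f c] o e] by auto
qed

end

section \<open>Change of variables over an arbitrary finite index type\<close>

text \<open>The change of variables theorem of the library requires a well-ordered index type; a copy of
  the index type that carries an arbitrary well-order removes this restriction.\<close>

typedef 'a ordered_copy = "UNIV :: 'a set"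
  morphisms of_copy to_copy ..

lemma bij_of_copy: "bij of_copy"
  by (metis bijI' of_copy_inverse to_copy_inverse UNIV_I)

instance ordered_copy :: (finite) finite
proof
  have "(UNIV :: 'a ordered_copy set) = to_copy ` UNIV"
    by (metis of_copy_inverse surj_def)
  then show "finite (UNIV :: 'a ordered_copy set)" by (metis finite finite_imageI)
qed

definition copy_index :: "'a::finite ordered_copy \<Rightarrow> nat" where
  "copy_index x = (SOME f :: 'a \<Rightarrow> nat. inj f) (of_copy x)"

lemma copy_index_inj: "copy_index x = copy_index y \<longleftrightarrow> x = y"
proof -
  have "\<exists>f :: 'a \<Rightarrow> nat. inj f" using finite_imp_inj_to_nat_seg[OF finite[of UNIV]] by blast
  from someI_ex[OF this] show ?thesis
    unfolding copy_index_def using inj_eq of_copy_inject by metis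
qed

instantiation ordered_copy :: (finite) wellorder
begin

definition less_eq_ordered_copy :: "'a ordered_copy \<Rightarrow> 'a ordered_copy \<Rightarrow> bool" where
  "less_eq_ordered_copy x y \<longleftrightarrow> copy_index x \<le> copy_index y"

definition less_ordered_copy :: "'a ordered_copy \<Rightarrow> 'a ordered_copy \<Rightarrow> bool" where
  "less_ordered_copy x y \<longleftrightarrow> copy_index x < copy_index y"

instance
proof
  fix P :: "'a ordered_copy \<Rightarrow> bool" and a :: "'a ordered_copy"
  assume step: "\<And>x. (\<And>y. y < x \<Longrightarrow> P y) \<Longrightarrow> P x"
  show "P a"
    by (induction a rule: measure_induct_rule[of copy_index]) (rule step, simp add: less_ordered_copy_def)
qed (auto simp: less_eq_ordered_copy_def less_ordered_copy_def copy_index_inj)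

end

text \<open>Conjugation by \<pi> is a bijection between the permutations of the two index types and
  preserves signs, so the Leibniz sums agree term by term.\<close>

lemma det_reindex:
  fixes A :: "real^'a::finite^'a" and \<pi> :: "'b::finite \<Rightarrow> 'a"
  assumes "bij \<pi>"
  shows "det (\<chi> i j. A $ \<pi> i $ \<pi> j) = det A"
proof -
  let ?m = "\<lambda>p x. if x \<in> UNIV then \<pi> (p (inv_into UNIV \<pi> x)) else x"
  have m: "?m p = map_permutation UNIV \<pi> p" for p
    using assms by (auto simp: map_permutation_def restrict_id_def bij_def)
  have "det A = (\<Sum>p | p permutes (UNIV :: 'b set). of_int (sign (?m p)) * (\<Prod>i\<in>UNIV. A $ i $ ?m p i))"
    unfolding det_def by (rule sum.reindex_bij_betw[symmetric, OF bij_betw_permutations[OF assms]])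
  also have "\<dots> = (\<Sum>p | p permutes (UNIV :: 'b set). of_int (sign p) * (\<Prod>i\<in>UNIV. A $ \<pi> i $ \<pi> (p i)))"
  proof (rule sum.cong[OF refl])
    fix p assume p: "p \<in> {p. p permutes (UNIV :: 'b set)}"
    have "sign (?m p) = sign p"
      unfolding m by (rule sign_map_permutation) (use p assms in \<open>auto simp: bij_def\<close>)
    moreover have "(\<Prod>i\<in>UNIV. A $ \<pi> i $ ?m p (\<pi> i)) = (\<Prod>i\<in>UNIV. A $ i $ ?m p i)"
      by (rule prod.reindex_bij_betw[OF assms])
    ultimately show "of_int (sign (?m p)) * (\<Prod>i\<in>UNIV. A $ i $ ?m p i) =
        of_int (sign p) * (\<Prod>i\<in>UNIV. A $ \<pi> i $ \<pi> (p i))"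
      using assms by (simp add: bij_def)
  qed
  finally show ?thesis by (simp add: det_def)
qed

lemma prod_Basis_vec:
  fixes v :: "real^'n::finite"
  shows "(\<Prod>b\<in>Basis. v \<bullet> b) = (\<Prod>i\<in>UNIV. v $ i)"
proof -
  have B: "Basis = (\<lambda>i::'n. axis i (1::real)) ` UNIV" by (auto simp: Basis_vec_def)
  have i: "inj_on (\<lambda>i::'n. axis i (1::real)) UNIV" by (auto simp: inj_on_def axis_eq_axis)
  have "(\<Prod>b\<in>Basis. v \<bullet> b) = (\<Prod>b\<in>(\<lambda>i::'n. axis i (1::real)) ` UNIV. v \<bullet> b)"
    by (rule prod.cong[OF B refl])
  also have "\<dots> = (\<Prod>i\<in>UNIV. v \<bullet> axis i 1)" using prod.reindex[OF i] by (simp add: o_def)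
  finally show ?thesis by (simp add: inner_axis)
qed

definition reindex :: "real^'a \<Rightarrow> real^('a::finite ordered_copy)" where
  "reindex v = (\<chi> i. v $ of_copy i)"

definition unindex :: "real^('a::finite ordered_copy) \<Rightarrow> real^'a" where
  "unindex v = (\<chi> i. v $ to_copy i)"

lemma unindex_reindex [simp]: "unindex (reindex v) = v" and reindex_unindex [simp]: "reindex (unindex w) = w"
  by (simp_all add: reindex_def unindex_def vec_eq_iff to_copy_inverse of_copy_inverse)

lemma linear_reindex: "linear reindex" and linear_unindex: "linear unindex"
  by (auto intro!: linearI simp: reindex_def unindex_def vec_eq_iff)

lemma bounded_linear_reindex: "bounded_linear reindex" and bounded_linear_unindex: "bounded_linear unindex"
  using linear_reindex linear_unindex linear_conv_bounded_linear by auto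

lemma measurable_reindex [measurable]: "reindex \<in> borel_measurable borel" "unindex \<in> borel_measurable borel"
  using bounded_linear_reindex bounded_linear_unindex
  by (auto intro!: borel_measurable_continuous_onI linear_continuous_on)

text \<open>Relabelling coordinates sends boxes to boxes with the same side lengths, and Lebesgue
  measure is characterised by its values on boxes.\<close>

lemma lborel_reindex: "distr lborel borel reindex = (lborel :: (real^('a::finite ordered_copy)) measure)"
proof (rule lborel_eqI[symmetric])
  fix l u :: "real^'a ordered_copy"
  assume le: "\<And>b. b \<in> Basis \<Longrightarrow> l \<bullet> b \<le> u \<bullet> b"
  have le': "l $ i \<le> u $ i" for i using le[of "axis i 1"] by (simp add: inner_axis axis_in_Basis_iff)
  have sur: "\<exists>k. i = to_copy k" for i :: "'a ordered_copy" by (metis of_copy_inverse)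
  have "reindex -` box l u = box (unindex l) (unindex u)"
  proof (intro set_eqI)
    fix x :: "real^'a"
    have "(\<forall>i. l $ i < x $ of_copy i \<and> x $ of_copy i < u $ i) \<longleftrightarrow>
        (\<forall>k. l $ to_copy k < x $ k \<and> x $ k < u $ to_copy k)"
      by (metis sur to_copy_inverse UNIV_I)
    then show "x \<in> reindex -` box l u \<longleftrightarrow> x \<in> box (unindex l) (unindex u)"
      by (simp add: mem_box_cart reindex_def unindex_def)
  qed
  then have "emeasure (distr lborel borel reindex) (box l u) = emeasure lborel (box (unindex l) (unindex u))"
    by (simp add: emeasure_distr)
  also have "\<dots> = ennreal (\<Prod>b\<in>Basis. (unindex u - unindex l) \<bullet> b)"
  proof (rule emeasure_lborel_box)
    fix b :: "real^'a" assume "b \<in> Basis"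
    then obtain i where "b = axis i 1" by (auto simp: Basis_vec_def)
    then show "unindex l \<bullet> b \<le> unindex u \<bullet> b" using le' by (simp add: inner_axis unindex_def)
  qed
  also have "(\<Prod>b\<in>Basis. (unindex u - unindex l) \<bullet> b) = (\<Prod>i\<in>UNIV. (u - l) $ to_copy i)"
    by (simp add: prod_Basis_vec unindex_def)
  also have "\<dots> = (\<Prod>i\<in>UNIV. (u - l) $ i)"
    by (rule prod.reindex_bij_betw) (metis bijI' of_copy_inverse to_copy_inverse UNIV_I)
  finally show "emeasure (distr lborel borel reindex) (box l u) = ennreal (\<Prod>b\<in>Basis. (u - l) \<bullet> b)"
    by (simp add: prod_Basis_vec)
qed simp

lemma absolutely_integrable_nn:
  fixes f :: "'a::euclidean_space \<Rightarrow> real"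
  assumes "(\<lambda>x. f x * indicator S x) \<in> borel_measurable borel" "\<And>x. x \<in> S \<Longrightarrow> 0 \<le> f x"
    "(\<integral>\<^sup>+x. ennreal (f x) * indicator S x \<partial>lborel) < \<infinity>"
  shows "f absolutely_integrable_on S"
proof -
  have "(\<lambda>x. f x * indicator S x) integrable_on UNIV"
  proof (rule nn_integral_integrable_on[OF assms(1)])
    show "0 \<le> f x * indicator S x" for x using assms(2) by (simp add: indicator_def)
    have "(\<integral>\<^sup>+x. ennreal (f x * indicator S x) \<partial>lborel) = (\<integral>\<^sup>+x. ennreal (f x) * indicator S x \<partial>lborel)"
      by (intro nn_integral_cong) (simp add: indicator_def)
    then show "(\<integral>\<^sup>+x. ennreal (f x * indicator S x) \<partial>lborel) < \<infinity>" using assms(3) by simp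
  qed
  moreover have "(\<lambda>x. f x * indicator S x) = (\<lambda>x. if x \<in> S then f x else 0)" by (auto simp: indicator_def)
  ultimately have "f integrable_on S" by (simp add: integrable_restrict_UNIV)
  then show ?thesis using assms(2) by (rule nonnegative_absolutely_integrable_1)
qed

text \<open>\<open>has_absolute_integral_change_of_variables\<close> speaks of absolutely integrable
  vector-valued functions, so \<open>u\<close> is passed through \<open>real^1\<close>. If either
  side is finite it yields equality; otherwise both are infinite.\<close>

lemma nn_integral_change_of_variables_wellorder:
  fixes \<theta> :: "real^'m::{finite,wellorder} \<Rightarrow> real^'m::_" and u :: "real^'m::_ \<Rightarrow> real"
  assumes E: "E \<in> sets borel"
    and der: "\<And>x. x \<in> E \<Longrightarrow> (\<theta> has_derivative \<theta>' x) (at x)" and inj: "inj_on \<theta> E"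
    and u: "\<And>y. y \<in> \<theta> ` E \<Longrightarrow> 0 \<le> u y"
    and meas: "(\<lambda>y. u y * indicator (\<theta> ` E) y) \<in> borel_measurable borel"
      "(\<lambda>x. \<bar>det (matrix (\<theta>' x))\<bar> * u (\<theta> x) * indicator E x) \<in> borel_measurable borel"
  shows "(\<integral>\<^sup>+y. ennreal (u y) * indicator (\<theta> ` E) y \<partial>lborel) =
    (\<integral>\<^sup>+x. ennreal (\<bar>det (matrix (\<theta>' x))\<bar> * u (\<theta> x)) * indicator E x \<partial>lborel)" (is "?A = ?B")
proof -
  let ?v = "\<lambda>x. \<bar>det (matrix (\<theta>' x))\<bar> * u (\<theta> x)"
  have v: "0 \<le> ?v x" if "x \<in> E" for x using u that by simp
  have iff: "?v absolutely_integrable_on E \<and> integral E ?v = b \<longleftrightarrow>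
      u absolutely_integrable_on (\<theta> ` E) \<and> integral (\<theta> ` E) u = b" for b
    using has_absolute_integral_change_of_variables[OF _ has_derivative_at_withinI[OF der] inj,
        of "\<lambda>x. vec (u x) :: real^1" "vec b"] E
    unfolding absolutely_integrable_on_1_iff integral_on_1_eq
    by (simp add: vec_eq_iff)
  have nn: "(\<integral>\<^sup>+x. ennreal (f x) * indicator S x \<partial>lborel) = ennreal (integral S f)"
    if "f absolutely_integrable_on S" "\<And>x. x \<in> S \<Longrightarrow> 0 \<le> f x" for f :: "real^'m::_ \<Rightarrow> real" and S
    using that by (intro nn_integral_has_integral_lebesgue') (auto simp: absolutely_integrable_on_def)
  show ?thesis
  proof (cases "?A < \<infinity> \<or> ?B < \<infinity>")
    case True
    then have "u absolutely_integrable_on (\<theta> ` E) \<or> ?v absolutely_integrable_on E"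
      using absolutely_integrable_nn[OF meas(1) u] absolutely_integrable_nn[OF meas(2) v] by blast
    then have "u absolutely_integrable_on (\<theta> ` E)" "?v absolutely_integrable_on E"
      "integral (\<theta> ` E) u = integral E ?v" using iff by blast+
    then show ?thesis using nn u v by simp
  next
    case False
    then show ?thesis by (simp add: not_less top.extremum_unique infinity_ennreal_def)
  qed
qed

lemma nn_integral_change_of_variables:
  fixes \<theta> :: "real^'m::finite \<Rightarrow> real^'m" and u :: "real^'m \<Rightarrow> real"
  assumes E: "E \<in> sets borel"
    and der: "\<And>x. x \<in> E \<Longrightarrow> (\<theta> has_derivative \<theta>' x) (at x)" and inj: "inj_on \<theta> E"
    and u: "\<And>y. y \<in> \<theta> ` E \<Longrightarrow> 0 \<le> u y"
    and meas: "(\<lambda>y. u y * indicator (\<theta> ` E) y) \<in> borel_measurable borel"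
      "(\<lambda>x. \<bar>det (matrix (\<theta>' x))\<bar> * u (\<theta> x) * indicator E x) \<in> borel_measurable borel"
  shows "(\<integral>\<^sup>+y. ennreal (u y) * indicator (\<theta> ` E) y \<partial>lborel) =
    (\<integral>\<^sup>+x. ennreal (\<bar>det (matrix (\<theta>' x))\<bar> * u (\<theta> x)) * indicator E x \<partial>lborel)"
proof -
  define F where "F = reindex ` E"
  define \<eta> where "\<eta> = (\<lambda>w. reindex (\<theta> (unindex w)))"
  define \<eta>' where "\<eta>' = (\<lambda>w v. reindex (\<theta>' (unindex w) (unindex v)))"
  have vim: "reindex ` S = unindex -` S" for S :: "(real^'m) set"
    by (auto simp: image_iff) (metis reindex_unindex)
  have F: "F \<in> sets borel" unfolding F_def vim using E measurable_sets[OF measurable_reindex(2)] by simp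
  have \<eta>F: "\<eta> ` F = reindex ` \<theta> ` E" by (auto simp: F_def \<eta>_def image_iff)
  have ind: "indicator (reindex ` S) w = (indicator S (unindex w) :: 'c::zero_neq_one)" for S and w :: "real^'m ordered_copy"
    unfolding vim by (simp add: indicator_def)
  have det: "det (matrix (\<eta>' w)) = det (matrix (\<theta>' (unindex w)))" for w
  proof -
    have ax: "unindex (axis j 1) = axis (of_copy j) 1" for j :: "'m ordered_copy"
      by (auto simp: unindex_def axis_def vec_eq_iff to_copy_inverse of_copy_inverse)
    have "matrix (\<eta>' w) = (\<chi> i j. matrix (\<theta>' (unindex w)) $ of_copy i $ of_copy j)"
      by (simp add: matrix_def \<eta>'_def vec_eq_iff ax) (simp add: reindex_def)
    then show ?thesis using det_reindex[OF bij_of_copy] by simp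
  qed
  have "(\<integral>\<^sup>+y. ennreal (u (unindex y)) * indicator (\<eta> ` F) y \<partial>lborel) =
    (\<integral>\<^sup>+x. ennreal (\<bar>det (matrix (\<eta>' x))\<bar> * u (unindex (\<eta> x))) * indicator F x \<partial>lborel)"
  proof (rule nn_integral_change_of_variables_wellorder[OF F])
    fix w assume "w \<in> F"
    then have "unindex w \<in> E" by (auto simp: F_def)
    from diff_chain_at[OF diff_chain_at[OF bounded_linear_imp_has_derivative[OF bounded_linear_unindex] der[OF this]]
        bounded_linear_imp_has_derivative[OF bounded_linear_reindex]]
    show "(\<eta> has_derivative \<eta>' w) (at w)" by (simp add: o_def \<eta>_def \<eta>'_def)
  next
    show "inj_on \<eta> F"
      using inj unfolding inj_on_def F_def \<eta>_def by (auto, metis unindex_reindex)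
    show "0 \<le> u (unindex y)" if "y \<in> \<eta> ` F" for y using that u by (auto simp: \<eta>F)
    show "(\<lambda>y. u (unindex y) * indicator (\<eta> ` F) y) \<in> borel_measurable borel"
      unfolding \<eta>F ind using measurable_compose[OF measurable_reindex(2) meas(1)] by simp
    show "(\<lambda>x. \<bar>det (matrix (\<eta>' x))\<bar> * u (unindex (\<eta> x)) * indicator F x) \<in> borel_measurable borel"
      unfolding F_def ind det using measurable_compose[OF measurable_reindex(2) meas(2)] by (simp add: \<eta>_def)
  qed
  moreover have "(\<integral>\<^sup>+y. ennreal (u (unindex y)) * indicator (\<eta> ` F) y \<partial>lborel) =
      (\<integral>\<^sup>+y. ennreal (u y) * indicator (\<theta> ` E) y \<partial>lborel)"
  proof -
    have m: "(\<lambda>y. ennreal (u y) * indicator (\<theta> ` E) y) \<in> borel_measurable borel"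
      using measurable_compose[OF meas(1) measurable_ennreal] by (rule measurable_cong[THEN iffD1, rotated]) (simp add: indicator_def)
    have "(\<lambda>y. ennreal (u (unindex y)) * indicator (\<eta> ` F) y) \<in> borel_measurable borel"
      unfolding \<eta>F ind by (rule measurable_compose[OF measurable_reindex(2) m])
    then show ?thesis
      unfolding lborel_reindex[symmetric] by (subst nn_integral_distr) (auto simp: \<eta>F ind)
  qed
  moreover have "(\<integral>\<^sup>+x. ennreal (\<bar>det (matrix (\<eta>' x))\<bar> * u (unindex (\<eta> x))) * indicator F x \<partial>lborel) =
      (\<integral>\<^sup>+x. ennreal (\<bar>det (matrix (\<theta>' x))\<bar> * u (\<theta> x)) * indicator E x \<partial>lborel)"
  proof -
    have m: "(\<lambda>x. ennreal (\<bar>det (matrix (\<theta>' x))\<bar> * u (\<theta> x)) * indicator E x) \<in> borel_measurable borel"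
      using measurable_compose[OF meas(2) measurable_ennreal] by (rule measurable_cong[THEN iffD1, rotated]) (simp add: indicator_def)
    have "(\<lambda>x. ennreal (\<bar>det (matrix (\<eta>' x))\<bar> * u (unindex (\<eta> x))) * indicator F x) \<in> borel_measurable borel"
      unfolding F_def ind det \<eta>_def unindex_reindex by (rule measurable_compose[OF measurable_reindex(2) m])
    then show ?thesis
      unfolding lborel_reindex[symmetric] by (subst nn_integral_distr) (auto simp: F_def ind det \<eta>_def)
  qed
  ultimately show ?thesis by simp
qed

lemma det_pullback:
  fixes T :: "real^'n::finite \<Rightarrow> real^'n"
  assumes T: "linear T" and g: "\<And>u v. ip g' u v = ip g (T u) (T v)"
  shows "det g' = (det (matrix T))\<^sup>2 * det g"
  unfolding pullback_matrix[OF assms] by (simp add: det_mul det_transpose power2_eq_square)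

section \<open>The volume measure of an immersion\<close>

lemma Diff_id: "smooth_manifold M \<Longrightarrow> id \<in> Diff M"
  by (simp add: Diff_def smooth_map_id)

lemma tmap_id:
  assumes "smooth_manifold M" "X \<in> tangent_space M x"
  shows "tmap M M id x X = X"
proof -
  note c = chart_at_props[OF assms(1), of x]
  have t: "tmap M M id x X \<in> tangent_space M x"
    using tmap_in[OF assms(1,1) smooth_map_id[OF assms(1)] assms(2)] by simp
  show ?thesis
    by (rule tangent_eqI[OF t assms(2) c])
      (use tmap_chart[OF assms(1,1) smooth_map_id[OF assms(1)] c(1) c(1) c(2) _ assms(2)] c
        chart_deriv_self[OF assms(1) c] in simp)
qed

lemma Imm_comp_Diff:
  assumes M: "smooth_manifold M" and N: "smooth_manifold N" and f: "f \<in> Imm M N" and \<phi>: "\<phi> \<in> Diff M"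
  shows "f \<circ> \<phi> \<in> Imm M N"
proof -
  have s: "smooth_map M N f" "smooth_map M M \<phi>" "smooth_map M M (inv \<phi>)" "bij \<phi>"
    using f \<phi> by (auto simp: Imm_def Diff_def)
  have inj: "inj_on (tmap M M \<phi> x) (tangent_space M x)" for x
  proof (rule inj_on_inverseI)
    fix X assume X: "X \<in> tangent_space M x"
    have "tmap M M (inv \<phi>) (\<phi> x) (tmap M M \<phi> x X) = tmap M M (inv \<phi> \<circ> \<phi>) x X"
      using tmap_comp[OF M M M s(2,3) X] by simp
    also have "inv \<phi> \<circ> \<phi> = id" using s(4) by (simp add: bij_def)
    finally show "tmap M M (inv \<phi>) (\<phi> x) (tmap M M \<phi> x X) = X" using tmap_id[OF M X] by (simp add: id_def)
  qed
  have "inj_on (tmap M N (f \<circ> \<phi>) x) (tangent_space M x)" for x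
  proof (rule inj_onI)
    fix X Y assume XY: "X \<in> tangent_space M x" "Y \<in> tangent_space M x"
      and eq: "tmap M N (f \<circ> \<phi>) x X = tmap M N (f \<circ> \<phi>) x Y"
    have "inj_on (tmap M N f (\<phi> x)) (tangent_space M (\<phi> x))" using f by (simp add: Imm_def)
    then have "tmap M M \<phi> x X = tmap M M \<phi> x Y"
      by (rule inj_onD) (use eq tmap_in[OF M M s(2)] XY in \<open>auto simp: tmap_comp[OF M M N s(2,1)]\<close>)
    then show "X = Y" using inj[of x] XY by (auto simp: inj_on_def)
  qed
  then show ?thesis using smooth_map_comp[OF M M N s(2,1)] by (simp add: Imm_def)
qed

text \<open>Outside the chart image \<open>cinv\<close> is arbitrary. A constant value there makes
  the map Borel measurable on the whole model space, so that measures can be pushed forward along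
  it.\<close>

definition chart_inv :: "('a, 'i::finite) chart \<Rightarrow> real ^ 'i \<Rightarrow> 'a" where
  "chart_inv c z = (if z \<in> cmap c ` cdom c then cinv c z else undefined)"

lemma measurable_chart_inv:
  assumes c: "is_chart c"
  shows "chart_inv c \<in> borel_measurable borel"
proof (rule borel_measurableI)
  fix S :: "'a set" assume S: "open S"
  let ?I = "cmap c ` cdom c"
  have "chart_inv c -` S \<inter> space borel = cmap c ` (cdom c \<inter> S) \<union> (if undefined \<in> S then - ?I else {})"
    unfolding chart_image_Int[OF c] by (auto simp: chart_inv_def split: if_splits)
  moreover have "open (cmap c ` (cdom c \<inter> S))" "open ?I" using open_chart_image[OF c S] chart_props(2)[OF c] by auto
  ultimately show "chart_inv c -` S \<inter> space borel \<in> sets borel" by auto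
qed

lemma chart_image_vimage:
  assumes "is_chart c" "E \<subseteq> cdom c"
  shows "cmap c ` E = chart_inv c -` E \<inter> cmap c ` cdom c"
proof (intro set_eqI iffI)
  show "z \<in> chart_inv c -` E \<inter> cmap c ` cdom c" if zE: "z \<in> cmap c ` E" for z
  proof -
    obtain x where x: "x \<in> E" "z = cmap c x" using zE by blast
    then have "z \<in> cmap c ` cdom c" "cinv c z = x" using assms(2) chart_props(5)[OF assms(1)] by auto
    then show ?thesis using x by (simp add: chart_inv_def)
  qed
  show "z \<in> cmap c ` E" if "z \<in> chart_inv c -` E \<inter> cmap c ` cdom c" for z
  proof -
    have z: "z \<in> cmap c ` cdom c" "cinv c z \<in> E" using that by (auto simp: chart_inv_def)
    then show ?thesis using chart_props(6)[OF assms(1) z(1)] by (metis image_eqI)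
  qed
qed

lemma borel_chart_image:
  assumes "is_chart c" "E \<subseteq> cdom c" "E \<in> sets borel"
  shows "cmap c ` E \<in> sets borel"
  using measurable_sets[OF measurable_chart_inv[OF assms(1)] assms(3)] chart_props(2)[OF assms(1)]
  by (simp add: chart_image_vimage[OF assms(1,2)])

section \<open>Volume in a single chart and its behaviour under diffeomorphisms\<close>

context riem_setup
begin

definition dens :: "('a \<Rightarrow> 'b) \<Rightarrow> ('a, 'm) chart \<Rightarrow> real^'m \<Rightarrow> real" where
  "dens f c z = indicator (cmap c ` cdom c) z * sqrt (det (GM f c z))"

text \<open>\<open>dens\<close> vanishes off the chart image, so the constant value that
  \<open>chart_inv\<close> takes there carries no mass.\<close>

definition chart_vol :: "('a \<Rightarrow> 'b) \<Rightarrow> ('a, 'm) chart \<Rightarrow> 'a measure" where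
  "chart_vol f c = distr (density lborel (\<lambda>z. ennreal (dens f c z))) borel (chart_inv c)"

lemma continuous_sqrt_det:
  assumes "smooth_map M N f" "c \<in> M"
  shows "continuous_on (cmap c ` cdom c) (\<lambda>z. sqrt (det (GM f c z)))"
  using Ck_on_imp_continuous[OF Ck_on_det[OF chart_props(2)[OF manifold_chart[OF M assms(2)]] Ck_on_GM[OF assms]]]
  by (intro continuous_on_real_sqrt)

lemma measurable_dens:
  assumes "smooth_map M N f" "c \<in> M"
  shows "dens f c \<in> borel_measurable borel"
  using borel_measurable_continuous_on_indicator[OF _ continuous_sqrt_det[OF assms]]
    chart_props(2)[OF manifold_chart[OF M assms(2)]]
  by (simp add: dens_def[abs_def])

lemma det_GM_pos:
  assumes "f \<in> Imm M N" "c \<in> M" "z \<in> cmap c ` cdom c"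
  shows "det (GM f c z) > 0"
  using assms sympd_det_pos[OF sympd_gram_pullback[OF M N g assms(1,2)]] by auto

lemma dens_nonneg: "f \<in> Imm M N \<Longrightarrow> c \<in> M \<Longrightarrow> dens f c z \<ge> 0"
  using det_GM_pos by (simp add: dens_def indicator_def less_imp_le)

lemma sets_chart_vol [simp]: "sets (chart_vol f c) = sets borel" "space (chart_vol f c) = UNIV"
  by (simp_all add: chart_vol_def)

lemma emeasure_chart_vol:
  assumes f: "f \<in> Imm M N" and c: "c \<in> M" and E: "E \<in> sets borel" "E \<subseteq> cdom c"
  shows "emeasure (chart_vol f c) E = (\<integral>\<^sup>+z\<in>cmap c ` E. ennreal (sqrt (det (GM f c z))) \<partial>lborel)"
proof -
  have sf: "smooth_map M N f" using f by (simp add: Imm_def)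
  note ch = manifold_chart[OF M c]
  note m = measurable_chart_inv[OF ch]
  have "emeasure (chart_vol f c) E = emeasure (density lborel (\<lambda>z. ennreal (dens f c z))) (chart_inv c -` E)"
    unfolding chart_vol_def using m E by (subst emeasure_distr) auto
  also have "\<dots> = (\<integral>\<^sup>+z. ennreal (dens f c z) * indicator (chart_inv c -` E) z \<partial>lborel)"
    using measurable_dens[OF sf c] measurable_sets[OF m E(1)] by (subst emeasure_density) auto
  also have "\<dots> = (\<integral>\<^sup>+z\<in>cmap c ` E. ennreal (sqrt (det (GM f c z))) \<partial>lborel)"
    unfolding chart_image_vimage[OF ch E(2)]
    by (intro nn_integral_cong) (auto simp: dens_def indicator_def)
  finally show ?thesis .
qed

lemma Diff_image_borel:
  assumes "\<phi> \<in> Diff M" "E \<in> sets borel"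
  shows "\<phi> ` E \<in> sets borel"
proof -
  have "inv \<phi> \<in> borel_measurable borel" "bij \<phi>"
    using assms(1) by (auto simp: Diff_def smooth_map_def intro: borel_measurable_continuous_onI)
  then show ?thesis using measurable_sets[of "inv \<phi>" borel borel E] assms(2) by (simp add: bij_image_Collect_eq bij_vimage_eq_inv_image inv_inv_eq bij_imp_bij_inv)
qed

text \<open>The Gram determinant of the metric pulled back by \<open>f \<circ> \<phi>\<close> is
  that of \<open>f\<close> times the squared Jacobian of \<phi> in charts; its square root supplies
  exactly the factor in the change of variables. The case of the identity gives independence of the
  chart, the general case invariance under reparametrization.\<close>

lemma chart_vol_diffeo:
  assumes f: "f \<in> Imm M N" and \<phi>: "\<phi> \<in> Diff M" and c: "c \<in> M" and c': "c' \<in> M"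
    and E: "E \<in> sets borel" "E \<subseteq> cdom c" "\<phi> ` E \<subseteq> cdom c'"
  shows "emeasure (chart_vol (f \<circ> \<phi>) c) E = emeasure (chart_vol f c') (\<phi> ` E)"
proof -
  have sf: "smooth_map M N f" "smooth_map M M \<phi>" and bij: "bij \<phi>" using f \<phi> by (auto simp: Imm_def Diff_def)
  note ch = manifold_chart[OF M c] and ch' = manifold_chart[OF M c']
  note f\<phi> = Imm_comp_Diff[OF M N f \<phi>]
  then have s\<phi>: "smooth_map M N (f \<circ> \<phi>)" by (simp add: Imm_def)
  define \<theta> where "\<theta> = local_rep c c' \<phi>"
  have \<theta>: "\<theta> (cmap c x) = cmap c' (\<phi> x)" if "x \<in> cdom c" for x
    using chart_props(5)[OF ch that] by (simp add: \<theta>_def local_rep_def)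
  have im: "cmap c' ` \<phi> ` E = \<theta> ` cmap c ` E" unfolding image_image
    by (rule image_cong[OF refl]) (use \<theta> E(2) in auto)
  have jac: "\<bar>det (matrix (frechet_derivative \<theta> (at z)))\<bar> * sqrt (det (GM f c' (\<theta> z))) = sqrt (det (GM (f \<circ> \<phi>) c z))"
    if "z \<in> cmap c ` E" for z
  proof -
    obtain x where x: "x \<in> E" "z = cmap c x" using \<open>z \<in> cmap c ` E\<close> by blast
    then have x': "x \<in> cdom c" "\<phi> x \<in> cdom c'" using E by auto
    define d where "d = chart_at N (f (\<phi> x))"
    note d = chart_at_props[OF N, of "f (\<phi> x)", folded d_def]
    have d2: "(f \<circ> \<phi>) x \<in> cdom d" using d by simp
    have "ip (GM (f \<circ> \<phi>) c z) u v = ip (GM f c' (\<theta> z)) (chart_deriv c c' \<phi> x u) (chart_deriv c c' \<phi> x v)" for u v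
      using gram_pullback[OF M N g s\<phi> c x'(1) d(1) d2] gram_pullback[OF M N g sf(1) c' x'(2) d]
        chart_deriv_comp[OF M M N sf(2,1) c c' d(1) x' d(2)]
      by (simp add: x \<theta>[OF x'(1)] o_def)
    then have "det (GM (f \<circ> \<phi>) c z) = (det (matrix (frechet_derivative \<theta> (at z))))\<^sup>2 * det (GM f c' (\<theta> z))"
      using det_pullback[OF linear_chart_deriv[OF M M sf(2) c c' x']] by (simp add: x chart_deriv_def \<theta>_def)
    then show ?thesis by (simp add: real_sqrt_mult)
  qed
  have cE: "cmap c ` E \<in> sets borel" by (rule borel_chart_image[OF ch E(2,1)])
  have \<phi>E: "\<phi> ` E \<in> sets borel" by (rule Diff_image_borel[OF \<phi> E(1)])
  have cE': "cmap c' ` \<phi> ` E \<in> sets borel" by (rule borel_chart_image[OF ch' E(3) \<phi>E])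
  have meas: "(\<lambda>z. sqrt (det (GM f c z)) * indicator (cmap c ` F) z) \<in> borel_measurable borel"
    if "smooth_map M N f" "c \<in> M" "cmap c ` F \<in> sets borel" "F \<subseteq> cdom c" for f c F
  proof -
    have "(\<lambda>z. dens f c z * indicator (cmap c ` F) z) \<in> borel_measurable borel"
      using measurable_dens[OF that(1,2)] that(3) by simp
    moreover have "(\<lambda>z. dens f c z * indicator (cmap c ` F) z) = (\<lambda>z. sqrt (det (GM f c z)) * indicator (cmap c ` F) z)"
    proof
      fix z
      show "dens f c z * indicator (cmap c ` F) z = sqrt (det (GM f c z)) * indicator (cmap c ` F) z"
        using that(4) by (cases "z \<in> cmap c ` F") (auto simp: dens_def)
    qed
    ultimately show ?thesis by simp
  qed
  have "emeasure (chart_vol f c') (\<phi> ` E) = (\<integral>\<^sup>+y. ennreal (sqrt (det (GM f c' y))) * indicator (\<theta> ` cmap c ` E) y \<partial>lborel)"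
    by (simp only: emeasure_chart_vol[OF f c' \<phi>E E(3)] im)
  also have "\<dots> = (\<integral>\<^sup>+z. ennreal (\<bar>det (matrix (frechet_derivative \<theta> (at z)))\<bar> * sqrt (det (GM f c' (\<theta> z)))) * indicator (cmap c ` E) z \<partial>lborel)"
  proof (rule nn_integral_change_of_variables[OF cE])
    show "(\<theta> has_derivative frechet_derivative \<theta> (at z)) (at z)" if "z \<in> cmap c ` E" for z
      using that E has_derivative_local_rep[OF M M sf(2) c c'] by (force simp: \<theta>_def chart_deriv_def)
    show "inj_on \<theta> (cmap c ` E)"
    proof (rule inj_onI)
      fix y z assume "y \<in> cmap c ` E" "z \<in> cmap c ` E" and eq: "\<theta> y = \<theta> z"
      then obtain p q where pq: "p \<in> E" "q \<in> E" "y = cmap c p" "z = cmap c q" by blast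
      then have "cmap c' (\<phi> p) = cmap c' (\<phi> q)" using eq \<theta>[OF subsetD[OF E(2)], of p] \<theta>[OF subsetD[OF E(2)], of q] by simp
      then have "\<phi> p = \<phi> q" using chart_props(5)[OF ch'] pq E(3) by (metis image_subset_iff)
      then show "y = z" using bij pq by (auto simp: bij_def inj_def)
    qed
    show "0 \<le> sqrt (det (GM f c' y))" if "y \<in> \<theta> ` cmap c ` E" for y
    proof -
      have "y \<in> cmap c' ` cdom c'" using that im E(3) by blast
      then show ?thesis using det_GM_pos[OF f c'] by (simp add: less_imp_le)
    qed
    show "(\<lambda>y. sqrt (det (GM f c' y)) * indicator (\<theta> ` cmap c ` E) y) \<in> borel_measurable borel"
      using meas[OF sf(1) c' cE' E(3)] by (simp add: im)
    show "(\<lambda>z. \<bar>det (matrix (frechet_derivative \<theta> (at z)))\<bar> * sqrt (det (GM f c' (\<theta> z))) * indicator (cmap c ` E) z) \<in> borel_measurable borel"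
      by (rule measurable_cong[THEN iffD1, OF _ meas[OF s\<phi> c cE E(2)]]) (use jac in \<open>simp add: indicator_def\<close>)
  qed
  also have "\<dots> = (\<integral>\<^sup>+z\<in>cmap c ` E. ennreal (sqrt (det (GM (f \<circ> \<phi>) c z))) \<partial>lborel)"
    by (intro nn_integral_cong) (use jac in \<open>simp add: indicator_def\<close>)
  also have "\<dots> = emeasure (chart_vol (f \<circ> \<phi>) c) E"
    by (rule emeasure_chart_vol[OF f\<phi> c E(1,2), symmetric])
  finally show ?thesis by simp
qed

lemma chart_vol_trans:
  assumes f: "f \<in> Imm M N" and c: "c \<in> M" and c': "c' \<in> M" and E: "E \<in> sets borel" "E \<subseteq> cdom c" "E \<subseteq> cdom c'"
  shows "emeasure (chart_vol f c) E = emeasure (chart_vol f c') E"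
  using chart_vol_diffeo[OF f Diff_id[OF M] c c' E(1,2)] E(3) by simp

end

section \<open>The global volume measure on a compact manifold\<close>

locale riem_compact = riem_setup M N g
  for M :: "('a::{t2_space,second_countable_topology}, 'm::finite) atlas"
    and N :: "('b::{t2_space,second_countable_topology}, 'n::finite) atlas"
    and g :: "('b, 'n) metric" +
  assumes compact: "compact (UNIV :: 'a set)"
begin

definition atlas_list :: "('a, 'm) chart list" where
  "atlas_list = (SOME cs. set cs \<subseteq> M \<and> (\<Union>c\<in>set cs. cdom c) = UNIV)"

lemma atlas_list: "set atlas_list \<subseteq> M" "(\<Union>c\<in>set atlas_list. cdom c) = UNIV"
proof -
  have "\<exists>D\<subseteq>cdom ` M. finite D \<and> (UNIV :: 'a set) \<subseteq> \<Union>D"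
  proof (rule compactE[OF compact])
    show "UNIV \<subseteq> \<Union>(cdom ` M)" using M by (auto simp: smooth_manifold_def)
    show "open B" if "B \<in> cdom ` M" for B using that manifold_chart[OF M] chart_props(1) by blast
  qed blast
  then obtain D where D: "D \<subseteq> cdom ` M" "finite D" "UNIV \<subseteq> \<Union>D" by blast
  obtain C where C: "C \<subseteq> M" "finite C" "UNIV \<subseteq> (\<Union>c\<in>C. cdom c)"
    using finite_subset_image[OF D(2,1)] D(3) by metis
  obtain cs where "set cs = C" using finite_list[OF C(2)] by blast
  then have "\<exists>cs. set cs \<subseteq> M \<and> (\<Union>c\<in>set cs. cdom c) = UNIV" using C by blast
  from someI_ex[OF this] show "set atlas_list \<subseteq> M" "(\<Union>c\<in>set atlas_list. cdom c) = UNIV"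
    unfolding atlas_list_def by auto
qed

abbreviation nch :: nat where "nch \<equiv> length atlas_list"

text \<open>Removing the earlier chart domains makes the pieces disjoint; they are Borel, cover
  \<open>M\<close> for indices below \<open>nch\<close>, and each lies in one chart. Statements
  about measures on \<open>M\<close> are reduced to single charts by cutting along them.\<close>

definition piece :: "nat \<Rightarrow> 'a set" where
  "piece k = cdom (atlas_list ! k) - (\<Union>j<k. cdom (atlas_list ! j))"

lemma nth_atlas: "k < nch \<Longrightarrow> atlas_list ! k \<in> M"
  using atlas_list by auto

lemma piece_borel: "k < nch \<Longrightarrow> piece k \<in> sets borel"
  unfolding piece_def
  by (intro sets.Diff sets.finite_UN borel_open chart_props(1) manifold_chart[OF M] nth_atlas) auto

lemma piece_sub: "piece k \<subseteq> cdom (atlas_list ! k)" by (auto simp: piece_def)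

lemma piece_disjoint: "disjoint_family_on (\<lambda>k. E \<inter> piece k) {..<nch}"
  unfolding disjoint_family_on_def
proof (intro ballI impI)
  have "piece m \<inter> piece n = {}" if "m < n" for m n using that by (auto simp: piece_def)
  then show "E \<inter> piece m \<inter> (E \<inter> piece n) = {}" if "m \<noteq> n" for m n
    using that by (cases m n rule: linorder_cases) auto
qed

lemma piece_cover: "(\<Union>k<nch. piece k) = UNIV"
proof (intro set_eqI iffI UNIV_I)
  fix x
  have "\<exists>k<nch. x \<in> cdom (atlas_list ! k)" using atlas_list(2) by (metis UNIV_I UN_iff in_set_conv_nth)
  then obtain k where k: "k < nch" "x \<in> cdom (atlas_list ! k)" "\<And>j. j < k \<Longrightarrow> \<not> (j < nch \<and> x \<in> cdom (atlas_list ! j))"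
    using exists_least_iff[of "\<lambda>k. k < nch \<and> x \<in> cdom (atlas_list ! k)"] by blast
  then show "x \<in> (\<Union>k<nch. piece k)" by (force simp: piece_def)
qed

lemma emeasure_pieces:
  assumes "sets \<mu> = sets borel" "E \<in> sets borel"
  shows "emeasure \<mu> E = (\<Sum>k<nch. emeasure \<mu> (E \<inter> piece k))"
proof -
  have "(\<Sum>k<nch. emeasure \<mu> (E \<inter> piece k)) = emeasure \<mu> (\<Union>k<nch. E \<inter> piece k)"
    using assms piece_borel by (intro sum_emeasure piece_disjoint) auto
  also have "(\<Union>k<nch. E \<inter> piece k) = E" using piece_cover by auto
  finally show ?thesis by simp
qed

text \<open>The property under the description operator in \<open>vol\<close>. Existence and
  uniqueness must be settled before anything can be said about the volume.\<close>

definition is_vol :: "('a \<Rightarrow> 'b) \<Rightarrow> 'a measure \<Rightarrow> bool" where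
  "is_vol f \<mu> \<longleftrightarrow> sets \<mu> = sets borel \<and> (\<forall>c\<in>M. \<forall>E\<in>sets borel. E \<subseteq> cdom c \<longrightarrow>
     emeasure \<mu> E = (\<integral>\<^sup>+z\<in>cmap c ` E. ennreal (sqrt (det (GM f c z))) \<partial>lborel))"

lemma is_vol_iff:
  assumes "f \<in> Imm M N"
  shows "is_vol f \<mu> \<longleftrightarrow> sets \<mu> = sets borel \<and>
    (\<forall>c\<in>M. \<forall>E\<in>sets borel. E \<subseteq> cdom c \<longrightarrow> emeasure \<mu> E = emeasure (chart_vol f c) E)"
  unfolding is_vol_def using emeasure_chart_vol[OF assms] by auto

lemma is_vol_unique:
  assumes f: "f \<in> Imm M N" and "is_vol f \<mu>" "is_vol f \<nu>"
  shows "\<mu> = \<nu>"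
proof (rule measure_eqI)
  have s: "sets \<mu> = sets borel" "sets \<nu> = sets borel" using assms by (auto simp: is_vol_def)
  then show "sets \<mu> = sets \<nu>" by simp
  fix E assume "E \<in> sets \<mu>"
  then have E: "E \<in> sets borel" using s by simp
  have "emeasure \<mu> (E \<inter> piece k) = emeasure \<nu> (E \<inter> piece k)" if k: "k < nch" for k
  proof -
    have "E \<inter> piece k \<subseteq> cdom (atlas_list ! k)" "E \<inter> piece k \<in> sets borel"
      using piece_sub[of k] piece_borel[OF k] E by auto
    then show ?thesis using assms nth_atlas[OF k] by (simp add: is_vol_iff)
  qed
  then show "emeasure \<mu> E = emeasure \<nu> E"
    unfolding emeasure_pieces[OF s(1) E] emeasure_pieces[OF s(2) E] by simp
qed

text \<open>On each piece the volume of its own chart is used and the results are added. That every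
  other chart sees the right value is \<open>chart_vol_trans\<close>, applied piece by
  piece.\<close>

lemma is_vol_exists:
  assumes f: "f \<in> Imm M N"
  shows "\<exists>\<mu>. is_vol f \<mu>"
proof -
  define \<mu>0 where "\<mu>0 = (\<lambda>E. \<Sum>k<nch. emeasure (chart_vol f (atlas_list ! k)) (E \<inter> piece k))"
  define \<mu> where "\<mu> = measure_of UNIV (sets (borel :: 'a measure)) \<mu>0"
  have sa: "sigma_algebra UNIV (sets (borel :: 'a measure))"
    using sets.sigma_algebra_axioms[of "borel :: 'a measure"] by simp
  have pos: "positive (sets borel) \<mu>0" by (simp add: positive_def \<mu>0_def)
  have ca: "countably_additive (sets borel) \<mu>0"
  proof (rule countably_additiveI)
    fix A :: "nat \<Rightarrow> 'a set"
    assume A: "range A \<subseteq> sets borel" "disjoint_family A" "(\<Union>i. A i) \<in> sets borel"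
    have "(\<Sum>i. emeasure (chart_vol f (atlas_list ! k)) (A i \<inter> piece k)) =
        emeasure (chart_vol f (atlas_list ! k)) ((\<Union>i. A i) \<inter> piece k)" if k: "k < nch" for k
    proof -
      have "disjoint_family (\<lambda>i. A i \<inter> piece k)" using A(2) by (auto simp: disjoint_family_on_def)
      then show ?thesis
        using suminf_emeasure[of "\<lambda>i. A i \<inter> piece k" "chart_vol f (atlas_list ! k)"] A(1) piece_borel[OF k] by auto
    qed
    then show "(\<Sum>i. \<mu>0 (A i)) = \<mu>0 (\<Union>i. A i)"
      unfolding \<mu>0_def by (subst suminf_sum) auto
  qed
  have e: "emeasure \<mu> E = \<mu>0 E" if "E \<in> sets borel" for E
    unfolding \<mu>_def by (rule emeasure_measure_of_sigma[OF sa pos ca that])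
  have s: "sets \<mu> = sets borel" unfolding \<mu>_def by (rule sigma_algebra.sets_measure_of_eq[OF sa])
  have "emeasure \<mu> E = emeasure (chart_vol f c) E" if c: "c \<in> M" and E: "E \<in> sets borel" "E \<subseteq> cdom c" for c E
  proof -
    have "emeasure (chart_vol f (atlas_list ! k)) (E \<inter> piece k) = emeasure (chart_vol f c) (E \<inter> piece k)" if k: "k < nch" for k
      by (rule chart_vol_trans[OF f nth_atlas[OF k] c]) (use piece_sub[of k] piece_borel[OF k] E in auto)
    then show ?thesis using emeasure_pieces[of "chart_vol f c" E] E by (simp add: e \<mu>0_def)
  qed
  then show ?thesis using s is_vol_iff[OF f] by auto
qed

abbreviation vol_of :: "('a \<Rightarrow> 'b) \<Rightarrow> 'a measure" where
  "vol_of f \<equiv> vol M (pullback M N f g)"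

lemma is_vol_vol:
  assumes f: "f \<in> Imm M N"
  shows "is_vol f (vol_of f)"
proof -
  have "\<exists>!\<mu>. is_vol f \<mu>" using is_vol_exists[OF f] is_vol_unique[OF f] by blast
  from theI'[OF this] show ?thesis unfolding vol_def is_vol_def by simp
qed

lemma sets_vol: "f \<in> Imm M N \<Longrightarrow> sets (vol_of f) = sets borel"
  using is_vol_vol by (simp add: is_vol_def)

lemma space_vol: "f \<in> Imm M N \<Longrightarrow> space (vol_of f) = UNIV"
  using sets_eq_imp_space_eq[OF sets_vol] by simp

lemma emeasure_vol:
  "f \<in> Imm M N \<Longrightarrow> c \<in> M \<Longrightarrow> E \<in> sets borel \<Longrightarrow> E \<subseteq> cdom c \<Longrightarrow> emeasure (vol_of f) E = emeasure (chart_vol f c) E"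
  using is_vol_vol by (simp add: is_vol_iff)

text \<open>The pushforward is shown to satisfy \<open>is_vol f\<close>, by cutting the preimage
  into pieces and using \<open>chart_vol_diffeo\<close> on each; uniqueness does the rest. The
  localized volume thereby becomes a function on shapes.\<close>

lemma vol_Diff:
  assumes f: "f \<in> Imm M N" and \<phi>: "\<phi> \<in> Diff M"
  shows "vol_of f = distr (vol_of (f \<circ> \<phi>)) borel \<phi>"
proof (rule is_vol_unique[OF f is_vol_vol[OF f]])
  note f\<phi> = Imm_comp_Diff[OF M N f \<phi>]
  have bij: "bij \<phi>" and cont: "continuous_on UNIV \<phi>" using \<phi> by (auto simp: Diff_def smooth_map_def)
  have m: "\<phi> \<in> measurable (vol_of (f \<circ> \<phi>)) borel"
    using borel_measurable_continuous_onI[OF cont] by (simp add: measurable_cong_sets[OF sets_vol[OF f\<phi>] refl])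
  have "emeasure (distr (vol_of (f \<circ> \<phi>)) borel \<phi>) E = emeasure (chart_vol f c) E"
    if c: "c \<in> M" and E: "E \<in> sets borel" "E \<subseteq> cdom c" for c E
  proof -
    have vE: "\<phi> -` E \<in> sets borel"
      using measurable_sets[OF borel_measurable_continuous_onI[OF cont] E(1)] by simp
    have "emeasure (distr (vol_of (f \<circ> \<phi>)) borel \<phi>) E = emeasure (vol_of (f \<circ> \<phi>)) (\<phi> -` E)"
      using emeasure_distr[OF m E(1)] by (simp add: space_vol[OF f\<phi>])
    also have "\<dots> = (\<Sum>k<nch. emeasure (vol_of (f \<circ> \<phi>)) (\<phi> -` E \<inter> piece k))"
      by (rule emeasure_pieces[OF sets_vol[OF f\<phi>] vE])
    also have "\<dots> = (\<Sum>k<nch. emeasure (chart_vol f c) (\<phi> ` (\<phi> -` E \<inter> piece k)))"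
    proof (intro sum.cong refl)
      fix k assume "k \<in> {..<nch}"
      then have k: "k < nch" by simp
      have P: "\<phi> -` E \<inter> piece k \<in> sets borel" "\<phi> -` E \<inter> piece k \<subseteq> cdom (atlas_list ! k)"
        using vE piece_borel[OF k] piece_sub by auto
      show "emeasure (vol_of (f \<circ> \<phi>)) (\<phi> -` E \<inter> piece k) = emeasure (chart_vol f c) (\<phi> ` (\<phi> -` E \<inter> piece k))"
        unfolding emeasure_vol[OF f\<phi> nth_atlas[OF k] P]
        by (rule chart_vol_diffeo[OF f \<phi> nth_atlas[OF k] c P]) (use E in auto)
    qed
    also have "\<dots> = emeasure (chart_vol f c) (\<Union>k<nch. \<phi> ` (\<phi> -` E \<inter> piece k))"
    proof (rule sum_emeasure)
      show "(\<lambda>k. \<phi> ` (\<phi> -` E \<inter> piece k)) ` {..<nch} \<subseteq> sets (chart_vol f c)"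
        using vE piece_borel Diff_image_borel[OF \<phi>] by auto
      show "disjoint_family_on (\<lambda>k. \<phi> ` (\<phi> -` E \<inter> piece k)) {..<nch}"
        using piece_disjoint[of "\<phi> -` E"] bij unfolding disjoint_family_on_def
        by (simp add: bij_def image_Int[symmetric])
    qed simp
    also have "(\<Union>k<nch. \<phi> ` (\<phi> -` E \<inter> piece k)) = E"
    proof -
      have "(\<Union>k<nch. \<phi> ` (\<phi> -` E \<inter> piece k)) = \<phi> ` (\<phi> -` E \<inter> (\<Union>k<nch. piece k))" by auto
      then show ?thesis using bij by (simp add: piece_cover bij_def)
    qed
    finally show ?thesis .
  qed
  then show "is_vol f (distr (vol_of (f \<circ> \<phi>)) borel \<phi>)" unfolding is_vol_iff[OF f] by simp
qed

text \<open>The bridge from Lebesgue integrals over \<open>M\<close> to integrals over a box in the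
  model space, where differentiation under the integral and the divergence argument take
  place.\<close>

lemma integral_vol_chart:
  assumes f: "f \<in> Imm M N" and c: "c \<in> M" and B: "cbox a b \<subseteq> cmap c ` cdom c"
    and u: "u \<in> borel_measurable borel" "\<And>x. x \<notin> cinv c ` cbox a b \<Longrightarrow> u x = 0"
    and cont: "continuous_on (cbox a b) (\<lambda>z. u (cinv c z))"
  shows "(\<integral>x. u x \<partial>vol_of f) = integral (cbox a b) (\<lambda>z. u (cinv c z) * sqrt (det (GM f c z)))"
proof -
  have sf: "smooth_map M N f" using f by (simp add: Imm_def)
  note ch = manifold_chart[OF M c]
  define D where "D = cdom c"
  have D: "D \<in> sets borel" unfolding D_def using chart_props(1)[OF ch] by simp
  have u0: "u x = 0" if "x \<notin> D" for x
    using u(2)[of x] that B chart_props(7)[OF ch] by (auto simp: D_def)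
  \<comment> \<open>The two measures are known to agree only on Borel subsets of the chart domain.
    Since \<open>u\<close> vanishes elsewhere, it may be integrated against the restriction of
    either.\<close>
  have restr: "restrict_space (vol_of f) D = restrict_space (chart_vol f c) D"
  proof (rule measure_eqI)
    show s: "sets (restrict_space (vol_of f) D) = sets (restrict_space (chart_vol f c) D)"
      by (simp add: sets_restrict_space sets_vol[OF f])
    fix A assume "A \<in> sets (restrict_space (vol_of f) D)"
    then have A: "A \<in> sets borel" "A \<subseteq> D" using D by (auto simp: sets_restrict_space sets_vol[OF f])
    then show "emeasure (restrict_space (vol_of f) D) A = emeasure (restrict_space (chart_vol f c) D) A"
      using emeasure_vol[OF f c A(1)] D by (simp add: emeasure_restrict_space sets_vol[OF f] space_vol[OF f] D_def)
  qed
  have uD: "indicator D x *\<^sub>R u x = u x" "indicator D x * u x = u x" for x using u0 by (auto simp: indicator_def)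
  have "(\<integral>x. u x \<partial>vol_of f) = (\<integral>x. u x \<partial>restrict_space (vol_of f) D)"
    by (subst integral_restrict_space) (auto simp: uD D sets_vol[OF f] space_vol[OF f])
  also have "\<dots> = (\<integral>x. u x \<partial>chart_vol f c)"
    unfolding restr by (subst integral_restrict_space) (auto simp: uD D)
  also have "\<dots> = (\<integral>z. u (chart_inv c z) \<partial>density lborel (\<lambda>z. ennreal (dens f c z)))"
    unfolding chart_vol_def using measurable_chart_inv[OF ch] by (intro integral_distr u) auto
  also have "\<dots> = (\<integral>z. dens f c z *\<^sub>R u (chart_inv c z) \<partial>lborel)"
    using measurable_dens[OF sf c] dens_nonneg[OF f c] measurable_compose[OF measurable_chart_inv[OF ch] u(1)]
    by (intro integral_density) auto
  also have "\<dots> = (LINT z:cbox a b|lborel. u (cinv c z) * sqrt (det (GM f c z)))"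
    unfolding set_lebesgue_integral_def
  proof (intro Bochner_Integration.integral_cong refl)
    fix z
    have "z \<in> cbox a b" if z: "z \<in> cmap c ` cdom c" "cinv c z \<in> cinv c ` cbox a b"
    proof -
      obtain w where w: "w \<in> cbox a b" "cinv c z = cinv c w" using z(2) by blast
      then have "cmap c (cinv c w) = w" using chart_props(6)[OF ch subsetD[OF B w(1)]] by simp
      then have "w = z" using chart_props(6)[OF ch z(1)] unfolding w(2) by (rule trans[OF sym])
      then show ?thesis using w(1) by simp
    qed
    then have "u (cinv c z) = 0" if "z \<in> cmap c ` cdom c" "z \<notin> cbox a b"
      by (intro u(2)) (use that in blast)
    then show "dens f c z *\<^sub>R u (chart_inv c z) = indicator (cbox a b) z *\<^sub>R (u (cinv c z) * sqrt (det (GM f c z)))"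
      using B by (auto simp: dens_def chart_inv_def indicator_def)
  qed
  also have "\<dots> = integral (cbox a b) (\<lambda>z. u (cinv c z) * sqrt (det (GM f c z)))"
  proof (rule set_borel_integral_eq_integral(2))
    show "set_integrable lborel (cbox a b) (\<lambda>z. u (cinv c z) * sqrt (det (GM f c z)))"
      unfolding set_integrable_def
      by (intro borel_integrable_compact continuous_on_mult cont continuous_on_subset[OF continuous_sqrt_det[OF sf c] B]) auto
  qed
  finally show ?thesis .
qed

lemma chart_box:
  shows "\<exists>a b. x \<in> cinv (chart_at M x) ` box a b \<and> cbox a b \<subseteq> cmap (chart_at M x) ` cdom (chart_at M x)"
proof -
  note c = chart_at_props[OF M, of x]
  note ch = manifold_chart[OF M c(1)]
  obtain a b where "cmap (chart_at M x) x \<in> box a b" "cbox a b \<subseteq> cmap (chart_at M x) ` cdom (chart_at M x)"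
    using open_contains_cbox[OF chart_props(2)[OF ch]] c(2) by (metis image_eqI)
  then show ?thesis using chart_props(5)[OF ch c(2)] by (metis image_eqI)
qed

lemma open_cinv_image:
  assumes "c \<in> M" "open W" "W \<subseteq> cmap c ` cdom c"
  shows "open (cinv c ` W)"
proof -
  note ch = manifold_chart[OF M assms(1)]
  have "cinv c ` W = cmap c -` W \<inter> cdom c"
    using assms(3) chart_props(5,6,7)[OF ch] by (auto simp: image_iff subset_iff) metis+
  then show ?thesis using continuous_open_preimage[OF chart_props(3,1)[OF ch] assms(2)] by (simp add: Int_commute)
qed

text \<open>The density is continuous, hence bounded on a closed box in a chart, so every point has
  a neighbourhood of finite volume; finitely many of them cover \<open>M\<close>. Continuous
  functions are therefore integrable.\<close>

lemma finite_vol: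
  assumes f: "f \<in> Imm M N"
  shows "finite_measure (vol_of f)"
proof -
  have sf: "smooth_map M N f" using f by (simp add: Imm_def)
  have "\<exists>V. open V \<and> x \<in> V \<and> emeasure (vol_of f) V < \<infinity>" for x
  proof -
    define c where "c = chart_at M x"
    note c = chart_at_props[OF M, of x, folded c_def]
    note ch = manifold_chart[OF M c(1)]
    obtain a b where ab: "x \<in> cinv c ` box a b" "cbox a b \<subseteq> cmap c ` cdom c" using chart_box c_def by metis
    have sub: "box a b \<subseteq> cmap c ` cdom c" using ab box_subset_cbox by blast
    define V where "V = cinv c ` box a b"
    have V: "open V" unfolding V_def by (rule open_cinv_image[OF c(1) open_box sub])
    have VD: "V \<subseteq> cdom c" unfolding V_def using sub chart_props(7)[OF ch] by auto
    have cV: "cmap c ` V = box a b" unfolding V_def using sub chart_props(6)[OF ch] by (force simp: image_iff)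
    have "emeasure (vol_of f) V = (\<integral>\<^sup>+z\<in>box a b. ennreal (sqrt (det (GM f c z))) \<partial>lborel)"
      using emeasure_vol[OF f c(1) borel_open[OF V] VD] emeasure_chart_vol[OF f c(1) borel_open[OF V] VD] by (simp add: cV)
    also have "\<dots> \<le> (\<integral>\<^sup>+z. ennreal (indicator (cbox a b) z *\<^sub>R sqrt (det (GM f c z))) \<partial>lborel)"
      by (intro nn_integral_mono) (use box_subset_cbox in \<open>auto simp: indicator_def\<close>)
    also have "\<dots> < \<infinity>"
    proof -
      have "integrable lborel (\<lambda>z. indicator (cbox a b) z *\<^sub>R sqrt (det (GM f c z)))"
        by (intro borel_integrable_compact continuous_on_subset[OF continuous_sqrt_det[OF sf c(1)] ab(2)]) auto
      then show ?thesis unfolding integrable_iff_bounded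
        by (rule order.strict_trans1[OF nn_integral_mono, rotated, OF conjunct2]) (auto intro: ennreal_leI)
    qed
    finally show ?thesis using V ab(1) by (auto simp: V_def)
  qed
  then obtain V where V: "\<And>x. open (V x)" "\<And>x. x \<in> V x" "\<And>x. emeasure (vol_of f) (V x) < \<infinity>" by metis
  obtain D where D: "D \<subseteq> range V" "finite D" "UNIV \<subseteq> \<Union>D"
    by (rule compactE[OF compact, of "range V"]) (use V in auto)
  have Dset: "D \<subseteq> sets (vol_of f)" using D(1) V(1) by (auto simp: sets_vol[OF f])
  have "emeasure (vol_of f) UNIV \<le> (\<Sum>B\<in>D. emeasure (vol_of f) B)"
    using emeasure_subadditive_finite[OF D(2), of "\<lambda>B. B" "vol_of f"] D(3) Dset by (simp add: top.extremum_unique)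
  also have "\<dots> < \<infinity>" using D V(3) by (auto simp: ennreal_sum_less_top)
  finally show ?thesis using space_vol[OF f] by (intro finite_measureI) auto
qed

lemma integrable_vol:
  fixes u :: "'a \<Rightarrow> real"
  assumes f: "f \<in> Imm M N" and u: "continuous_on UNIV u"
  shows "integrable (vol_of f) u"
proof -
  interpret finite_measure "vol_of f" by (rule finite_vol[OF f])
  have "bounded (range u)" using compact_imp_bounded[OF compact_continuous_image[OF u compact]] .
  then obtain B where B: "\<And>x. norm (u x) \<le> B" by (auto simp: bounded_iff)
  have "u \<in> borel_measurable (vol_of f)"
    using borel_measurable_continuous_onI[OF u] by (simp add: measurable_cong_sets[OF sets_vol[OF f] refl])
  then show ?thesis using B by (intro integrable_const_bound[of u B]) auto
qed

end

section \<open>Bump functions and partitions of unity\<close>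

text \<open>The squared positive part is C^1 across 0, and one derivative of the test function is
  all that the first variation takes. The derivative is twice the unsquared positive part, which is
  the origin of the estimate of d\<phi> by \<psi>.\<close>

lemma has_real_derivative_pos_part_sq:
  "((\<lambda>s::real. (max 0 s)\<^sup>2) has_real_derivative 2 * max 0 s) (at s)"
proof (cases "s = 0")
  case True
  have "((\<lambda>h::real. ((max 0 (0 + h))\<^sup>2 - (max 0 0)\<^sup>2) / h) \<longlongrightarrow> 0) (at 0)"
  proof (rule Lim_null_comparison)
    have "norm (((max 0 (0 + h))\<^sup>2 - (max 0 0)\<^sup>2) / h) \<le> \<bar>h\<bar>" for h :: real
      by (cases "h > 0") (auto simp: power2_eq_square max_def)
    then show "\<forall>\<^sub>F h in at (0::real). norm (((max 0 (0 + h))\<^sup>2 - (max 0 0)\<^sup>2) / h) \<le> \<bar>h\<bar>" by simp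
    show "((\<lambda>h::real. \<bar>h\<bar>) \<longlongrightarrow> 0) (at 0)" by (intro tendsto_eq_intros) auto
  qed
  then show ?thesis using True by (simp add: DERIV_def)
next
  case False
  show ?thesis
  proof (cases "s > 0")
    case True
    have "((\<lambda>s::real. s\<^sup>2) has_real_derivative 2 * max 0 s) (at s)"
      using True by (auto intro!: derivative_eq_intros)
    then show ?thesis
      by (rule has_field_derivative_transform_within_open[of _ _ _ "{0<..}"]) (use True in auto)
  next
    case False
    with \<open>s \<noteq> 0\<close> have "s < 0" by simp
    have "((\<lambda>s::real. 0) has_real_derivative 2 * max 0 s) (at s)"
      using \<open>s < 0\<close> by (auto intro!: derivative_eq_intros)
    then show ?thesis
      by (rule has_field_derivative_transform_within_open[of _ _ _ "{..<0}"]) (use \<open>s < 0\<close> in auto)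
  qed
qed

definition bump :: "'a::real_inner \<Rightarrow> real \<Rightarrow> 'a \<Rightarrow> real" where
  "bump z0 r z = (max 0 (r\<^sup>2 - (z - z0) \<bullet> (z - z0)))\<^sup>2"

lemma has_derivative_bump:
  "(bump z0 r has_derivative (\<lambda>v. - (4 * max 0 (r\<^sup>2 - (z - z0) \<bullet> (z - z0)) * ((z - z0) \<bullet> v)))) (at z)"
proof -
  have "((\<lambda>z. r\<^sup>2 - (z - z0) \<bullet> (z - z0)) has_derivative (\<lambda>v. - (2 * ((z - z0) \<bullet> v)))) (at z)"
    by (auto intro!: derivative_eq_intros simp: inner_commute)
  from diff_chain_at[OF this has_real_derivative_pos_part_sq[unfolded has_field_derivative_def]]
  show ?thesis unfolding bump_def o_def by (simp add: mult_ac)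
qed

lemma Ck_on_bump:
  fixes z0 :: "'a::euclidean_space"
  shows "Ck_on (Suc 0) UNIV (bump z0 r)"
  by (rule Ck_on_SucI[OF has_derivative_bump]) (auto intro!: continuous_intros)

definition C1_fun :: "('a, 'i::finite) atlas \<Rightarrow> ('a \<Rightarrow> real) \<Rightarrow> bool" where
  "C1_fun M \<zeta> \<longleftrightarrow> (\<forall>c\<in>M. Ck_on (Suc 0) (cmap c ` cdom c) (\<lambda>z. \<zeta> (cinv c z)))"

lemma bump_outside: "r \<ge> 0 \<Longrightarrow> z \<notin> cball z0 r \<Longrightarrow> bump z0 r z = 0"
proof -
  assume r: "r \<ge> 0" and "z \<notin> cball z0 r"
  then have "r < norm (z - z0)" by (simp add: dist_norm norm_minus_commute)
  then have "r\<^sup>2 \<le> (norm (z - z0))\<^sup>2" using r by (intro power_mono) auto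
  then show ?thesis by (simp add: bump_def power2_norm_eq_inner)
qed

lemma bump_center: "r > 0 \<Longrightarrow> bump z0 r z0 > 0"
  by (simp add: bump_def)

lemma bump_nonneg: "bump z0 r z \<ge> 0"
  by (simp add: bump_def)

definition chart_bump :: "('a, 'i::finite) chart \<Rightarrow> real^'i \<Rightarrow> real \<Rightarrow> 'a \<Rightarrow> real" where
  "chart_bump c z0 r x = (if x \<in> cdom c then bump z0 r (cmap c x) else 0)"

lemma chart_bump_support:
  assumes "is_chart c" "r > 0" "x \<notin> cinv c ` cball z0 r"
  shows "chart_bump c z0 r x = 0"
proof (cases "x \<in> cdom c")
  case True
  then have "cmap c x \<notin> cball z0 r" using chart_props(5)[OF assms(1) True] assms(3) by (metis image_eqI)
  from bump_outside[OF less_imp_le[OF assms(2)] this] show ?thesis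
    unfolding chart_bump_def by (simp del: mem_cball)
qed (simp add: chart_bump_def)

lemma compact_chart_ball:
  assumes "is_chart c" "cball z0 r \<subseteq> cmap c ` cdom c"
  shows "compact (cinv c ` cball z0 r)"
  by (intro compact_continuous_image continuous_on_subset[OF chart_props(4)[OF assms(1)] assms(2)] compact_cball)

text \<open>The support \<open>K\<close> is compact, hence closed because \<open>M\<close> is
  Hausdorff. A point outside the chart domain thus has a neighbourhood that misses \<open>K\<close>,
  and there the extension by zero is constant.\<close>

lemma C1_fun_chart_bump:
  fixes M :: "('a::{t2_space,second_countable_topology}, 'i::finite) atlas"
  assumes M: "smooth_manifold M" and c: "c \<in> M" and r: "r > 0" "cball z0 r \<subseteq> cmap c ` cdom c"
  shows "C1_fun M (chart_bump c z0 r)"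
  unfolding C1_fun_def
proof (intro ballI Ck_on_local)
  fix e z assume e: "e \<in> M" and "z \<in> cmap e ` cdom e"
  then obtain x where x: "x \<in> cdom e" "z = cmap e x" by blast
  note ch = manifold_chart[OF M c] and che = manifold_chart[OF M e]
  define K where "K = cinv c ` cball z0 r"
  have K: "closed K" unfolding K_def by (intro compact_imp_closed compact_chart_ball ch r)
  show "\<exists>U. open U \<and> z \<in> U \<and> Ck_on (Suc 0) U (\<lambda>z. chart_bump c z0 r (cinv e z))"
  proof (cases "x \<in> cdom c")
    case True
    define U where "U = cmap e ` (cdom e \<inter> id -` cdom c)"
    have U: "open U" unfolding U_def using smooth_map_id[OF M] by (intro open_rep_domain che ch) (simp add: smooth_map_def)
    have "Ck_on (Suc 0) U (\<lambda>z. bump z0 r (local_rep e c id z))"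
      by (rule Ck_on_compose[OF U Ck_on_bump]) (simp_all only: U_def Ck_on_local_rep[OF M M smooth_map_id[OF M] e c] subset_UNIV)
    then have "Ck_on (Suc 0) U (\<lambda>z. chart_bump c z0 r (cinv e z))"
      by (rule Ck_on_cong[OF U, rotated]) (auto simp: U_def chart_bump_def local_rep_def chart_props(5)[OF che])
    then show ?thesis using U x True by (intro exI[of _ U]) (auto simp: U_def)
  next
    case False
    then have xK: "x \<notin> K" using r chart_props(7)[OF ch] by (auto simp: K_def)
    define U where "U = cmap e ` (cdom e \<inter> - K)"
    have U: "open U" unfolding U_def using K by (intro open_chart_image che) auto
    have "Ck_on (Suc 0) U (\<lambda>z. chart_bump c z0 r (cinv e z))"
    proof (rule Ck_on_cong[OF U _ Ck_on_const[OF U]])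
      show "0 = chart_bump c z0 r (cinv e z)" if "z \<in> U" for z
        using that chart_bump_support[OF ch r(1), of "cinv e z" z0]
        by (auto simp: U_def chart_props(5)[OF che] K_def)
    qed
    then show ?thesis using U x xK by (intro exI[of _ U]) (auto simp: U_def)
  qed
qed

lemma C1_fun_continuous:
  assumes M: "smooth_manifold M" and \<zeta>: "C1_fun M \<zeta>"
  shows "continuous_on UNIV \<zeta>"
proof (rule continuous_at_imp_continuous_on, rule ballI)
  fix x
  define c where "c = chart_at M x"
  note c = chart_at_props[OF M, of x, folded c_def]
  note ch = manifold_chart[OF M c(1)]
  have "continuous_on (cmap c ` cdom c) (\<lambda>z. \<zeta> (cinv c z))"
    using \<zeta> c(1) Ck_on_imp_continuous unfolding C1_fun_def by blast
  then have "continuous_on (cdom c) (\<lambda>x. \<zeta> (cinv c (cmap c x)))"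
    by (rule continuous_on_compose2[OF _ chart_props(3)[OF ch]]) auto
  then have "continuous_on (cdom c) \<zeta>"
    by (rule continuous_on_eq) (simp add: chart_props(5)[OF ch])
  then show "isCont \<zeta> x" using c(2) chart_props(1)[OF ch] continuous_on_eq_continuous_at by blast
qed

lemma C1_fun_divide_sum:
  assumes M: "smooth_manifold M" and "\<And>k. k \<in> I \<Longrightarrow> C1_fun M (b k)" "\<And>x. (\<Sum>k\<in>I. b k x) \<noteq> 0" "j \<in> I"
  shows "C1_fun M (\<lambda>x. b j x / (\<Sum>k\<in>I. b k x))"
  unfolding C1_fun_def
proof
  fix c assume c: "c \<in> M"
  have o: "open (cmap c ` cdom c)" by (rule chart_props(2)[OF manifold_chart[OF M c]])
  show "Ck_on (Suc 0) (cmap c ` cdom c) (\<lambda>z. b j (cinv c z) / (\<Sum>k\<in>I. b k (cinv c z)))"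
    by (intro Ck_on_divide Ck_on_sum o assms(3)) (use assms(2,4) c in \<open>auto simp: C1_fun_def simp del: Ck_on.simps\<close>)
qed

definition dfun :: "('a, 'i::finite) atlas \<Rightarrow> ('a \<Rightarrow> real) \<Rightarrow> 'a \<Rightarrow> ('a, 'i) tangent \<Rightarrow> real" where
  "dfun M \<zeta> x X = frechet_derivative (\<lambda>z. \<zeta> (cinv (chart_at M x) z)) (at (cmap (chart_at M x) x)) (X (chart_at M x))"

lemma C1_fun_has_derivative:
  assumes "C1_fun M \<zeta>" "c \<in> M" "x \<in> cdom c"
  shows "((\<lambda>z. \<zeta> (cinv c z)) has_derivative frechet_derivative (\<lambda>z. \<zeta> (cinv c z)) (at (cmap c x))) (at (cmap c x))"
  using assms Ck_on_SucD[of 0 "cmap c ` cdom c" "\<lambda>z. \<zeta> (cinv c z)" "cmap c x"] unfolding C1_fun_def by blast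

lemma dfun_chart:
  assumes M: "smooth_manifold M" and \<zeta>: "C1_fun M \<zeta>" and c: "c \<in> M" "x \<in> cdom c" and X: "X \<in> tangent_space M x"
  shows "dfun M \<zeta> x X = frechet_derivative (\<lambda>z. \<zeta> (cinv c z)) (at (cmap c x)) (X c)"
proof -
  define e where "e = chart_at M x"
  note e = chart_at_props[OF M, of x, folded e_def]
  note ch = manifold_chart[OF M c(1)] and che = manifold_chart[OF M e(1)]
  note idM = smooth_map_id[OF M]
  have i: "id x \<in> cdom c" using c by simp
  have \<theta>: "local_rep e c id (cmap e x) = cmap c x"
    using chart_props(5)[OF che e(2)] by (simp add: local_rep_def)
  have "((\<lambda>z. \<zeta> (cinv c z)) \<circ> local_rep e c id has_derivative
      frechet_derivative (\<lambda>z. \<zeta> (cinv c z)) (at (cmap c x)) \<circ> chart_deriv e c id x) (at (cmap e x))"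
    by (rule diff_chain_at[OF has_derivative_local_rep[OF M M idM e(1) c(1) e(2) i]])
      (simp only: \<theta> C1_fun_has_derivative[OF \<zeta> c])
  then have "((\<lambda>z. \<zeta> (cinv e z)) has_derivative
      frechet_derivative (\<lambda>z. \<zeta> (cinv c z)) (at (cmap c x)) \<circ> chart_deriv e c id x) (at (cmap e x))"
  proof (rule has_derivative_transform_within_open)
    show "open (cmap e ` (cdom e \<inter> cdom c))" by (rule open_chart_image[OF che chart_props(1)[OF ch]])
  qed (use e c chart_props(5)[OF che] chart_props(5)[OF ch] in \<open>auto simp: local_rep_def\<close>)
  from frechet_derivative_at[OF this]
  have "dfun M \<zeta> x X = frechet_derivative (\<lambda>z. \<zeta> (cinv c z)) (at (cmap c x)) (chart_deriv e c id x (X e))"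
    unfolding dfun_def e_def[symmetric] by (simp add: fun_eq_iff)
  then show ?thesis using tangent_spaceD(2)[OF X e(1) c(1) e(2) c(2)] by simp
qed

lemma dfun_outside:
  assumes M: "smooth_manifold M" and K: "closed K" "x \<notin> K" and u: "\<And>y. y \<notin> K \<Longrightarrow> u y = 0"
  shows "dfun M u x X = 0"
proof -
  define c where "c = chart_at M x"
  note c = chart_at_props[OF M, of x, folded c_def]
  note chc = manifold_chart[OF M c(1)]
  have "open (cmap c ` (cdom c \<inter> - K))" using K by (intro open_chart_image[OF chc]) auto
  moreover have "cmap c x \<in> cmap c ` (cdom c \<inter> - K)" using c K by auto
  ultimately have "((\<lambda>z. u (cinv c z)) has_derivative (\<lambda>v. 0)) (at (cmap c x))"
    by (rule has_derivative_transform_within_open[OF has_derivative_const])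
      (use u in \<open>auto simp: chart_props(5)[OF chc]\<close>)
  then show ?thesis unfolding dfun_def c_def[symmetric] by (simp add: frechet_derivative_at[symmetric])
qed

section \<open>Derivatives of compactly supported functions integrate to zero\<close>

lemma integral_zero_outside:
  fixes f :: "'a::euclidean_space \<Rightarrow> real"
  assumes "\<And>x. x \<notin> S \<Longrightarrow> f x = 0"
  shows "integral S f = integral UNIV f"
proof -
  have "integral S f = integral UNIV (\<lambda>x. if x \<in> S then f x else 0)" by (simp add: integral_restrict_UNIV)
  also have "(\<lambda>x. if x \<in> S then f x else 0) = f" using assms by auto
  finally show ?thesis .
qed

text \<open>The integral of a directional derivative of \<open>w\<close> is the derivative of the constant function
  \<open>s \<mapsto> \<integral> w (z + s v) dz\<close>.\<close>

lemma integral_directional_derivative: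
  fixes w :: "real^'m::finite \<Rightarrow> real"
  assumes w: "Ck_on (Suc 0) UNIV w" and S: "compact S" "S \<subseteq> cbox a b" and w0: "\<And>z. z \<notin> S \<Longrightarrow> w z = 0"
  shows "integral (cbox a b) (\<lambda>z. frechet_derivative w (at z) v) = 0"
proof -
  have wd: "(w has_derivative frechet_derivative w (at z)) (at z)" for z by (rule Ck_on_SucD[OF w UNIV_I])
  have wc: "continuous_on UNIV w" by (rule Ck_on_imp_continuous[OF w])
  have dc: "continuous_on UNIV (\<lambda>z. frechet_derivative w (at z) v)" using w by simp
  have d0: "frechet_derivative w (at z) v = 0" if z: "z \<notin> S" for z
  proof -
    have "((\<lambda>z. 0) has_derivative (\<lambda>v. 0)) (at z)" by simp
    then have "(w has_derivative (\<lambda>v. 0)) (at z)"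
      by (rule has_derivative_transform_within_open[of _ _ _ _ "- S"]) (use z w0 compact_imp_closed[OF S(1)] in auto)
    then show ?thesis by (simp add: frechet_derivative_at[symmetric])
  qed
  obtain R where R: "\<And>z. z \<in> S \<Longrightarrow> norm z \<le> R" using compact_imp_bounded[OF S(1)] by (auto simp: bounded_iff)
  \<comment> \<open>This box has room for the support of \<open>w\<close> and for all its translates
    by \<open>s *\<^sub>R v\<close> with |s| < 1, so integrating over it is integrating over the
    whole space, which translations leave unchanged. The given box is only known to contain
    \<open>S\<close>; since the derivative vanishes off \<open>S\<close>, the two boxes can be
    exchanged at the end.\<close>
  obtain A where A: "cball 0 (R + norm v) \<subseteq> cbox (- A) (A :: real^'m)"
    using bounded_subset_cbox_symmetric[OF bounded_cball] by blast
  have zero: "w (s *\<^sub>R v + z) = 0" if "s \<in> {-1<..<1}" "z \<notin> cbox (- A) A" for s z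
  proof (rule w0, rule notI)
    assume "s *\<^sub>R v + z \<in> S"
    then have "norm (s *\<^sub>R v + z) \<le> R" by (rule R)
    moreover have "norm (s *\<^sub>R v) \<le> norm v" using that(1) mult_right_mono[of "\<bar>s\<bar>" 1 "norm v"] by auto
    moreover have "norm z \<le> norm (s *\<^sub>R v + z) + norm (s *\<^sub>R v)"
      using norm_triangle_ineq4[of "s *\<^sub>R v + z" "s *\<^sub>R v"] by simp
    ultimately have "norm z \<le> R + norm v" by linarith
    then have "z \<in> cball 0 (R + norm v)" by simp
    then show False using subsetD[OF A] that(2) by blast
  qed
  define \<Psi> where "\<Psi> = (\<lambda>s. integral (cbox (- A) A) (\<lambda>z. w (s *\<^sub>R v + z)))"
  have \<Psi>: "\<Psi> s = (\<integral>z. w z \<partial>lborel)" if s: "s \<in> {-1<..<1}" for s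
  proof -
    have "continuous_on (cbox (- A) A) (\<lambda>z. w (s *\<^sub>R v + z))"
      by (intro continuous_on_compose2[OF wc] continuous_intros) auto
    then have i: "set_integrable lborel (cbox (- A) A) (\<lambda>z. w (s *\<^sub>R v + z))"
      unfolding set_integrable_def by (intro borel_integrable_compact) auto
    have "\<Psi> s = (LINT z:cbox (- A) A|lborel. w (s *\<^sub>R v + z))"
      unfolding \<Psi>_def by (rule set_borel_integral_eq_integral(2)[OF i, symmetric])
    also have "\<dots> = (\<integral>z. w (s *\<^sub>R v + z) \<partial>lborel)"
      unfolding set_lebesgue_integral_def
      by (intro Bochner_Integration.integral_cong refl) (use zero[OF s] in \<open>auto simp: indicator_def\<close>)
    also have "\<dots> = (\<integral>z. w z \<partial>distr lborel borel ((+) (s *\<^sub>R v)))"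
      using borel_measurable_continuous_onI[OF wc] by (subst integral_distr) auto
    finally show ?thesis by (simp add: lborel_distr_plus)
  qed
  have "(\<Psi> has_real_derivative integral (cbox (- A) A) (\<lambda>z. frechet_derivative w (at (0 *\<^sub>R v + z)) v)) (at 0 within {-1<..<1})"
    unfolding \<Psi>_def
  proof (rule leibniz_rule_field_derivative)
    show "((\<lambda>s. w (s *\<^sub>R v + z)) has_field_derivative frechet_derivative w (at (s *\<^sub>R v + z)) v) (at s within {-1<..<1})" for s z
    proof -
      have "((\<lambda>s. s *\<^sub>R v + z) has_derivative (\<lambda>r. r *\<^sub>R v)) (at s)" by (auto intro!: derivative_eq_intros)
      from diff_chain_at[OF this wd]
      have "((\<lambda>s. w (s *\<^sub>R v + z)) has_field_derivative frechet_derivative w (at (s *\<^sub>R v + z)) v) (at s)"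
        using linear_cmul[OF has_derivative_linear[OF wd[of "s *\<^sub>R v + z"]]]
        by (auto simp: has_field_derivative_def o_def mult.commute elim!: has_derivative_eq_rhs)
      then show ?thesis by (rule has_field_derivative_at_within)
    qed
    show "(\<lambda>z. w (s *\<^sub>R v + z)) integrable_on cbox (- A) A" for s
      by (intro integrable_continuous continuous_on_compose2[OF wc] continuous_intros) auto
    show "continuous_on ({-1<..<1} \<times> cbox (- A) A) (\<lambda>(s, z). frechet_derivative w (at (s *\<^sub>R v + z)) v)"
      unfolding split_beta by (intro continuous_on_compose2[OF dc] continuous_intros) auto
  qed auto
  then have "(\<Psi> has_real_derivative integral (cbox (- A) A) (\<lambda>z. frechet_derivative w (at z) v)) (at 0)"
    using at_within_open[of "0::real" "{-1<..<1}"] by simp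
  moreover have "(\<Psi> has_real_derivative 0) (at 0)"
    by (rule has_field_derivative_transform_within_open[OF DERIV_const[of "\<integral>z. w z \<partial>lborel"], where S = "{-1<..<1}"]) (use \<Psi> in auto)
  ultimately have "integral (cbox (- A) A) (\<lambda>z. frechet_derivative w (at z) v) = 0"
    by (rule DERIV_unique)
  moreover have "integral (cbox (- A) A) (\<lambda>z. frechet_derivative w (at z) v) = integral UNIV (\<lambda>z. frechet_derivative w (at z) v)"
  proof (rule integral_zero_outside, rule d0, rule notI)
    fix z assume "z \<notin> cbox (- A) A" "z \<in> S"
    have "norm z \<le> R + norm v" using R[OF \<open>z \<in> S\<close>] norm_ge_zero[of v] by linarith
    then have "z \<in> cball 0 (R + norm v)" by simp
    then show False using subsetD[OF A] \<open>z \<notin> cbox (- A) A\<close> by blast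
  qed
  moreover have "integral (cbox a b) (\<lambda>z. frechet_derivative w (at z) v) = integral UNIV (\<lambda>z. frechet_derivative w (at z) v)"
    by (rule integral_zero_outside, rule d0) (use S in auto)
  ultimately show ?thesis by simp
qed

text \<open>A function in a chart is defined on \<open>V\<close> only. As \<open>S\<close> is
  compact and contained in \<open>V\<close>, its extension by zero is C^1 on the whole
  space.\<close>

lemma integral_directional_derivative_open:
  fixes w :: "real^'m::finite \<Rightarrow> real"
  assumes V: "open V" "Ck_on (Suc 0) V w" and S: "compact S" "S \<subseteq> cbox a b" "cbox a b \<subseteq> V"
    and w0: "\<And>z. z \<in> V \<Longrightarrow> z \<notin> S \<Longrightarrow> w z = 0"
  shows "integral (cbox a b) (\<lambda>z. frechet_derivative w (at z) v) = 0"
proof -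
  define w' where "w' = (\<lambda>z. if z \<in> S then w z else 0)"
  have SV: "S \<subseteq> V" using S by auto
  have eq: "w z = w' z" if "z \<in> V" for z using that w0 by (auto simp: w'_def)
  have "Ck_on (Suc 0) UNIV w'"
  proof (rule Ck_on_local)
    fix z :: "real^'m"
    show "\<exists>U. open U \<and> z \<in> U \<and> Ck_on (Suc 0) U w'"
    proof (cases "z \<in> S")
      case True
      then show ?thesis using Ck_on_cong[OF V(1) eq V(2)] V(1) SV by blast
    next
      case False
      have o: "open (- S)" using compact_imp_closed[OF S(1)] by auto
      have "Ck_on (Suc 0) (- S) w'"
        by (rule Ck_on_cong[OF o _ Ck_on_const[OF o, of _ 0]]) (simp add: w'_def)
      then show ?thesis using o False by blast
    qed
  qed
  then have "integral (cbox a b) (\<lambda>z. frechet_derivative w' (at z) v) = 0"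
    by (rule integral_directional_derivative[OF _ S(1,2)]) (simp add: w'_def)
  moreover have "frechet_derivative w' (at z) = frechet_derivative w (at z)" if "z \<in> cbox a b" for z
  proof -
    have "z \<in> V" using that S by auto
    from frechet_derivative_at[OF has_derivative_transform_within_open[OF Ck_on_SucD[OF V(2) this] V(1) this eq]]
    show ?thesis by simp
  qed
  ultimately show ?thesis by (simp cong: integral_cong)
qed

section \<open>Partition of unity\<close>

context riem_compact
begin

text \<open>Finitely many chart bumps with positive sum, divided by that sum. Each function is
  supported in a closed ball inside a box inside a chart image: the box serves as domain of
  integration, and the ball is the compact support required by the divergence argument.\<close>

lemma partition_of_unity:
  "\<exists>(I :: 'a set) a b z0 r \<zeta>. finite I \<and>
     (\<forall>k\<in>I. cbox (a k) (b k) \<subseteq> cmap (chart_at M k) ` cdom (chart_at M k) \<and>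
       cball (z0 k) (r k) \<subseteq> cbox (a k) (b k) \<and> C1_fun M (\<zeta> k) \<and>
       (\<forall>x. x \<notin> cinv (chart_at M k) ` cball (z0 k) (r k) \<longrightarrow> \<zeta> k x = 0)) \<and>
     (\<forall>x. (\<Sum>k\<in>I. \<zeta> k x) = (1::real))"
proof -
  have ex: "\<exists>a b r. cbox a b \<subseteq> cmap (chart_at M x) ` cdom (chart_at M x) \<and> 0 < r \<and> cball (cmap (chart_at M x) x) r \<subseteq> cbox a b" for x
  proof -
    note c = chart_at_props[OF M, of x]
    note ch = manifold_chart[OF M c(1)]
    have "cmap (chart_at M x) x \<in> cmap (chart_at M x) ` cdom (chart_at M x)" using c(2) by blast
    then obtain a b where ab: "cmap (chart_at M x) x \<in> box a b" "cbox a b \<subseteq> cmap (chart_at M x) ` cdom (chart_at M x)"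
      using open_contains_cbox[OF chart_props(2)[OF ch]] by metis
    obtain r where "r > 0" "cball (cmap (chart_at M x) x) r \<subseteq> box a b"
      using open_contains_cball[of "box a b"] ab(1) open_box by blast
    then show ?thesis using ab(2) box_subset_cbox by blast
  qed
  then obtain a b r where abr: "\<And>x. cbox (a x) (b x) \<subseteq> cmap (chart_at M x) ` cdom (chart_at M x)"
    "\<And>x. 0 < r x" "\<And>x. cball (cmap (chart_at M x) x) (r x) \<subseteq> cbox (a x) (b x)" by metis
  define \<beta> where "\<beta> = (\<lambda>k. chart_bump (chart_at M k) (cmap (chart_at M k) k) (r k))"
  have \<beta>: "C1_fun M (\<beta> k)" for k
    unfolding \<beta>_def by (intro C1_fun_chart_bump M chart_at_props(1) abr(2) order_trans[OF abr(3) abr(1)])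
  have supp: "\<beta> k x = 0" if "x \<notin> cinv (chart_at M k) ` cball (cmap (chart_at M k) k) (r k)" for k x
    unfolding \<beta>_def by (rule chart_bump_support[OF manifold_chart[OF M chart_at_props(1)[OF M]] abr(2) that])
  have pos: "\<beta> k k > 0" for k
    unfolding \<beta>_def chart_bump_def using chart_at_props(2)[OF M, of k] abr(2) by (simp add: bump_center)
  have nn: "\<beta> k x \<ge> 0" for k x unfolding \<beta>_def chart_bump_def by (simp add: bump_nonneg)
  have op: "open {x. \<beta> k x > 0}" for k
    using C1_fun_continuous[OF M \<beta>, of k] by (intro open_Collect_less) auto
  obtain D where D: "D \<subseteq> range (\<lambda>k. {x. \<beta> k x > 0})" "finite D" "UNIV \<subseteq> \<Union>D"
    by (rule compactE[OF compact, of "range (\<lambda>k. {x. \<beta> k x > 0})"]) (use op pos in auto)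
  obtain I where I: "finite I" "D = (\<lambda>k. {x. \<beta> k x > 0}) ` I"
    using finite_subset_image[OF D(2,1)] by blast
  have sum: "(\<Sum>k\<in>I. \<beta> k x) > 0" for x
  proof -
    have "x \<in> \<Union>((\<lambda>k. {x. \<beta> k x > 0}) ` I)" using subsetD[OF D(3) UNIV_I, of x] unfolding I(2) .
    then obtain k where k: "k \<in> I" "\<beta> k x > 0" by blast
    show ?thesis by (rule sum_pos2[of _ _ "\<lambda>k. \<beta> k x", OF I(1) k nn])
  qed
  define \<zeta> where "\<zeta> = (\<lambda>k x. \<beta> k x / (\<Sum>k\<in>I. \<beta> k x))"
  have C1: "C1_fun M (\<zeta> k)" if "k \<in> I" for k
    unfolding \<zeta>_def by (rule C1_fun_divide_sum[OF M \<beta> _ that]) (use sum in \<open>simp add: less_imp_neq[symmetric]\<close>)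
  have one: "(\<Sum>k\<in>I. \<zeta> k x) = 1" for x
    using sum[of x] unfolding \<zeta>_def sum_divide_distrib[symmetric] by simp
  have supp': "\<zeta> k x = 0" if "x \<notin> cinv (chart_at M k) ` cball (cmap (chart_at M k) k) (r k)" for k x
    using supp[OF that] by (simp add: \<zeta>_def)
  show ?thesis
    apply (rule exI[of _ I], rule exI[of _ a], rule exI[of _ b], rule exI[of _ "\<lambda>k. cmap (chart_at M k) k"],
        rule exI[of _ r], rule exI[of _ \<zeta>])
    apply (intro conjI ballI allI impI)
         apply (rule I(1) abr C1 one | assumption)+
    apply (rule supp', assumption)
    apply (rule one)
    done
qed

end

section \<open>First variation in coordinates\<close>

lemma has_derivative_vec:
  fixes f :: "'a::real_normed_vector \<Rightarrow> 'b::euclidean_space ^ 'n::finite"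
  assumes "\<And>i. ((\<lambda>x. f x $ i) has_derivative (\<lambda>v. f' v $ i)) (at x)"
  shows "(f has_derivative f') (at x)"
proof -
  have e: "g = (\<lambda>x. \<Sum>i\<in>UNIV. axis i (g x $ i))" for g :: "'c \<Rightarrow> 'b ^ 'n"
    by (auto simp: fun_eq_iff vec_eq_iff axis_def sum.delta)
  have "((\<lambda>x. \<Sum>i\<in>UNIV. axis i (f x $ i)) has_derivative (\<lambda>v. \<Sum>i\<in>UNIV. axis i (f' v $ i))) (at x)"
    by (intro has_derivative_sum bounded_linear.has_derivative[OF bounded_linear_axis] assms)
  then show ?thesis unfolding e[symmetric] .
qed

lemma ip_mat: "ip (A + B) u v = ip A u v + ip B u v" "ip (a *\<^sub>R A) u v = a * ip A u v" "ip 0 u v = 0"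
  by (simp_all add: ip_sum algebra_simps sum.distrib sum_distrib_left)

lemma ip_mat_sum: "ip (\<Sum>i\<in>I. A i) u v = (\<Sum>i\<in>I. ip (A i) u v)"
  by (induction I rule: infinite_finite_induct) (auto simp: ip_mat)

lemma Ck_on_matrix_vector:
  fixes A :: "'a::real_normed_vector \<Rightarrow> real^'n::finite^'m::finite"
  assumes "open S" "\<And>i j. Ck_on k S (\<lambda>x. A x $ i $ j)" "\<And>i. Ck_on k S (\<lambda>x. a x $ i)"
  shows "Ck_on k S (\<lambda>x. (A x *v a x) $ i)"
  unfolding matrix_vector_mult_def vec_lambda_beta by (intro Ck_on_sum Ck_on_mult assms)

lemma Ck_on_christoffel:
  fixes G :: "real^'n::finite \<Rightarrow> real^'n^'n"
  assumes V: "open V" and G: "\<And>k i j. Ck_on k V (\<lambda>y. G y $ i $ j)" and det: "\<And>y. y \<in> V \<Longrightarrow> det (G y) \<noteq> 0"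
  shows "Ck_on k V (\<lambda>y. christoffel G y l i j)"
  unfolding christoffel_def partial_def
  by (intro Ck_on_sum Ck_on_mult Ck_on_diff Ck_on_add Ck_on_const Ck_on_matrix_inv Ck_on_frechet V G det)

text \<open>A path of immersions in coordinates: \<open>h\<close> depends on time and place,
  \<open>G\<close> is the metric of the target, and \<open>nondeg\<close> says that the induced
  metric has nonzero determinant. No manifold is left, and the variation formula becomes an identity
  at a point \<open>p\<close>.\<close>

locale local_family =
  fixes h :: "real \<times> (real^'m::finite) \<Rightarrow> real^'n::finite" and U and G :: "real^'n \<Rightarrow> real^'n^'n" and V
  assumes U: "open U" and V: "open V" and hV: "h ` U \<subseteq> V"
    and h: "\<And>k. Ck_on k U h" and G: "\<And>k i j. Ck_on k V (\<lambda>y. G y $ i $ j)"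
    and pd: "\<And>y. y \<in> V \<Longrightarrow> sympd (G y)"
    and nondeg: "\<And>p. p \<in> U \<Longrightarrow> det (\<chi> i j. ip (G (h p)) (frechet_derivative h (at p) (0, axis i 1)) (frechet_derivative h (at p) (0, axis j 1))) \<noteq> 0"
begin

text \<open>In this order: differential in the space variables, velocity, induced metric, tangential
  velocity in coordinates, normal velocity, ambient Hessian, its metric trace, mean curvature
  vector, volume density.\<close>

definition T where "T p v = frechet_derivative h (at p) (0, v)"
definition vel where "vel p = frechet_derivative h (at p) (1, 0)"
definition gam where "gam p = (\<chi> i j. ip (G (h p)) (T p (axis i 1)) (T p (axis j 1)))"
definition Xf where "Xf p = tcomp (G (h p)) (T p) (gam p) (vel p)"
definition Wf where "Wf p = nrm (G (h p)) (T p) (gam p) (vel p)"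
definition hessf where "hessf p i j = D2 h p (0, axis i 1) (0, axis j 1) + chr G (h p) (T p (axis i 1)) (T p (axis j 1))"
definition Kf where "Kf p = (\<Sum>i\<in>UNIV. \<Sum>j\<in>UNIV. matrix_inv (gam p) $ i $ j *\<^sub>R hessf p i j)"
definition Hf where "Hf p = nrm (G (h p)) (T p) (gam p) (Kf p)"
definition Rf where "Rf p = sqrt (det (gam p))"

lemma hd: "p \<in> U \<Longrightarrow> (h has_derivative frechet_derivative h (at p)) (at p)"
  using Ck_on_SucD[OF h] .

lemma hpV: "p \<in> U \<Longrightarrow> h p \<in> V" using hV by blast

lemma linear_T: "p \<in> U \<Longrightarrow> linear (T p)"
proof -
  assume "p \<in> U"
  note L = has_derivative_linear[OF hd[OF this]]
  show ?thesis
  proof (rule linearI)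
    show "T p (u + v) = T p u + T p v" for u v
      using linear_add[OF L, of "(0, u)" "(0, v)"] by (simp add: T_def)
    show "T p (r *\<^sub>R v) = r *\<^sub>R T p v" for r v
      using linear_cmul[OF L, of r "(0, v)"] by (simp add: T_def)
  qed
qed

lemma det_gam: "p \<in> U \<Longrightarrow> det (gam p) \<noteq> 0"
  using nondeg by (simp add: gam_def T_def)

lemma ip_gam:
  assumes "p \<in> U"
  shows "ip (gam p) u v = ip (G (h p)) (T p u) (T p v)"
proof -
  have "ip (gam p) u v = (\<Sum>i\<in>UNIV. \<Sum>j\<in>UNIV. u $ i * ip (G (h p)) (T p (axis i 1)) (T p (axis j 1)) * v $ j)"
    by (subst ip_sum) (simp add: gam_def)
  also have "\<dots> = ip (G (h p)) (\<Sum>i\<in>UNIV. u $ i *\<^sub>R T p (axis i 1)) (\<Sum>j\<in>UNIV. v $ j *\<^sub>R T p (axis j 1))"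
    unfolding ip_sum_left ip_sum_right ip_scaleR_left ip_scaleR_right
    by (subst sum.swap) (simp add: sum_distrib_left mult_ac)
  finally show ?thesis by (simp only: linear_expand[OF linear_T[OF assms], symmetric])
qed

lemma sympd_gam:
  assumes p: "p \<in> U"
  shows "sympd (gam p)"
proof -
  note pdp = pd[OF hpV[OF p]]
  have "T p v \<noteq> 0" if v: "v \<noteq> 0" for v
  proof
    assume "T p v = 0"
    then have "ip (gam p) u v = 0" for u by (simp add: ip_gam[OF p] ip_bilinear)
    then have "gam p *v v = 0" by (metis ip_def inner_eq_zero_iff)
    then have "matrix_inv (gam p) *v (gam p *v v) = 0" by simp
    then show False using v matrix_inv_mult(2)[OF det_gam[OF p]] by (simp add: matrix_vector_mul_assoc)
  qed
  then show ?thesis using sympd_sym[OF pdp] sympd_pos[OF pdp] by (auto simp: sympd_def ip_gam[OF p])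
qed

lemma Ck_on_T: "Ck_on k U (\<lambda>p. T p v $ i)"
  unfolding T_def by (intro Ck_on_vec_nth U Ck_on_frechet h)

lemma Ck_on_vel: "Ck_on k U (\<lambda>p. vel p $ i)"
  unfolding vel_def by (intro Ck_on_vec_nth U Ck_on_frechet h)

lemma Ck_on_Gh: "Ck_on k U (\<lambda>p. G (h p) $ i $ j)"
  by (rule Ck_on_compose[OF U G h hV])

lemma Ck_on_gam: "Ck_on k U (\<lambda>p. gam p $ i $ j)"
  unfolding gam_def vec_lambda_beta by (intro Ck_on_ip U Ck_on_Gh Ck_on_T)

lemma Ck_on_Rf: "Ck_on k U Rf"
  unfolding Rf_def[abs_def] using sympd_det_pos[OF sympd_gam] by (intro Ck_on_sqrt Ck_on_det U Ck_on_gam)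

lemma Ck_on_tcomp:
  assumes "\<And>i. Ck_on k U (\<lambda>p. a p $ i)"
  shows "Ck_on k U (\<lambda>p. tcomp (G (h p)) (T p) (gam p) (a p) $ i)"
  unfolding tcomp_def
proof (intro Ck_on_matrix_vector U Ck_on_matrix_inv Ck_on_gam)
  show "det (gam p) \<noteq> 0" if "p \<in> U" for p by (rule det_gam[OF that])
  show "Ck_on k U (\<lambda>p. (\<chi> j. ip (G (h p)) (a p) (T p (axis j 1))) $ i)" for i
    unfolding vec_lambda_beta by (intro Ck_on_ip U Ck_on_Gh Ck_on_T assms)
qed

lemma Ck_on_nrm:
  assumes "\<And>i. Ck_on k U (\<lambda>p. a p $ i)"
  shows "Ck_on k U (\<lambda>p. nrm (G (h p)) (T p) (gam p) (a p) $ i)"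
proof (rule Ck_on_cong[OF U])
  show "Ck_on k U (\<lambda>p. a p $ i - (\<Sum>j\<in>UNIV. tcomp (G (h p)) (T p) (gam p) (a p) $ j * T p (axis j 1) $ i))"
    by (intro Ck_on_diff Ck_on_sum Ck_on_mult U assms Ck_on_tcomp Ck_on_T)
  show "a p $ i - (\<Sum>j\<in>UNIV. tcomp (G (h p)) (T p) (gam p) (a p) $ j * T p (axis j 1) $ i) =
      nrm (G (h p)) (T p) (gam p) (a p) $ i" if "p \<in> U" for p
    unfolding nrm_def by (subst (2) linear_expand[OF linear_T[OF that]]) simp
qed

lemma Ck_on_Xf: "Ck_on k U (\<lambda>p. Xf p $ i)" and Ck_on_Wf: "Ck_on k U (\<lambda>p. Wf p $ j)"
  unfolding Xf_def Wf_def by (intro Ck_on_tcomp Ck_on_nrm Ck_on_vel)+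

lemma Ck_on_Kf: "Ck_on k U (\<lambda>p. Kf p $ l)"
proof -
  have "Ck_on k U (\<lambda>p. chr G (h p) (T p u) (T p v) $ l)" for u v l
    unfolding chr_def vec_lambda_beta
    using sympd_det_pos[OF pd] by (intro Ck_on_sum Ck_on_mult U Ck_on_T Ck_on_compose[OF U Ck_on_christoffel h hV] V G) force
  moreover have "Ck_on k U (\<lambda>p. D2 h p u v $ l)" for u v
    unfolding D2_def by (intro Ck_on_vec_nth Ck_on_frechet U h)
  ultimately show ?thesis
    unfolding Kf_def hessf_def sum_component vector_scaleR_component vector_add_component real_scaleR_def
    by (intro Ck_on_sum Ck_on_mult Ck_on_add U Ck_on_matrix_inv Ck_on_gam det_gam)
qed

lemma Ck_on_Hf: "Ck_on k U (\<lambda>p. Hf p $ l)"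
  unfolding Hf_def by (rule Ck_on_nrm[OF Ck_on_Kf])

lemma Ck_on_ipG:
  assumes "\<And>i. Ck_on k U (\<lambda>p. a p $ i)" "\<And>i. Ck_on k U (\<lambda>p. b p $ i)"
  shows "Ck_on k U (\<lambda>p. ip (G (h p)) (a p) (b p))"
  by (intro Ck_on_ip U Ck_on_Gh assms)

lemma Wf_orth: "p \<in> U \<Longrightarrow> ip (G (h p)) (Wf p) (T p u) = 0"
  unfolding Wf_def by (rule nrm_orthogonal[OF ip_gam sympd_gam linear_T])

lemma vel_decomp: "p \<in> U \<Longrightarrow> vel p = Wf p + (\<Sum>k\<in>UNIV. Xf p $ k *\<^sub>R T p (axis k 1))"
  using linear_expand[OF linear_T, of p "Xf p"] by (simp add: Wf_def nrm_def Xf_def)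

text \<open>The first variation formula before integration; the last sum is a coordinate divergence.
  It holds because the induced metric evolves by its Lie derivative along the tangential velocity
  minus twice the second fundamental form paired with the normal velocity. \<open>Kf\<close> may
  stand for the mean curvature, since the two differ by a tangential vector and \<open>Wf\<close> is
  normal.\<close>

theorem first_variation:
  assumes p: "p \<in> U" and \<phi>: "Ck_on (Suc 0) V \<phi>"
  shows "frechet_derivative (\<lambda>q. \<phi> (h q) * Rf q) (at p) (1, 0) =
    Rf p * (frechet_derivative \<phi> (at (h p)) (Wf p) - \<phi> (h p) * ip (G (h p)) (Kf p) (Wf p)) +
    (\<Sum>k\<in>UNIV. frechet_derivative (\<lambda>q. \<phi> (h q) * Rf q * Xf q $ k) (at p) (0, axis k 1))"
proof -
  let ?D = "frechet_derivative h (at p)"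
  let ?G = "G (h p)"
  note hp = hpV[OF p]
  note sG = sympd_sym[OF pd[OF hp]]
  define E where "E = (\<lambda>i. T p (axis i 1))"
  define \<tau> where "\<tau> = (\<lambda>i::'m. (0::real, axis i (1::real)))"
  define B where "B = (\<lambda>i j. D2 h p (\<tau> i) (\<tau> j))"
  define DG where "DG = frechet_derivative G (at (h p))"
  define X where "X = Xf p"
  define W where "W = Wf p"
  define inv where "inv = matrix_inv (gam p)"
  have DE: "?D (\<tau> i) = E i" for i by (simp add: E_def T_def \<tau>_def)
  have Bsym: "B i j = B j i" for i j unfolding B_def by (rule D2_props(1)[OF U h p])
  have GV: "Ck_on (Suc 0) V G" by (intro Ck_on_vec V G)
  have Gd: "(G has_derivative DG) (at (h p))" unfolding DG_def by (rule Ck_on_SucD[OF GV hp])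
  note DGlin = has_derivative_linear[OF Gd]
  have Ghd: "((\<lambda>q. G (h q)) has_derivative (\<lambda>t. DG (?D t))) (at p)"
    using diff_chain_at[OF hd[OF p] Gd] by (simp add: o_def)
  have DGsym: "ip (DG u) a b = ip (DG u) b a" for u a b
  proof -
    have d: "((\<lambda>y. ip (G y) a b) has_derivative (\<lambda>u. ip (DG u) a b)) (at (h p))" for a b
      using has_derivative_ip[OF Gd has_derivative_const has_derivative_const, of a b] by (simp add: ip_bilinear)
    have "((\<lambda>y. ip (G y) a b) has_derivative (\<lambda>u. ip (DG u) b a)) (at (h p))"
      by (rule has_derivative_transform_within_open[OF d[of b a] V hp]) (use sympd_sym[OF pd] in blast)
    then show ?thesis using has_derivative_unique[OF d[of a b]] by (auto simp: fun_eq_iff)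
  qed
  have Dd: "((\<lambda>q. frechet_derivative h (at q) s) has_derivative (\<lambda>t. D2 h p t s)) (at p)" for s
    by (rule D2_props(2)[OF U h p])
  have Td: "((\<lambda>q. T q (axis i 1)) has_derivative (\<lambda>t. D2 h p t (\<tau> i))) (at p)" for i
    unfolding T_def \<tau>_def by (rule Dd)
  define \<Gamma> where "\<Gamma> = (\<lambda>t. \<chi> i j. ip (DG (?D t)) (E i) (E j) + ip ?G (D2 h p t (\<tau> i)) (E j) + ip ?G (E i) (D2 h p t (\<tau> j)))"
  have gamd: "(gam has_derivative \<Gamma>) (at p)"
    by (intro has_derivative_vec) (simp add: gam_def \<Gamma>_def E_def, intro has_derivative_ip Ghd Td)
  have \<Gamma>sym: "\<Gamma> t $ i $ j = \<Gamma> t $ j $ i" for t i j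
    by (simp add: \<Gamma>_def DGsym[of _ "E i"] sG[of _ "E j"] sG[of "E i"])
  define tr where "tr = (\<lambda>t. \<Sum>i\<in>UNIV. \<Sum>j\<in>UNIV. inv $ i $ j * \<Gamma> t $ i $ j)"
  have "trace (inv ** \<Gamma> t) = tr t" for t
    unfolding tr_def trace_def matrix_matrix_mult_def vec_lambda_beta
    by (intro sum.cong refl) (simp add: \<Gamma>sym[of t])
  then have "((\<lambda>q. det (gam q)) has_derivative (\<lambda>t. det (gam p) * tr t)) (at p)"
    using has_derivative_det[OF gamd det_gam[OF p]] by (simp add: inv_def)
  from has_derivative_real_sqrt[OF sympd_det_pos[OF sympd_gam[OF p]] this]
  have Rd: "(Rf has_derivative (\<lambda>t. Rf p * tr t / 2)) (at p)"
    using sympd_det_pos[OF sympd_gam[OF p]]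
    by (auto simp: Rf_def[abs_def] field_simps real_sqrt_mult_self elim!: has_derivative_eq_rhs)
  define D\<phi> where "D\<phi> = frechet_derivative \<phi> (at (h p))"
  have \<phi>d: "(\<phi> has_derivative D\<phi>) (at (h p))" unfolding D\<phi>_def by (rule Ck_on_SucD[OF \<phi> hp])
  note D\<phi>lin = has_derivative_linear[OF \<phi>d]
  have \<phi>hd: "((\<lambda>q. \<phi> (h q)) has_derivative (\<lambda>t. D\<phi> (?D t))) (at p)"
    using diff_chain_at[OF hd[OF p] \<phi>d] by (simp add: o_def)
  define DP where "DP = (\<lambda>t. \<phi> (h p) * (Rf p * tr t / 2) + D\<phi> (?D t) * Rf p)"
  have Pd: "((\<lambda>q. \<phi> (h q) * Rf q) has_derivative DP) (at p)"
    unfolding DP_def by (rule has_derivative_mult[OF \<phi>hd Rd])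
  define X' where "X' = (\<lambda>k. frechet_derivative (\<lambda>q. Xf q $ k) (at p))"
  have Xd: "((\<lambda>q. Xf q $ k) has_derivative X' k) (at p)" for k
    unfolding X'_def by (rule Ck_on_SucD[OF Ck_on_Xf p])
  define W' where "W' = frechet_derivative Wf (at p)"
  have Wd: "(Wf has_derivative W') (at p)"
    unfolding W'_def by (rule Ck_on_SucD[OF Ck_on_vec[OF U Ck_on_Wf] p])
  have Y: "frechet_derivative (\<lambda>q. \<phi> (h q) * Rf q * Xf q $ k) (at p) = (\<lambda>t. \<phi> (h p) * Rf p * X' k t + DP t * X $ k)" for k
    unfolding X_def by (rule frechet_derivative_at[symmetric, OF has_derivative_mult[OF Pd Xd]])
  have veld: "D2 h p t (1, 0) = W' t + (\<Sum>k\<in>UNIV. X $ k *\<^sub>R D2 h p t (\<tau> k) + X' k t *\<^sub>R E k)" for t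
  proof -
    have "((\<lambda>q. Wf q + (\<Sum>k\<in>UNIV. Xf q $ k *\<^sub>R T q (axis k 1))) has_derivative
        (\<lambda>t. W' t + (\<Sum>k\<in>UNIV. X $ k *\<^sub>R D2 h p t (\<tau> k) + X' k t *\<^sub>R E k))) (at p)"
      unfolding X_def E_def by (intro has_derivative_add Wd has_derivative_sum has_derivative_scaleR Xd Td)
    then have "(vel has_derivative (\<lambda>t. W' t + (\<Sum>k\<in>UNIV. X $ k *\<^sub>R D2 h p t (\<tau> k) + X' k t *\<^sub>R E k))) (at p)"
      by (rule has_derivative_transform_within_open[OF _ U p]) (rule vel_decomp[symmetric])
    moreover have "(vel has_derivative (\<lambda>t. D2 h p t (1, 0))) (at p)" unfolding vel_def by (rule Dd)
    ultimately show ?thesis using has_derivative_unique by (metis (no_types, lifting))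
  qed
  \<comment> \<open>Derivative of the relation that \<open>Wf\<close> is orthogonal to the tangent
    vectors, the Weingarten relation: it trades the derivative of the normal velocity for second
    derivatives of \<open>h\<close>, and this is how curvature enters.\<close>
  have orth: "ip ?G (W' t) (E j) = - ip (DG (?D t)) W (E j) - ip ?G W (D2 h p t (\<tau> j))" for t j
  proof -
    have "((\<lambda>q. ip (G (h q)) (Wf q) (T q (axis j 1))) has_derivative
        (\<lambda>t. ip (DG (?D t)) W (E j) + ip ?G (W' t) (E j) + ip ?G W (D2 h p t (\<tau> j)))) (at p)"
      unfolding W_def E_def by (intro has_derivative_ip Ghd Wd Td)
    moreover have "((\<lambda>q. ip (G (h q)) (Wf q) (T q (axis j 1))) has_derivative (\<lambda>t. 0)) (at p)"
      by (rule has_derivative_transform_within_open[OF has_derivative_const U p]) (simp add: Wf_orth)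
    ultimately have "(\<lambda>t. ip (DG (?D t)) W (E j) + ip ?G (W' t) (E j) + ip ?G W (D2 h p t (\<tau> j))) = (\<lambda>t. 0)"
      by (rule has_derivative_unique)
    then have "ip (DG (?D t)) W (E j) + ip ?G (W' t) (E j) + ip ?G W (D2 h p t (\<tau> j)) = 0" by (rule fun_cong)
    then show ?thesis by linarith
  qed
  \<comment> \<open>Since \<open>W\<close> is normal, this is the second fundamental form paired
    with \<open>W\<close>; the formula below is the Koszul expression for the Christoffel
    part.\<close>
  define C where "C = (\<lambda>i j. ip ?G W (hessf p i j))"
  have C: "2 * C i j = 2 * ip ?G W (B i j) + ip (DG (E i)) (E j) W + ip (DG (E j)) (E i) W - ip (DG W) (E i) (E j)" for i j
  proof -
    have "ip ?G W (chr G (h p) (E i) (E j)) = clow G (h p) (E i) (E j) W"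
      by (rule ip_chr) (use Gd differentiable_def sympd_det_pos[OF pd[OF hp]] in auto)
    then show ?thesis
      by (simp add: C_def hessf_def ip_bilinear B_def \<tau>_def E_def clow_def dmet_def DG_def)
  qed
  have Dvel: "?D (1, 0) = W + (\<Sum>k\<in>UNIV. X $ k *\<^sub>R E k)"
    using vel_decomp[OF p] by (simp add: vel_def W_def X_def E_def)
  have \<Gamma>\<tau>: "\<Gamma> (\<tau> k) $ i $ j = ip (DG (E k)) (E i) (E j) + ip ?G (B k i) (E j) + ip ?G (E i) (B k j)" for k i j
    by (simp add: \<Gamma>_def DE B_def)
  have DB: "D2 h p (\<tau> i) (\<tau> j) = B i j" for i j by (simp add: B_def)
  \<comment> \<open>By symmetry of \<open>D2\<close> the time derivative of the tangent vector
    \<open>E i\<close> is the \<open>i\<close>-th space derivative of the velocity, and the velocity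
    can be split by \<open>veld\<close>.\<close>
  have half: "ip ?G (D2 h p (1, 0) (\<tau> i)) (E j) =
      - ip (DG (E i)) W (E j) - ip ?G W (B i j) + (\<Sum>k\<in>UNIV. X $ k * ip ?G (B k i) (E j)) + (\<Sum>k\<in>UNIV. X' k (\<tau> i) * ip ?G (E k) (E j))" for i j
    unfolding D2_props(1)[OF U h p, of "(1, 0)" "\<tau> i"] veld
    by (simp add: ip_bilinear orth DE sum.distrib DB Bsym)
  \<comment> \<open>The evolution of the induced metric. The sum with
    \<open>\<Gamma> (\<tau> k)\<close> and the two sums with \<open>X'\<close> are together its Lie
    derivative along the tangential velocity; the terms with derivatives of \<open>G\<close> combine
    to \<open>C\<close>.\<close>
  have key: "\<Gamma> (1, 0) $ i $ j = (\<Sum>k\<in>UNIV. X $ k * \<Gamma> (\<tau> k) $ i $ j) - 2 * C i j +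
      (\<Sum>k\<in>UNIV. X' k (\<tau> i) * ip ?G (E k) (E j)) + (\<Sum>k\<in>UNIV. X' k (\<tau> j) * ip ?G (E i) (E k))" for i j
  proof -
    have "\<Gamma> (1, 0) $ i $ j = ip (DG (?D (1, 0))) (E i) (E j) + ip ?G (D2 h p (1, 0) (\<tau> i)) (E j) + ip ?G (D2 h p (1, 0) (\<tau> j)) (E i)"
      using sG by (simp add: \<Gamma>_def)
    also have "ip (DG (?D (1, 0))) (E i) (E j) = ip (DG W) (E i) (E j) + (\<Sum>k\<in>UNIV. X $ k * ip (DG (E k)) (E i) (E j))"
      by (simp add: Dvel linear_add[OF DGlin] linear_sum[OF DGlin] linear_cmul[OF DGlin] ip_mat ip_mat_sum)
    finally show ?thesis
      unfolding half C \<Gamma>\<tau> Bsym[of j i]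
      using DGsym[of "E i" W "E j"] DGsym[of "E j" W "E i"]
      by (simp add: sum.distrib distrib_left sG[of _ "E i"])
  qed
  have inv1: "inv ** gam p = mat 1" "gam p ** inv = mat 1"
    unfolding inv_def using matrix_inv_mult[OF det_gam[OF p]] by auto
  have gmE: "gam p $ i $ j = ip ?G (E i) (E j)" for i j by (simp add: gam_def E_def)
  have i1: "(\<Sum>j\<in>UNIV. inv $ i $ j * ip ?G (E k) (E j)) = (if i = k then 1 else 0)" for i k
  proof -
    have "(\<Sum>j\<in>UNIV. inv $ i $ j * ip ?G (E k) (E j)) = (inv ** gam p) $ i $ k"
      by (simp add: matrix_matrix_mult_def gmE sG[of "E k"])
    then show ?thesis by (simp add: inv1 mat_def)
  qed
  have i2: "(\<Sum>i\<in>UNIV. inv $ i $ j * ip ?G (E i) (E k)) = (if k = j then 1 else 0)" for j k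
  proof -
    have "(\<Sum>i\<in>UNIV. inv $ i $ j * ip ?G (E i) (E k)) = (gam p ** inv) $ k $ j"
      by (simp add: matrix_matrix_mult_def gmE sG[of _ "E k"] mult.commute)
    then show ?thesis by (simp add: inv1 mat_def)
  qed
  have t1: "(\<Sum>i\<in>UNIV. \<Sum>j\<in>UNIV. inv $ i $ j * (\<Sum>k\<in>UNIV. X' k (\<tau> i) * ip ?G (E k) (E j))) = (\<Sum>k\<in>UNIV. X' k (\<tau> k))"
  proof -
    have "(\<Sum>j\<in>UNIV. inv $ i $ j * (\<Sum>k\<in>UNIV. X' k (\<tau> i) * ip ?G (E k) (E j))) =
        (\<Sum>k\<in>UNIV. X' k (\<tau> i) * (\<Sum>j\<in>UNIV. inv $ i $ j * ip ?G (E k) (E j)))" for i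
      unfolding sum_distrib_left by (subst sum.swap) (simp add: mult_ac)
    then show ?thesis by (simp add: i1 if_distrib cong: if_cong)
  qed
  have t2: "(\<Sum>i\<in>UNIV. \<Sum>j\<in>UNIV. inv $ i $ j * (\<Sum>k\<in>UNIV. X' k (\<tau> j) * ip ?G (E i) (E k))) = (\<Sum>k\<in>UNIV. X' k (\<tau> k))"
  proof -
    have "(\<Sum>i\<in>UNIV. inv $ i $ j * (\<Sum>k\<in>UNIV. X' k (\<tau> j) * ip ?G (E i) (E k))) =
        (\<Sum>k\<in>UNIV. X' k (\<tau> j) * (\<Sum>i\<in>UNIV. inv $ i $ j * ip ?G (E i) (E k)))" for j
      unfolding sum_distrib_left by (subst sum.swap) (simp add: mult_ac)
    then show ?thesis by (subst sum.swap) (simp add: i2 if_distrib cong: if_cong)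
  qed
  have t3: "(\<Sum>i\<in>UNIV. \<Sum>j\<in>UNIV. inv $ i $ j * (\<Sum>k\<in>UNIV. X $ k * \<Gamma> (\<tau> k) $ i $ j)) = (\<Sum>k\<in>UNIV. X $ k * tr (\<tau> k))"
    unfolding tr_def sum_distrib_left sum.cartesian_product
    by (rule sum.reindex_bij_witness[where i = "\<lambda>(k, i, j). (i, j, k)" and j = "\<lambda>(i, j, k). (k, i, j)"]) auto
  have t4: "(\<Sum>i\<in>UNIV. \<Sum>j\<in>UNIV. inv $ i $ j * (2 * C i j)) = 2 * ip ?G (Kf p) W"
    by (simp add: Kf_def C_def inv_def[symmetric] ip_bilinear sG[of W] sum_distrib_left mult_ac)
  \<comment> \<open>The metric trace of \<open>key\<close>. By \<open>Rd\<close>, half of it times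
    \<open>Rf p\<close> is the time derivative of the volume density; the terms in \<open>X\<close>
    then assemble to the coordinate divergence of the density times \<open>Xf\<close>.\<close>
  have trvel: "tr (1, 0) = (\<Sum>k\<in>UNIV. X $ k * tr (\<tau> k)) - 2 * ip ?G (Kf p) W + 2 * (\<Sum>k\<in>UNIV. X' k (\<tau> k))"
  proof -
    have "tr (1, 0) = (\<Sum>i\<in>UNIV. \<Sum>j\<in>UNIV. inv $ i $ j * (\<Sum>k\<in>UNIV. X $ k * \<Gamma> (\<tau> k) $ i $ j)) -
       (\<Sum>i\<in>UNIV. \<Sum>j\<in>UNIV. inv $ i $ j * (2 * C i j)) +
       (\<Sum>i\<in>UNIV. \<Sum>j\<in>UNIV. inv $ i $ j * (\<Sum>k\<in>UNIV. X' k (\<tau> i) * ip ?G (E k) (E j))) +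
       (\<Sum>i\<in>UNIV. \<Sum>j\<in>UNIV. inv $ i $ j * (\<Sum>k\<in>UNIV. X' k (\<tau> j) * ip ?G (E i) (E k)))"
      unfolding tr_def key by (simp add: distrib_left right_diff_distrib sum.distrib sum_subtractf)
    then show ?thesis unfolding t1 t2 t3 t4 by simp
  qed
  have "frechet_derivative (\<lambda>q. \<phi> (h q) * Rf q) (at p) = DP" by (rule frechet_derivative_at[symmetric, OF Pd])
  moreover have "DP (1, 0) = Rf p * (D\<phi> W - \<phi> (h p) * ip ?G (Kf p) W) + (\<Sum>k\<in>UNIV. \<phi> (h p) * Rf p * X' k (\<tau> k) + DP (\<tau> k) * X $ k)"
  proof -
    have s: "(\<Sum>k\<in>UNIV. DP (\<tau> k) * X $ k) = \<phi> (h p) * Rf p / 2 * (\<Sum>k\<in>UNIV. X $ k * tr (\<tau> k)) + Rf p * (\<Sum>k\<in>UNIV. X $ k * D\<phi> (E k))"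
      unfolding sum_distrib_left sum.distrib[symmetric]
      by (intro sum.cong refl) (simp add: DP_def DE algebra_simps)
    have "DP (1, 0) = \<phi> (h p) * Rf p / 2 * tr (1, 0) + Rf p * (D\<phi> W + (\<Sum>k\<in>UNIV. X $ k * D\<phi> (E k)))"
      by (simp add: DP_def Dvel linear_add[OF D\<phi>lin] linear_sum[OF D\<phi>lin] linear_cmul[OF D\<phi>lin])
    then show ?thesis unfolding sum.distrib s trvel
      by (simp add: sum_distrib_left[symmetric] algebra_simps)
  qed
  ultimately show ?thesis
    by (simp add: Y \<tau>_def W_def D\<phi>_def)
qed

end

section \<open>Paths of immersions in charts\<close>

lemma continuous_on_charts:
  assumes M: "smooth_manifold M" and u: "\<And>c. c \<in> M \<Longrightarrow> continuous_on (cmap c ` cdom c) (\<lambda>z. u (cinv c z))"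
  shows "continuous_on UNIV u"
proof (rule continuous_at_imp_continuous_on, rule ballI)
  fix x
  define c where "c = chart_at M x"
  note c = chart_at_props[OF M, of x, folded c_def]
  note ch = manifold_chart[OF M c(1)]
  have "continuous_on (cdom c) (\<lambda>x. u (cinv c (cmap c x)))"
    by (rule continuous_on_compose2[OF u[OF c(1)] chart_props(3)[OF ch]]) auto
  then have "continuous_on (cdom c) u"
    by (rule continuous_on_eq) (simp add: chart_props(5)[OF ch])
  then show "isCont u x" using c(2) chart_props(1)[OF ch] continuous_on_eq_continuous_at by blast
qed

text \<open>Quantities along a path have a meaning for times in [0,1] only, whereas the local
  extensions live on open sets. Agreement on \<open>S\<close> near each point suffices for
  continuity relative to \<open>S\<close>.\<close>

lemma continuous_on_local_model:
  fixes u :: "'a::t2_space \<Rightarrow> 'b::topological_space"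
  assumes "\<And>p. p \<in> S \<Longrightarrow> \<exists>U \<psi>. open U \<and> p \<in> U \<and> continuous_on U \<psi> \<and> (\<forall>q\<in>U \<inter> S. u q = \<psi> q)"
  shows "continuous_on S u"
proof (subst continuous_on_eq_continuous_within, rule ballI)
  fix p assume p: "p \<in> S"
  then obtain U \<psi> where U: "open U" "p \<in> U" "continuous_on U \<psi>" "\<And>q. q \<in> U \<inter> S \<Longrightarrow> u q = \<psi> q"
    using assms by meson
  have "continuous (at p within S) \<psi>"
    using U continuous_on_eq_continuous_at continuous_at_imp_continuous_at_within by blast
  moreover have "eventually (\<lambda>q. \<psi> q = u q) (at p within S)"
    using U unfolding eventually_at_topological by (intro exI[of _ U]) auto
  ultimately show "continuous (at p within S) u"
    unfolding continuous_within using U(4)[of p] U(2) p Lim_transform_eventually by fastforce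
qed

lemma slice_derivative:
  assumes "(w has_derivative w') (at (t, z))"
  shows "((\<lambda>z. w (t, z)) has_derivative (\<lambda>v. w' (0, v))) (at z)"
proof -
  have "((\<lambda>z. (t, z)) has_derivative (\<lambda>v. (0, v))) (at z)" by (auto intro!: derivative_eq_intros)
  from diff_chain_at[OF this assms] show ?thesis by (simp add: o_def)
qed

lemma slice_derivative_left:
  fixes w :: "real \<times> 'a::real_normed_vector \<Rightarrow> 'b::real_normed_vector"
  assumes "(w has_derivative w') (at (t, z))"
  shows "((\<lambda>s. w (s, z)) has_vector_derivative w' (1, 0)) (at t)"
proof -
  have "((\<lambda>s. (s, z)) has_derivative (\<lambda>r. (r, 0))) (at t)" by (auto intro!: derivative_eq_intros)
  from diff_chain_at[OF this assms]
  have "((\<lambda>s. w (s, z)) has_derivative (\<lambda>r. w' (r, 0))) (at t)" by (simp add: o_def)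
  moreover have "w' (r, 0) = r *\<^sub>R w' (1, 0)" for r
    using linear_cmul[OF has_derivative_linear[OF assms], of r "(1, 0)"] by simp
  ultimately show ?thesis
    unfolding has_vector_derivative_def by (elim has_derivative_eq_rhs) (rule ext)
qed

lemma open_slice: "open U \<Longrightarrow> open {z. (t, z) \<in> U}"
proof -
  assume "open U"
  have "continuous_on UNIV (\<lambda>z. (t, z))" by (intro continuous_intros)
  from open_vimage[OF \<open>open U\<close> this] show ?thesis by (simp add: vimage_def)
qed

lemma open_slice_left: "open U \<Longrightarrow> open {s. (s, z) \<in> U}"
proof -
  assume "open U"
  have "continuous_on UNIV (\<lambda>s. (s, z))" by (intro continuous_intros)
  from open_vimage[OF \<open>open U\<close> this] show ?thesis by (simp add: vimage_def)
qed

lemma slice_continuous: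
  assumes "continuous_on (I \<times> S) (\<lambda>(t, z). u t z)" "t \<in> I"
  shows "continuous_on S (u t)"
proof -
  have "continuous_on S (\<lambda>z. (t, z))" by (intro continuous_intros)
  from continuous_on_compose2[OF assms(1) this] show ?thesis using assms(2) by auto
qed

lemma Ck_on_slice:
  assumes "Ck_on (Suc 0) U (w :: real \<times> (real^'k::finite) \<Rightarrow> real)" "open U" "open S" "\<And>z. z \<in> S \<Longrightarrow> (t, z) \<in> U"
  shows "Ck_on (Suc 0) S (\<lambda>z. w (t, z))"
proof (rule Ck_on_compose[OF assms(3,1)])
  show "Ck_on (Suc 0) S (\<lambda>z. (t, z))"
  proof (rule Ck_on_SucI[where D = "\<lambda>z v. (0, v)"])
    show "((\<lambda>z. (t, z)) has_derivative (\<lambda>v. (0, v))) (at z)" for z :: "real^'k" by (auto intro!: derivative_eq_intros)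
  qed (auto intro: Ck_on_const assms(3))
qed (use assms(4) in auto)

locale riem_path = riem_compact M N g
  for M :: "('a::{t2_space,second_countable_topology}, 'm::finite) atlas"
    and N :: "('b::{t2_space,second_countable_topology}, 'n::finite) atlas"
    and g :: "('b, 'n) metric" +
  fixes f :: "real \<Rightarrow> 'a \<Rightarrow> 'b" and A :: real
  assumes path: "smooth_path M N f" and imm: "\<And>t. t \<in> {0..1} \<Longrightarrow> f t \<in> Imm M N" and A: "A > 0"
begin

lemma smooth_t: "t \<in> {0..1} \<Longrightarrow> smooth_map M N (f t)"
  using imm by (auto simp: Imm_def)

text \<open>Smoothness of the path means that it extends smoothly to neighbourhoods; \<open>h\<close> is such an
  extension in charts, so it is unconstrained for times outside \<open>[0,1]\<close>.\<close>

definition lmodel :: "('a, 'm) chart \<Rightarrow> ('b, 'n) chart \<Rightarrow> (real \<times> (real^'m)) set \<Rightarrow> (real \<times> (real^'m) \<Rightarrow> real^'n) \<Rightarrow> bool" where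
  "lmodel c d U h \<longleftrightarrow> open U \<and> (\<forall>k. Ck_on k U h) \<and> h ` U \<subseteq> cmap d ` cdom d \<and>
    (\<forall>t z. (t, z) \<in> U \<longrightarrow> z \<in> cmap c ` cdom c) \<and>
    (\<forall>t z. (t, z) \<in> U \<longrightarrow> t \<in> {0..1} \<longrightarrow> f t (cinv c z) \<in> cdom d \<and> h (t, z) = cmap d (f t (cinv c z)))"

lemma lmodel_exists:
  assumes t0: "t0 \<in> {0..1}" and c: "c \<in> M" "x0 \<in> cdom c" and d: "d \<in> N" "f t0 x0 \<in> cdom d"
  shows "\<exists>U h. lmodel c d U h \<and> (t0, cmap c x0) \<in> U"
proof -
  note ch = manifold_chart[OF M c(1)] and chd = manifold_chart[OF N d(1)]
  define S where "S = {(t, z). t \<in> {0..1} \<and> z \<in> cmap c ` cdom c \<and> f t (cinv c z) \<in> cdom d}"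
  have "smooth_on S (\<lambda>(t, z). cmap d (f t (cinv c z)))"
    using path c(1) d(1) unfolding smooth_path_def S_def by blast
  moreover have "(t0, cmap c x0) \<in> S" using t0 c d chart_props(5)[OF ch c(2)] by (auto simp: S_def)
  ultimately have "\<exists>U h. open U \<and> (t0, cmap c x0) \<in> U \<and> (\<forall>k. Ck_on k U h) \<and>
      (\<forall>y\<in>S \<inter> U. h y = (case y of (t, z) \<Rightarrow> cmap d (f t (cinv c z))))"
    unfolding smooth_on_def by (rule bspec)
  then obtain U0 h where U0: "open U0" "(t0, cmap c x0) \<in> U0" "\<And>k. Ck_on k U0 h"
    "\<And>y. y \<in> S \<inter> U0 \<Longrightarrow> h y = (case y of (t, z) \<Rightarrow> cmap d (f t (cinv c z)))"
    by (elim exE conjE) blast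
  have "continuous_on ({0..1} \<times> cmap c ` cdom c) (\<lambda>p. f (fst p) (cinv c (snd p)))"
  proof -
    have "continuous_on ({0..1} \<times> UNIV) (\<lambda>p. f (fst p) (snd p))"
      using path unfolding smooth_path_def by (simp add: split_beta)
    moreover have "continuous_on ({0..1} \<times> cmap c ` cdom c) (\<lambda>p. (fst p, cinv c (snd p)))"
      by (intro continuous_on_Pair continuous_on_fst continuous_on_id
          continuous_on_compose2[OF chart_props(4)[OF ch] continuous_on_snd[OF continuous_on_id]]) auto
    ultimately have "continuous_on ({0..1} \<times> cmap c ` cdom c)
        (\<lambda>p. f (fst (fst p, cinv c (snd p))) (snd (fst p, cinv c (snd p))))"
      by (rule continuous_on_compose2) auto
    then show ?thesis by simp
  qed
  \<comment> \<open>Because time is confined to [0,1], the set of points that the path sends into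
    \<open>cdom d\<close> is only relatively open. The open set \<open>W\<close> cuts it
    out.\<close>
  from this[unfolded continuous_on_open_invariant, rule_format, OF chart_props(1)[OF chd]]
  have "\<exists>W. open W \<and> W \<inter> ({0..1} \<times> cmap c ` cdom c) =
      (\<lambda>p. f (fst p) (cinv c (snd p))) -` cdom d \<inter> ({0..1} \<times> cmap c ` cdom c)" .
  then obtain W where W: "open W"
    "W \<inter> ({0..1} \<times> cmap c ` cdom c) = (\<lambda>p. f (fst p) (cinv c (snd p))) -` cdom d \<inter> ({0..1} \<times> cmap c ` cdom c)"
    by (elim exE conjE) (rule that)
  have SW: "p \<in> S \<longleftrightarrow> p \<in> W \<inter> ({0..1} \<times> cmap c ` cdom c)" for p
    unfolding W(2) by (auto simp: S_def)
  define U1 where "U1 = U0 \<inter> W \<inter> (UNIV \<times> cmap c ` cdom c)"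
  have U1: "open U1" unfolding U1_def using U0(1) W(1) chart_props(2)[OF ch] by (intro open_Int open_Times) auto
  have hU1: "continuous_on U1 h"
    by (rule continuous_on_subset[OF Ck_on_imp_continuous[OF U0(3)[of 0]]]) (auto simp: U1_def)
  \<comment> \<open>For times outside [0,1] nothing ties \<open>h\<close> to the path, so staying in
    the chart image has to be imposed; at times in [0,1] it follows from \<open>hS\<close>.\<close>
  define U where "U = U1 \<inter> h -` (cmap d ` cdom d)"
  have hS: "f t (cinv c z) \<in> cdom d \<and> h (t, z) = cmap d (f t (cinv c z))" if "(t, z) \<in> U1" "t \<in> {0..1}" for t z
  proof -
    have "(t, z) \<in> S" unfolding SW using that by (auto simp: U1_def)
    then show ?thesis using U0(4)[of "(t, z)"] that by (auto simp: U1_def S_def)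
  qed
  have in1: "(t0, cmap c x0) \<in> U1"
    using U0(2) SW[of "(t0, cmap c x0)"] \<open>(t0, cmap c x0) \<in> S\<close> by (auto simp: U1_def)
  have "lmodel c d U h"
    unfolding lmodel_def
  proof (intro conjI allI impI)
    show "open U" unfolding U_def by (rule continuous_open_preimage[OF hU1 U1 chart_props(2)[OF chd]])
    show "Ck_on k U h" for k by (rule Ck_on_subset[OF U0(3)]) (auto simp: U_def U1_def)
  qed (use hS in \<open>auto simp: U_def U1_def\<close>)
  moreover have "(t0, cmap c x0) \<in> U" using in1 hS[OF in1 t0] by (auto simp: U_def)
  ultimately show ?thesis by blast
qed

lemma lmodelD:
  assumes "lmodel c d U h"
  shows "open U" "Ck_on k U h" "h ` U \<subseteq> cmap d ` cdom d" "(t, z) \<in> U \<Longrightarrow> z \<in> cmap c ` cdom c"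
    "(t, z) \<in> U \<Longrightarrow> t \<in> {0..1} \<Longrightarrow> f t (cinv c z) \<in> cdom d"
    "(t, z) \<in> U \<Longrightarrow> t \<in> {0..1} \<Longrightarrow> h (t, z) = cmap d (f t (cinv c z))"
  using assms unfolding lmodel_def by blast+

text \<open>At a fixed time in [0,1] the slice of \<open>U\<close> is open in space and
  \<open>h\<close> agrees on it with the chart representation of \<open>f t\<close>. Space
  derivatives of all orders are therefore those of the immersion, also at the endpoints.\<close>

lemma lmodel_T:
  assumes c: "c \<in> M" and d: "d \<in> N" and m: "lmodel c d U h" and tz: "(t, z) \<in> U" "t \<in> {0..1}"
  shows "frechet_derivative (local_rep c d (f t)) (at z) = (\<lambda>v. frechet_derivative h (at (t, z)) (0, v))"
    "D2 (local_rep c d (f t)) z u v = D2 h (t, z) (0, u) (0, v)"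
    "chart_deriv c d (f t) (cinv c z) v = frechet_derivative h (at (t, z)) (0, v)"
proof -
  note m = lmodelD[OF m]
  have eq: "h (t, z) = local_rep c d (f t) z" if "(t, z) \<in> U" for z
    using m(6)[OF that tz(2)] by (simp add: local_rep_def)
  have 1: "frechet_derivative (local_rep c d (f t)) (at z) = (\<lambda>v. frechet_derivative h (at (t, z)) (0, v))"
    if "(t, z) \<in> U" for z
  proof -
    have "((\<lambda>z. h (t, z)) has_derivative (\<lambda>v. frechet_derivative h (at (t, z)) (0, v))) (at z)"
      by (rule slice_derivative[OF Ck_on_SucD[OF m(2) that]])
    then have "(local_rep c d (f t) has_derivative (\<lambda>v. frechet_derivative h (at (t, z)) (0, v))) (at z)"
      by (rule has_derivative_transform_within_open[OF _ open_slice[OF m(1)]]) (use that eq in auto)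
    then show ?thesis by (rule frechet_derivative_at[symmetric])
  qed
  then show "frechet_derivative (local_rep c d (f t)) (at z) = (\<lambda>v. frechet_derivative h (at (t, z)) (0, v))"
    using tz by blast
  then show "chart_deriv c d (f t) (cinv c z) v = frechet_derivative h (at (t, z)) (0, v)"
    using chart_props(6)[OF manifold_chart[OF M c] m(4)[OF tz(1)]] by (simp add: chart_deriv_def)
  have "((\<lambda>z. frechet_derivative h (at (t, z)) (0, v)) has_derivative (\<lambda>u. D2 h (t, z) (0, u) (0, v))) (at z)"
    by (rule slice_derivative[OF D2_props(2)[OF m(1,2) tz(1)]])
  then have "((\<lambda>z. frechet_derivative (local_rep c d (f t)) (at z) v) has_derivative (\<lambda>u. D2 h (t, z) (0, u) (0, v))) (at z)"
    by (rule has_derivative_transform_within_open[OF _ open_slice[OF m(1)]]) (use tz 1 in auto)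
  then show "D2 (local_rep c d (f t)) z u v = D2 h (t, z) (0, u) (0, v)"
    unfolding D2_def[of "local_rep c d (f t)"] by (simp add: frechet_derivative_at[symmetric])
qed

lemma lmodel_gam:
  assumes c: "c \<in> M" and d: "d \<in> N" and m: "lmodel c d U h" and tz: "(t, z) \<in> U" "t \<in> {0..1}"
  shows "GM (f t) c z = (\<chi> i j. ip (GN d (h (t, z))) (frechet_derivative h (at (t, z)) (0, axis i 1)) (frechet_derivative h (at (t, z)) (0, axis j 1)))"
proof -
  note m' = lmodelD[OF m]
  note ch = manifold_chart[OF M c]
  have x: "cinv c z \<in> cdom c" "cmap c (cinv c z) = z" using chart_props(6,7)[OF ch m'(4)[OF tz(1)]] by auto
  have "GM (f t) c z $ i $ j = ip (GN d (h (t, z))) (frechet_derivative h (at (t, z)) (0, axis i 1)) (frechet_derivative h (at (t, z)) (0, axis j 1))" for i j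
    using gram_pullback[OF M N g smooth_t[OF tz(2)] c x(1) d m'(5)[OF tz], of "axis i 1" "axis j 1"]
    by (simp add: x(2) ip_axis lmodel_T(3)[OF c d m tz] m'(6)[OF tz])
  then show ?thesis by (simp add: vec_eq_iff)
qed

definition good_model where
  "good_model c d U h \<longleftrightarrow> lmodel c d U h \<and> local_family h U (GN d) (cmap d ` cdom d)"

lemma good_model_exists:
  assumes t0: "t0 \<in> {0..1}" and c: "c \<in> M" "x0 \<in> cdom c" and d: "d \<in> N" "f t0 x0 \<in> cdom d"
  shows "\<exists>U h. good_model c d U h \<and> (t0, cmap c x0) \<in> U"
proof -
  obtain U h where m: "lmodel c d U h" and in0: "(t0, cmap c x0) \<in> U" using lmodel_exists[OF assms] by blast
  note m' = lmodelD[OF m]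
  note chd = manifold_chart[OF N d(1)]
  define B where "B = (\<lambda>p. \<chi> i j. ip (GN d (h p)) (frechet_derivative h (at p) (0, axis i 1)) (frechet_derivative h (at p) (0, axis j 1)))"
  have "Ck_on 0 U (\<lambda>p. det (B p))"
    unfolding B_def
    by (intro Ck_on_det m'(1), unfold vec_lambda_beta)
      (intro Ck_on_ip m'(1) Ck_on_vec_nth Ck_on_frechet m'(2) Ck_on_compose[OF m'(1) Ck_on_gram[OF N g d(1)] m'(2,3)])
  then have cont: "continuous_on U (\<lambda>p. det (B p))" by simp
  \<comment> \<open>The determinant is nonzero at the given point because \<open>f t0\<close> is an
    immersion. Shrinking to the open set where it stays nonzero extends this to nearby times outside
    [0,1], where \<open>h\<close> is not known to come from immersions.\<close>
  define U' where "U' = U \<inter> (\<lambda>p. det (B p)) -` (- {0})"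
  have U': "open U'" unfolding U'_def by (rule continuous_open_preimage[OF cont m'(1)]) auto
  have lm: "lmodel c d U' h"
    using m U' Ck_on_subset[of _ U h U'] unfolding lmodel_def by (auto simp: U'_def)
  moreover have "local_family h U' (GN d) (cmap d ` cdom d)"
  proof
    show "open U'" by (rule U')
    show "open (cmap d ` cdom d)" by (rule chart_props(2)[OF chd])
    show "h ` U' \<subseteq> cmap d ` cdom d" "Ck_on k U' h" for k using lmodelD[OF lm] by auto
    show "Ck_on k (cmap d ` cdom d) (\<lambda>y. GN d y $ i $ j)" for k i j by (rule Ck_on_gram[OF N g d(1)])
    show "sympd (GN d y)" if "y \<in> cmap d ` cdom d" for y using that sympd_gram[OF N g d(1)] by auto
    show "det (\<chi> i j. ip (GN d (h p)) (frechet_derivative h (at p) (0, axis i 1)) (frechet_derivative h (at p) (0, axis j 1))) \<noteq> 0"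
      if "p \<in> U'" for p using that by (simp add: U'_def B_def)
  qed
  moreover have "(t0, cmap c x0) \<in> U'"
  proof -
    have "B (t0, cmap c x0) = GM (f t0) c (cmap c x0)" unfolding B_def by (rule lmodel_gam[OF c(1) d(1) m in0 t0, symmetric])
    then show ?thesis using in0 sympd_det_pos[OF sympd_gram_pullback[OF M N g imm[OF t0] c]] by (simp add: U'_def)
  qed
  ultimately show ?thesis unfolding good_model_def by blast
qed

text \<open>At the endpoints the velocity is a one-sided derivative; the extension \<open>h\<close>
  gives it as an ordinary partial derivative.\<close>

lemma velocity_has_derivative:
  assumes t: "t \<in> {0..1}" and c: "c \<in> M" "x \<in> cdom c" and d: "d \<in> N" and m: "lmodel c d U h" and U: "(t, cmap c x) \<in> U"
  shows "((\<lambda>s. cmap d (f s x)) has_vector_derivative frechet_derivative h (at (t, cmap c x)) (1, 0)) (at t within {0..1})"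
    "velocity N f t x d = frechet_derivative h (at (t, cmap c x)) (1, 0)"
proof -
  note m = lmodelD[OF m]
  have cx: "cinv c (cmap c x) = x" using chart_props(5)[OF manifold_chart[OF M c(1)] c(2)] .
  define z where "z = cmap c x"
  have Uz: "(t, z) \<in> U" using U by (simp add: z_def)
  note hd = Ck_on_SucD[OF m(2) Uz]
  have "((\<lambda>s. h (s, z)) has_vector_derivative frechet_derivative h (at (t, z)) (1, 0)) (at t)"
    by (rule slice_derivative_left[OF hd])
  then have "((\<lambda>s. h (s, z)) has_vector_derivative frechet_derivative h (at (t, z)) (1, 0)) (at t within {0..1})"
    by (rule has_vector_derivative_at_within)
  moreover obtain e where e: "e > 0" "\<And>s. dist s t < e \<Longrightarrow> (s, z) \<in> U"
  proof -
    have "open {s. (s, z) \<in> U}" by (rule open_slice_left[OF m(1)])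
    then have "\<exists>e>0. \<forall>s. dist s t < e \<longrightarrow> s \<in> {s. (s, z) \<in> U}" using Uz unfolding open_dist by blast
    then show ?thesis using that by auto
  qed
  ultimately show 1: "((\<lambda>s. cmap d (f s x)) has_vector_derivative frechet_derivative h (at (t, cmap c x)) (1, 0)) (at t within {0..1})"
    unfolding z_def[symmetric]
    by (elim has_vector_derivative_transform_within[where d = e])
      (use t e m(6)[of _ z] cx in \<open>auto simp: z_def\<close>)
  show "velocity N f t x d = frechet_derivative h (at (t, cmap c x)) (1, 0)"
    using vector_derivative_within_cbox[of 0 1 t] 1 t d m(5)[OF U t] cx by (simp add: velocity_def)
qed

lemma velocity_tangent:
  assumes t: "t \<in> {0..1}"
  shows "velocity N f t x \<in> tangent_space N (f t x)"
  unfolding tangent_space_iff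
proof (intro conjI allI ballI impI)
  show "velocity N f t x d = 0" if "d \<notin> N \<or> f t x \<notin> cdom d" for d using that by (auto simp: velocity_def)
  fix d d' assume dd: "d \<in> N" "d' \<in> N" "f t x \<in> cdom d \<inter> cdom d'"
  then have y: "f t x \<in> cdom d" "f t x \<in> cdom d'" by auto
  define c where "c = chart_at M x"
  note c = chart_at_props[OF M, of x, folded c_def]
  note chd = manifold_chart[OF N dd(1)]
  have cx: "cinv c (cmap c x) = x" using chart_props(5)[OF manifold_chart[OF M c(1)] c(2)] .
  obtain U h where m: "lmodel c d U h" "(t, cmap c x) \<in> U" using lmodel_exists[OF t c dd(1) y(1)] by blast
  obtain U' h' where m': "lmodel c d' U' h'" "(t, cmap c x) \<in> U'" using lmodel_exists[OF t c dd(2) y(2)] by blast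
  note v = velocity_has_derivative[OF t c dd(1) m] and v' = velocity_has_derivative[OF t c dd(2) m']
  have i: "id (f t x) \<in> cdom d'" using y by simp
  note \<sigma> = has_derivative_local_rep[OF N N smooth_map_id[OF N] dd(1,2) y(1) i]
  have "((\<lambda>s. local_rep d d' id (cmap d (f s x))) has_derivative (\<lambda>r. chart_deriv d d' id (f t x) (r *\<^sub>R velocity N f t x d))) (at t within {0..1})"
    using diff_chain_within[OF v(1)[unfolded has_vector_derivative_def] has_derivative_at_withinI[OF \<sigma>]] v(2) by (simp add: o_def id_def)
  then have w: "((\<lambda>s. local_rep d d' id (cmap d (f s x))) has_vector_derivative chart_deriv d d' id (f t x) (velocity N f t x d)) (at t within {0..1})"
    unfolding has_vector_derivative_def by (simp add: linear_cmul[OF linear_trans[OF N dd(1,2) y]])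
  have "open {s. (s, cmap c x) \<in> U}" by (rule open_slice_left[OF lmodelD(1)[OF m(1)]])
  then obtain e where e: "e > 0" "\<And>s. dist s t < e \<Longrightarrow> (s, cmap c x) \<in> U"
    using m(2) unfolding open_dist mem_Collect_eq by blast
  have "((\<lambda>s. cmap d' (f s x)) has_vector_derivative chart_deriv d d' id (f t x) (velocity N f t x d)) (at t within {0..1})"
  proof (rule has_vector_derivative_transform_within[OF w e(1) t])
    fix s assume s: "s \<in> {0..1}" "dist s t < e"
    have "f s x \<in> cdom d" using lmodelD(5)[OF m(1) e(2)[OF s(2)] s(1)] cx by simp
    then show "local_rep d d' id (cmap d (f s x)) = cmap d' (f s x)"
      using chart_props(5)[OF chd] by (simp add: local_rep_def)
  qed
  then show "velocity N f t x d' = chart_deriv d d' id (f t x) (velocity N f t x d)"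
    using vector_derivative_within_cbox[of 0 1 t] t dd y by (simp add: velocity_def[of N f t x] )
qed

section \<open>Normal velocity, mean curvature and localized volume density in local models\<close>

abbreviation wv where "wv t x \<equiv> normal_part M N g (f t) x (velocity N f t x)"
abbreviation Xv where "Xv t x \<equiv> tangent_part (f t) x (velocity N f t x)"
abbreviation Hv where "Hv t x \<equiv> mean_curvature M N g (f t) x"

lemma wv_tangent: "t \<in> {0..1} \<Longrightarrow> wv t x \<in> tangent_space N (f t x)"
  using normal_decomposition(1)[OF imm velocity_tangent] by (simp add: normal_space_def)

lemma Hv_tangent: "t \<in> {0..1} \<Longrightarrow> Hv t x \<in> tangent_space N (f t x)"
  using mean_curvature_normal[OF imm] by (simp add: normal_space_def)

text \<open>Here the pointwise definitions meet the smooth formulas of \<open>local_family\<close>.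
  Continuity and differentiability in time and space are imported through these equations.\<close>

lemma good_model_formulas:
  assumes c: "c \<in> M" and d: "d \<in> N" and m: "good_model c d U h" and tz: "(t, z) \<in> U" "t \<in> {0..1}"
  shows "sqrt (det (GM (f t) c z)) = local_family.Rf h (GN d) (t, z)"
    "wv t (cinv c z) d = local_family.Wf h (GN d) (t, z)"
    "Xv t (cinv c z) c = local_family.Xf h (GN d) (t, z)"
    "Hv t (cinv c z) d = local_family.Hf h (GN d) (t, z)"
proof -
  have lm: "lmodel c d U h" and lf: "local_family h U (GN d) (cmap d ` cdom d)"
    using m by (auto simp: good_model_def)
  interpret L: local_family h U "GN d" "cmap d ` cdom d" by (rule lf)
  note m' = lmodelD[OF lm]
  note ch = manifold_chart[OF M c]
  have x: "cinv c z \<in> cdom c" "cmap c (cinv c z) = z" using chart_props(6,7)[OF ch m'(4)[OF tz(1)]] by auto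
  note y = m'(5)[OF tz] and hy = m'(6)[OF tz]
  have gam: "GM (f t) c z = L.gam (t, z)" unfolding L.gam_def L.T_def by (rule lmodel_gam[OF c d lm tz])
  have T: "chart_deriv c d (f t) (cinv c z) = L.T (t, z)"
    using lmodel_T(3)[OF c d lm tz] by (simp add: fun_eq_iff L.T_def)
  have v: "velocity N f t (cinv c z) d = L.vel (t, z)"
    using velocity_has_derivative(2)[OF tz(2) c x(1) d lm] tz(1) by (simp add: x(2) L.vel_def)
  show "sqrt (det (GM (f t) c z)) = L.Rf (t, z)" by (simp add: gam L.Rf_def)
  show "wv t (cinv c z) d = L.Wf (t, z)"
    unfolding normal_part_chart(1)[OF imm[OF tz(2)] velocity_tangent[OF tz(2)] c x(1) d y]
    by (simp add: x(2) gam T v L.Wf_def hy)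
  show "Xv t (cinv c z) c = L.Xf (t, z)"
    unfolding normal_part_chart(2)[OF imm[OF tz(2)] velocity_tangent[OF tz(2)] c x(1) d y]
    by (simp add: x(2) gam T v L.Xf_def hy)
  have "hess (f t) c d (cinv c z) (axis i 1) (axis j 1) = L.hessf (t, z) i j" for i j
    by (simp add: hess_def L.hessf_def x(2) lmodel_T(2)[OF c d lm tz] T hy)
  then have "hess_trace (f t) c d (cinv c z) = L.Kf (t, z)"
    by (simp add: hess_trace_def L.Kf_def x(2) gam)
  then show "Hv t (cinv c z) d = L.Hf (t, z)"
    unfolding mean_curvature_nrm[OF imm[OF tz(2)] c x(1) d y] by (simp add: x(2) gam T L.Hf_def hy)
qed

text \<open>\<open>qv\<close> is the integrand of \<open>G_metric\<close> at the normal velocity,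
  \<open>Qv\<close> the integrand that the derivative of the localized volume will have,
  \<open>Pv\<close> the density of that volume in a chart, and \<open>Yv\<close> the flux whose
  coordinate divergence separates the time derivative of \<open>Pv\<close> from
  \<open>Qv\<close>.\<close>

definition qv where "qv t x = (1 + A * g (f t x) (Hv t x) (Hv t x)) * g (f t x) (wv t x) (wv t x)"

definition Qv where "Qv \<phi> t x = dfun N \<phi> (f t x) (wv t x) - \<phi> (f t x) * g (f t x) (Hv t x) (wv t x)"

definition Pv where "Pv \<phi> c t z = \<phi> (f t (cinv c z)) * sqrt (det (GM (f t) c z))"

definition Yv where "Yv \<phi> c k t z = Pv \<phi> c t z * Xv t (cinv c z) c $ k"

lemma model_at:
  assumes t: "t \<in> {0..1}" and c: "c \<in> M" and z: "z \<in> cmap c ` cdom c"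
  obtains d U h where "d \<in> N" "good_model c d U h" "(t, z) \<in> U"
proof -
  note ch = manifold_chart[OF M c]
  note d = chart_at_props[OF N, of "f t (cinv c z)"]
  obtain U h where "good_model c (chart_at N (f t (cinv c z))) U h" "(t, cmap c (cinv c z)) \<in> U"
    using good_model_exists[OF t c chart_props(7)[OF ch z] d] by blast
  then show ?thesis using that d(1) unfolding chart_props(6)[OF ch z] by blast
qed

lemma good_model_metric:
  assumes c: "c \<in> M" and d: "d \<in> N" and m: "good_model c d U h" and tz: "(t, z) \<in> U" "t \<in> {0..1}"
    and u: "u \<in> tangent_space N (f t (cinv c z))" and v: "v \<in> tangent_space N (f t (cinv c z))"
  shows "g (f t (cinv c z)) u v = ip (GN d (h (t, z))) (u d) (v d)"
proof -
  have lm: "lmodel c d U h" using m by (simp add: good_model_def)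
  show ?thesis
    using metric_chart[OF N g d lmodelD(5)[OF lm tz] u v] lmodelD(6)[OF lm tz] by simp
qed

lemma good_model_qv:
  assumes c: "c \<in> M" and d: "d \<in> N" and m: "good_model c d U h" and tz: "(t, z) \<in> U" "t \<in> {0..1}"
  defines "p \<equiv> (t, z)"
  shows "qv t (cinv c z) = (1 + A * ip (GN d (h p)) (local_family.Hf h (GN d) p) (local_family.Hf h (GN d) p)) *
      ip (GN d (h p)) (local_family.Wf h (GN d) p) (local_family.Wf h (GN d) p)"
  unfolding qv_def p_def
  by (simp add: good_model_metric[OF c d m tz] Hv_tangent[OF tz(2)] wv_tangent[OF tz(2)] good_model_formulas[OF c d m tz])

lemma good_model_phi:
  assumes d: "d \<in> N" and m: "good_model c d U h" and tz: "(t, z) \<in> U" "t \<in> {0..1}"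
  shows "\<phi> (f t (cinv c z)) = \<phi> (cinv d (h (t, z)))"
proof -
  have lm: "lmodel c d U h" using m by (simp add: good_model_def)
  show ?thesis using lmodelD(5,6)[OF lm tz] chart_props(5)[OF manifold_chart[OF N d]] by simp
qed

text \<open>The normal velocity does not see the tangential difference between \<open>Hf\<close> and
  \<open>Kf\<close>; this brings \<open>Qv\<close> into the form that occurs in
  \<open>first_variation\<close>.\<close>

lemma good_model_Qv:
  assumes c: "c \<in> M" and d: "d \<in> N" and m: "good_model c d U h" and tz: "(t, z) \<in> U" "t \<in> {0..1}"
    and \<phi>: "C1_fun N \<phi>"
  defines "p \<equiv> (t, z)"
  shows "Qv \<phi> t (cinv c z) = frechet_derivative (\<lambda>y. \<phi> (cinv d y)) (at (h p)) (local_family.Wf h (GN d) p) -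
    \<phi> (cinv d (h p)) * ip (GN d (h p)) (local_family.Kf h (GN d) p) (local_family.Wf h (GN d) p)"
proof -
  have lm: "lmodel c d U h" and lf: "local_family h U (GN d) (cmap d ` cdom d)"
    using m by (auto simp: good_model_def)
  interpret L: local_family h U "GN d" "cmap d ` cdom d" by (rule lf)
  have "ip (GN d (h p)) (L.Hf p) (L.Wf p) = ip (GN d (h p)) (L.Kf p) (L.Wf p)"
    using sympd_sym[OF L.pd[OF L.hpV[OF tz(1)]], of "L.Wf p"] L.Wf_orth[OF tz(1)]
    by (simp add: L.Hf_def nrm_def ip_bilinear p_def)
  moreover have "dfun N \<phi> (f t (cinv c z)) (wv t (cinv c z)) = frechet_derivative (\<lambda>y. \<phi> (cinv d y)) (at (h p)) (L.Wf p)"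
    using dfun_chart[OF N \<phi> d lmodelD(5)[OF lm tz] wv_tangent[OF tz(2)]] lmodelD(6)[OF lm tz]
    by (simp add: good_model_formulas[OF c d m tz] p_def)
  ultimately show ?thesis
    unfolding Qv_def
    by (simp add: good_model_metric[OF c d m tz] Hv_tangent[OF tz(2)] wv_tangent[OF tz(2)] good_model_formulas[OF c d m tz]
        good_model_phi[OF d m tz, of \<phi>] p_def)
qed

text \<open>A model exists around every point, so continuity on a whole chart can be checked model
  by model. The time set is a parameter because \<open>DPv\<close> is treated on the open interval
  and the other quantities on the closed one.\<close>

lemma continuous_on_model:
  assumes c: "c \<in> M" and I: "I \<subseteq> {0..1}"
    and loc: "\<And>d U h. d \<in> N \<Longrightarrow> good_model c d U h \<Longrightarrow>
      \<exists>\<psi>. continuous_on U \<psi> \<and> (\<forall>t z. (t, z) \<in> U \<longrightarrow> t \<in> I \<longrightarrow> u t z = \<psi> (t, z))"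
  shows "continuous_on (I \<times> cmap c ` cdom c) (\<lambda>(t, z). u t z)"
proof (rule continuous_on_local_model)
  fix p assume "p \<in> I \<times> cmap c ` cdom c"
  then obtain t z where p: "p = (t, z)" "t \<in> I" "z \<in> cmap c ` cdom c" by blast
  then have "t \<in> {0..1}" using I by auto
  then obtain d U h where m: "d \<in> N" "good_model c d U h" "(t, z) \<in> U"
    using model_at[OF _ c p(3)] by blast
  obtain \<psi> where "continuous_on U \<psi>" "\<And>t z. (t, z) \<in> U \<Longrightarrow> t \<in> I \<Longrightarrow> u t z = \<psi> (t, z)"
    using loc[OF m(1,2)] by blast
  moreover have "open U" using m(2) by (simp add: good_model_def lmodel_def)
  ultimately show "\<exists>U \<psi>. open U \<and> p \<in> U \<and> continuous_on U \<psi> \<and> (\<forall>q\<in>U \<inter> I \<times> cmap c ` cdom c. (case q of (t, z) \<Rightarrow> u t z) = \<psi> q)"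
    using m(3) p by (intro exI[of _ U] exI[of _ \<psi>]) auto
qed

lemma continuous_qv:
  assumes c: "c \<in> M"
  shows "continuous_on ({0..1} \<times> cmap c ` cdom c) (\<lambda>(t, z). qv t (cinv c z))"
proof (rule continuous_on_model[OF c order_refl])
  fix d U h assume m: "d \<in> N" "good_model c d U h"
  then interpret L: local_family h U "GN d" "cmap d ` cdom d" by (simp add: good_model_def)
  let ?\<psi> = "\<lambda>p. (1 + A * ip (GN d (h p)) (L.Hf p) (L.Hf p)) * ip (GN d (h p)) (L.Wf p) (L.Wf p)"
  have "Ck_on 0 U ?\<psi>"
    by (intro Ck_on_mult Ck_on_add Ck_on_const L.U L.Ck_on_ipG L.Ck_on_Hf L.Ck_on_Wf)
  then show "\<exists>\<psi>. continuous_on U \<psi> \<and> (\<forall>t z. (t, z) \<in> U \<longrightarrow> t \<in> {0..1} \<longrightarrow> qv t (cinv c z) = \<psi> (t, z))"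
    using good_model_qv[OF c m] by (intro exI[of _ ?\<psi>]) auto
qed

lemma continuous_Rv:
  assumes c: "c \<in> M"
  shows "continuous_on ({0..1} \<times> cmap c ` cdom c) (\<lambda>(t, z). sqrt (det (GM (f t) c z)))"
proof (rule continuous_on_model[OF c order_refl])
  fix d U h assume m: "d \<in> N" "good_model c d U h"
  then interpret L: local_family h U "GN d" "cmap d ` cdom d" by (simp add: good_model_def)
  show "\<exists>\<psi>. continuous_on U \<psi> \<and> (\<forall>t z. (t, z) \<in> U \<longrightarrow> t \<in> {0..1} \<longrightarrow> sqrt (det (GM (f t) c z)) = \<psi> (t, z))"
    using good_model_formulas(1)[OF c m] L.Ck_on_Rf[of 0] by (intro exI[of _ L.Rf]) auto
qed

lemma Ck_on_phi_h:
  assumes \<phi>: "C1_fun N \<phi>" and d: "d \<in> N" and m: "good_model c d U h"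
  shows "Ck_on (Suc 0) U (\<lambda>p. \<phi> (cinv d (h p)))"
proof -
  interpret L: local_family h U "GN d" "cmap d ` cdom d" using m by (simp add: good_model_def)
  have "Ck_on (Suc 0) (cmap d ` cdom d) (\<lambda>y. \<phi> (cinv d y))" using \<phi> d unfolding C1_fun_def by blast
  then show ?thesis by (rule Ck_on_compose[OF L.U _ L.h L.hV])
qed

lemma continuous_Qv:
  assumes c: "c \<in> M" and \<phi>: "C1_fun N \<phi>"
  shows "continuous_on ({0..1} \<times> cmap c ` cdom c) (\<lambda>(t, z). Qv \<phi> t (cinv c z))"
proof (rule continuous_on_model[OF c order_refl])
  fix d U h assume m: "d \<in> N" "good_model c d U h"
  then interpret L: local_family h U "GN d" "cmap d ` cdom d" by (simp add: good_model_def)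
  let ?\<phi> = "\<lambda>y. \<phi> (cinv d y)"
  have \<phi>1: "Ck_on (Suc 0) (cmap d ` cdom d) ?\<phi>" using \<phi> m(1) unfolding C1_fun_def by blast
  let ?\<psi> = "\<lambda>p. (\<Sum>k\<in>UNIV. L.Wf p $ k * frechet_derivative ?\<phi> (at (h p)) (axis k 1)) - ?\<phi> (h p) * ip (GN d (h p)) (L.Kf p) (L.Wf p)"
  have "Ck_on 0 U ?\<psi>"
    by (intro Ck_on_diff Ck_on_sum Ck_on_mult L.U L.Ck_on_Wf L.Ck_on_ipG L.Ck_on_Kf
        Ck_on_compose[OF L.U _ L.h L.hV] Ck_on_frechet[OF \<phi>1] Ck_on_Suc[OF \<phi>1])
  moreover have "Qv \<phi> t (cinv c z) = ?\<psi> (t, z)" if "(t, z) \<in> U" "t \<in> {0..1}" for t z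
  proof -
    have "linear (frechet_derivative ?\<phi> (at (h (t, z))))"
      by (rule has_derivative_linear[OF Ck_on_SucD[OF \<phi>1 L.hpV[OF that(1)]]])
    from linear_expand[OF this, of "L.Wf (t, z)"]
    show ?thesis using good_model_Qv[OF c m that \<phi>] by simp
  qed
  ultimately show "\<exists>\<psi>. continuous_on U \<psi> \<and> (\<forall>t z. (t, z) \<in> U \<longrightarrow> t \<in> {0..1} \<longrightarrow> Qv \<phi> t (cinv c z) = \<psi> (t, z))"
    by (intro exI[of _ ?\<psi>]) auto
qed

lemma model_PY:
  assumes c: "c \<in> M" and d: "d \<in> N" and m: "good_model c d U h" and tz: "(t, z) \<in> U" "t \<in> {0..1}"
  shows "Pv \<phi> c t z = \<phi> (cinv d (h (t, z))) * local_family.Rf h (GN d) (t, z)"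
    "Yv \<phi> c k t z = \<phi> (cinv d (h (t, z))) * local_family.Rf h (GN d) (t, z) * local_family.Xf h (GN d) (t, z) $ k"
  unfolding Yv_def Pv_def
  by (simp_all add: good_model_formulas[OF c d m tz] good_model_phi[OF d m tz, of \<phi>])

lemma Ck_on_Yv:
  assumes c: "c \<in> M" and \<phi>: "C1_fun N \<phi>" and t: "t \<in> {0..1}"
  shows "Ck_on (Suc 0) (cmap c ` cdom c) (Yv \<phi> c k t)"
proof (rule Ck_on_local)
  fix z assume z: "z \<in> cmap c ` cdom c"
  obtain d U h where m: "d \<in> N" "good_model c d U h" "(t, z) \<in> U" using model_at[OF t c z] by blast
  interpret L: local_family h U "GN d" "cmap d ` cdom d" using m(2) by (simp add: good_model_def)
  let ?S = "{z. (t, z) \<in> U}"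
  have S: "open ?S" by (rule open_slice[OF L.U])
  let ?w = "\<lambda>p. \<phi> (cinv d (h p)) * L.Rf p * L.Xf p $ k"
  have "Ck_on (Suc 0) U ?w"
    by (intro Ck_on_mult L.U Ck_on_phi_h[OF \<phi> m(1,2)] L.Ck_on_Rf L.Ck_on_Xf)
  then have "Ck_on (Suc 0) ?S (\<lambda>z. ?w (t, z))" by (rule Ck_on_slice[OF _ L.U S]) simp
  then have "Ck_on (Suc 0) ?S (Yv \<phi> c k t)"
    by (rule Ck_on_cong[OF S, rotated]) (simp add: model_PY(2)[OF c m(1,2) _ t])
  then show "\<exists>U. open U \<and> z \<in> U \<and> Ck_on (Suc 0) U (Yv \<phi> c k t)" using S m(3) by blast
qed

lemma continuous_Pv:
  assumes c: "c \<in> M" and \<phi>: "C1_fun N \<phi>"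
  shows "continuous_on ({0..1} \<times> cmap c ` cdom c) (\<lambda>(t, z). Pv \<phi> c t z)"
proof (rule continuous_on_model[OF c order_refl])
  fix d U h assume m: "d \<in> N" "good_model c d U h"
  then interpret L: local_family h U "GN d" "cmap d ` cdom d" by (simp add: good_model_def)
  let ?\<psi> = "\<lambda>p. \<phi> (cinv d (h p)) * L.Rf p"
  have "Ck_on (Suc 0) U ?\<psi>" by (intro Ck_on_mult L.U Ck_on_phi_h[OF \<phi> m] L.Ck_on_Rf)
  then show "\<exists>\<psi>. continuous_on U \<psi> \<and> (\<forall>t z. (t, z) \<in> U \<longrightarrow> t \<in> {0..1} \<longrightarrow> Pv \<phi> c t z = \<psi> (t, z))"
    using model_PY(1)[OF c m] Ck_on_imp_continuous by (intro exI[of _ ?\<psi>]) blast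
qed

text \<open>The right-hand side of the first variation formula in terms that mention no model. It is
  thus one function on the whole chart, to which differentiation under the integral can be
  applied.\<close>

definition DPv where
  "DPv \<phi> c t z = sqrt (det (GM (f t) c z)) * Qv \<phi> t (cinv c z) + (\<Sum>k\<in>UNIV. frechet_derivative (Yv \<phi> c k t) (at z) (axis k 1))"

lemma model_DPv:
  assumes c: "c \<in> M" and \<phi>: "C1_fun N \<phi>" and m: "d \<in> N" "good_model c d U h" and tz: "(t, z) \<in> U" "t \<in> {0<..<1}"
  shows "DPv \<phi> c t z = frechet_derivative (\<lambda>p. \<phi> (cinv d (h p)) * local_family.Rf h (GN d) p) (at (t, z)) (1, 0)"
proof -
  interpret L: local_family h U "GN d" "cmap d ` cdom d" using m(2) by (simp add: good_model_def)
  have t: "t \<in> {0..1}" using tz by auto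
  have \<phi>1: "Ck_on (Suc 0) (cmap d ` cdom d) (\<lambda>y. \<phi> (cinv d y))" using \<phi> m(1) unfolding C1_fun_def by blast
  have "frechet_derivative (Yv \<phi> c k t) (at z) v =
      frechet_derivative (\<lambda>p. \<phi> (cinv d (h p)) * L.Rf p * L.Xf p $ k) (at (t, z)) (0, v)" for k v
  proof -
    let ?w = "\<lambda>p. \<phi> (cinv d (h p)) * L.Rf p * L.Xf p $ k"
    have "Ck_on (Suc 0) U ?w"
      by (intro Ck_on_mult L.U Ck_on_phi_h[OF \<phi> m] L.Ck_on_Rf L.Ck_on_Xf)
    from slice_derivative[OF Ck_on_SucD[OF this tz(1)]]
    have "((\<lambda>z. ?w (t, z)) has_derivative (\<lambda>v. frechet_derivative ?w (at (t, z)) (0, v))) (at z)" .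
    then have "(Yv \<phi> c k t has_derivative (\<lambda>v. frechet_derivative ?w (at (t, z)) (0, v))) (at z)"
      by (rule has_derivative_transform_within_open[OF _ open_slice[OF L.U, of t]]) (use tz(1) model_PY(2)[OF c m _ t] in auto)
    then show ?thesis by (simp add: frechet_derivative_at[symmetric])
  qed
  then show ?thesis
    unfolding DPv_def L.first_variation[OF tz(1) \<phi>1] good_model_Qv[OF c m tz(1) t \<phi>] good_model_formulas(1)[OF c m tz(1) t]
    by simp
qed

lemma Pv_derivative:
  assumes c: "c \<in> M" and \<phi>: "C1_fun N \<phi>" and t: "t \<in> {0<..<1}" and z: "z \<in> cmap c ` cdom c"
  shows "((\<lambda>s. Pv \<phi> c s z) has_real_derivative DPv \<phi> c t z) (at t)"
proof -
  have t': "t \<in> {0..1}" using t by auto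
  obtain d U h where m: "d \<in> N" "good_model c d U h" "(t, z) \<in> U" using model_at[OF t' c z] by blast
  interpret L: local_family h U "GN d" "cmap d ` cdom d" using m(2) by (simp add: good_model_def)
  let ?w = "\<lambda>p. \<phi> (cinv d (h p)) * L.Rf p"
  have "Ck_on (Suc 0) U ?w" by (intro Ck_on_mult L.U Ck_on_phi_h[OF \<phi> m(1,2)] L.Ck_on_Rf)
  note wd = Ck_on_SucD[OF this m(3)]
  have "((\<lambda>s. ?w (s, z)) has_real_derivative frechet_derivative ?w (at (t, z)) (1, 0)) (at t)"
    using slice_derivative_left[OF wd] by (simp add: has_real_derivative_iff_has_vector_derivative)
  moreover have "open ({s. (s, z) \<in> U} \<inter> {0<..<1})" by (intro open_Int open_slice_left L.U) auto
  ultimately have "((\<lambda>s. Pv \<phi> c s z) has_real_derivative frechet_derivative ?w (at (t, z)) (1, 0)) (at t)"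
    by (rule has_field_derivative_transform_within_open)
      (use m t model_PY(1)[OF c m(1,2)] in auto)
  then show ?thesis using model_DPv[OF c \<phi> m(1,2,3) t] by simp
qed

lemma continuous_DPv:
  assumes c: "c \<in> M" and \<phi>: "C1_fun N \<phi>"
  shows "continuous_on ({0<..<1} \<times> cmap c ` cdom c) (\<lambda>(t, z). DPv \<phi> c t z)"
proof (rule continuous_on_model[OF c])
  fix d U h assume m: "d \<in> N" "good_model c d U h"
  then interpret L: local_family h U "GN d" "cmap d ` cdom d" by (simp add: good_model_def)
  let ?w = "\<lambda>p. \<phi> (cinv d (h p)) * L.Rf p"
  have "Ck_on (Suc 0) U ?w" by (intro Ck_on_mult L.U Ck_on_phi_h[OF \<phi> m] L.Ck_on_Rf)
  then have "continuous_on U (\<lambda>p. frechet_derivative ?w (at p) (1, 0))" by simp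
  then show "\<exists>\<psi>. continuous_on U \<psi> \<and> (\<forall>t z. (t, z) \<in> U \<longrightarrow> t \<in> {0<..<1} \<longrightarrow> DPv \<phi> c t z = \<psi> (t, z))"
    using model_DPv[OF c \<phi> m] by (intro exI[of _ "\<lambda>p. frechet_derivative ?w (at p) (1, 0)"]) auto
qed auto

end

section \<open>The localized volume along a path\<close>

locale riem_path_pou = riem_path M N g f A
  for M :: "('a::{t2_space,second_countable_topology}, 'm::finite) atlas"
    and N :: "('b::{t2_space,second_countable_topology}, 'n::finite) atlas"
    and g :: "('b, 'n) metric" and f :: "real \<Rightarrow> 'a \<Rightarrow> 'b" and A :: real +
  fixes I :: "'a set" and a b z0 :: "'a \<Rightarrow> real^'m" and r :: "'a \<Rightarrow> real" and \<zeta> :: "'a \<Rightarrow> 'a \<Rightarrow> real"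
    and \<phi> :: "'b \<Rightarrow> real"
  assumes I: "finite I"
    and box: "\<And>k. k \<in> I \<Longrightarrow> cbox (a k) (b k) \<subseteq> cmap (chart_at M k) ` cdom (chart_at M k)"
    and ball: "\<And>k. k \<in> I \<Longrightarrow> cball (z0 k) (r k) \<subseteq> cbox (a k) (b k)"
    and \<zeta>: "\<And>k. k \<in> I \<Longrightarrow> C1_fun M (\<zeta> k)"
    and supp: "\<And>k x. k \<in> I \<Longrightarrow> x \<notin> cinv (chart_at M k) ` cball (z0 k) (r k) \<Longrightarrow> \<zeta> k x = 0"
    and one: "\<And>x. (\<Sum>k\<in>I. \<zeta> k x) = 1"
    and \<phi>: "C1_fun N \<phi>"
begin

abbreviation "ch k \<equiv> chart_at M k"
abbreviation "B k \<equiv> cbox (a k) (b k)"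

lemma chM: "ch k \<in> M" by (rule chart_at_props(1)[OF M])

lemma \<zeta>_chart: "k \<in> I \<Longrightarrow> c \<in> M \<Longrightarrow> Ck_on (Suc 0) (cmap c ` cdom c) (\<lambda>z. \<zeta> k (cinv c z))"
  using \<zeta> unfolding C1_fun_def by blast

lemma continuous_\<zeta>B: "k \<in> I \<Longrightarrow> continuous_on (B k) (\<lambda>z. \<zeta> k (cinv (ch k) z))"
  using continuous_on_subset[OF Ck_on_imp_continuous[OF \<zeta>_chart[OF _ chM]] box] .

lemma continuous_cinvB: "k \<in> I \<Longrightarrow> continuous_on (B k) (cinv (ch k))"
  using continuous_on_subset[OF chart_props(4)[OF manifold_chart[OF M chM]] box] .

lemma integral_vol_ball:
  assumes f': "f' \<in> Imm M N" and k: "k \<in> I" and u: "continuous_on UNIV u"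
    and u0: "\<And>x. x \<notin> cinv (ch k) ` cball (z0 k) (r k) \<Longrightarrow> u x = 0"
  shows "(\<integral>x. u x \<partial>vol_of f') = integral (B k) (\<lambda>z. u (cinv (ch k) z) * sqrt (det (GM f' (ch k) z)))"
proof (rule integral_vol_chart[OF f' chM box[OF k]])
  show "u \<in> borel_measurable borel" by (rule borel_measurable_continuous_onI[OF u])
  show "u x = 0" if "x \<notin> cinv (ch k) ` B k" for x
    by (rule u0) (use that ball[OF k] in blast)
  show "continuous_on (B k) (\<lambda>z. u (cinv (ch k) z))"
    by (rule continuous_on_compose2[OF u continuous_cinvB[OF k]]) auto
qed

text \<open>The weights replace an integral over \<open>M\<close> against a moving measure by
  finitely many integrals over fixed boxes, with the dependence on the immersion in the integrand
  only.\<close>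

lemma integral_pou:
  assumes f': "f' \<in> Imm M N" and u: "continuous_on UNIV u"
  shows "(\<integral>x. u x \<partial>vol_of f') =
    (\<Sum>k\<in>I. integral (B k) (\<lambda>z. \<zeta> k (cinv (ch k) z) * u (cinv (ch k) z) * sqrt (det (GM f' (ch k) z))))"
proof -
  have c: "continuous_on UNIV (\<lambda>x. \<zeta> k x * u x)" if "k \<in> I" for k
    using C1_fun_continuous[OF M \<zeta>[OF that]] u by (intro continuous_on_mult)
  have "(\<integral>x. u x \<partial>vol_of f') = (\<integral>x. (\<Sum>k\<in>I. \<zeta> k x * u x) \<partial>vol_of f')"
    by (simp add: sum_distrib_right[symmetric] one)
  also have "\<dots> = (\<Sum>k\<in>I. \<integral>x. \<zeta> k x * u x \<partial>vol_of f')"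
    by (intro Bochner_Integration.integral_sum integrable_vol[OF f'] c)
  also have "\<dots> = (\<Sum>k\<in>I. integral (B k) (\<lambda>z. \<zeta> k (cinv (ch k) z) * u (cinv (ch k) z) * sqrt (det (GM f' (ch k) z))))"
    by (intro sum.cong refl integral_vol_ball f' c) (simp_all add: supp)
  finally show ?thesis .
qed

section \<open>Continuity and derivative of the localized volume\<close>

lemma continuous_t:
  assumes "\<And>c. c \<in> M \<Longrightarrow> continuous_on ({0..1} \<times> cmap c ` cdom c) (\<lambda>(t, z). u t (cinv c z))" "t \<in> {0..1}"
  shows "continuous_on UNIV (u t)"
  by (rule continuous_on_charts[OF M]) (rule slice_continuous[OF assms])

lemma continuous_\<phi>f: "t \<in> {0..1} \<Longrightarrow> continuous_on UNIV (\<lambda>x. \<phi> (f t x))"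
  using continuous_on_compose2[OF C1_fun_continuous[OF N \<phi>], of UNIV "f t"] smooth_t[of t] by (auto simp: smooth_map_def)

lemma continuous_Xv:
  assumes c: "c \<in> M"
  shows "continuous_on ({0..1} \<times> cmap c ` cdom c) (\<lambda>(t, z). Xv t (cinv c z) c $ i)"
proof (rule continuous_on_model[OF c order_refl])
  fix d U h assume m: "d \<in> N" "good_model c d U h"
  then interpret L: local_family h U "GN d" "cmap d ` cdom d" by (simp add: good_model_def)
  show "\<exists>\<psi>. continuous_on U \<psi> \<and> (\<forall>t z. (t, z) \<in> U \<longrightarrow> t \<in> {0..1} \<longrightarrow> Xv t (cinv c z) c $ i = \<psi> (t, z))"
    using good_model_formulas(3)[OF c m] L.Ck_on_Xf[of 0] by (intro exI[of _ "\<lambda>p. L.Xf p $ i"]) auto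
qed

definition \<Phi> where "\<Phi> t = (\<integral>x. \<phi> (f t x) \<partial>vol_of (f t))"

lemma \<Phi>_pou: "t \<in> {0..1} \<Longrightarrow> \<Phi> t = (\<Sum>k\<in>I. integral (B k) (\<lambda>z. \<zeta> k (cinv (ch k) z) * Pv \<phi> (ch k) t z))"
  unfolding \<Phi>_def using integral_pou[OF imm continuous_\<phi>f] by (simp add: Pv_def mult.assoc)

lemma continuous_on_boxes:
  assumes k: "k \<in> I" and u: "continuous_on (J \<times> cmap (ch k) ` cdom (ch k)) (\<lambda>(t, z). u t z)"
  shows "continuous_on (J \<times> B k) (\<lambda>(t, z). \<zeta> k (cinv (ch k) z) * u t z)"
proof -
  have "continuous_on (J \<times> B k) (\<lambda>p. \<zeta> k (cinv (ch k) (snd p)))"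
    by (rule continuous_on_compose2[OF continuous_\<zeta>B[OF k]]) (auto intro: continuous_on_snd continuous_on_id)
  moreover have "continuous_on (J \<times> B k) (\<lambda>p. u (fst p) (snd p))"
    by (rule continuous_on_subset[OF u[unfolded split_beta]]) (use box[OF k] in auto)
  ultimately show ?thesis unfolding split_beta by (rule continuous_on_mult)
qed

lemma continuous_\<Phi>: "continuous_on {0..1} \<Phi>"
proof -
  have "continuous_on {0..1} (\<lambda>t. \<Sum>k\<in>I. integral (B k) (\<lambda>z. \<zeta> k (cinv (ch k) z) * Pv \<phi> (ch k) t z))"
    by (intro continuous_on_sum integral_continuous_on_param continuous_on_boxes continuous_Pv chM \<phi>)
  then show ?thesis by (rule continuous_on_eq) (simp add: \<Phi>_pou)
qed

definition energy where "energy t = (\<integral>x. qv t x \<partial>vol_of (f t))"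

lemma continuous_qvR:
  assumes c: "c \<in> M"
  shows "continuous_on ({0..1} \<times> cmap c ` cdom c) (\<lambda>(t, z). qv t (cinv c z) * sqrt (det (GM (f t) c z)))"
  using continuous_on_mult[OF continuous_qv[OF c] continuous_Rv[OF c]] by (simp add: split_beta)

lemma continuous_energy: "continuous_on {0..1} energy"
proof -
  have "continuous_on {0..1} (\<lambda>t. \<Sum>k\<in>I. integral (B k) (\<lambda>z. \<zeta> k (cinv (ch k) z) * (qv t (cinv (ch k) z) * sqrt (det (GM (f t) (ch k) z)))))"
    by (intro continuous_on_sum integral_continuous_on_param continuous_on_boxes continuous_qvR chM)
  then show ?thesis
    by (rule continuous_on_eq)
      (simp add: energy_def integral_pou[OF imm continuous_t[OF continuous_qv]] mult.assoc)
qed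

lemma \<Phi>_derivative_pou:
  assumes t: "t \<in> {0<..<1}"
  shows "(\<Phi> has_real_derivative (\<Sum>k\<in>I. integral (B k) (\<lambda>z. \<zeta> k (cinv (ch k) z) * DPv \<phi> (ch k) t z))) (at t)"
proof -
  have "((\<lambda>t. integral (B k) (\<lambda>z. \<zeta> k (cinv (ch k) z) * Pv \<phi> (ch k) t z)) has_real_derivative
      integral (B k) (\<lambda>z. \<zeta> k (cinv (ch k) z) * DPv \<phi> (ch k) t z)) (at t within {0<..<1})" if k: "k \<in> I" for k
  proof (rule leibniz_rule_field_derivative)
    fix s z assume s: "s \<in> {0<..<1::real}" and z: "z \<in> B k"
    have "((\<lambda>s. Pv \<phi> (ch k) s z) has_real_derivative DPv \<phi> (ch k) s z) (at s within {0<..<1})"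
      using Pv_derivative[OF chM \<phi> s] z box[OF k] by (blast intro: has_field_derivative_at_within)
    from DERIV_cmult[OF this]
    show "((\<lambda>s. \<zeta> k (cinv (ch k) z) * Pv \<phi> (ch k) s z) has_real_derivative \<zeta> k (cinv (ch k) z) * DPv \<phi> (ch k) s z) (at s within {0<..<1})" .
  next
    fix s assume s: "s \<in> {0<..<1::real}"
    then have s': "s \<in> {0..1}" by auto
    show "(\<lambda>z. \<zeta> k (cinv (ch k) z) * Pv \<phi> (ch k) s z) integrable_on B k"
      by (rule integrable_continuous, rule slice_continuous[OF continuous_on_boxes[OF k continuous_Pv[OF chM \<phi>]] s'])
  next
    show "continuous_on ({0<..<1} \<times> B k) (\<lambda>(s, z). \<zeta> k (cinv (ch k) z) * DPv \<phi> (ch k) s z)"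
      by (rule continuous_on_boxes[OF k continuous_DPv[OF chM \<phi>]])
  qed (use t in auto)
  then have "((\<lambda>t. \<Sum>k\<in>I. integral (B k) (\<lambda>z. \<zeta> k (cinv (ch k) z) * Pv \<phi> (ch k) t z)) has_real_derivative
      (\<Sum>k\<in>I. integral (B k) (\<lambda>z. \<zeta> k (cinv (ch k) z) * DPv \<phi> (ch k) t z))) (at t within {0<..<1})"
    by (rule DERIV_sum)
  then have "((\<lambda>t. \<Sum>k\<in>I. integral (B k) (\<lambda>z. \<zeta> k (cinv (ch k) z) * Pv \<phi> (ch k) t z)) has_real_derivative
      (\<Sum>k\<in>I. integral (B k) (\<lambda>z. \<zeta> k (cinv (ch k) z) * DPv \<phi> (ch k) t z))) (at t)"
    using at_within_open[OF t open_greaterThanLessThan] by simp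
  then show ?thesis
    by (rule has_field_derivative_transform_within_open[where S = "{0<..<1}"]) (use t in \<open>auto simp: \<Phi>_pou\<close>)
qed

lemma dfun_expand:
  assumes \<chi>: "C1_fun M u" and c: "c \<in> M" "x \<in> cdom c" and X: "X \<in> tangent_space M x"
  shows "dfun M u x X = (\<Sum>i\<in>UNIV. X c $ i * frechet_derivative (\<lambda>z. u (cinv c z)) (at (cmap c x)) (axis i 1))"
  unfolding dfun_chart[OF M \<chi> c X]
  using linear_expand[OF has_derivative_linear[OF C1_fun_has_derivative[OF \<chi> c]], of "X c"] by simp

lemma Xv_tangent: "t \<in> {0..1} \<Longrightarrow> Xv t x \<in> tangent_space M x"
  by (rule tangent_part_props(1)[OF imm velocity_tangent])

lemma continuous_dfun:
  assumes t: "t \<in> {0..1}" and k: "k \<in> I"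
  shows "continuous_on UNIV (\<lambda>x. \<phi> (f t x) * dfun M (\<zeta> k) x (Xv t x))"
proof (intro continuous_on_mult continuous_\<phi>f t continuous_on_charts[OF M])
  fix c assume c: "c \<in> M"
  note chc = manifold_chart[OF M c]
  have "continuous_on (cmap c ` cdom c) (\<lambda>z. \<Sum>i\<in>UNIV. Xv t (cinv c z) c $ i * frechet_derivative (\<lambda>z. \<zeta> k (cinv c z)) (at z) (axis i 1))"
    using \<zeta>_chart[OF k c] by (intro continuous_on_sum continuous_on_mult slice_continuous[OF continuous_Xv[OF c] t]) simp
  then show "continuous_on (cmap c ` cdom c) (\<lambda>z. dfun M (\<zeta> k) (cinv c z) (Xv t (cinv c z)))"
    by (rule continuous_on_eq)
      (simp add: dfun_expand[OF \<zeta>[OF k] c chart_props(7)[OF chc] Xv_tangent[OF t]] chart_props(6)[OF chc])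
qed

lemma dfun_support:
  assumes k: "k \<in> I" and x: "x \<notin> cinv (ch k) ` cball (z0 k) (r k)"
  shows "dfun M (\<zeta> k) x X = 0"
proof (rule dfun_outside[OF M _ x supp[OF k]])
  have "cball (z0 k) (r k) \<subseteq> cmap (ch k) ` cdom (ch k)" using box[OF k] ball[OF k] by (rule order_trans[rotated])
  then show "closed (cinv (ch k) ` cball (z0 k) (r k))"
    by (intro compact_imp_closed compact_chart_ball manifold_chart[OF M chM])
qed

text \<open>The differential of the constant function 1. Integration by parts against \<zeta> leaves
  one error term per chart, and this identity makes their sum vanish.\<close>

lemma dfun_sum:
  assumes X: "X \<in> tangent_space M x"
  shows "(\<Sum>k\<in>I. dfun M (\<zeta> k) x X) = 0"
proof -
  define c where "c = chart_at M x"
  note c = chart_at_props[OF M, of x, folded c_def]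
  have "((\<lambda>z. \<Sum>k\<in>I. \<zeta> k (cinv c z)) has_derivative
      (\<lambda>v. \<Sum>k\<in>I. frechet_derivative (\<lambda>z. \<zeta> k (cinv c z)) (at (cmap c x)) v)) (at (cmap c x))"
    by (intro has_derivative_sum C1_fun_has_derivative[OF \<zeta> c])
  then have "(\<lambda>v. \<Sum>k\<in>I. frechet_derivative (\<lambda>z. \<zeta> k (cinv c z)) (at (cmap c x)) v) = (\<lambda>v. 0)"
    unfolding one by (rule has_derivative_unique[OF _ has_derivative_const])
  then show ?thesis unfolding dfun_def c_def[symmetric] by (rule fun_cong)
qed

text \<open>The divergence theorem in one chart: \<zeta> times the divergence of \<open>Yv\<close>
  is the divergence of the product, which integrates to zero by compact support, minus the
  derivative of \<zeta> along the tangential velocity. The remaining term is written as an integral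
  over \<open>M\<close>, so that the terms from different charts can be added.\<close>

lemma \<Phi>_derivative_chart:
  assumes t: "t \<in> {0<..<1}" and k: "k \<in> I"
  shows "integral (B k) (\<lambda>z. \<zeta> k (cinv (ch k) z) * DPv \<phi> (ch k) t z) =
    integral (B k) (\<lambda>z. \<zeta> k (cinv (ch k) z) * Qv \<phi> t (cinv (ch k) z) * sqrt (det (GM (f t) (ch k) z))) -
    (\<integral>x. \<phi> (f t x) * dfun M (\<zeta> k) x (Xv t x) \<partial>vol_of (f t))"
proof -
  have t': "t \<in> {0..1}" using t by auto
  let ?V = "cmap (ch k) ` cdom (ch k)"
  note chk = manifold_chart[OF M chM[of k]]
  have V: "open ?V" by (rule chart_props(2)[OF chk])
  let ?\<zeta> = "\<lambda>z. \<zeta> k (cinv (ch k) z)"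
  let ?Y = "\<lambda>i. Yv \<phi> (ch k) i t"
  have \<zeta>1: "Ck_on (Suc 0) ?V ?\<zeta>" by (rule \<zeta>_chart[OF k chM])
  have Y1: "Ck_on (Suc 0) ?V (?Y i)" for i by (rule Ck_on_Yv[OF chM \<phi> t'])
  have \<zeta>Y: "Ck_on (Suc 0) ?V (\<lambda>z. ?\<zeta> z * ?Y i z)" for i by (rule Ck_on_mult[OF V \<zeta>1 Y1])
  have zero: "integral (B k) (\<lambda>z. frechet_derivative (\<lambda>z. ?\<zeta> z * ?Y i z) (at z) (axis i 1)) = 0" for i
  proof (rule integral_directional_derivative_open[OF V \<zeta>Y compact_cball ball[OF k] box[OF k]])
    fix z assume z: "z \<in> ?V" "z \<notin> cball (z0 k) (r k)"
    have "cinv (ch k) z \<notin> cinv (ch k) ` cball (z0 k) (r k)"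
    proof
      assume "cinv (ch k) z \<in> cinv (ch k) ` cball (z0 k) (r k)"
      then obtain w where w: "w \<in> cball (z0 k) (r k)" "cinv (ch k) z = cinv (ch k) w" by blast
      have "w \<in> ?V" using w(1) ball[OF k] box[OF k] by blast
      then have "w = z" using chart_props(6)[OF chk z(1)] chart_props(6)[OF chk] w(2) by metis
      then show False using w(1) z(2) by simp
    qed
    then show "?\<zeta> z * ?Y i z = 0" using supp[OF k] by simp
  qed
  have prod: "frechet_derivative (\<lambda>z. ?\<zeta> z * ?Y i z) (at z) v =
      ?\<zeta> z * frechet_derivative (?Y i) (at z) v + frechet_derivative ?\<zeta> (at z) v * ?Y i z" if "z \<in> ?V" for i z v
    using frechet_derivative_at[OF has_derivative_mult[OF Ck_on_SucD[OF \<zeta>1 that] Ck_on_SucD[OF Y1[of i] that]]]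
    by (metis (mono_tags, lifting))
  have tang: "(\<Sum>i\<in>UNIV. frechet_derivative ?\<zeta> (at z) (axis i 1) * ?Y i z) =
      \<phi> (f t (cinv (ch k) z)) * dfun M (\<zeta> k) (cinv (ch k) z) (Xv t (cinv (ch k) z)) * sqrt (det (GM (f t) (ch k) z))" if "z \<in> ?V" for z
    unfolding dfun_expand[OF \<zeta>[OF k] chM chart_props(7)[OF chk that] Xv_tangent[OF t']] chart_props(6)[OF chk that]
    by (simp add: Yv_def Pv_def sum_distrib_left sum_distrib_right mult_ac)
  have eq: "?\<zeta> z * DPv \<phi> (ch k) t z =
      ?\<zeta> z * Qv \<phi> t (cinv (ch k) z) * sqrt (det (GM (f t) (ch k) z)) +
      (\<Sum>i\<in>UNIV. frechet_derivative (\<lambda>z. ?\<zeta> z * ?Y i z) (at z) (axis i 1)) -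
      \<phi> (f t (cinv (ch k) z)) * dfun M (\<zeta> k) (cinv (ch k) z) (Xv t (cinv (ch k) z)) * sqrt (det (GM (f t) (ch k) z))"
    if "z \<in> B k" for z
  proof -
    have z: "z \<in> ?V" using that box[OF k] by blast
    show ?thesis unfolding prod[OF z] tang[OF z, symmetric] DPv_def
      by (simp add: sum.distrib sum_distrib_left algebra_simps)
  qed
  have R: "continuous_on (B k) (\<lambda>z. sqrt (det (GM (f t) (ch k) z)))"
    by (rule continuous_on_subset[OF slice_continuous[OF continuous_Rv[OF chM] t'] box[OF k]])
  have i1: "(\<lambda>z. ?\<zeta> z * Qv \<phi> t (cinv (ch k) z) * sqrt (det (GM (f t) (ch k) z))) integrable_on B k"
    by (intro integrable_continuous continuous_on_mult R continuous_\<zeta>B k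
        continuous_on_subset[OF slice_continuous[OF continuous_Qv[OF chM \<phi>] t'] box[OF k]])
  have i2: "(\<lambda>z. frechet_derivative (\<lambda>z. ?\<zeta> z * ?Y i z) (at z) (axis i 1)) integrable_on B k" for i
    using \<zeta>Y[of i] by (intro integrable_continuous continuous_on_subset[OF _ box[OF k]]) simp
  have i3: "(\<lambda>z. \<phi> (f t (cinv (ch k) z)) * dfun M (\<zeta> k) (cinv (ch k) z) (Xv t (cinv (ch k) z)) * sqrt (det (GM (f t) (ch k) z))) integrable_on B k"
    by (intro integrable_continuous continuous_on_mult[OF _ R]
        continuous_on_compose2[OF continuous_dfun[OF t' k] continuous_cinvB[OF k]]) auto
  have i4: "(\<lambda>z. \<Sum>i\<in>UNIV. frechet_derivative (\<lambda>z. ?\<zeta> z * ?Y i z) (at z) (axis i 1)) integrable_on B k"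
    by (intro integrable_sum i2) auto
  have "integral (B k) (\<lambda>z. ?\<zeta> z * DPv \<phi> (ch k) t z) =
      integral (B k) (\<lambda>z. ?\<zeta> z * Qv \<phi> t (cinv (ch k) z) * sqrt (det (GM (f t) (ch k) z))) +
      integral (B k) (\<lambda>z. \<Sum>i\<in>UNIV. frechet_derivative (\<lambda>z. ?\<zeta> z * ?Y i z) (at z) (axis i 1)) -
      integral (B k) (\<lambda>z. \<phi> (f t (cinv (ch k) z)) * dfun M (\<zeta> k) (cinv (ch k) z) (Xv t (cinv (ch k) z)) * sqrt (det (GM (f t) (ch k) z)))"
    unfolding integral_diff[OF integrable_add[OF i1 i4] i3, symmetric] integral_add[OF i1 i4, symmetric]
    by (rule integral_cong[OF eq])
  also have "integral (B k) (\<lambda>z. \<Sum>i\<in>UNIV. frechet_derivative (\<lambda>z. ?\<zeta> z * ?Y i z) (at z) (axis i 1)) = 0"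
    by (subst integral_sum) (auto simp: zero i2)
  also have "integral (B k) (\<lambda>z. \<phi> (f t (cinv (ch k) z)) * dfun M (\<zeta> k) (cinv (ch k) z) (Xv t (cinv (ch k) z)) * sqrt (det (GM (f t) (ch k) z))) =
      (\<integral>x. \<phi> (f t x) * dfun M (\<zeta> k) x (Xv t x) \<partial>vol_of (f t))"
    by (rule integral_vol_ball[OF imm[OF t'] k continuous_dfun[OF t' k], symmetric])
      (simp add: dfun_support[OF k])
  finally show ?thesis by simp
qed

lemma \<Phi>_derivative:
  assumes t: "t \<in> {0<..<1}"
  shows "(\<Phi> has_real_derivative (\<integral>x. Qv \<phi> t x \<partial>vol_of (f t))) (at t)"
proof -
  have t': "t \<in> {0..1}" using t by auto
  have "(\<Sum>k\<in>I. \<integral>x. \<phi> (f t x) * dfun M (\<zeta> k) x (Xv t x) \<partial>vol_of (f t)) =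
      (\<integral>x. (\<Sum>k\<in>I. \<phi> (f t x) * dfun M (\<zeta> k) x (Xv t x)) \<partial>vol_of (f t))"
    by (intro Bochner_Integration.integral_sum[symmetric] integrable_vol imm t' continuous_dfun)
  also have "\<dots> = 0"
    unfolding sum_distrib_left[symmetric] by (simp add: dfun_sum[OF Xv_tangent[OF t']])
  finally have "(\<Sum>k\<in>I. integral (B k) (\<lambda>z. \<zeta> k (cinv (ch k) z) * DPv \<phi> (ch k) t z)) =
      (\<integral>x. Qv \<phi> t x \<partial>vol_of (f t))"
    using integral_pou[OF imm[OF t'] continuous_t[OF continuous_Qv[OF _ \<phi>] t']]
    by (simp add: \<Phi>_derivative_chart[OF t] sum_subtractf)
  then show ?thesis using \<Phi>_derivative_pou[OF t] by simp
qed

lemma qv_nonneg: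
  assumes "t \<in> {0..1}"
  shows "qv t x \<ge> 0"
  using metric_nonneg[OF N g Hv_tangent[OF assms]] metric_nonneg[OF N g wv_tangent[OF assms]] A
  by (simp add: qv_def)

lemma L_hor_energy: "L_hor M N g A f = integral {0..1} (\<lambda>t. sqrt (energy t))"
  by (simp add: L_hor_def energy_def G_metric_def qv_def Let_def)

text \<open>\<open>C\<close> bounds the gradient term, using 1 \<le> sqrt (1 + A |H|^2). The
  quotient \<open>D / sqrt A\<close> bounds the curvature term, using \<phi> \<le> D \<psi> and |H|
  \<le> sqrt (1 + A |H|^2) / sqrt A. The factor 1/2 comes from differentiating the square
  root.\<close>

theorem localized_volume_bound:
  assumes \<psi>: "\<And>y. \<phi> y = (\<psi> y)\<^sup>2" "\<And>y. 0 \<le> \<psi> y" "\<And>y. \<psi> y \<le> D"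
    and d\<phi>: "\<And>y w. w \<in> tangent_space N y \<Longrightarrow> \<bar>dfun N \<phi> y w\<bar> \<le> C * \<psi> y * sqrt (g y w w)"
    and C: "0 \<le> C" and \<epsilon>: "\<epsilon> > 0"
  shows "\<bar>sqrt (\<Phi> 1 + \<epsilon>) - sqrt (\<Phi> 0 + \<epsilon>)\<bar> \<le> (C + D / sqrt A) / 2 * L_hor M N g A f"
proof -
  define C' where "C' = C + D / sqrt A"
  have D: "0 \<le> D" using \<psi>(2,3) order_trans by blast
  have C': "0 \<le> C'" unfolding C'_def using C D A by simp
  have \<Phi>nn: "\<Phi> t \<ge> 0" for t unfolding \<Phi>_def \<psi>(1) by simp
  have Enn: "energy t \<ge> 0" if "t \<in> {0..1}" for t
    unfolding energy_def by (rule Bochner_Integration.integral_nonneg) (rule qv_nonneg[OF that])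
  have Q: "\<bar>Qv \<phi> t x\<bar> \<le> C' * (\<psi> (f t x) * sqrt (qv t x))" if t: "t \<in> {0..1}" for t x
  proof -
    note w = wv_tangent[OF t, of x] and H = Hv_tangent[OF t, of x]
    define W where "W = sqrt (g (f t x) (wv t x) (wv t x))"
    define h where "h = sqrt (g (f t x) (Hv t x) (Hv t x))"
    have W: "W \<ge> 0" and h: "h \<ge> 0" unfolding W_def h_def using metric_nonneg[OF N g] w H by auto
    have h2: "g (f t x) (Hv t x) (Hv t x) = h\<^sup>2" unfolding h_def using metric_nonneg[OF N g H] by simp
    define s where "s = sqrt (1 + A * h\<^sup>2)"
    have s: "s \<ge> 1" "sqrt A * h \<le> s"
    proof -
      show "s \<ge> 1" unfolding s_def using A by simp
      have "sqrt (A * h\<^sup>2) \<le> s" unfolding s_def by (rule real_sqrt_le_mono) simp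
      then show "sqrt A * h \<le> s" using h by (simp add: real_sqrt_mult)
    qed
    have q: "sqrt (qv t x) = s * W" unfolding qv_def h2 s_def W_def by (rule real_sqrt_mult)
    have "\<bar>\<phi> (f t x) * g (f t x) (Hv t x) (wv t x)\<bar> \<le> (\<psi> (f t x))\<^sup>2 * (h * W)"
      unfolding abs_mult \<psi>(1) h_def W_def using metric_cauchy[OF N g H w] by (intro mult_mono) auto
    also have "\<dots> \<le> (\<psi> (f t x) * D) * (h * W)"
      unfolding power2_eq_square using \<psi>(2,3) W h by (intro mult_right_mono mult_left_mono) auto
    finally have 1: "\<bar>\<phi> (f t x) * g (f t x) (Hv t x) (wv t x)\<bar> \<le> \<psi> (f t x) * W * (D * h)" by (simp add: mult_ac)
    have "D * h \<le> D / sqrt A * s"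
    proof -
      have "h \<le> s / sqrt A" using s(2) A by (simp add: field_simps)
      then show ?thesis using D mult_left_mono[of h "s / sqrt A" D] by (simp add: field_simps)
    qed
    then have "\<psi> (f t x) * W * (D * h) \<le> \<psi> (f t x) * W * (D / sqrt A * s)"
      using \<psi>(2) W by (intro mult_left_mono) auto
    moreover have "C * \<psi> (f t x) * W \<le> \<psi> (f t x) * W * (C * s)"
    proof -
      have "C \<le> C * s" using C s(1) by (simp add: mult_le_cancel_left1)
      then have "\<psi> (f t x) * W * C \<le> \<psi> (f t x) * W * (C * s)" using \<psi>(2) W by (intro mult_left_mono) auto
      then show ?thesis by (simp add: mult_ac)
    qed
    moreover have "\<bar>Qv \<phi> t x\<bar> \<le> C * \<psi> (f t x) * W + \<psi> (f t x) * W * (D * h)"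
      using d\<phi>[OF w] 1 unfolding Qv_def W_def by linarith
    ultimately have "\<bar>Qv \<phi> t x\<bar> \<le> \<psi> (f t x) * W * (C * s) + \<psi> (f t x) * W * (D / sqrt A * s)" by linarith
    also have "\<dots> = C' * (\<psi> (f t x) * sqrt (qv t x))" unfolding q C'_def by (simp add: algebra_simps)
    finally show ?thesis .
  qed
  \<comment> \<open>The Cauchy-Schwarz inequality as a weighted arithmetic-geometric mean
    inequality: the free weight \<open>l\<close> allows a pointwise estimate to be integrated term
    by term and is chosen afterwards.\<close>
  have bound: "\<bar>\<integral>x. Qv \<phi> t x \<partial>vol_of (f t)\<bar> \<le> C' / 2 * (l * \<Phi> t + energy t / l)"
    if t: "t \<in> {0..1}" and l: "l > 0" for t l
  proof -
    have iq: "integrable (vol_of (f t)) (qv t)" by (rule integrable_vol[OF imm[OF t] continuous_t[OF continuous_qv t]])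
    have i\<phi>: "integrable (vol_of (f t)) (\<lambda>x. \<phi> (f t x))" by (rule integrable_vol[OF imm[OF t] continuous_\<phi>f[OF t]])
    have iQ: "integrable (vol_of (f t)) (Qv \<phi> t)" by (rule integrable_vol[OF imm[OF t] continuous_t[OF continuous_Qv[OF _ \<phi>] t]])
    have pt: "\<bar>Qv \<phi> t x\<bar> \<le> C' / 2 * (l * \<phi> (f t x) + qv t x / l)" for x
    proof -
      define y where "y = sqrt (qv t x)"
      have y: "qv t x = y\<^sup>2" unfolding y_def using qv_nonneg[OF t] by simp
      have "0 \<le> (l * \<psi> (f t x) - y)\<^sup>2 / l" using l by simp
      also have "(l * \<psi> (f t x) - y)\<^sup>2 / l = l * (\<psi> (f t x))\<^sup>2 + y\<^sup>2 / l - 2 * (\<psi> (f t x) * y)"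
        using l by (simp add: power2_eq_square field_simps)
      finally have "\<psi> (f t x) * y \<le> (l * (\<psi> (f t x))\<^sup>2 + y\<^sup>2 / l) / 2" by simp
      then have "C' * (\<psi> (f t x) * y) \<le> C' * ((l * (\<psi> (f t x))\<^sup>2 + y\<^sup>2 / l) / 2)" by (rule mult_left_mono[OF _ C'])
      also have "\<dots> = C' / 2 * (l * \<phi> (f t x) + qv t x / l)" unfolding \<psi>(1) y by simp
      finally show ?thesis using Q[OF t, of x] unfolding y_def[symmetric] by (rule order_trans[rotated])
    qed
    have "\<bar>\<integral>x. Qv \<phi> t x \<partial>vol_of (f t)\<bar> \<le> (\<integral>x. \<bar>Qv \<phi> t x\<bar> \<partial>vol_of (f t))"
      using integral_norm_bound[of "vol_of (f t)" "Qv \<phi> t"] by simp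
    also have "\<dots> \<le> (\<integral>x. C' / 2 * (l * \<phi> (f t x) + qv t x / l) \<partial>vol_of (f t))"
      by (intro integral_mono pt integrable_abs iQ integrable_mult_right Bochner_Integration.integrable_add integrable_divide iq i\<phi>)
    also have "\<dots> = C' / 2 * (l * \<Phi> t + energy t / l)"
      using iq i\<phi> by (simp add: \<Phi>_def energy_def)
    finally show ?thesis .
  qed
  define \<Phi>' where "\<Phi>' = (\<lambda>t. \<integral>x. Qv \<phi> t x \<partial>vol_of (f t))"
  \<comment> \<open>The weight is the ratio \<open>G / F\<close> of the square roots of the energy
    and of the shifted volume. It is positive only if the energy is, hence the case
    distinction.\<close>
  have cs: "\<bar>\<Phi>' t\<bar> \<le> C' * (sqrt (energy t) * sqrt (\<Phi> t + \<epsilon>))" if t: "t \<in> {0..1}" for t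
  proof (cases "energy t = 0")
    case False
    define G where "G = sqrt (energy t)"
    define F where "F = sqrt (\<Phi> t + \<epsilon>)"
    have G: "G > 0" unfolding G_def using False Enn[OF t] by simp
    have F: "F > 0" unfolding F_def using \<Phi>nn[of t] \<epsilon> by simp
    have e: "energy t = G\<^sup>2" unfolding G_def using Enn[OF t] by simp
    have "\<Phi> t \<le> F\<^sup>2" unfolding F_def using \<Phi>nn[of t] \<epsilon> by simp
    then have "G / F * \<Phi> t \<le> G / F * F\<^sup>2" using F G by (intro mult_left_mono) auto
    also have "\<dots> = G * F" using F by (simp add: power2_eq_square)
    finally have "G / F * \<Phi> t + energy t / (G / F) \<le> 2 * (G * F)" using G F by (simp add: e power2_eq_square mult.commute)
    then have "C' / 2 * (G / F * \<Phi> t + energy t / (G / F)) \<le> C' / 2 * (2 * (G * F))" using C' by (intro mult_left_mono) auto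
    then show ?thesis using bound[OF t, of "G / F"] G F unfolding \<Phi>'_def G_def[symmetric] F_def[symmetric] by simp
  next
    case True
    have "\<Phi>' t = 0"
    proof (rule ccontr)
      assume ne: "\<Phi>' t \<noteq> 0"
      define K where "K = C' / 2 * \<Phi> t"
      have K: "K \<ge> 0" unfolding K_def using C' \<Phi>nn by simp
      \<comment> \<open>With zero energy the bound is \<open>l * K\<close> for every positive
        \<open>l\<close>. This weight makes it at most half of the left-hand side; the 1 in the
        denominator covers the case that \<open>K\<close> is zero.\<close>
      define l where "l = \<bar>\<Phi>' t\<bar> / (2 * (K + 1))"
      have l: "l > 0" unfolding l_def using ne K by simp
      have "\<bar>\<Phi>' t\<bar> \<le> l * K" using bound[OF t l] by (simp add: True K_def \<Phi>'_def mult_ac)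
      also have "\<dots> \<le> l * (K + 1)" using l by simp
      also have "\<dots> = \<bar>\<Phi>' t\<bar> / 2" unfolding l_def using K by (simp add: field_simps)
      finally show False using ne by simp
    qed
    then show ?thesis using True by simp
  qed
  define E where "E = (\<lambda>t. sqrt (\<Phi> t + \<epsilon>))"
  \<comment> \<open>The derivative of \<open>E\<close> is known in the interior only. The value 0 at
    the endpoints is harmless, since the fundamental theorem used here asks there for continuity of
    \<open>E\<close> alone.\<close>
  define e where "e = (\<lambda>t. if t \<in> {0<..<1} then \<Phi>' t / (2 * E t) else 0)"
  have Epos: "E t > 0" for t unfolding E_def using \<Phi>nn[of t] \<epsilon> by simp
  have "(e has_integral (E 1 - E 0)) {0..1}"
  proof (rule fundamental_theorem_of_calculus_interior)
    show "continuous_on {0..1} E" unfolding E_def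
      by (intro continuous_on_real_sqrt continuous_on_add continuous_\<Phi> continuous_on_const)
    fix t :: real assume t: "t \<in> {0<..<1}"
    have "((\<lambda>t. \<Phi> t + \<epsilon>) has_real_derivative \<Phi>' t) (at t)"
      unfolding \<Phi>'_def using DERIV_add[OF \<Phi>_derivative[OF t] DERIV_const[of \<epsilon>]] by simp
    from DERIV_chain2[OF DERIV_real_sqrt this] have "(E has_real_derivative inverse (sqrt (\<Phi> t + \<epsilon>)) / 2 * \<Phi>' t) (at t)"
      unfolding E_def using \<Phi>nn[of t] \<epsilon> by simp
    moreover have "inverse (sqrt (\<Phi> t + \<epsilon>)) / 2 * \<Phi>' t = e t" using t by (simp add: e_def E_def field_simps)
    ultimately show "(E has_vector_derivative e t) (at t)" by (simp add: has_real_derivative_iff_has_vector_derivative)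
  qed simp
  moreover have "(\<lambda>t. C' / 2 * sqrt (energy t)) integrable_on {0..1}"
    by (intro integrable_continuous_real continuous_on_mult continuous_on_const continuous_on_real_sqrt continuous_energy)
  moreover have "\<bar>e t\<bar> \<le> C' / 2 * sqrt (energy t)" if t: "t \<in> {0..1}" for t
  proof (cases "t \<in> {0<..<1}")
    case True
    have "\<bar>\<Phi>' t\<bar> / (2 * E t) \<le> C' * (sqrt (energy t) * E t) / (2 * E t)"
      using cs[OF t] Epos[of t] unfolding E_def by (intro divide_right_mono) auto
    also have "\<dots> = C' / 2 * sqrt (energy t)" using Epos[of t] by simp
    finally show ?thesis using True Epos[of t] by (simp add: e_def abs_divide)
  next
    case False
    then have "e t = 0" unfolding e_def by (rule if_not_P)
    then show ?thesis using C' Enn[OF t] by simp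
  qed
  ultimately have "\<bar>E 1 - E 0\<bar> \<le> integral {0..1} (\<lambda>t. C' / 2 * sqrt (energy t))"
    using integral_norm_bound_integral[of e "{0..1}" "\<lambda>t. C' / 2 * sqrt (energy t)"]
    by (auto simp: has_integral_iff)
  then show ?thesis unfolding L_hor_energy E_def C'_def[symmetric] by simp
qed

end

section \<open>Embeddings with the same image\<close>

lemma linear_left_inverse_bounded:
  fixes T :: "real^'m::finite \<Rightarrow> real^'n::finite"
  assumes "linear T" "inj T"
  obtains P where "bounded_linear P" "\<And>v. P (T v) = v"
  using linear_injective_left_inverse[OF assms] linear_conv_bounded_linear by (metis comp_apply id_apply)

text \<open>The inverse \<open>h\<close> of the embedding is only continuous on the image, so
  smoothness of the lift is obtained differently. If \<open>P\<close> is a left inverse of the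
  differential of \<open>e\<close>, then \<open>P\<close> after \<open>e\<close> is a local
  diffeomorphism in charts with inverse \<open>G\<close>, and the lift is locally \<open>G\<close>
  after \<open>P\<close> after \<open>f\<close>.\<close>

lemma smooth_map_lift:
  assumes M: "smooth_manifold M" and N: "smooth_manifold N"
    and e: "e \<in> Imm M N" and h: "homeomorphism UNIV (range e) e h"
    and f: "smooth_map M N f" and sub: "range f \<subseteq> range e"
  shows "smooth_map M M (h \<circ> f)"
  unfolding smooth_map_def
proof (intro conjI ballI smooth_on_localI)
  have se: "smooth_map M N e" using e by (simp add: Imm_def)
  have fc: "continuous_on UNIV f" using f by (simp add: smooth_map_def)
  have ec: "continuous_on UNIV e" using se by (simp add: smooth_map_def)
  show cont: "continuous_on UNIV (h \<circ> f)"
  proof (rule continuous_on_compose[OF fc])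
    have "continuous_on (range e) h" using h by (simp add: homeomorphism_def)
    then show "continuous_on (range f) h" using sub by (rule continuous_on_subset)
  qed
  have eh: "e (h (f x)) = f x" for x
    using h sub unfolding homeomorphism_def by blast
  fix c c' z assume c: "c \<in> M" and c': "c' \<in> M" and "z \<in> cmap c ` (cdom c \<inter> (h \<circ> f) -` cdom c')"
  then obtain x where x: "x \<in> cdom c" "h (f x) \<in> cdom c'" "z = cmap c x" by auto
  define y where "y = h (f x)"
  define d where "d = chart_at N (f x)"
  note d = chart_at_props[OF N, of "f x", folded d_def]
  have ey: "e y = f x" by (simp add: y_def eh)
  have y: "y \<in> cdom c'" "e y \<in> cdom d" using x d ey by (auto simp: y_def)
  note ch = manifold_chart[OF M c] and ch' = manifold_chart[OF M c'] and chd = manifold_chart[OF N d(1)]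
  obtain P where P: "bounded_linear P" "\<And>v. P (chart_deriv c' d e y v) = v"
    using linear_left_inverse_bounded[OF linear_chart_deriv[OF M N se c' d(1) y] chart_deriv_inj[OF M N e c' d(1) y]] by blast
  define U where "U = cmap c' ` (cdom c' \<inter> e -` cdom d)"
  have U: "open U" unfolding U_def by (rule open_rep_domain[OF ch' chd ec])
  have yU: "cmap c' y \<in> U" using y by (auto simp: U_def)
  have F: "Ck_on k U (\<lambda>z. P (local_rep c' d e z))" for k
    unfolding U_def by (rule Ck_on_bounded_linear_comp[OF U[unfolded U_def] P(1) Ck_on_local_rep[OF M N se c' d(1)]])
  have "((\<lambda>z. P (local_rep c' d e z)) has_derivative (\<lambda>v. P (chart_deriv c' d e y v))) (at (cmap c' y))"
    by (rule bounded_linear.has_derivative[OF P(1) has_derivative_local_rep[OF M N se c' d(1) y]])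
  from frechet_derivative_at[OF this] have "inj (frechet_derivative (\<lambda>z. P (local_rep c' d e z)) (at (cmap c' y)))"
    by (simp add: P(2) inj_def fun_eq_iff)
  then obtain U1 V1 G where U1: "open U1" "U1 \<subseteq> U" "cmap c' y \<in> U1" "open V1"
    "homeomorphism U1 V1 (\<lambda>z. P (local_rep c' d e z)) G" "\<And>k. Ck_on k V1 G"
    using Ck_on_inverse_function[OF U F yU] by blast
  \<comment> \<open>The lift has to stay in \<open>U1\<close>, where \<open>G\<close> undoes
    \<open>P\<close> after \<open>e\<close>. That this is an open condition uses the continuity of
    \<open>h\<close> on the image, that is, that \<open>e\<close> is a topological
    embedding.\<close>
  define W where "W = cdom c \<inter> (f -` cdom d \<inter> (h \<circ> f) -` (cmap c' -` U1 \<inter> cdom c'))"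
  have o1: "open (cmap c' -` U1 \<inter> cdom c')"
    using continuous_open_preimage[OF chart_props(3,1)[OF ch'] U1(1)] by (simp add: Int_commute)
  have W: "open (cmap c ` W)" unfolding W_def
    by (intro open_chart_image[OF ch] open_Int open_vimage chart_props(1)[OF chd] o1 fc cont)
  have rep: "local_rep c c' (h \<circ> f) w = G (P (local_rep c d f w))" "P (local_rep c d f w) \<in> V1" if w: "w \<in> cmap c ` W" for w
  proof -
    obtain x' where x': "x' \<in> W" "w = cmap c x'" using w by blast
    have cx: "x' \<in> cdom c" "h (f x') \<in> cdom c'" "cmap c' (h (f x')) \<in> U1" using x'(1) by (auto simp: W_def)
    have "local_rep c' d e (cmap c' (h (f x'))) = cmap d (f x')"
      using chart_props(5)[OF ch' cx(2)] by (simp add: local_rep_def eh)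
    moreover have lf: "local_rep c d f w = cmap d (f x')"
      using chart_props(5)[OF ch cx(1)] by (simp add: local_rep_def x'(2))
    ultimately have *: "P (local_rep c' d e (cmap c' (h (f x')))) = P (local_rep c d f w)" by simp
    show "P (local_rep c d f w) \<in> V1"
      using U1(5) cx(3) unfolding homeomorphism_def *[symmetric] by blast
    have "G (P (local_rep c d f w)) = cmap c' (h (f x'))"
      using U1(5) cx(3) unfolding homeomorphism_def *[symmetric] by blast
    then show "local_rep c c' (h \<circ> f) w = G (P (local_rep c d f w))"
      using chart_props(5)[OF ch cx(1)] by (simp add: local_rep_def x'(2))
  qed
  have "Ck_on k (cmap c ` W) (\<lambda>w. G (P (local_rep c d f w)))" for k
  proof (rule Ck_on_compose[OF W U1(6)])
    show "Ck_on k (cmap c ` W) (\<lambda>w. P (local_rep c d f w))"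
      by (rule Ck_on_bounded_linear_comp[OF W P(1) Ck_on_subset[OF Ck_on_local_rep[OF M N f c d(1)]]]) (auto simp: W_def)
  qed (use rep in auto)
  then have "Ck_on k (cmap c ` W) (local_rep c c' (h \<circ> f))" for k
    by (rule Ck_on_cong[OF W, rotated]) (simp add: rep)
  moreover have "z \<in> cmap c ` W" using x d(2) U1(3) by (auto simp: W_def y_def)
  ultimately show "\<exists>U. open U \<and> z \<in> U \<and> (\<forall>k. Ck_on k U (local_rep c c' (h \<circ> f)))" using W by blast
qed

lemma Diff_comp: "smooth_manifold M \<Longrightarrow> \<phi> \<in> Diff M \<Longrightarrow> \<psi> \<in> Diff M \<Longrightarrow> \<phi> \<circ> \<psi> \<in> Diff M"
  unfolding Diff_def using smooth_map_comp[of M M M] by (auto simp: bij_comp o_inv_distrib)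

lemma shape_comp_subset:
  assumes "smooth_manifold M" "\<phi> \<in> Diff M"
  shows "shape M (e \<circ> \<phi>) \<subseteq> shape M e"
  unfolding shape_def using Diff_comp[OF assms] by (auto simp: comp_assoc)

text \<open>Each embedding followed by the inverse of the other is a map of \<open>M\<close> into
  itself; the two maps are mutually inverse and smooth by \<open>smooth_map_lift\<close>, hence
  diffeomorphisms. By contraposition, distinct shapes have distinct images.\<close>

lemma shape_eq_of_range_eq:
  assumes M: "smooth_manifold M" and N: "smooth_manifold N"
    and e: "e0 \<in> Emb M N" "e1 \<in> Emb M N" and r: "range e0 = range e1"
  shows "shape M e0 = shape M e1"
proof -
  obtain h0 h1 where h: "homeomorphism UNIV (range e0) e0 h0" "homeomorphism UNIV (range e1) e1 h1"
    using e by (auto simp: Emb_def)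
  have i: "e0 \<in> Imm M N" "e1 \<in> Imm M N" and s: "smooth_map M N e0" "smooth_map M N e1"
    using e by (auto simp: Emb_def Imm_def)
  have p: "h0 (e0 x) = x" "h1 (e1 x) = x" "e0 (h0 (e1 x)) = e1 x" "e1 (h1 (e0 x)) = e0 x" for x
    using h r unfolding homeomorphism_def by blast+
  have a: "smooth_map M M (h0 \<circ> e1)" by (rule smooth_map_lift[OF M N i(1) h(1) s(2)]) (simp add: r)
  have b: "smooth_map M M (h1 \<circ> e0)" by (rule smooth_map_lift[OF M N i(2) h(2) s(1)]) (simp add: r)
  have inv1: "(h0 \<circ> e1) \<circ> (h1 \<circ> e0) = id" "(h1 \<circ> e0) \<circ> (h0 \<circ> e1) = id"
    using p by (auto simp: fun_eq_iff)
  have bij: "bij (h0 \<circ> e1)" "bij (h1 \<circ> e0)" using inv1 o_bij by blast+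
  have "inv (h0 \<circ> e1) = h1 \<circ> e0" "inv (h1 \<circ> e0) = h0 \<circ> e1"
    using inv1 by (simp_all add: inv_unique_comp)
  then have d: "h0 \<circ> e1 \<in> Diff M" "h1 \<circ> e0 \<in> Diff M" using a b bij by (auto simp: Diff_def)
  have "e0 \<circ> (h0 \<circ> e1) = e1" "e1 \<circ> (h1 \<circ> e0) = e0" using p by (auto simp: fun_eq_iff)
  then show ?thesis using shape_comp_subset[OF M d(1), of e0] shape_comp_subset[OF M d(2), of e1] by auto
qed

section \<open>Separation of submanifolds\<close>

context riem_setup
begin

text \<open>On the compact product of \<open>K\<close> with the unit sphere the form attains a
  positive minimum \<open>m\<close>; rescaling gives the constant \<open>1 / sqrt m\<close>.\<close>

lemma metric_lower_bound:
  assumes d: "d \<in> N" and K: "compact K" "K \<subseteq> cmap d ` cdom d"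
  shows "\<exists>C\<ge>0. \<forall>y\<in>K. \<forall>v. norm v \<le> C * sqrt (ip (GN d y) v v)"
proof (cases "K = {}")
  case False
  let ?S = "sphere (0 :: real^'n) 1"
  have "continuous_on (K \<times> ?S) (\<lambda>p. \<Sum>i\<in>UNIV. \<Sum>j\<in>UNIV. snd p $ i * GN d (fst p) $ i $ j * snd p $ j)"
    by (intro continuous_intros continuous_on_compose2[OF Ck_on_imp_continuous[OF Ck_on_gram[OF N g d]]]) (use K in auto)
  then have cont: "continuous_on (K \<times> ?S) (\<lambda>p. ip (GN d (fst p)) (snd p) (snd p))" by (simp add: ip_sum)
  have "?S \<noteq> {}" by simp
  then obtain p where p: "p \<in> K \<times> ?S" "\<And>q. q \<in> K \<times> ?S \<Longrightarrow> ip (GN d (fst p)) (snd p) (snd p) \<le> ip (GN d (fst q)) (snd q) (snd q)"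
    using continuous_attains_inf[OF compact_Times[OF K(1) compact_sphere] _ cont] False by blast
  define m where "m = ip (GN d (fst p)) (snd p) (snd p)"
  have pd: "sympd (GN d y)" if "y \<in> K" for y using that K(2) sympd_gram[OF N g d] by blast
  have "snd p \<noteq> 0" using p(1) by (auto simp: mem_Times_iff)
  then have m: "m > 0" unfolding m_def using p(1) by (intro sympd_pos pd) auto
  have "norm v \<le> 1 / sqrt m * sqrt (ip (GN d y) v v)" if y: "y \<in> K" for y v
  proof (cases "v = 0")
    case False
    define n where "n = norm v"
    have n: "n > 0" using False by (simp add: n_def)
    have "m \<le> ip (GN d y) ((1 / n) *\<^sub>R v) ((1 / n) *\<^sub>R v)"
      unfolding m_def using p(2)[of "(y, (1 / n) *\<^sub>R v)"] y n by (simp add: n_def)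
    also have "\<dots> = ip (GN d y) v v / n\<^sup>2" by (simp add: ip_bilinear power2_eq_square)
    finally have "m * n\<^sup>2 \<le> ip (GN d y) v v" using n by (simp add: field_simps)
    then have "sqrt (m * n\<^sup>2) \<le> sqrt (ip (GN d y) v v)" by (rule real_sqrt_le_mono)
    then show ?thesis using m n by (simp add: real_sqrt_mult n_def[symmetric] field_simps)
  qed (simp add: ip_bilinear)
  then show ?thesis using m by (intro exI[of _ "1 / sqrt m"]) auto
qed auto

text \<open>The function \<psi>, the square root of \<open>chart_bump\<close>. It has a kink at the
  boundary of its support and is never differentiated, only its square is.\<close>

definition cutoff :: "('b, 'n) chart \<Rightarrow> real^'n \<Rightarrow> real \<Rightarrow> 'b \<Rightarrow> real" where
  "cutoff d y0 r y = (if y \<in> cdom d then max 0 (r\<^sup>2 - (cmap d y - y0) \<bullet> (cmap d y - y0)) else 0)"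

lemma chart_bump_cutoff: "chart_bump d y0 r y = (cutoff d y0 r y)\<^sup>2"
  by (simp add: chart_bump_def cutoff_def bump_def)

lemma cutoff_bounds: "0 \<le> cutoff d y0 r y" "cutoff d y0 r y \<le> r\<^sup>2"
  by (auto simp: cutoff_def)

text \<open>Differentiating the square leaves one factor \<open>cutoff\<close>. Where that factor is
  nonzero, the point lies within \<open>r\<close> of the centre in coordinates, and
  \<open>metric_lower_bound\<close> compares coordinate length with the metric; this is the origin
  of \<open>4 * r * C\<close>.\<close>

lemma dfun_chart_bump:
  assumes d: "d \<in> N" and r: "r > 0" "cball y0 r \<subseteq> cmap d ` cdom d"
  shows "\<exists>C\<ge>0. \<forall>y. \<forall>w\<in>tangent_space N y. \<bar>dfun N (chart_bump d y0 r) y w\<bar> \<le> C * cutoff d y0 r y * sqrt (g y w w)"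
proof -
  note chd = manifold_chart[OF N d]
  obtain C where C: "C \<ge> 0" "\<And>y v. y \<in> cball y0 r \<Longrightarrow> norm v \<le> C * sqrt (ip (GN d y) v v)"
    using metric_lower_bound[OF d compact_cball r(2)] by blast
  have "\<bar>dfun N (chart_bump d y0 r) y w\<bar> \<le> (4 * r * C) * cutoff d y0 r y * sqrt (g y w w)" if w: "w \<in> tangent_space N y" for y w
  proof (cases "y \<in> cdom d")
    case True
    define z where "z = cmap d y"
    have "((\<lambda>z. chart_bump d y0 r (cinv d z)) has_derivative
        (\<lambda>v. - (4 * max 0 (r\<^sup>2 - (z - y0) \<bullet> (z - y0)) * ((z - y0) \<bullet> v)))) (at z)"
      by (rule has_derivative_transform_within_open[OF has_derivative_bump chart_props(2)[OF chd]])
        (use True in \<open>auto simp: z_def chart_bump_def chart_props(5)[OF chd]\<close>)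
    from frechet_derivative_at[OF this]
    have df: "dfun N (chart_bump d y0 r) y w = - (4 * cutoff d y0 r y * ((z - y0) \<bullet> w d))"
      unfolding dfun_chart[OF N C1_fun_chart_bump[OF N d r] d True w] z_def[symmetric]
      by (metis (no_types, lifting) True cutoff_def z_def)
    show ?thesis
    proof (cases "cutoff d y0 r y = 0")
      case False
      then have "(z - y0) \<bullet> (z - y0) < r\<^sup>2" using True by (auto simp: cutoff_def z_def max_def split: if_splits)
      then have nz: "norm (z - y0) \<le> r"
        using r(1) by (simp add: power2_norm_eq_inner[symmetric] power2_less_imp_less less_imp_le)
      then have "z \<in> cball y0 r" by (simp add: dist_norm norm_minus_commute)
      then have "norm (w d) \<le> C * sqrt (g y w w)"
        using C(2) metric_chart[OF N g d True w w] by (simp add: z_def)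
      then have "norm (z - y0) * norm (w d) \<le> r * (C * sqrt (g y w w))" using nz r(1) by (intro mult_mono) auto
      then have "\<bar>(z - y0) \<bullet> w d\<bar> \<le> r * (C * sqrt (g y w w))" using Cauchy_Schwarz_ineq2 order_trans by blast
      then have "4 * cutoff d y0 r y * \<bar>(z - y0) \<bullet> w d\<bar> \<le> 4 * cutoff d y0 r y * (r * (C * sqrt (g y w w)))"
        using cutoff_bounds by (intro mult_left_mono) auto
      then show ?thesis unfolding df using cutoff_bounds(1)[of d y0 r y] by (simp add: abs_mult mult_ac)
    qed (simp add: df)
  next
    case False
    have "dfun N (chart_bump d y0 r) y w = 0"
    proof (rule dfun_outside[OF N])
      show "closed (cinv d ` cball y0 r)" by (intro compact_imp_closed compact_chart_ball chd r)
      show "y \<notin> cinv d ` cball y0 r" using False r(2) chart_props(7)[OF chd] by blast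
    qed (rule chart_bump_support[OF chd r(1)])
    then show ?thesis using False by (simp add: cutoff_def)
  qed
  then show ?thesis using C(1) r(1) by (intro exI[of _ "4 * r * C"]) auto
qed

end

section \<open>Positivity of the localized volume and the lower bound for path length\<close>

context riem_compact
begin

lemma localized_volume_Diff:
  assumes e: "e \<in> Imm M N" and \<delta>: "\<delta> \<in> Diff M" and \<phi>: "continuous_on UNIV \<phi>"
  shows "(\<integral>x. \<phi> ((e \<circ> \<delta>) x) \<partial>vol_of (e \<circ> \<delta>)) = (\<integral>x. \<phi> (e x) \<partial>vol_of e :: real)"
proof -
  note e\<delta> = Imm_comp_Diff[OF M N e \<delta>]
  have c: "continuous_on UNIV \<delta>" "continuous_on UNIV e" using \<delta> e by (auto simp: Diff_def Imm_def smooth_map_def)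
  have "\<delta> \<in> measurable (vol_of (e \<circ> \<delta>)) borel"
    using borel_measurable_continuous_onI[OF c(1)] by (simp add: measurable_cong_sets[OF sets_vol[OF e\<delta>] refl])
  moreover have "(\<lambda>x. \<phi> (e x)) \<in> borel_measurable borel"
    by (rule borel_measurable_continuous_onI, rule continuous_on_compose2[OF \<phi> c(2)]) auto
  ultimately show ?thesis by (subst vol_Diff[OF e \<delta>]) (simp add: integral_distr)
qed

text \<open>In a chart the volume has positive density, and a nonempty open set in the model space
  is not negligible.\<close>

lemma vol_open_pos:
  assumes e: "e \<in> Imm M N" and W: "open W" "x \<in> W"
  shows "emeasure (vol_of e) W > 0"
proof -
  define c where "c = chart_at M x"
  note c = chart_at_props[OF M, of x, folded c_def]
  note ch = manifold_chart[OF M c(1)]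
  define E where "E = cdom c \<inter> W"
  have E: "open E" "E \<subseteq> cdom c" unfolding E_def using chart_props(1)[OF ch] W by auto
  have cE: "open (cmap c ` E)" unfolding E_def by (rule open_chart_image[OF ch W(1)])
  have ne: "cmap c ` E \<noteq> {}" using c W by (auto simp: E_def)
  have se: "smooth_map M N e" using e by (simp add: Imm_def)
  have "emeasure (vol_of e) E \<noteq> 0"
  proof
    assume "emeasure (vol_of e) E = 0"
    then have "(\<integral>\<^sup>+z\<in>cmap c ` E. ennreal (sqrt (det (GM e c z))) \<partial>lborel) = 0"
      using emeasure_vol[OF e c(1) borel_open[OF E(1)] E(2)] emeasure_chart_vol[OF e c(1) borel_open[OF E(1)] E(2)] by simp
    moreover have m: "(\<lambda>z. ennreal (sqrt (det (GM e c z))) * indicator (cmap c ` E) z) \<in> borel_measurable lborel"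
    proof -
      have "(\<lambda>z. ennreal (dens e c z) * indicator (cmap c ` E) z) \<in> borel_measurable lborel"
        using measurable_dens[OF se c(1)] cE by simp
      moreover have "ennreal (dens e c z) * indicator (cmap c ` E) z = ennreal (sqrt (det (GM e c z))) * indicator (cmap c ` E) z" for z
        using E(2) by (cases "z \<in> cmap c ` E") (auto simp: dens_def)
      ultimately show ?thesis by simp
    qed
    ultimately have "AE z in lborel. ennreal (sqrt (det (GM e c z))) * indicator (cmap c ` E) z = 0"
      using nn_integral_0_iff_AE[OF m] by simp
    then have "AE z in lborel. z \<notin> cmap c ` E"
    proof (rule eventually_mono)
      fix z assume z: "ennreal (sqrt (det (GM e c z))) * indicator (cmap c ` E) z = 0"
      show "z \<notin> cmap c ` E"
      proof
        assume "z \<in> cmap c ` E"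
        moreover then have "det (GM e c z) > 0" using det_GM_pos[OF e c(1)] E(2) by blast
        ultimately show False using z by simp
      qed
    qed
    then have "cmap c ` E \<in> null_sets lborel" using cE by (subst (asm) AE_iff_null_sets[symmetric]) auto
    then have "negligible (cmap c ` E)" using negligible_iff_null_sets null_sets_completionI by blast
    then show False using open_not_negligible[OF cE ne] by blast
  qed
  moreover have "emeasure (vol_of e) E \<le> emeasure (vol_of e) W"
    using E W by (intro emeasure_mono) (auto simp: E_def sets_vol[OF e])
  ultimately show ?thesis by (metis bot.not_eq_extremum bot_ennreal le_zero_eq)
qed

lemma localized_volume_pos:
  assumes e: "e \<in> Imm M N" and \<phi>: "continuous_on UNIV \<phi>" "\<And>y. \<phi> y \<ge> (0::real)" "\<phi> (e x) > 0"
  shows "(\<integral>x. \<phi> (e x) \<partial>vol_of e) > 0"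
proof -
  have ec: "continuous_on UNIV e" using e by (auto simp: Imm_def smooth_map_def)
  have c: "continuous_on UNIV (\<lambda>x. \<phi> (e x))" by (rule continuous_on_compose2[OF \<phi>(1) ec]) auto
  define W where "W = {x. \<phi> (e x) > 0}"
  have W: "open W" "x \<in> W" unfolding W_def using c \<phi>(3) by (auto intro: open_Collect_less)
  have "(\<integral>x. \<phi> (e x) \<partial>vol_of e) \<noteq> 0"
  proof
    assume "(\<integral>x. \<phi> (e x) \<partial>vol_of e) = 0"
    then have "AE x in vol_of e. \<phi> (e x) = 0"
      using integral_nonneg_eq_0_iff_AE[OF integrable_vol[OF e c]] \<phi>(2) by simp
    then have "AE x in vol_of e. x \<notin> W" by (rule eventually_mono) (simp add: W_def)
    then have "W \<in> null_sets (vol_of e)" using W(1) by (subst (asm) AE_iff_null_sets[symmetric]) (auto simp: sets_vol[OF e])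
    then show False using vol_open_pos[OF e W] by auto
  qed
  moreover have "(\<integral>x. \<phi> (e x) \<partial>vol_of e) \<ge> 0" by (rule Bochner_Integration.integral_nonneg) (rule \<phi>(2))
  ultimately show ?thesis by simp
qed

lemma L_hor_lower_bound:
  assumes e: "e \<in> Imm M N" and A: "A > 0" and C: "closed S" and p: "e x \<notin> S"
  shows "\<exists>\<eta>>0. \<forall>f. smooth_path M N f \<longrightarrow> (\<forall>t\<in>{0..1}. f t \<in> Imm M N) \<longrightarrow>
    (\<exists>\<delta>\<in>Diff M. f 0 = e \<circ> \<delta> \<and> range (f 1) \<subseteq> S \<or> f 1 = e \<circ> \<delta> \<and> range (f 0) \<subseteq> S) \<longrightarrow> \<eta> \<le> L_hor M N g A f"
proof -
  define d where "d = chart_at N (e x)"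
  note d = chart_at_props[OF N, of "e x", folded d_def]
  note chd = manifold_chart[OF N d(1)]
  define y0 where "y0 = cmap d (e x)"
  have "open (cmap d ` (cdom d \<inter> - S))" using C by (intro open_chart_image[OF chd]) auto
  moreover have "y0 \<in> cmap d ` (cdom d \<inter> - S)" using d p by (auto simp: y0_def)
  ultimately obtain r where r: "r > 0" "cball y0 r \<subseteq> cmap d ` (cdom d \<inter> - S)"
    by (meson open_contains_cball)
  then have r': "cball y0 r \<subseteq> cmap d ` cdom d" by blast
  define \<phi> where "\<phi> = chart_bump d y0 r"
  have \<phi>: "C1_fun N \<phi>" unfolding \<phi>_def by (rule C1_fun_chart_bump[OF N d(1) r(1) r'])
  note \<phi>c = C1_fun_continuous[OF N \<phi>]
  have \<phi>S: "\<phi> y = 0" if "y \<in> S" for y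
    unfolding \<phi>_def
  proof (rule chart_bump_support[OF chd r(1)], rule notI)
    assume "y \<in> cinv d ` cball y0 r"
    then obtain z where z: "z \<in> cball y0 r" "y = cinv d z" by blast
    then obtain y' where "y' \<in> cdom d" "y' \<notin> S" "z = cmap d y'" using r(2) by blast
    then show False using z(2) that chart_props(5)[OF chd] by simp
  qed
  have \<phi>nn: "\<phi> y \<ge> 0" for y unfolding \<phi>_def chart_bump_cutoff by simp
  have \<phi>p: "\<phi> (e x) > 0" unfolding \<phi>_def chart_bump_def using d(2) r(1) by (simp add: bump_center y0_def[symmetric])
  obtain C where C: "C \<ge> 0" "\<And>y w. w \<in> tangent_space N y \<Longrightarrow> \<bar>dfun N \<phi> y w\<bar> \<le> C * cutoff d y0 r y * sqrt (g y w w)"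
    using dfun_chart_bump[OF d(1) r(1) r'] unfolding \<phi>_def by blast
  define V where "V = (\<integral>x. \<phi> (e x) \<partial>vol_of e)"
  have V: "V > 0" unfolding V_def by (rule localized_volume_pos[OF e \<phi>c \<phi>nn \<phi>p])
  define C' where "C' = C + r\<^sup>2 / sqrt A"
  have C': "C' > 0" unfolding C'_def using C(1) r(1) A by (simp add: add_nonneg_pos)
  \<comment> \<open>Between the endpoints the localized volume changes from \<open>V\<close> to 0 or
    back. With \<epsilon> equal to \<open>V\<close>, the shifted square roots are
    \<open>sqrt (V + V)\<close> and \<open>sqrt V\<close>, and solving the length estimate for the
    length gives this value.\<close>
  define \<eta> where "\<eta> = 2 * (sqrt (V + V) - sqrt V) / C'"
  have \<eta>: "\<eta> > 0" unfolding \<eta>_def using V C' by simp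
  obtain I a b z0 \<rho> \<zeta> where pou: "finite (I :: 'a set) \<and>
     (\<forall>k\<in>I. cbox (a k) (b k) \<subseteq> cmap (chart_at M k) ` cdom (chart_at M k) \<and>
       cball (z0 k) (\<rho> k) \<subseteq> cbox (a k) (b k) \<and> C1_fun M (\<zeta> k) \<and>
       (\<forall>x. x \<notin> cinv (chart_at M k) ` cball (z0 k) (\<rho> k) \<longrightarrow> \<zeta> k x = 0)) \<and>
     (\<forall>x. (\<Sum>k\<in>I. \<zeta> k x) = (1::real))"
    using partition_of_unity by (elim exE) (rule that)
  note pou1 = conjunct1[OF pou] and pou2 = bspec[OF conjunct1[OF conjunct2[OF pou]]]
    and pou3 = spec[OF conjunct2[OF conjunct2[OF pou]]]
  have "\<eta> \<le> L_hor M N g A f" if f: "smooth_path M N f" "\<forall>t\<in>{0..1}. f t \<in> Imm M N"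
    and \<delta>: "\<delta> \<in> Diff M" "f 0 = e \<circ> \<delta> \<and> range (f 1) \<subseteq> S \<or> f 1 = e \<circ> \<delta> \<and> range (f 0) \<subseteq> S" for f \<delta>
  proof -
    interpret P: riem_path_pou M N g f A I a b z0 \<rho> \<zeta> \<phi>
    proof unfold_locales
      show "f t \<in> Imm M N" if "t \<in> {0..1}" for t using f(2) that by blast
      show "cbox (a k) (b k) \<subseteq> cmap (chart_at M k) ` cdom (chart_at M k)" "cball (z0 k) (\<rho> k) \<subseteq> cbox (a k) (b k)"
        "C1_fun M (\<zeta> k)" if "k \<in> I" for k using pou2[OF that] by blast+
      show "\<zeta> k x = 0" if "k \<in> I" "x \<notin> cinv (chart_at M k) ` cball (z0 k) (\<rho> k)" for k x
        using pou2[OF that(1)] that(2) by blast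
    qed (rule f(1) A pou1 pou3 \<phi>)+
    have vol: "P.\<Phi> t = V" if "f t = e \<circ> \<delta>" for t
      unfolding P.\<Phi>_def that V_def by (rule localized_volume_Diff[OF e \<delta>(1) \<phi>c])
    have zero: "P.\<Phi> t = 0" if "range (f t) \<subseteq> S" for t
      unfolding P.\<Phi>_def using that \<phi>S by (simp add: image_subset_iff)
    have "\<bar>sqrt (P.\<Phi> 1 + V) - sqrt (P.\<Phi> 0 + V)\<bar> \<le> C' / 2 * L_hor M N g A f"
      unfolding C'_def
      by (rule P.localized_volume_bound[where \<psi> = "cutoff d y0 r"])
        (simp_all add: \<phi>_def chart_bump_cutoff cutoff_bounds C[unfolded \<phi>_def] V)
    moreover have "\<bar>sqrt (P.\<Phi> 1 + V) - sqrt (P.\<Phi> 0 + V)\<bar> = sqrt (V + V) - sqrt V"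
      using \<delta>(2) vol zero V by auto
    ultimately show ?thesis unfolding \<eta>_def using C' by (simp add: field_simps)
  qed
  then show ?thesis using \<eta> by blast
qed

end

theorem mainTheorem3:
  fixes M :: "('a::{t2_space,second_countable_topology}, 'm::finite) atlas"
    and N :: "('b::{t2_space,second_countable_topology}, 'n::finite) atlas"
    and g :: "('b, 'n) metric"
    and A :: real
    and F0 F1 :: "('a \<Rightarrow> 'b) set"
  assumes "smooth_manifold M" and "compact (UNIV :: 'a set)" and "connected (UNIV :: 'a set)"
    and "smooth_manifold N" and "connected (UNIV :: 'b set)" and "riemannian_metric N g"
    and "CARD('m) \<ge> 1" and "CARD('n) > CARD('m)"
    and "A > 0"
    and "F0 \<in> B_e M N" and "F1 \<in> B_e M N" and "F0 \<noteq> F1"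
  shows "dist_Bi M N g A F0 F1 > 0"
proof -
  interpret riem_compact M N g by unfold_locales (use assms in auto)
  obtain e0 e1 where e: "e0 \<in> Emb M N" "F0 = shape M e0" "e1 \<in> Emb M N" "F1 = shape M e1"
    using assms(10,11) by (auto simp: B_e_def)
  have i: "e0 \<in> Imm M N" "e1 \<in> Imm M N" using e by (auto simp: Emb_def)
  have cl: "closed (range e0)" "closed (range e1)"
    using i compact by (auto simp: Imm_def smooth_map_def intro!: compact_imp_closed compact_continuous_image)
  have "range e0 \<noteq> range e1"
    using shape_eq_of_range_eq[OF assms(1,4) e(1,3)] e(2,4) assms(12) by blast
  \<comment> \<open>Distinct images differ by a point of one or of the other. The first case follows
    the localized volume of \<open>e0\<close>, the second that of \<open>e1\<close>, each bump
    vanishing on the other image.\<close>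
  then consider x where "e0 x \<notin> range e1" | x where "e1 x \<notin> range e0" by blast
  then have "\<exists>\<eta>>0. \<forall>f. smooth_path M N f \<longrightarrow> (\<forall>t\<in>{0..1}. f t \<in> Imm M N) \<longrightarrow>
      (\<exists>\<delta>0\<in>Diff M. f 0 = e0 \<circ> \<delta>0) \<longrightarrow> (\<exists>\<delta>1\<in>Diff M. f 1 = e1 \<circ> \<delta>1) \<longrightarrow> \<eta> \<le> L_hor M N g A f"
  proof cases
    case 1
    from L_hor_lower_bound[OF i(1) assms(9) cl(2) this]
    obtain \<eta> where \<eta>: "\<eta> > 0" and L: "\<forall>f. smooth_path M N f \<longrightarrow> (\<forall>t\<in>{0..1}. f t \<in> Imm M N) \<longrightarrow>
      (\<exists>\<delta>\<in>Diff M. f 0 = e0 \<circ> \<delta> \<and> range (f 1) \<subseteq> range e1 \<or> f 1 = e0 \<circ> \<delta> \<and> range (f 0) \<subseteq> range e1) \<longrightarrow> \<eta> \<le> L_hor M N g A f"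
      by (elim exE conjE) (rule that)
    have "\<eta> \<le> L_hor M N g A f" if f: "smooth_path M N f" "\<forall>t\<in>{0..1}. f t \<in> Imm M N"
      and \<delta>: "\<delta>0 \<in> Diff M" "f 0 = e0 \<circ> \<delta>0" "\<delta>1 \<in> Diff M" "f 1 = e1 \<circ> \<delta>1" for f \<delta>0 \<delta>1
    proof -
      have "range (f 1) \<subseteq> range e1" unfolding \<delta> by auto
      then show ?thesis using L[THEN spec, THEN mp, THEN mp, THEN mp, OF f] \<delta> by blast
    qed
    then show ?thesis using \<eta> by (intro exI[of _ \<eta>] conjI allI impI) (auto elim!: bexE)
  next
    case 2
    from L_hor_lower_bound[OF i(2) assms(9) cl(1) this]
    obtain \<eta> where \<eta>: "\<eta> > 0" and L: "\<forall>f. smooth_path M N f \<longrightarrow> (\<forall>t\<in>{0..1}. f t \<in> Imm M N) \<longrightarrow>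
      (\<exists>\<delta>\<in>Diff M. f 0 = e1 \<circ> \<delta> \<and> range (f 1) \<subseteq> range e0 \<or> f 1 = e1 \<circ> \<delta> \<and> range (f 0) \<subseteq> range e0) \<longrightarrow> \<eta> \<le> L_hor M N g A f"
      by (elim exE conjE) (rule that)
    have "\<eta> \<le> L_hor M N g A f" if f: "smooth_path M N f" "\<forall>t\<in>{0..1}. f t \<in> Imm M N"
      and \<delta>: "\<delta>0 \<in> Diff M" "f 0 = e0 \<circ> \<delta>0" "\<delta>1 \<in> Diff M" "f 1 = e1 \<circ> \<delta>1" for f \<delta>0 \<delta>1
    proof -
      have "range (f 0) \<subseteq> range e0" unfolding \<delta> by auto
      then show ?thesis using L[THEN spec, THEN mp, THEN mp, THEN mp, OF f] \<delta> by blast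
    qed
    then show ?thesis using \<eta> by (intro exI[of _ \<eta>] conjI allI impI) (auto elim!: bexE)
  qed
  then obtain \<eta> where \<eta>: "\<eta> > 0" and L: "\<And>f. smooth_path M N f \<Longrightarrow> \<forall>t\<in>{0..1}. f t \<in> Imm M N \<Longrightarrow>
      \<exists>\<delta>0\<in>Diff M. f 0 = e0 \<circ> \<delta>0 \<Longrightarrow> \<exists>\<delta>1\<in>Diff M. f 1 = e1 \<circ> \<delta>1 \<Longrightarrow> \<eta> \<le> L_hor M N g A f" by blast
  \<comment> \<open>Equal shapes give a reparametrization because the identity is a diffeomorphism,
    so that a map belongs to its own shape.\<close>
  have mem: "\<exists>\<delta>\<in>Diff M. u = e \<circ> \<delta>" if "shape M u = shape M e" for u e :: "'a \<Rightarrow> 'b"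
  proof -
    have "u \<in> shape M u" unfolding shape_def using Diff_id[OF assms(1)] by (intro CollectI exI[of _ id]) simp
    then show ?thesis unfolding that by (auto simp: shape_def)
  qed
  \<comment> \<open>A lower bound for every admissible path is one for the infimum; without
    admissible paths the infimum is \<infinity> and the inequality still holds.\<close>
  have "ereal \<eta> \<le> dist_Bi M N g A F0 F1"
    unfolding dist_Bi_def by (intro INF_greatest) (use L mem e(2,4) in auto)
  then show ?thesis using \<eta> by (meson ereal_less(2) less_le_trans)
qed

end
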